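(* For every real number $c>\frac32$ there exists $\mu_0=\mu_0(c)\in[0,1)$ such that for all $\mu$ with $\mu_0<\mu<1$ there exists a global disk-like surface of section for the (regularized, Hamiltonian) flow on the component $\Sigma_{\mu,c}$ of the energy hypersurface $K_{\mu,c}^{-1}(0)$, where $$K_{\mu,c}(v,u)=\tfrac12|u|^2+2|v|^2\langle u,iv\rangle-\mu\,\mathrm{Im}(uv)-\frac{1-\mu}{2}-\frac{\mu|v|^2}{|2v^2-1|}+c|v|^2 .$$
   Context: **Planar restricted 3-body problem.** For $\mu\in(0,1)$ let $H=H_\mu:(\mathbb{C}\setminus\{0,1\})\times\mathbb{C}\to\mathbb{R}$, $$H(q,p)=\tfrac12|p|^2+\langle p,iq\rangle-\langle p,i\mu\rangle-\frac{1-\mu}{|q|}-\frac{\mu}{|q-1|},$$ where $\langle a,b\rangle=\mathrm{Re}(a\bar b)$ is the standard real inner product on $\mathbb{C}=\mathbb{R}^2$ (so $\langle p,iq\rangle=p_2q_1-p_1q_2$). The primary at $q=0$ (the "earth") has mass $1-\mu$ and the primary at $q=1$ (the "sun") has mass $\mu$. $H$ has five critical points $L_1,\dots,L_5$, ordered by increasing value of $H$; thus $H(L_1)$ is the smallest critical value. It converges to $-\frac32$ as $\mu\to1$. If $-c<H(L_1)$, then $H^{-1}(-c)$ has three connected components: one near $q=0$, one near $q=1$, one near infinity. **Levi-Civita regularization.** Substituting $q=2v^2$, $p=u/\bar v$ (a 2:1 map, with $\mathrm{Re}(dq\wedge d\bar p)=4\,\mathrm{Re}(dv\wedge d\bar u)$)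 gives $K_{\mu,c}=|v|^2(H+c)$, which is the displayed function of $(v,u)\in\mathbb{C}^2=\mathbb{R}^4$, $2v^2\neq1$. **The component $\Sigma_{\mu,c}$.** When $-c<H(L_1)$, $\Sigma_{\mu,c}$ is the compact connected component of $K_{\mu,c}^{-1}(0)$ to which the component of $H^{-1}(-c)$ near the earth $q=0$ lifts; equivalently, it is the connected component of $K_{\mu,c}^{-1}(0)$ containing the circle $\{v=0,\ |u|^2=1-\mu\}$. It is diffeomorphic to $S^3$. For fixed $c>\frac32$ the condition $-c<H(L_1)$ holds for all $\mu<1$ sufficiently close to $1$, and $\mu_0(c)$ is understood to be such that it holds for all $\mu\in(\mu_0(c),1)$. The flow on $\Sigma_{\mu,c}$ is the restriction of the Hamiltonian flow of $K_{\mu,c}$ with respect to the symplectic form $\mathrm{Re}(dv\wedge d\bar u)$. **Global disk-like surface of section.** Let $\Sigma$ be a smooth closed three-manifold with a smooth flow without rest points. A global disk-like surface of section is a topologically embedded closed disk $\mathcal{D}\subset\Sigma$ such that: 1. the boundary $\partial\mathcal{D}$ is an (unparametrized) periodic orbit, called the spanning orbit; 2. the interior $\dot{\mathcal{D}}=\mathcal{D}\setminus\partial\mathcal{D}$ is a smooth submanifold of $\Sigma$ and is transversal to the flow; 3. every orbit other than the spanning orbit intersects $\dot{\mathcal{D}}$ in forward and in backward time. *)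

theory Defs
  imports "HOL-Analysis.Analysis"
begin

section \<open>Smooth maps and submanifolds of Euclidean space\<close>

text \<open>In finite dimension a map is \<open>C\<^sup>n\<^sup>+\<^sup>1\<close> on an open set iff it is differentiable there and all
  its directional derivatives are \<open>C\<^sup>n\<close>.\<close>

fun higher_differentiable_on ::
  "'a::euclidean_space set \<Rightarrow> ('a \<Rightarrow> 'b::euclidean_space) \<Rightarrow> nat \<Rightarrow> bool" where
  "higher_differentiable_on S f 0 \<longleftrightarrow> continuous_on S f"
| "higher_differentiable_on S f (Suc n) \<longleftrightarrow>
     (\<forall>x\<in>S. f differentiable (at x)) \<and>
     (\<forall>h. higher_differentiable_on S (\<lambda>x. frechet_derivative f (at x) h) n)"

definition smooth_on :: "'a::euclidean_space set \<Rightarrow> ('a \<Rightarrow> 'b::euclidean_space) \<Rightarrow> bool" where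
  "smooth_on S f \<longleftrightarrow> (\<forall>n. higher_differentiable_on S f n)"

text \<open>Embedded submanifolds without boundary, by slice charts: near each point an ambient
  diffeomorphism \<open>\<Phi>\<close> with inverse \<open>\<Psi>\<close> straightens \<open>S\<close> to a linear subspace \<open>L\<close>. If \<open>M\<close> is such
  a submanifold and \<open>S \<subseteq> M\<close>, then \<open>S\<close> is an embedded submanifold of \<open>M\<close> iff it is one of the
  ambient space.\<close>

definition smooth_submanifold :: "nat \<Rightarrow> 'a::euclidean_space set \<Rightarrow> bool" where
  "smooth_submanifold k S \<longleftrightarrow>
     (\<forall>z\<in>S. \<exists>W V (\<Phi> :: 'a \<Rightarrow> 'a) \<Psi> L. open W \<and> z \<in> W \<and> open V \<and> homeomorphism W V \<Phi> \<Psi> \<and>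
        smooth_on W \<Phi> \<and> smooth_on V \<Psi> \<and>
        subspace L \<and> dim L = k \<and> \<Phi> ` (S \<inter> W) = L \<inter> V)"

definition tangent_space :: "'a::euclidean_space set \<Rightarrow> 'a \<Rightarrow> 'a set" where
  "tangent_space S z =
     {w. \<exists>\<epsilon>>0. \<exists>\<gamma>. smooth_on {-\<epsilon><..<\<epsilon>} \<gamma> \<and> \<gamma> ` {-\<epsilon><..<\<epsilon>} \<subseteq> S \<and> \<gamma> (0::real) = z \<and>
          (\<gamma> has_vector_derivative w) (at 0)}"


section \<open>Flows and global disk-like surfaces of section\<close>

definition flow_on ::
  "'a::euclidean_space set \<Rightarrow> ('a \<Rightarrow> 'a) \<Rightarrow> (real \<Rightarrow> 'a \<Rightarrow> 'a) \<Rightarrow> bool" where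
  "flow_on M X \<phi> \<longleftrightarrow>
     (\<forall>z\<in>M. \<phi> 0 z = z \<and>
       (\<forall>t. \<phi> t z \<in> M \<and> ((\<lambda>s. \<phi> s z) has_vector_derivative X (\<phi> t z)) (at t)))"

text \<open>The flow is smooth, and determined on \<open>M\<close> by \<open>X\<close>, because \<open>X\<close> is smooth near \<open>M\<close>.\<close>

definition closed_3manifold_with_flow ::
  "'a::euclidean_space set \<Rightarrow> ('a \<Rightarrow> 'a) \<Rightarrow> (real \<Rightarrow> 'a \<Rightarrow> 'a) \<Rightarrow> bool" where
  "closed_3manifold_with_flow M X \<phi> \<longleftrightarrow>
     compact M \<and> smooth_submanifold 3 M \<and>
     (\<exists>U. open U \<and> M \<subseteq> U \<and> smooth_on U X) \<and> (\<forall>z\<in>M. X z \<noteq> 0) \<and>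
     flow_on M X \<phi>"

definition orbit :: "(real \<Rightarrow> 'a \<Rightarrow> 'a) \<Rightarrow> 'a \<Rightarrow> 'a set" where
  "orbit \<phi> z = range (\<lambda>t. \<phi> t z)"

definition periodic_orbit :: "'a set \<Rightarrow> (real \<Rightarrow> 'a \<Rightarrow> 'a) \<Rightarrow> 'a set \<Rightarrow> bool" where
  "periodic_orbit M \<phi> P \<longleftrightarrow> (\<exists>z\<in>M. P = orbit \<phi> z \<and> (\<exists>T>0. \<phi> T z = z))"

text \<open>\<open>D\<close> is a topologically embedded closed disk with boundary circle \<open>B\<close>. By invariance of
  domain, \<open>B\<close> depends only on \<open>D\<close>.\<close>

definition embedded_closed_disk :: "'a::euclidean_space set \<Rightarrow> 'a set \<Rightarrow> bool" where
  "embedded_closed_disk D B \<longleftrightarrow>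
     (\<exists>h g. homeomorphism (cball (0::complex) 1) D h g \<and> B = h ` sphere 0 1)"

definition global_disklike_surface_of_section ::
  "'a::euclidean_space set \<Rightarrow> ('a \<Rightarrow> 'a) \<Rightarrow> (real \<Rightarrow> 'a \<Rightarrow> 'a) \<Rightarrow> 'a set \<Rightarrow> bool" where
  "global_disklike_surface_of_section M X \<phi> D \<longleftrightarrow>
     D \<subseteq> M \<and>
     (\<exists>B. embedded_closed_disk D B \<and>
        periodic_orbit M \<phi> B \<and>
        smooth_submanifold 2 (D - B) \<and>
        (\<forall>z \<in> D - B. X z \<notin> tangent_space (D - B) z) \<and>
        (\<forall>z\<in>M. orbit \<phi> z \<noteq> B \<longrightarrow>
           (\<exists>t>0. \<phi> t z \<in> D - B) \<and> (\<exists>t<0. \<phi> t z \<in> D - B)))"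


section \<open>The planar restricted three-body problem\<close>

definition H :: "real \<Rightarrow> complex \<times> complex \<Rightarrow> real" where
  "H \<mu> = (\<lambda>(q, p). (1/2) * (norm p)\<^sup>2 + p \<bullet> (\<i> * q) - p \<bullet> (\<i> * of_real \<mu>)
            - (1 - \<mu>) / norm q - \<mu> / norm (q - 1))"

definition critical_points_H :: "real \<Rightarrow> (complex \<times> complex) set" where
  "critical_points_H \<mu> =
     {(q, p). q \<noteq> 0 \<and> q \<noteq> 1 \<and> (H \<mu> has_derivative (\<lambda>_. 0)) (at (q, p))}"

text \<open>The critical point of lowest value.\<close>

definition L1 :: "real \<Rightarrow> complex \<times> complex" where
  "L1 \<mu> = arg_min (H \<mu>) (\<lambda>z. z \<in> critical_points_H \<mu>)"

definition K :: "real \<Rightarrow> real \<Rightarrow> complex \<times> complex \<Rightarrow> real" where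
  "K \<mu> c = (\<lambda>(v, u). (1/2) * (norm u)\<^sup>2 + 2 * (norm v)\<^sup>2 * (u \<bullet> (\<i> * v)) - \<mu> * Im (u * v)
              - (1 - \<mu>) / 2 - \<mu> * (norm v)\<^sup>2 / norm (2 * v\<^sup>2 - 1) + c * (norm v)\<^sup>2)"

lemma K_levi_civita:
  assumes "v \<noteq> 0"
  shows "K \<mu> c (v, u) = (norm v)\<^sup>2 * (H \<mu> (2 * v\<^sup>2, u / cnj v) + c)"
proof -
  have n: "(norm v)\<^sup>2 \<noteq> 0" using assms by simp
  have 1: "(norm v)\<^sup>2 * (norm (u / cnj v))\<^sup>2 = (norm u)\<^sup>2"
    using assms by (simp add: norm_divide power_divide)
  have uv: "of_real ((norm v)\<^sup>2) * (u / cnj v) = u * v"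
    using assms by (simp add: complex_norm_square field_simps flip: of_real_power)
  have sc: "(norm v)\<^sup>2 * ((u / cnj v) \<bullet> w) = (u * v) \<bullet> w" for w
  proof -
    have "(norm v)\<^sup>2 * ((u / cnj v) \<bullet> w) = ((norm v)\<^sup>2 *\<^sub>R (u / cnj v)) \<bullet> w" by simp
    then show ?thesis by (simp only: scaleR_conv_of_real uv)
  qed
  have 2: "(norm v)\<^sup>2 * ((u / cnj v) \<bullet> (\<i> * (2 * v\<^sup>2))) = 2 * (norm v)\<^sup>2 * (u \<bullet> (\<i> * v))"
    unfolding sc unfolding cmod_power2 by (simp add: inner_complex_def power2_eq_square algebra_simps)
  have 3: "(norm v)\<^sup>2 * ((u / cnj v) \<bullet> (\<i> * of_real \<mu>)) = \<mu> * Im (u * v)"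
    unfolding sc by (simp add: inner_complex_def algebra_simps)
  have 4: "(norm v)\<^sup>2 * ((1 - \<mu>) / norm (2 * v\<^sup>2)) = (1 - \<mu>) / 2"
    using n by (simp add: norm_mult norm_power)
  have 5: "(norm v)\<^sup>2 * (\<mu> / norm (2 * v\<^sup>2 - 1)) = \<mu> * (norm v)\<^sup>2 / norm (2 * v\<^sup>2 - 1)"
    by simp
  have 6: "(norm v)\<^sup>2 * ((1/2) * (norm (u / cnj v))\<^sup>2) = (1/2) * (norm u)\<^sup>2"
    using 1 by linarith
  show ?thesis
    unfolding K_def H_def prod.case distrib_left right_diff_distrib 2 3 4 5 6
    by (simp only: mult.commute)
qed

text \<open>The singularity \<open>2v\<^sup>2 = 1\<close> (collision with the primary at \<open>q = 1\<close>) must be excluded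
  explicitly, since division is total.\<close>

definition K_level :: "real \<Rightarrow> real \<Rightarrow> (complex \<times> complex) set" where
  "K_level \<mu> c = {(v, u). 2 * v\<^sup>2 \<noteq> 1 \<and> K \<mu> c (v, u) = 0}"

definition collision_circle :: "real \<Rightarrow> (complex \<times> complex) set" where
  "collision_circle \<mu> = {(v, u). v = 0 \<and> (norm u)\<^sup>2 = 1 - \<mu>}"

text \<open>The component of the level set containing the collision circle over \<open>q = 0\<close>.\<close>

definition Sigma_comp :: "real \<Rightarrow> real \<Rightarrow> (complex \<times> complex) set" where
  "Sigma_comp \<mu> c = (THE C. C \<in> components (K_level \<mu> c) \<and> collision_circle \<mu> \<subseteq> C)"

lemma Sigma_comp_eq:
  assumes "\<mu> < 1"
  shows "Sigma_comp \<mu> c = connected_component_set (K_level \<mu> c) (0, of_real (sqrt (1 - \<mu>)))"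
proof -
  let ?z = "(0, of_real (sqrt (1 - \<mu>))) :: complex \<times> complex"
  have z: "?z \<in> collision_circle \<mu>" using assms by (simp add: collision_circle_def)
  have sub: "collision_circle \<mu> \<subseteq> K_level \<mu> c"
    by (auto simp: collision_circle_def K_level_def K_def)
  have "collision_circle \<mu> = {0} \<times> sphere 0 (sqrt (1 - \<mu>))"
    using assms by (auto simp: collision_circle_def) (metis abs_norm_cancel real_sqrt_abs)
  then have con: "connected (collision_circle \<mu>)"
    using connected_sphere[of "0::complex" "sqrt (1 - \<mu>)"]
    by (simp add: connected_Times)
  show ?thesis unfolding Sigma_comp_def
  proof (rule the_equality)
    show "connected_component_set (K_level \<mu> c) ?z \<in> components (K_level \<mu> c) \<and>
        collision_circle \<mu> \<subseteq> connected_component_set (K_level \<mu> c) ?z"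
      using z sub con connected_component_maximal by (blast intro: componentsI)
  next
    fix C assume "C \<in> components (K_level \<mu> c) \<and> collision_circle \<mu> \<subseteq> C"
    then show "C = connected_component_set (K_level \<mu> c) ?z"
      using z by (metis componentsE connected_component_eq in_mono)
  qed
qed

text \<open>The symplectic form \<open>Re (dv \<and> d\<bar>u)\<close>, evaluated on \<open>X = (X\<^sub>v, X\<^sub>u)\<close> and \<open>Y = (Y\<^sub>v, Y\<^sub>u)\<close>.\<close>

definition symp :: "complex \<times> complex \<Rightarrow> complex \<times> complex \<Rightarrow> real" where
  "symp X Y = Re (fst X * cnj (snd Y) - fst Y * cnj (snd X))"

text \<open>Sign convention \<open>\<omega>(X\<^sub>F, \<cdot>) = dF\<close>, i.e. \<open>v' = \<partial>F/\<partial>u\<close>, \<open>u' = -\<partial>F/\<partial>v\<close>; the opposite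
  convention reverses time, which does not affect surfaces of section.\<close>

definition hamiltonian_vf :: "(complex \<times> complex \<Rightarrow> real) \<Rightarrow> complex \<times> complex \<Rightarrow> complex \<times> complex" where
  "hamiltonian_vf F z = (THE X. (F has_derivative symp X) (at z))"

lemma hamiltonian_vf_eqI:
  assumes "(F has_derivative symp X) (at z)"
  shows "hamiltonian_vf F z = X"
  unfolding hamiltonian_vf_def
proof (rule the_equality)
  show "(F has_derivative symp X) (at z)" by (fact assms)
next
  fix X' assume "(F has_derivative symp X') (at z)"
  then have eq: "symp X' = symp X" using assms has_derivative_unique by blast
  have "symp X' (1, 0) = symp X (1, 0)" "symp X' (\<i>, 0) = symp X (\<i>, 0)"
    "symp X' (0, 1) = symp X (0, 1)" "symp X' (0, \<i>) = symp X (0, \<i>)"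
    using eq by simp_all
  then show "X' = X" by (auto simp: symp_def prod_eq_iff complex_eq_iff)
qed

end

theory Submission
  imports Defs
begin

text \<open>
  As \<open>\<mu> \<rightarrow> 1\<close> the component \<open>\<Sigma>\<close> shrinks to the collision \<open>q = 0\<close>. After the momentum shift
  \<open>u \<mapsto> u - \<i>\<mu> cnj v\<close> and a rescaling by powers of \<open>1 - \<mu>\<close>, the Hamiltonian becomes a small perturbation of
  a pair of equal harmonic oscillators \<open>(|z\<^sub>1|\<^sup>2 + |z\<^sub>2|\<^sup>2) / 4\<close>, whose leading correction, of size \<open>\<kappa>\<close>, is the
  Coriolis term, and whose tidal terms are smaller by a further factor \<open>\<delta>\<close>. The unperturbed flow is the
  Hopf flow, all of whose orbits are closed. The Coriolis term singles out an orbit invariant under the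
  reflection that reverses time; it is found by shooting from the fixed set of the reflection to itself. All other orbits
  rotate around it at a definite rate, so the angle around this orbit increases along the
  flow, and a level set of this angle is the interior of the disk.

  The assumption on \<open>c\<close> enters in two places: \<open>- c\<close> lies below the lowest critical value, which tends to
  \<open>- 3/2\<close>, and the oscillator frequency \<open>\<omega>\<close>, with \<open>\<omega>\<^sup>2 \<ge> 2 * (c - 3/2)\<close>, stays away from zero.
\<close>

text \<open>The obstacle is degeneracy. For \<open>\<kappa> = 0\<close> every orbit is closed, so no
  periodic orbit is isolated and the first order in \<kappa> has to decide. Averaged over the Hopf
  flow the Coriolis term becomes a multiple of \<open>|z1|^4 - |z2|^4\<close>; on the sphere of Hopf
  circles this is a height function, whose pole \<open>z2 = 0\<close> is a nondegenerate critical
  point and therefore survives. The remaining terms must be small compared with \<kappa>, not merely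
  small, and this is why the tidal part is required to be of order
  \<open>\<delta> * \<kappa>\<close>. Locating the orbit by signs on a rectangle keeps the estimates
  at the level of Lipschitz bounds.

  Once the orbit is C^1 close to the circle \<open>z2 = 0\<close>, the section property is robust:
  z2 turns around 0 with speed close to -1, and from there on only the smallness of the perturbation
  counts, no longer its ratio to \<kappa>. The disk is a bent copy of the section of the Hopf flow
  on which z2 is real and nonnegative. The bound \<delta> has to be fixed before \<mu>, because
  \<kappa> tends to 0 as \<mu> tends to 1.\<close>

section \<open>Calculus of finitely often differentiable maps\<close>

lemma higher_differentiable_on_imp_continuous_on:
  "higher_differentiable_on S f n \<Longrightarrow> continuous_on S f"
  by (cases n) (auto intro!: continuous_at_imp_continuous_on differentiable_imp_continuous_within)

lemma higher_differentiable_on_SucD: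
  "higher_differentiable_on S f (Suc n) \<Longrightarrow> higher_differentiable_on S f n"
proof (induction n arbitrary: f)
  case 0
  then have "continuous_on S f" by (rule higher_differentiable_on_imp_continuous_on)
  then show ?case by simp
next
  case (Suc n)
  then show ?case using higher_differentiable_on.simps(2) by blast
qed

lemma higher_differentiable_on_subset:
  "higher_differentiable_on S f n \<Longrightarrow> T \<subseteq> S \<Longrightarrow> higher_differentiable_on T f n"
  by (induction n arbitrary: f) (auto intro: continuous_on_subset)

lemma frechet_derivative_cong_open:
  assumes "open S" "x \<in> S" "\<And>x. x \<in> S \<Longrightarrow> f x = g x"
  shows "frechet_derivative f (at x) = frechet_derivative g (at x)"
proof -
  have "(f has_derivative D) (at x) \<longleftrightarrow> (g has_derivative D) (at x)" for D
    using assms has_derivative_transform_within_open[of f D x UNIV S g]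
      has_derivative_transform_within_open[of g D x UNIV S f] by force
  then show ?thesis unfolding frechet_derivative_def by simp
qed

lemma higher_differentiable_on_cong:
  assumes "open S" "\<And>x. x \<in> S \<Longrightarrow> f x = g x" "higher_differentiable_on S f n"
  shows "higher_differentiable_on S g n"
  using assms(2,3)
proof (induction n arbitrary: f g)
  case 0
  then show ?case using continuous_on_cong by force
next
  case (Suc n)
  have "g differentiable at x" if "x \<in> S" for x
    using Suc.prems that assms(1)
    by (metis differentiable_def has_derivative_transform_within_open higher_differentiable_on.simps(2))
  moreover have "higher_differentiable_on S (\<lambda>x. frechet_derivative g (at x) h) n" for h
    by (rule Suc.IH[of "\<lambda>x. frechet_derivative f (at x) h"])
      (use Suc.prems frechet_derivative_cong_open[OF assms(1), of _ f g] in auto)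
  ultimately show ?case by simp
qed

text \<open>Derivatives are unique, so an explicit formula may replace the chosen
  \<open>frechet_derivative\<close>. Each closure property below is then an induction driven by the
  usual differentiation rule.\<close>

lemma higher_differentiable_on_SucI:
  assumes "open S" "\<And>x. x \<in> S \<Longrightarrow> (f has_derivative f' x) (at x)"
    "\<And>h. higher_differentiable_on S (\<lambda>x. f' x h) n"
  shows "higher_differentiable_on S f (Suc n)"
proof -
  have "frechet_derivative f (at x) = f' x" if "x \<in> S" for x
    using assms(2)[OF that] frechet_derivative_at by metis
  then have "higher_differentiable_on S (\<lambda>x. frechet_derivative f (at x) h) n" for h
    using higher_differentiable_on_cong[OF assms(1) _ assms(3)[of h]] by simp
  then show ?thesis using assms(2) by (auto simp: differentiable_def)
qed

text \<open>For functions that are given by different smooth formulas near different points, such as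
  a periodic function of the argument.\<close>

lemma higher_differentiable_on_local:
  assumes "\<And>x. x \<in> S \<Longrightarrow> \<exists>T. open T \<and> x \<in> T \<and> higher_differentiable_on T f n"
  shows "higher_differentiable_on S f n"
  using assms
proof (induction n arbitrary: f)
  case 0
  have "isCont f x" if "x \<in> S" for x
    using 0[OF that] by (auto simp: continuous_on_eq_continuous_at)
  then show ?case by (simp add: continuous_at_imp_continuous_on)
next
  case (Suc n)
  have "f differentiable at x" if "x \<in> S" for x
    using Suc.prems[OF that] by auto
  moreover have "higher_differentiable_on S (\<lambda>x. frechet_derivative f (at x) h) n" for h
  proof (rule Suc.IH)
    fix x assume "x \<in> S"
    then obtain T where "open T" "x \<in> T" "higher_differentiable_on T f (Suc n)" using Suc.prems by blast
    then show "\<exists>T. open T \<and> x \<in> T \<and> higher_differentiable_on T (\<lambda>x. frechet_derivative f (at x) h) n"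
      by auto
  qed
  ultimately show ?case by simp
qed

lemma higher_differentiable_on_const: "higher_differentiable_on S (\<lambda>x. c) n"
proof (induction n arbitrary: c)
  case (Suc n)
  have "frechet_derivative (\<lambda>x. c) (at x) h = 0" for x :: 'a and h
    using frechet_derivative_at[OF has_derivative_const[of c "at x"]] by metis
  with Suc show ?case by simp
qed simp

lemma higher_differentiable_on_bounded_linear_comp:
  assumes "bounded_linear A" "open S" "higher_differentiable_on S f n"
  shows "higher_differentiable_on S (\<lambda>x. A (f x)) n"
  using assms(3)
proof (induction n arbitrary: f)
  case 0
  then show ?case using assms(1) by (simp add: bounded_linear.continuous_on)
next
  case (Suc n)
  show ?case
  proof (rule higher_differentiable_on_SucI[OF assms(2)])
    show "((\<lambda>x. A (f x)) has_derivative (\<lambda>h. A (frechet_derivative f (at x) h))) (at x)" if "x \<in> S" for x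
      using Suc.prems that
      by (auto intro!: bounded_linear.has_derivative[OF assms(1)] simp: frechet_derivative_works)
    show "higher_differentiable_on S (\<lambda>x. A (frechet_derivative f (at x) h)) n" for h
      using Suc by simp
  qed
qed

lemma higher_differentiable_on_id: "open S \<Longrightarrow> higher_differentiable_on S (\<lambda>x. x) n"
proof (cases n)
  case (Suc m)
  assume "open S"
  then show ?thesis unfolding Suc
    by (rule higher_differentiable_on_SucI[where f' = "\<lambda>x h. h"])
      (auto intro: higher_differentiable_on_const)
qed simp

lemma higher_differentiable_on_add:
  assumes "open S" "higher_differentiable_on S f n" "higher_differentiable_on S g n"
  shows "higher_differentiable_on S (\<lambda>x. f x + g x) n"
  using assms(2,3)
proof (induction n arbitrary: f g)
  case 0
  then show ?case by (auto intro: continuous_intros)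
next
  case (Suc n)
  show ?case
  proof (rule higher_differentiable_on_SucI[OF assms(1)])
    show "((\<lambda>x. f x + g x) has_derivative
      (\<lambda>h. frechet_derivative f (at x) h + frechet_derivative g (at x) h)) (at x)" if "x \<in> S" for x
      using Suc.prems that by (auto intro!: has_derivative_add simp: frechet_derivative_works)
    show "higher_differentiable_on S (\<lambda>x. frechet_derivative f (at x) h + frechet_derivative g (at x) h) n" for h
      using Suc by simp
  qed
qed

lemma higher_differentiable_on_bounded_bilinear:
  assumes "bounded_bilinear B" "open S" "higher_differentiable_on S f n" "higher_differentiable_on S g n"
  shows "higher_differentiable_on S (\<lambda>x. B (f x) (g x)) n"
  using assms(3,4)
proof (induction n arbitrary: f g)
  case 0
  then show ?case using bounded_bilinear.continuous_on[OF assms(1)] by auto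
next
  case (Suc n)
  show ?case
  proof (rule higher_differentiable_on_SucI[OF assms(2)])
    show "((\<lambda>x. B (f x) (g x)) has_derivative
      (\<lambda>h. B (f x) (frechet_derivative g (at x) h) + B (frechet_derivative f (at x) h) (g x))) (at x)"
      if "x \<in> S" for x
      using Suc.prems that
      by (auto intro!: bounded_bilinear.FDERIV[OF assms(1)] simp: frechet_derivative_works)
    have "higher_differentiable_on S f n" "higher_differentiable_on S g n"
      using Suc.prems higher_differentiable_on_SucD by blast+
    then show "higher_differentiable_on S (\<lambda>x. B (f x) (frechet_derivative g (at x) h) +
        B (frechet_derivative f (at x) h) (g x)) n" for h
      using Suc.prems by (intro higher_differentiable_on_add[OF assms(2)] Suc.IH) auto
  qed
qed

lemma higher_differentiable_on_sum:
  assumes "open S" "\<And>i. i \<in> I \<Longrightarrow> higher_differentiable_on S (f i) n"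
  shows "higher_differentiable_on S (\<lambda>x. \<Sum>i\<in>I. f i x) n"
  using assms(2)
  by (induction I rule: infinite_finite_induct)
    (auto intro: higher_differentiable_on_const higher_differentiable_on_add[OF assms(1)])

text \<open>Regularity of a derivative is known only for each fixed direction. Expanding
  \<open>w x\<close> in the basis reduces a moving direction to fixed ones, which is what the chain
  rule requires.\<close>

lemma higher_differentiable_on_linear_family:
  fixes A :: "'a::euclidean_space \<Rightarrow> 'b::euclidean_space \<Rightarrow> 'c::euclidean_space"
  assumes "open S" "\<And>x. x \<in> S \<Longrightarrow> linear (A x)" "\<And>e. higher_differentiable_on S (\<lambda>x. A x e) n"
    "higher_differentiable_on S w n"
  shows "higher_differentiable_on S (\<lambda>x. A x (w x)) n"
proof (rule higher_differentiable_on_cong[OF assms(1)])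
  have "higher_differentiable_on S (\<lambda>x. (w x \<bullet> b) *\<^sub>R A x b) n" for b
    by (rule higher_differentiable_on_bounded_bilinear[OF bounded_bilinear_scaleR assms(1) _ assms(3)])
      (rule higher_differentiable_on_bounded_linear_comp[OF bounded_linear_inner_left assms(1,4)])
  then show "higher_differentiable_on S (\<lambda>x. \<Sum>b\<in>Basis. (w x \<bullet> b) *\<^sub>R A x b) n"
    by (intro higher_differentiable_on_sum assms(1))
  show "(\<Sum>b\<in>Basis. (w x \<bullet> b) *\<^sub>R A x b) = A x (w x)" if "x \<in> S" for x
    using assms(2)[OF that]
    by (subst (2) euclidean_representation[symmetric])
      (simp add: linear_sum linear_scale del: euclidean_representation)
qed

lemma higher_differentiable_on_compose:
  fixes f :: "'b::euclidean_space \<Rightarrow> 'c::euclidean_space" and g :: "'a::euclidean_space \<Rightarrow> 'b"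
  assumes "open S" "open T" "g ` S \<subseteq> T" "higher_differentiable_on T f n" "higher_differentiable_on S g n"
  shows "higher_differentiable_on S (\<lambda>x. f (g x)) n"
  using assms(4,5)
proof (induction n arbitrary: f)
  case 0
  then show ?case using assms(3) by (auto intro: continuous_on_compose2)
next
  case (Suc n)
  show ?case
  proof (rule higher_differentiable_on_SucI[OF assms(1)])
    show D: "((\<lambda>x. f (g x)) has_derivative
      (\<lambda>h. frechet_derivative f (at (g x)) (frechet_derivative g (at x) h))) (at x)" if "x \<in> S" for x
    proof -
      have "(f has_derivative frechet_derivative f (at (g x))) (at (g x))"
        "(g has_derivative frechet_derivative g (at x)) (at x)"
        using Suc.prems that assms(3) by (auto simp flip: frechet_derivative_works)
      from diff_chain_at[OF this(2,1)] show ?thesis by (simp add: o_def)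
    qed
    have "linear (frechet_derivative f (at (g x)))" if "x \<in> S" for x
      using Suc.prems that assms(3) by (auto intro!: linear_frechet_derivative)
    \<comment> \<open>The induction generalizes the outer map only: its hypothesis is used for a
      directional derivative of \<open>f\<close> composed with the same \<open>g\<close>.\<close>
    moreover have "higher_differentiable_on S (\<lambda>x. frechet_derivative f (at (g x)) e) n" for e
      using Suc.IH[of "\<lambda>y. frechet_derivative f (at y) e"] Suc.prems higher_differentiable_on_SucD by auto
    ultimately show "higher_differentiable_on S
      (\<lambda>x. frechet_derivative f (at (g x)) (frechet_derivative g (at x) h)) n" for h
      using higher_differentiable_on_linear_family[OF assms(1),
          of "\<lambda>x. frechet_derivative f (at (g x))" n "\<lambda>x. frechet_derivative g (at x) h"] Suc.prems by simp
  qed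
qed

section \<open>Infinitely differentiable maps\<close>

lemma smooth_on_imp_continuous_on: "smooth_on S f \<Longrightarrow> continuous_on S f"
  using higher_differentiable_on_imp_continuous_on by (auto simp: smooth_on_def)

lemma smooth_on_imp_differentiable: "smooth_on S f \<Longrightarrow> x \<in> S \<Longrightarrow> f differentiable at x"
  unfolding smooth_on_def using higher_differentiable_on.simps(2)[of S f 0] by blast

lemma smooth_on_has_derivative:
  "smooth_on S f \<Longrightarrow> x \<in> S \<Longrightarrow> (f has_derivative frechet_derivative f (at x)) (at x)"
  using smooth_on_imp_differentiable frechet_derivative_works by blast

lemma smooth_on_frechet_derivative: "smooth_on S f \<Longrightarrow> smooth_on S (\<lambda>x. frechet_derivative f (at x) h)"
  unfolding smooth_on_def using higher_differentiable_on.simps(2)[of S f] by blast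

lemma smooth_on_subset: "smooth_on S f \<Longrightarrow> T \<subseteq> S \<Longrightarrow> smooth_on T f"
  unfolding smooth_on_def using higher_differentiable_on_subset by blast

lemma smooth_on_cong: "open S \<Longrightarrow> (\<And>x. x \<in> S \<Longrightarrow> f x = g x) \<Longrightarrow> smooth_on S f \<Longrightarrow> smooth_on S g"
  unfolding smooth_on_def using higher_differentiable_on_cong by blast

lemma smooth_on_local:
  assumes "\<And>x. x \<in> S \<Longrightarrow> \<exists>T. open T \<and> x \<in> T \<and> smooth_on T f"
  shows "smooth_on S f"
  unfolding smooth_on_def
proof
  fix n show "higher_differentiable_on S f n"
  proof (rule higher_differentiable_on_local)
    fix x assume "x \<in> S"
    from assms[OF this] show "\<exists>T. open T \<and> x \<in> T \<and> higher_differentiable_on T f n"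
      unfolding smooth_on_def by blast
  qed
qed

lemma smooth_onI_derivative:
  assumes "open S" "\<And>x. x \<in> S \<Longrightarrow> (f has_derivative f' x) (at x)" "\<And>h. smooth_on S (\<lambda>x. f' x h)"
  shows "smooth_on S f"
  unfolding smooth_on_def
proof
  fix n show "higher_differentiable_on S f n"
    by (rule higher_differentiable_on_SucD, rule higher_differentiable_on_SucI[OF assms(1,2)])
      (use assms(3) in \<open>auto simp: smooth_on_def\<close>)
qed

lemma smooth_on_const [simp, intro]: "smooth_on S (\<lambda>x. c)"
  by (simp add: smooth_on_def higher_differentiable_on_const)

lemma smooth_on_id: "open S \<Longrightarrow> smooth_on S (\<lambda>x. x)"
  by (simp add: smooth_on_def higher_differentiable_on_id)

lemma smooth_on_bounded_linear:
  "bounded_linear A \<Longrightarrow> open S \<Longrightarrow> smooth_on S f \<Longrightarrow> smooth_on S (\<lambda>x. A (f x))"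
  by (simp add: smooth_on_def higher_differentiable_on_bounded_linear_comp)

lemma smooth_on_bounded_bilinear:
  "bounded_bilinear B \<Longrightarrow> open S \<Longrightarrow> smooth_on S f \<Longrightarrow> smooth_on S g \<Longrightarrow> smooth_on S (\<lambda>x. B (f x) (g x))"
  by (simp add: smooth_on_def higher_differentiable_on_bounded_bilinear)

lemmas smooth_on_fst = smooth_on_bounded_linear[OF bounded_linear_fst]
lemmas smooth_on_snd = smooth_on_bounded_linear[OF bounded_linear_snd]
lemmas smooth_on_Re = smooth_on_bounded_linear[OF bounded_linear_Re]
lemmas smooth_on_Im = smooth_on_bounded_linear[OF bounded_linear_Im]
lemmas smooth_on_cnj = smooth_on_bounded_linear[OF bounded_linear_cnj]
lemmas smooth_on_uminus = smooth_on_bounded_linear[OF bounded_linear_minus[OF bounded_linear_ident]]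
lemmas smooth_on_scaleR = smooth_on_bounded_bilinear[OF bounded_bilinear_scaleR]
lemmas smooth_on_inner = smooth_on_bounded_bilinear[OF bounded_bilinear_inner]

lemma smooth_on_mult:
  fixes f g :: "'a::euclidean_space \<Rightarrow> 'b::{real_normed_algebra,euclidean_space}"
  shows "open S \<Longrightarrow> smooth_on S f \<Longrightarrow> smooth_on S g \<Longrightarrow> smooth_on S (\<lambda>x. f x * g x)"
  by (rule smooth_on_bounded_bilinear[OF bounded_bilinear_mult])

lemma smooth_on_power:
  fixes f :: "'a::euclidean_space \<Rightarrow> 'b::{real_normed_algebra_1,euclidean_space}"
  shows "open S \<Longrightarrow> smooth_on S f \<Longrightarrow> smooth_on S (\<lambda>x. f x ^ n)"
  by (induction n) (simp_all add: smooth_on_mult)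

lemma smooth_on_add:
  "open S \<Longrightarrow> smooth_on S f \<Longrightarrow> smooth_on S g \<Longrightarrow> smooth_on S (\<lambda>x. f x + g x)"
  by (simp add: smooth_on_def higher_differentiable_on_add)

lemma smooth_on_diff:
  "open S \<Longrightarrow> smooth_on S f \<Longrightarrow> smooth_on S g \<Longrightarrow> smooth_on S (\<lambda>x. f x - g x)"
  using smooth_on_add[OF _ _ smooth_on_uminus, of S f g] by simp

lemma smooth_on_Pair:
  fixes f :: "'a::euclidean_space \<Rightarrow> 'b::euclidean_space" and g :: "'a \<Rightarrow> 'c::euclidean_space"
  assumes "open S" "smooth_on S f" "smooth_on S g"
  shows "smooth_on S (\<lambda>x. (f x, g x))"
proof -
  have "smooth_on S (\<lambda>x. (f x, 0) + (0, g x))"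
    by (intro smooth_on_add assms
        smooth_on_bounded_linear[OF bounded_linear_Pair[OF bounded_linear_ident bounded_linear_zero]]
        smooth_on_bounded_linear[OF bounded_linear_Pair[OF bounded_linear_zero bounded_linear_ident]])
  then show ?thesis by simp
qed

lemma smooth_on_compose:
  "open S \<Longrightarrow> open T \<Longrightarrow> (\<And>x. x \<in> S \<Longrightarrow> g x \<in> T) \<Longrightarrow> smooth_on T f \<Longrightarrow> smooth_on S g \<Longrightarrow> smooth_on S (\<lambda>x. f (g x))"
  unfolding smooth_on_def by (blast intro: higher_differentiable_on_compose)

text \<open>The derivative is a polynomial in the inverse itself, so each order of differentiability
  yields the next.\<close>

lemma smooth_on_inverse_field: "smooth_on (- {0::'a::{real_normed_field,euclidean_space}}) inverse"
  unfolding smooth_on_def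
proof
  fix n show "higher_differentiable_on (- {0::'a}) inverse n"
  proof (induction n)
    case 0
    then show ?case by (auto intro!: continuous_intros)
  next
    case (Suc n)
    show ?case
    proof (rule higher_differentiable_on_SucI)
      show "(inverse has_derivative (\<lambda>h. - (inverse x * h * inverse x))) (at x)" if "x \<in> - {0::'a}" for x
        using that by (intro has_derivative_inverse') auto
      show "higher_differentiable_on (- {0::'a}) (\<lambda>x. - (inverse x * h * inverse x)) n" for h
        by (intro higher_differentiable_on_bounded_linear_comp[OF bounded_linear_minus[OF bounded_linear_ident]]
            higher_differentiable_on_bounded_bilinear[OF bounded_bilinear_mult]
            higher_differentiable_on_const Suc) auto
    qed auto
  qed
qed

lemma smooth_on_inverse:
  fixes f :: "'a::euclidean_space \<Rightarrow> 'b::{real_normed_field,euclidean_space}"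
  assumes "open S" "smooth_on S f" "\<And>x. x \<in> S \<Longrightarrow> f x \<noteq> 0"
  shows "smooth_on S (\<lambda>x. inverse (f x))"
  by (rule smooth_on_compose[OF assms(1) _ _ smooth_on_inverse_field assms(2)]) (use assms(3) in auto)

lemma smooth_on_divide:
  fixes f g :: "'a::euclidean_space \<Rightarrow> 'b::{real_normed_field,euclidean_space}"
  assumes "open S" "smooth_on S f" "smooth_on S g" "\<And>x. x \<in> S \<Longrightarrow> g x \<noteq> 0"
  shows "smooth_on S (\<lambda>x. f x / g x)"
  using smooth_on_mult[OF assms(1,2) smooth_on_inverse[OF assms(1,3,4)]]
  by (simp add: divide_inverse)

text \<open>Bootstrapping as for the inverse: the derivative is half the reciprocal of the
  function.\<close>

lemma smooth_on_sqrt_pos: "smooth_on {0<..} sqrt"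
  unfolding smooth_on_def
proof
  fix n show "higher_differentiable_on {0<..} sqrt n"
  proof (induction n)
    case 0
    then show ?case by (auto intro!: continuous_intros)
  next
    case (Suc n)
    show ?case
    proof (rule higher_differentiable_on_SucI)
      show "(sqrt has_derivative (\<lambda>h. (inverse (sqrt x) / 2) * h)) (at x)" if "x \<in> {0<..}" for x
        using DERIV_real_sqrt[of x] that by (simp only: has_field_derivative_def greaterThan_iff)
      have "higher_differentiable_on {0<..} (\<lambda>x. inverse (sqrt x)) n"
        by (rule higher_differentiable_on_compose[where T = "- {0}"])
          (use Suc smooth_on_inverse_field in \<open>auto simp: smooth_on_def\<close>)
      then have "higher_differentiable_on {0<..} (\<lambda>x. (h / 2) * inverse (sqrt x)) n" for h
        by (rule higher_differentiable_on_bounded_linear_comp[OF bounded_linear_mult_right open_greaterThan])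
      then show "higher_differentiable_on {0<..} (\<lambda>x. (inverse (sqrt x) / 2) * h) n" for h
        by (simp add: mult.commute)
    qed auto
  qed
qed

lemma smooth_on_sqrt:
  "open S \<Longrightarrow> smooth_on S f \<Longrightarrow> (\<And>x. x \<in> S \<Longrightarrow> f x > 0) \<Longrightarrow> smooth_on S (\<lambda>x. sqrt (f x))"
  by (rule smooth_on_compose[OF _ open_greaterThan _ smooth_on_sqrt_pos]) simp_all

lemma smooth_on_norm:
  assumes "open S" "smooth_on S f" "\<And>x. x \<in> S \<Longrightarrow> f x \<noteq> 0"
  shows "smooth_on S (\<lambda>x. norm (f x))"
  using smooth_on_sqrt[OF assms(1) smooth_on_inner[OF assms(1,2,2)]] assms(3)
  by (simp add: norm_eq_sqrt_inner)

lemma smooth_on_Ln: "smooth_on (- \<real>\<^sub>\<le>\<^sub>0) Ln"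
proof (rule smooth_onI_derivative)
  show "open (- \<real>\<^sub>\<le>\<^sub>0 :: complex set)" by (simp add: open_Compl)
  show "(Ln has_derivative (\<lambda>h. inverse x * h)) (at x)" if "x \<in> - \<real>\<^sub>\<le>\<^sub>0" for x
    using has_field_derivative_Ln[of x] that by (auto simp: has_field_derivative_def)
  show "smooth_on (- \<real>\<^sub>\<le>\<^sub>0) (\<lambda>x::complex. inverse x * h)" for h
    by (intro smooth_on_mult smooth_on_inverse smooth_on_id smooth_on_const) (auto simp: open_Compl)
qed

text \<open>The differential equation expresses the derivative as \<open>X\<close> of the curve,
  which raises the order of differentiability by one.\<close>

lemma smooth_on_integral_curve:
  fixes z :: "real \<Rightarrow> 'a::euclidean_space"
  assumes "open U" "smooth_on U X" "\<And>t. z t \<in> U" "\<And>t. (z has_vector_derivative X (z t)) (at t)"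
  shows "smooth_on UNIV z"
  unfolding smooth_on_def
proof
  fix n show "higher_differentiable_on UNIV z n"
  proof (induction n)
    case 0
    then show ?case
      using assms(4) by (auto intro!: continuous_at_imp_continuous_on has_vector_derivative_continuous)
  next
    case (Suc n)
    show ?case
    proof (rule higher_differentiable_on_SucI)
      show "(z has_derivative (\<lambda>h. h *\<^sub>R X (z t))) (at t)" for t
        using assms(4) by (simp add: has_vector_derivative_def)
      have "higher_differentiable_on UNIV (\<lambda>t. X (z t)) n"
        by (rule higher_differentiable_on_compose[where f = X and g = z, OF open_UNIV assms(1)])
          (use assms Suc in \<open>auto simp: smooth_on_def\<close>)
      then show "higher_differentiable_on UNIV (\<lambda>t. h *\<^sub>R X (z t)) n" for h
        by (rule higher_differentiable_on_bounded_linear_comp[OF bounded_linear_scaleR_right open_UNIV])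
    qed auto
  qed
qed

section \<open>Smooth inverse functions and regular level sets\<close>

text \<open>The map \<open>(y, w) \<mapsto> (y, A\<^sub>y w)\<close> has the inverse \<open>(y, h) \<mapsto> (y, A\<^sub>y\<inverse> h)\<close>, so differentiability of the
  family of inverses is an instance of differentiability of inverse maps.\<close>

lemma has_derivative_inverse_family:
  fixes A B :: "'a::euclidean_space \<Rightarrow> 'b::euclidean_space \<Rightarrow> 'b"
  assumes S: "open S" "x \<in> S" and lin: "\<And>x. x \<in> S \<Longrightarrow> linear (A x)" "\<And>x. x \<in> S \<Longrightarrow> linear (B x)"
    and inv: "\<And>x h. x \<in> S \<Longrightarrow> A x (B x h) = h" "\<And>x h. x \<in> S \<Longrightarrow> B x (A x h) = h"
    and diff: "\<And>e x. x \<in> S \<Longrightarrow> (\<lambda>x. A x e) differentiable (at x)"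
  shows "((\<lambda>x. B x h) has_derivative
    (\<lambda>k. - B x (\<Sum>b\<in>Basis. (B x h \<bullet> b) *\<^sub>R frechet_derivative (\<lambda>x. A x b) (at x) k))) (at x)"
proof -
  define D where "D x b = frechet_derivative (\<lambda>x. A x b) (at x)" for x b
  define f where "f = (\<lambda>p. (fst p, \<Sum>b\<in>Basis. (snd p \<bullet> b) *\<^sub>R A (fst p) b))"
  define g where "g = (\<lambda>p. (fst p, B (fst p) (snd p)))"
  define f' where "f' p = (\<lambda>q. (fst q, \<Sum>b\<in>Basis. (snd p \<bullet> b) *\<^sub>R D (fst p) b (fst q)
      + (snd q \<bullet> b) *\<^sub>R A (fst p) b))" for p :: "'a \<times> 'b"
  define w where "w = B x h"
  define g' where "g' = (\<lambda>q. (fst q, B x (snd q - (\<Sum>b\<in>Basis. (w \<bullet> b) *\<^sub>R D x b (fst q)))))"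
  have rep: "(\<Sum>b\<in>Basis. (v \<bullet> b) *\<^sub>R A y b) = A y v" if "y \<in> S" for y v
    using lin(1)[OF that] by (subst (2) euclidean_representation[symmetric])
      (simp add: linear_sum linear_scale del: euclidean_representation)
  have derf: "(f has_derivative f' p) (at p)" if "p \<in> S \<times> UNIV" for p
  proof -
    have 1: "((\<lambda>x. A x b) has_derivative D (fst p) b) (at (fst p))" for b
      unfolding D_def using diff that frechet_derivative_works by (auto simp: mem_Times_iff)
    have 2: "((\<lambda>q. A (fst q) b) has_derivative (\<lambda>q. D (fst p) b (fst q))) (at p)" for b
      using diff_chain_at[OF has_derivative_fst[OF has_derivative_ident] 1] by (simp add: o_def)
    show ?thesis unfolding f_def f'_def
      by (intro has_derivative_Pair has_derivative_fst has_derivative_ident has_derivative_sum,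
          rule has_derivative_scaleR[OF has_derivative_inner_left[OF has_derivative_snd[OF has_derivative_ident]] 2])
  qed
  have "(g has_derivative g') (at (f (x, w)))"
  proof (rule has_derivative_inverse_strong[where f = f and x = "(x, w)" and S = "S \<times> UNIV" and f' = "f' (x, w)"])
    show "open (S \<times> (UNIV :: 'b set))" using S by (simp add: open_Times)
    show "(x, w) \<in> S \<times> UNIV" using S by simp
    show "continuous_on (S \<times> UNIV) f"
      using derf by (meson continuous_at_imp_continuous_on has_derivative_continuous)
    show "g (f p) = p" if "p \<in> S \<times> UNIV" for p
      using that rep inv(2) by (auto simp: f_def g_def)
    show "(f has_derivative f' (x, w)) (at (x, w))" using derf S by simp
    show "f' (x, w) \<circ> g' = id"
      using rep[OF S(2)] inv(1)[OF S(2)] by (auto simp: fun_eq_iff f'_def g'_def sum.distrib)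
  qed
  moreover have "f (x, w) = (x, h)" unfolding f_def w_def using rep inv S by simp
  ultimately have "(g has_derivative g') (at (x, h))" by simp
  moreover have "((\<lambda>y. (y, h)) has_derivative (\<lambda>k. (k, 0))) (at x)"
    by (intro has_derivative_Pair has_derivative_ident has_derivative_const)
  ultimately have "(g \<circ> (\<lambda>y. (y, h)) has_derivative g' \<circ> (\<lambda>k. (k, 0))) (at x)"
    by (metis diff_chain_at)
  then have "((\<lambda>y. snd (g (y, h))) has_derivative (\<lambda>k. snd (g' (k, 0)))) (at x)"
    by (auto simp: o_def intro: has_derivative_snd)
  then show ?thesis
    using lin(2)[OF S(2)] by (simp add: g_def g'_def w_def D_def linear_neg)
qed

text \<open>The derivative of the family of inverses is \<open>- B (dA) B\<close>. It contains
  \<open>B\<close> only undifferentiated, so the order of \<open>B\<close> can be raised one by one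
  as long as \<open>A\<close> allows it.\<close>

lemma higher_differentiable_on_inverse_family:
  fixes A B :: "'a::euclidean_space \<Rightarrow> 'b::euclidean_space \<Rightarrow> 'b"
  assumes S: "open S" and lin: "\<And>x. x \<in> S \<Longrightarrow> linear (A x)" "\<And>x. x \<in> S \<Longrightarrow> linear (B x)"
    and inv: "\<And>x h. x \<in> S \<Longrightarrow> A x (B x h) = h" "\<And>x h. x \<in> S \<Longrightarrow> B x (A x h) = h"
    and diff: "\<And>e x. x \<in> S \<Longrightarrow> (\<lambda>x. A x e) differentiable (at x)"
    and hd: "\<And>e. higher_differentiable_on S (\<lambda>x. A x e) n"
  shows "higher_differentiable_on S (\<lambda>x. B x h) n"
  using hd
proof (induction n arbitrary: h)
  case 0
  have "isCont (\<lambda>x. B x h) x" if "x \<in> S" for x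
    using has_derivative_continuous[OF has_derivative_inverse_family[OF S that lin inv diff]] by blast
  then show ?case by (simp add: continuous_at_imp_continuous_on)
next
  case (Suc n)
  have IH: "higher_differentiable_on S (\<lambda>x. B x h) n" for h
    using Suc higher_differentiable_on_SucD by blast
  have D: "higher_differentiable_on S (\<lambda>x. frechet_derivative (\<lambda>x. A x b) (at x) k) n" for b k
    using Suc.prems by simp
  show ?case
  proof (rule higher_differentiable_on_SucI[OF S])
    show "((\<lambda>x. B x h) has_derivative
      (\<lambda>k. - B x (\<Sum>b\<in>Basis. (B x h \<bullet> b) *\<^sub>R frechet_derivative (\<lambda>x. A x b) (at x) k))) (at x)"
      if "x \<in> S" for x
      by (rule has_derivative_inverse_family[OF S that lin inv diff])
    have "higher_differentiable_on S (\<lambda>x. (B x h \<bullet> b) *\<^sub>R frechet_derivative (\<lambda>x. A x b) (at x) k) n" for b k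
      by (rule higher_differentiable_on_bounded_bilinear[OF bounded_bilinear_scaleR S _ D])
        (rule higher_differentiable_on_bounded_linear_comp[OF bounded_linear_inner_left S IH])
    then have w: "higher_differentiable_on S
      (\<lambda>x. \<Sum>b\<in>Basis. (B x h \<bullet> b) *\<^sub>R frechet_derivative (\<lambda>x. A x b) (at x) k) n" for k
      by (rule higher_differentiable_on_sum[OF S])
    show "higher_differentiable_on S (\<lambda>x. - B x
      (\<Sum>b\<in>Basis. (B x h \<bullet> b) *\<^sub>R frechet_derivative (\<lambda>x. A x b) (at x) k)) n" for k
      by (rule higher_differentiable_on_bounded_linear_comp[OF bounded_linear_minus[OF bounded_linear_ident] S])
        (rule higher_differentiable_on_linear_family[OF S lin(2) IH w])
  qed
qed

text \<open>By the chain rule \<open>g' y\<close> inverts the derivative of \<open>f\<close> at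
  \<open>g y\<close>. If \<open>g\<close> is n times differentiable, so is this family of
  derivatives along \<open>g\<close>, hence so is the family of its inverses, and \<open>g\<close>
  gains one order.\<close>

lemma smooth_on_inverse_map:
  fixes f g :: "'a::euclidean_space \<Rightarrow> 'a"
  assumes S: "open S" and T: "open T" and f: "smooth_on S f" and gT: "\<And>y. y \<in> T \<Longrightarrow> g y \<in> S"
    and fg: "\<And>y. y \<in> T \<Longrightarrow> f (g y) = y" and dg: "\<And>y. y \<in> T \<Longrightarrow> (g has_derivative g' y) (at y)"
  shows "smooth_on T g"
proof -
  define A where "A y = frechet_derivative f (at (g y))" for y
  have df: "(f has_derivative A y) (at (g y))" if "y \<in> T" for y
    unfolding A_def using smooth_on_has_derivative[OF f gT[OF that]] .
  have lin: "linear (A y)" "linear (g' y)" if "y \<in> T" for y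
    using df[OF that] dg[OF that] has_derivative_linear by auto
  have Ag: "A y \<circ> g' y = id" if "y \<in> T" for y
  proof -
    have "(f \<circ> g has_derivative A y \<circ> g' y) (at y)"
      using diff_chain_at[OF dg df] that by blast
    then have "(id has_derivative A y \<circ> g' y) (at y)"
      by (rule has_derivative_transform_within_open[OF _ T that]) (simp add: fg)
    then show ?thesis
      using has_derivative_unique[OF _ has_derivative_id] by blast
  qed
  have gA: "g' y \<circ> A y = id" if "y \<in> T" for y
    using linear_inverse_left[OF lin[OF that]] Ag[OF that] by simp
  have inv: "A y (g' y h) = h" "g' y (A y h) = h" if "y \<in> T" for y h
    using Ag[OF that] gA[OF that] by (simp_all add: fun_eq_iff)
  have d: "(\<lambda>y. A y e) differentiable (at y)" if "y \<in> T" for e y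
  proof -
    have "(\<lambda>x. frechet_derivative f (at x) e) differentiable (at (g y))"
      using smooth_on_imp_differentiable[OF smooth_on_frechet_derivative[OF f] gT[OF that]] .
    moreover have "g differentiable (at y)" using dg[OF that] by (auto simp: differentiable_def)
    ultimately show ?thesis unfolding A_def using differentiable_chain_at[of g y]
      by (auto simp: o_def)
  qed
  have "higher_differentiable_on T g n" for n
  proof (induction n)
    case 0
    then show ?case using dg
      by (auto intro!: continuous_at_imp_continuous_on has_derivative_continuous)
  next
    case (Suc n)
    have "higher_differentiable_on T (\<lambda>y. A y e) n" for e
      unfolding A_def
      by (rule higher_differentiable_on_compose[where f = "\<lambda>x. frechet_derivative f (at x) e" and g = g, OF T S _ _ Suc])
        (use gT smooth_on_frechet_derivative[OF f] in \<open>auto simp: smooth_on_def\<close>)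
    then have "higher_differentiable_on T (\<lambda>y. g' y h) n" for h
      using higher_differentiable_on_inverse_family[OF T lin inv d] by blast
    then show ?case by (intro higher_differentiable_on_SucI[OF T dg])
  qed
  then show ?thesis by (simp add: smooth_on_def)
qed

lemma smooth_inverse_function_theorem:
  fixes f :: "'a::euclidean_space \<Rightarrow> 'a"
  assumes U: "open U" and f: "smooth_on U f" and x0: "x0 \<in> U"
    and d: "(f has_derivative f0) (at x0)" "inj f0"
  obtains U' V g where "open U'" "U' \<subseteq> U" "x0 \<in> U'" "open V" "homeomorphism U' V f g" "smooth_on V g"
proof -
  \<comment> \<open>The inverse function theorem asks for a derivative that is continuous in the
    operator norm. In finite dimension this follows from continuity on basis vectors.\<close>
  define f' where "f' x = Blinfun (frechet_derivative f (at x))" for x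
  have f': "blinfun_apply (f' x) = frechet_derivative f (at x)" if "x \<in> U" for x
    unfolding f'_def using smooth_on_has_derivative[OF f that]
    by (simp add: bounded_linear_Blinfun_apply has_derivative_bounded_linear)
  have der: "(f has_derivative blinfun_apply (f' x)) (at x)" if "x \<in> U" for x
    using smooth_on_has_derivative[OF f that] f'[OF that] by simp
  have cont: "continuous_on U f'"
    unfolding continuous_on_eq_continuous_at[OF U]
  proof
    fix x assume x: "x \<in> U"
    show "isCont f' x"
    proof (rule continuous_blinfun_componentwiseI1)
      fix i :: 'a assume "i \<in> Basis"
      have "continuous_on U (\<lambda>x. frechet_derivative f (at x) i)"
        using smooth_on_imp_continuous_on[OF smooth_on_frechet_derivative[OF f]] .
      then have "continuous_on U (\<lambda>x. blinfun_apply (f' x) i)"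
        using continuous_on_cong[of U U "\<lambda>x. blinfun_apply (f' x) i"] f' by simp
      then show "isCont (\<lambda>x. blinfun_apply (f' x) i) x"
        using continuous_on_eq_continuous_at[OF U] x by blast
    qed
  qed
  have f0: "f0 = blinfun_apply (f' x0)"
    using has_derivative_unique[OF d(1) der[OF x0]] .
  have "linear f0" using d(1) has_derivative_linear by blast
  then obtain h where h: "linear h" "\<And>x. h (f0 x) = x"
    using linear_injective_left_inverse[OF _ d(2)] by (auto simp: fun_eq_iff)
  define i where "i = Blinfun h"
  have i: "blinfun_apply i = h"
    unfolding i_def using h(1) by (simp add: bounded_linear_Blinfun_apply linear_conv_bounded_linear)
  have "i o\<^sub>L f' x0 = id_blinfun"
    by (rule blinfun_eqI) (simp add: i f0[symmetric] h)
  from inverse_function_theorem[OF U der cont x0 this]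
  obtain U' V g g' where *: "open U'" "U' \<subseteq> U" "x0 \<in> U'" "open V" "f x0 \<in> V" "homeomorphism U' V f g"
    "\<And>y. y \<in> V \<Longrightarrow> (g has_derivative (g' y)) (at y)" by metis
  have "smooth_on V g"
    by (rule smooth_on_inverse_map[OF *(1,4) smooth_on_subset[OF f *(2)] _ _ *(7)])
      (use *(6) in \<open>auto simp: homeomorphism_def\<close>)
  with * that show thesis by blast
qed

lemma dim_kernel_of_surj:
  fixes A :: "'a::euclidean_space \<Rightarrow> 'b::euclidean_space"
  assumes A: "linear A" "surj A"
  shows "dim {x. A x = 0} = DIM('a) - DIM('b)"
proof -
  obtain B where B: "linear B" "A \<circ> B = id" using linear_surjective_right_inverse[OF A] by blast
  have AB: "A (B y) = y" for y using B(2) by (simp add: fun_eq_iff)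
  have sub: "subspace {x. A x = 0}" "subspace (range B)"
    using A(1) B(1) linear_subspace_image[OF B(1) subspace_UNIV]
    by (auto intro: linear_subspace_kernel)
  have "x \<in> {x + y |x y. x \<in> {x. A x = 0} \<and> y \<in> range B}" for x
  proof -
    have "x = (x - B (A x)) + B (A x)" by simp
    moreover have "A (x - B (A x)) = 0" using A(1) AB by (simp add: linear_diff)
    ultimately show ?thesis by blast
  qed
  then have 1: "{x + y |x y. x \<in> {x. A x = 0} \<and> y \<in> range B} = UNIV" by auto
  have 2: "{x. A x = 0} \<inter> range B = {0}"
    using AB linear_0[OF A(1)] linear_0[OF B(1)] by (auto intro: range_eqI[of _ _ 0])
  have "inj B" using AB by (metis injI)
  then have 3: "dim (range B) = DIM('b)"
    using dim_image_eq[OF B(1), of UNIV] by simp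
  from dim_sums_Int[OF sub] show ?thesis unfolding 1 2 3 by simp
qed

lemma smooth_submanifold_regular_level_set:
  fixes F :: "'a::euclidean_space \<Rightarrow> 'b::euclidean_space"
  assumes U: "open U" "smooth_on U F" and S: "S = {z \<in> U. F z = 0}"
    and reg: "\<And>z. z \<in> S \<Longrightarrow> \<exists>A. (F has_derivative A) (at z) \<and> surj A"
  shows "smooth_submanifold (DIM('a) - DIM('b)) S"
  unfolding smooth_submanifold_def
proof
  fix z assume z: "z \<in> S"
  obtain A where A: "(F has_derivative A) (at z)" "surj A" using reg[OF z] by blast
  have linA: "linear A" using A(1) has_derivative_linear by blast
  then have blA: "bounded_linear A" by (simp add: linear_conv_bounded_linear)
  obtain B where B: "linear B" "A \<circ> B = id" using linear_surjective_right_inverse[OF linA A(2)] by blast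
  have AB: "A (B y) = y" for y using B(2) by (simp add: fun_eq_iff)
  have blB: "bounded_linear B" using B(1) by (simp add: linear_conv_bounded_linear)
  \<comment> \<open>The component of \<open>x\<close> along the range of \<open>B\<close> is
    replaced by \<open>F x\<close>. The derivative at \<open>z\<close> is the identity, and
    \<open>A (\<Phi> x) = F x\<close> turns the zero set of \<open>F\<close> into the kernel of
    \<open>A\<close>.\<close>
  define \<Phi> where "\<Phi> x = x - B (A x) + B (F x)" for x
  have A\<Phi>: "A (\<Phi> x) = F x" for x
    using linA AB by (simp add: \<Phi>_def linear_diff linear_add)
  have sm: "smooth_on U \<Phi>" unfolding \<Phi>_def
    by (intro smooth_on_add smooth_on_diff smooth_on_id smooth_on_bounded_linear[OF blB]
        smooth_on_bounded_linear[OF blA] U)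
  have "(\<Phi> has_derivative (\<lambda>h. h - B (A h) + B (A h))) (at z)"
    unfolding \<Phi>_def
    by (intro has_derivative_add has_derivative_diff has_derivative_ident
        bounded_linear.has_derivative[OF blB] bounded_linear.has_derivative[OF blA] A(1))
  moreover have "inj (\<lambda>h. h - B (A h) + B (A h))" by (simp add: inj_def)
  ultimately obtain W V \<Psi> where W: "open W" "W \<subseteq> U" "z \<in> W" "open V" "homeomorphism W V \<Phi> \<Psi>" "smooth_on V \<Psi>"
    using smooth_inverse_function_theorem[OF U(1) sm] z S by blast
  have "\<Phi> ` (S \<inter> W) = {x. A x = 0} \<inter> V"
  proof (intro equalityI subsetI)
    fix y assume "y \<in> \<Phi> ` (S \<inter> W)"
    then show "y \<in> {x. A x = 0} \<inter> V" using W(5) S by (auto simp: A\<Phi> homeomorphism_def)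
  next
    fix y assume y: "y \<in> {x. A x = 0} \<inter> V"
    then have "\<Psi> y \<in> W" "\<Phi> (\<Psi> y) = y" using W(5) by (auto simp: homeomorphism_def)
    moreover from this y have "F (\<Psi> y) = 0" using A\<Phi>[of "\<Psi> y"] by simp
    ultimately show "y \<in> \<Phi> ` (S \<inter> W)" using W(2) S by (auto intro!: image_eqI[of _ _ "\<Psi> y"])
  qed
  moreover have "subspace {x. A x = 0}" using linA by (rule linear_subspace_kernel)
  ultimately have "open W \<and> z \<in> W \<and> open V \<and> homeomorphism W V \<Phi> \<Psi> \<and> smooth_on W \<Phi> \<and>
      smooth_on V \<Psi> \<and> subspace {x. A x = 0} \<and> dim {x. A x = 0} = DIM('a) - DIM('b) \<and>
      \<Phi> ` (S \<inter> W) = {x. A x = 0} \<inter> V"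
    using W smooth_on_subset[OF sm W(2)] dim_kernel_of_surj[OF linA A(2)] by (intro conjI)
  then show "\<exists>W V (\<Phi> :: 'a \<Rightarrow> 'a) \<Psi> L. open W \<and> z \<in> W \<and> open V \<and> homeomorphism W V \<Phi> \<Psi> \<and> smooth_on W \<Phi> \<and>
      smooth_on V \<Psi> \<and> subspace L \<and> dim L = DIM('a) - DIM('b) \<and> \<Phi> ` (S \<inter> W) = L \<inter> V"
    by (intro exI)
qed

text \<open>A positive lower bound for the slope gives surjectivity as well as injectivity. This is
  what allows an orbit to be parametrized by an angle instead of by time.\<close>

lemma smooth_inverse_real:
  fixes f :: "real \<Rightarrow> real"
  assumes f: "smooth_on UNIV f" and d: "\<And>t. (f has_real_derivative f' t) (at t)"
    and pos: "\<And>t. f' t \<ge> c" "c > 0"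
  obtains g where "smooth_on UNIV g" "\<And>t. g (f t) = t" "\<And>y. f (g y) = y"
    "\<And>y. (g has_real_derivative inverse (f' (g y))) (at y)"
proof -
  have mono: "f s + c * (t - s) \<le> f t" if "s \<le> t" for s t
  proof -
    have "f s - c * s \<le> f t - c * t"
    proof (rule DERIV_nonneg_imp_nondecreasing[OF that])
      fix x assume "s \<le> x" "x \<le> t"
      show "\<exists>y. ((\<lambda>x. f x - c * x) has_real_derivative y) (at x) \<and> 0 \<le> y"
        by (rule exI[of _ "f' x - c"]) (auto intro!: derivative_eq_intros d pos)
    qed
    then show ?thesis by (simp add: algebra_simps)
  qed
  have "f s < f t" if "s < t" for s t
    using mono[of s t] that mult_pos_pos[OF pos(2), of "t - s"] by simp
  then have inj: "inj f" by (metis injI linorder_neqE_linordered_idom less_irrefl)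
  have cont: "continuous_on UNIV f" using smooth_on_imp_continuous_on[OF f] .
  have "\<exists>t. f t = y" for y
  proof -
    define r where "r = \<bar>y - f 0\<bar> / c"
    have r: "c * r = \<bar>y - f 0\<bar>" "r \<ge> 0" using pos(2) by (auto simp: r_def)
    have "f (-r) \<le> y" using mono[of "-r" 0] r by (simp add: algebra_simps)
    moreover have "y \<le> f r" using mono[of 0 r] r by (simp add: algebra_simps)
    moreover have "-r \<le> r" using r by simp
    moreover have "continuous_on {-r..r} f" using cont continuous_on_subset by blast
    ultimately obtain t where "f t = y" using IVT'[of f "-r" y r] by blast
    then show ?thesis ..
  qed
  then have surj: "surj f" unfolding surj_def by metis
  define g where "g = inv f"
  have gf: "g (f t) = t" and fg: "f (g y) = y" for t y
    using inj surj by (auto simp: g_def surj_f_inv_f)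
  have dg: "(g has_real_derivative inverse (f' (g y))) (at y)" for y
  proof -
    have nz: "f' (g y) \<noteq> 0" using pos(1)[of "g y"] pos(2) by linarith
    have "(g has_derivative (*) (inverse (f' (g y)))) (at (f (g y)))"
      by (rule has_derivative_inverse_strong[OF open_UNIV _ cont _ d[unfolded has_field_derivative_def]])
        (use gf nz in \<open>auto simp: fun_eq_iff\<close>)
    then show ?thesis unfolding has_field_derivative_def fg .
  qed
  have "smooth_on UNIV g"
    by (rule smooth_on_inverse_map[OF open_UNIV open_UNIV f _ fg dg[unfolded has_field_derivative_def]]) simp
  from that[OF this gf fg dg] show thesis .
qed

section \<open>A smooth step function\<close>

text \<open>The powers in the denominator make the family closed under differentiation up to linear
  combinations, so smoothness can be proved by one induction over all \<open>m\<close>.\<close>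

definition flat :: "nat \<Rightarrow> real \<Rightarrow> real" where
  "flat m x = (if x \<le> 0 then 0 else exp (- 1 / x) / x ^ m)"

text \<open>Quadratic decay is what differentiability at 0 needs. It comes from
  \<open>exp y \<ge> (y / k) ^ k\<close> with \<open>y = 1 / x\<close>, where
  \<open>k = m + 2\<close> leaves two powers of \<open>x\<close> after division by
  \<open>x ^ m\<close>.\<close>

lemma flat_le: 
  obtains C where "\<And>x. \<bar>flat m x\<bar> \<le> C * x\<^sup>2"
proof
  fix x :: real
  define k where "k = m + 2"
  show "\<bar>flat m x\<bar> \<le> real k ^ k * x\<^sup>2"
  proof (cases "x \<le> 0")
    case False
    then have x: "x > 0" by simp
    have "(1 + (1/x) / real k) ^ k \<le> exp (1/x)"
      using x by (intro exp_ge_one_plus_x_over_n_power_n) (auto simp: k_def intro: order_trans[of _ 0])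
    moreover have "((1/x) / real k) ^ k \<le> (1 + (1/x) / real k) ^ k"
      using x by (intro power_mono) auto
    ultimately have "1 / (x ^ k * real k ^ k) \<le> exp (1/x)"
      by (simp add: power_divide power_mult_distrib)
    then have "1 \<le> exp (1/x) * (x ^ k * real k ^ k)"
      using x by (simp add: divide_le_eq k_def)
    then have "exp (-1/x) \<le> x ^ k * real k ^ k"
      by (simp add: exp_minus divide_simps mult.commute mult.left_commute)
    then have "exp (-1/x) / x ^ m \<le> x ^ k * real k ^ k / x ^ m"
      using x by (intro divide_right_mono) auto
    also have "\<dots> = real k ^ k * x\<^sup>2" using x by (simp add: k_def power_add power2_eq_square)
    finally show ?thesis using x by (simp add: flat_def)
  qed (simp add: flat_def)
qed

lemma has_derivative_flat:
  "(flat m has_real_derivative flat (m + 2) x - m * flat (m + 1) x) (at x)"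
proof (cases x "0::real" rule: linorder_cases)
  case less
  have "((\<lambda>x. 0) has_real_derivative 0) (at x)" by simp
  then have "(flat m has_real_derivative 0) (at x)"
    by (rule DERIV_cong_ev[THEN iffD1, rotated 3])
      (use less eventually_nhds_in_open[of "{..<0}" x] in \<open>auto simp: flat_def elim!: eventually_mono\<close>)
  then show ?thesis using less by (simp add: flat_def)
next
  case equal
  obtain C where C: "\<And>x. \<bar>flat m x\<bar> \<le> C * x\<^sup>2" using flat_le by blast
  have "((\<lambda>h. flat m h / h) \<longlongrightarrow> 0) (at 0)"
  proof (rule Lim_null_comparison)
    show "\<forall>\<^sub>F h in at 0. norm (flat m h / h) \<le> C * \<bar>h\<bar>"
    proof (rule eventually_at_filter[THEN iffD2], rule always_eventually, intro allI impI)
      fix h :: real assume "h \<noteq> 0"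
      then have "\<bar>flat m h\<bar> / \<bar>h\<bar> \<le> C * h\<^sup>2 / \<bar>h\<bar>" using C by (intro divide_right_mono) auto
      also have "h\<^sup>2 = \<bar>h\<bar> * \<bar>h\<bar>" by (simp add: power2_eq_square)
      also have "C * (\<bar>h\<bar> * \<bar>h\<bar>) / \<bar>h\<bar> = C * \<bar>h\<bar>" using \<open>h \<noteq> 0\<close> by (simp del: abs_mult_self_eq)
      finally show "norm (flat m h / h) \<le> C * \<bar>h\<bar>" by simp
    qed
    have "((\<lambda>h::real. C * \<bar>h\<bar>) \<longlongrightarrow> C * \<bar>0\<bar>) (at 0)" by (intro tendsto_intros)
    then show "((\<lambda>h::real. C * \<bar>h\<bar>) \<longlongrightarrow> 0) (at 0)" by simp
  qed
  then have "(flat m has_real_derivative 0) (at 0)"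
    by (simp add: DERIV_def flat_def)
  then show ?thesis using equal by (simp add: flat_def)
next
  case greater
  have "((\<lambda>x. exp (- 1 / x) / x ^ m) has_real_derivative
      (exp (-1/x) / x\<^sup>2 * x ^ m - exp (-1/x) * (m * x ^ (m - 1))) / (x ^ m * x ^ m)) (at x)"
    using greater by (auto intro!: derivative_eq_intros simp: power2_eq_square)
  also have "(exp (-1/x) / x\<^sup>2 * x ^ m - exp (-1/x) * (m * x ^ (m - 1))) / (x ^ m * x ^ m)
     = flat (m + 2) x - m * flat (m + 1) x"
    using greater by (cases m) (auto simp: flat_def field_simps power2_eq_square)
  finally show ?thesis
    by (rule DERIV_cong_ev[THEN iffD1, rotated 3])
      (use greater eventually_nhds_in_open[of "{0<..}" x] in \<open>auto simp: flat_def elim!: eventually_mono\<close>)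
qed

lemma smooth_on_flat: "smooth_on UNIV (flat m)"
proof -
  have "higher_differentiable_on UNIV (flat m) n" for n
  proof (induction n arbitrary: m)
    case 0
    then show ?case using DERIV_isCont[OF has_derivative_flat]
      by (simp add: continuous_at_imp_continuous_on)
  next
    case (Suc n)
    show ?case
    proof (rule higher_differentiable_on_SucI[OF open_UNIV])
      show "(flat m has_derivative (\<lambda>h. h * (flat (m + 2) x + (- real m) * flat (m + 1) x))) (at x)" for x
        using has_derivative_flat[of m x] by (simp add: has_field_derivative_def mult.commute[of _ "_ - _"])
      have "higher_differentiable_on UNIV (\<lambda>x. (- real m) * flat (m + 1) x) n"
        by (rule higher_differentiable_on_bounded_linear_comp[OF bounded_linear_mult_right open_UNIV Suc])
      from higher_differentiable_on_add[OF open_UNIV Suc this]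
      show "higher_differentiable_on UNIV (\<lambda>x. h * (flat (m + 2) x + (- real m) * flat (m + 1) x)) n" for h
        by (rule higher_differentiable_on_bounded_linear_comp[OF bounded_linear_mult_right open_UNIV])
    qed
  qed
  then show ?thesis by (simp add: smooth_on_def)
qed

lemma smooth_step:
  obtains \<sigma> :: "real \<Rightarrow> real" where "smooth_on UNIV \<sigma>" "\<And>x. x \<le> 1/2 \<Longrightarrow> \<sigma> x = 0" "\<And>x. 1 \<le> x \<Longrightarrow> \<sigma> x = 1"
    "\<And>x. 0 \<le> \<sigma> x" "\<And>x. \<sigma> x \<le> 1"
proof -
  \<comment> \<open>The two summands of the denominator do not vanish together, since
    \<open>x - 1/2\<close> and \<open>1 - x\<close> cannot both be nonpositive.\<close>
  define \<sigma> where "\<sigma> x = flat 0 (x - 1/2) / (flat 0 (x - 1/2) + flat 0 (1 - x))" for x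
  have nn: "flat 0 x \<ge> 0" for x by (simp add: flat_def)
  have pos: "flat 0 (x - 1/2) + flat 0 (1 - x) > 0" for x
    using nn[of "x - 1/2"] nn[of "1 - x"] by (auto simp: flat_def add_pos_pos)
  have sm: "smooth_on UNIV (\<lambda>x. flat 0 (x - 1/2))" "smooth_on UNIV (\<lambda>x::real. flat 0 (1 - x))"
    by (rule smooth_on_compose[OF open_UNIV open_UNIV _ smooth_on_flat];
        auto intro!: smooth_on_diff smooth_on_id)+
  have "smooth_on UNIV \<sigma>" unfolding \<sigma>_def
    by (intro smooth_on_divide smooth_on_add sm open_UNIV) (metis pos less_irrefl)
  moreover have "0 \<le> \<sigma> x" "\<sigma> x \<le> 1" for x
    using nn[of "x - 1/2"] nn[of "1 - x"] pos[of x] by (auto simp: \<sigma>_def divide_le_eq)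
  moreover have "\<sigma> x = 0" if "x \<le> 1/2" for x using that by (simp add: \<sigma>_def flat_def)
  moreover have "\<sigma> x = 1" if "1 \<le> x" for x
    using that pos[of x] by (simp add: \<sigma>_def flat_def)
  ultimately show thesis using that by blast
qed

section \<open>Ordinary differential equations\<close>

lemma antiderivative_exists:
  fixes f :: "real \<Rightarrow> 'a::euclidean_space"
  assumes "continuous_on UNIV f"
  shows "\<exists>F. F 0 = 0 \<and> (\<forall>t. (F has_vector_derivative f t) (at t))"
proof -
  \<comment> \<open>One of the two intervals is empty or a point, so this is the oriented integral
    from 0.\<close>
  define F where "F t = integral {0..t} f - integral {t..0} f" for t
  have int: "f integrable_on {a..b}" for a b
    using assms by (intro integrable_continuous_real) (rule continuous_on_subset, auto)
  have F: "F t = integral {-N..t} f - integral {-N..0} f" if "N > 0" "-N < t" for N t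
  proof (cases "t \<ge> 0")
    case True
    have "integral {-N..0} f + integral {0..t} f = integral {-N..t} f"
      using True that by (intro Henstock_Kurzweil_Integration.integral_combine[OF _ _ int]) auto
    moreover have "integral {t..0} f = 0" using True by (cases "t = 0") auto
    ultimately show ?thesis by (simp add: F_def algebra_simps)
  next
    case False
    have "integral {-N..t} f + integral {t..0} f = integral {-N..0} f"
      using False that by (intro Henstock_Kurzweil_Integration.integral_combine[OF _ _ int]) auto
    moreover have "integral {0..t} f = 0" using False by auto
    ultimately show ?thesis by (simp add: F_def algebra_simps)
  qed
  have "(F has_vector_derivative f t) (at t)" for t
  proof -
    define N where "N = \<bar>t\<bar> + 1"
    have N: "N > 0" "-N < t" "t < N" by (auto simp: N_def)
    have "((\<lambda>u. integral {-N..u} f) has_vector_derivative f t) (at t within {-N..N})"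
      using N by (intro integral_has_vector_derivative continuous_on_subset[OF assms subset_UNIV]) auto
    then have "((\<lambda>u. integral {-N..u} f) has_vector_derivative f t) (at t)"
      using N by (simp only: at_within_Icc_at)
    then have "((\<lambda>u. integral {-N..u} f - integral {-N..0} f) has_vector_derivative f t) (at t)"
      using has_vector_derivative_diff[OF _ has_vector_derivative_const[of "integral {-N..0} f"]] by simp
    then show ?thesis
      by (rule has_vector_derivative_transform_within_open[where S = "{-N<..<N}"]) (use N F[OF N(1)] in auto)
  qed
  moreover have "F 0 = 0" by (simp add: F_def)
  ultimately show ?thesis by blast
qed

lemma norm_le_of_derivative_le:
  fixes F :: "real \<Rightarrow> 'a::real_normed_vector"
  assumes F: "\<And>s. 0 \<le> s \<Longrightarrow> s \<le> t \<Longrightarrow> (F has_vector_derivative F' s) (at s)"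
    and \<phi>: "\<And>s. 0 \<le> s \<Longrightarrow> s \<le> t \<Longrightarrow> (\<phi> has_real_derivative \<phi>' s) (at s)"
    and le: "\<And>s. 0 \<le> s \<Longrightarrow> s \<le> t \<Longrightarrow> norm (F' s) \<le> \<phi>' s" and t: "0 \<le> t"
  shows "norm (F t - F 0) \<le> \<phi> t - \<phi> 0"
proof (cases "t = 0")
  case False
  show ?thesis
  proof (rule differentiable_bound_general[of 0 t F \<phi> F' \<phi>'])
    show "continuous_on {0..t} F" using F
      by (intro continuous_at_imp_continuous_on ballI has_vector_derivative_continuous) auto
    show "continuous_on {0..t} \<phi>" using \<phi>
      by (intro continuous_at_imp_continuous_on ballI) (meson DERIV_isCont atLeastAtMost_iff)
  qed (use assms False in \<open>auto simp: has_real_derivative_iff_has_vector_derivative\<close>)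
qed simp

lemma has_vector_derivative_reflect:
  assumes "(F has_vector_derivative F') (at (- t))"
  shows "((\<lambda>s. F (- s)) has_vector_derivative - F') (at (t::real))"
proof -
  have "((uminus :: real \<Rightarrow> real) has_vector_derivative (- 1)) (at t)"
    by (auto intro!: derivative_eq_intros)
  from vector_diff_chain_at[OF this, of F F'] assms show ?thesis by (simp add: o_def)
qed

lemma norm_le_of_derivative_le_abs:
  fixes F :: "real \<Rightarrow> 'a::real_normed_vector"
  assumes F: "\<And>s. (F has_vector_derivative F' s) (at s)"
    and \<phi>: "\<And>s. (\<phi> has_real_derivative \<phi>' s) (at s)"
    and le: "\<And>s. norm (F' s) \<le> \<phi>' \<bar>s\<bar>"
  shows "norm (F t - F 0) \<le> \<phi> \<bar>t\<bar> - \<phi> 0"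
proof (cases "t \<ge> 0")
  case True
  have "norm (F' s) \<le> \<phi>' s" if "s \<ge> 0" for s using le[of s] that by simp
  with norm_le_of_derivative_le[of t F F' \<phi> \<phi>'] F \<phi> True show ?thesis by simp
next
  case False
  have "norm (F' (- s)) \<le> \<phi>' s" if "s \<ge> 0" for s using le[of "- s"] that by simp
  with norm_le_of_derivative_le[of "- t" "\<lambda>s. F (- s)" "\<lambda>s. - F' (- s)" \<phi> \<phi>'] F \<phi> False
  show ?thesis by (simp add: has_vector_derivative_reflect)
qed

text \<open>The solution is a fixed point in a space of functions of controlled exponential growth, so
  that Banach's theorem applies on all of \<open>\<real>\<close> at once.\<close>

lemma ode_solution_exists:
  fixes X :: "'a::euclidean_space \<Rightarrow> 'a"
  assumes lip: "\<And>x y. norm (X x - X y) \<le> L * norm (x - y)" and L: "L > 0"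
    and M: "\<And>x. norm (X x) \<le> M"
  shows "\<exists>z. z 0 = z0 \<and> (\<forall>t. (z has_vector_derivative X (z t)) (at t))"
proof -
  define A where "A f = (SOME F. F 0 = 0 \<and> (\<forall>t. (F has_vector_derivative f t) (at t)))"
    for f :: "real \<Rightarrow> 'a"
  have A: "A f 0 = 0 \<and> (\<forall>t. (A f has_vector_derivative f t) (at t))" if "continuous_on UNIV f" for f
    unfolding A_def by (rule someI_ex[OF antiderivative_exists[OF that]])
  \<comment> \<open>The unknown is the deviation from \<open>z0\<close> divided by this weight. As
    \<open>L * exp (2 * L * s)\<close> integrates to at most half of the weight, the Picard map
    contracts by 1/2 on the whole line.\<close>
  define e where "e t = exp (2 * L * \<bar>t\<bar>)" for t
  have e: "e t > 0" "continuous_on UNIV e" for t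
    by (auto simp: e_def[abs_def] intro!: continuous_intros)
  define z where "z y t = z0 + e t *\<^sub>R apply_bcontfun y t" for y t
  have contX: "continuous_on UNIV X"
    using lip by (intro continuous_on_iff[THEN iffD2])
      (smt (verit) L dist_norm mult.commute pos_less_divide_eq divide_pos_pos order_le_less_trans)
  have contz: "continuous_on UNIV (z y)" for y
    unfolding z_def[abs_def] by (intro continuous_intros e continuous_on_apply_bcontfun)
  have contXz: "continuous_on UNIV (\<lambda>s. X (z y s))" for y
    by (rule continuous_on_compose2[OF contX contz]) auto
  define I where "I y = A (\<lambda>s. X (z y s))" for y
  have I0: "I y 0 = 0" and dI: "(I y has_vector_derivative X (z y t)) (at t)" for y t
    unfolding I_def using A[OF contXz[of y]] by auto
  define T where "T y t = (1 / e t) *\<^sub>R I y t" for y t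
  have Mpos: "M \<ge> 0" using M[of z0] norm_ge_zero order_trans by blast
  have bI: "norm (I y t) \<le> M * \<bar>t\<bar>" for y t
    using norm_le_of_derivative_le_abs[of "I y" "\<lambda>t. X (z y t)" "\<lambda>t. M * t" "\<lambda>_. M" t] dI M I0
    by (auto intro!: derivative_eq_intros)
  have T_b: "norm (T y t) \<le> M / (2 * L)" for y t
  proof -
    have "2 * L * \<bar>t\<bar> \<le> e t" unfolding e_def using exp_ge_add_one_self[of "2 * L * \<bar>t\<bar>"] by linarith
    then have "M * (2 * L * \<bar>t\<bar>) \<le> M * e t" using Mpos by (rule mult_left_mono)
    then have "M * \<bar>t\<bar> \<le> M / (2 * L) * e t" using L by (simp add: field_simps)
    then have "norm (I y t) \<le> M / (2 * L) * e t" using bI[of y t] by linarith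
    moreover have "norm (T y t) = norm (I y t) / e t" using e(1)[of t] by (simp add: T_def)
    ultimately show ?thesis using e(1)[of t] by (simp only: pos_divide_le_eq)
  qed
  have T_c: "continuous_on UNIV (T y)" for y
    unfolding T_def[abs_def] using e(1)
    by (intro continuous_intros e continuous_at_imp_continuous_on ballI
        has_vector_derivative_continuous[OF dI]) (auto simp: less_imp_neq[symmetric])
  define TT where "TT y = Bcontfun (T y)" for y
  have TT: "apply_bcontfun (TT y) = T y" for y
    unfolding TT_def by (rule Bcontfun_inverse) (rule bcontfun_normI[OF T_c T_b])
  have contr: "dist (TT y) (TT y') \<le> (1/2) * dist y y'" for y y'
  proof (rule dist_bound)
    fix t
    define d where "d = dist y y'"
    have "norm (X (z y s) - X (z y' s)) \<le> L * (e s * d)" for s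
    proof -
      have "norm (X (z y s) - X (z y' s)) \<le> L * norm (z y s - z y' s)" by (rule lip)
      also have "z y s - z y' s = e s *\<^sub>R (apply_bcontfun y s - apply_bcontfun y' s)"
        by (simp add: z_def algebra_simps)
      also have "norm \<dots> = e s * dist (apply_bcontfun y s) (apply_bcontfun y' s)"
        using e(1)[of s] by (simp add: dist_norm)
      also have "\<dots> \<le> e s * d" unfolding d_def using e(1)[of s] by (intro mult_left_mono dist_bounded) auto
      finally show ?thesis using L by simp
    qed
    then have "norm (X (z y s) - X (z y' s)) \<le> L * (exp (2 * L * \<bar>s\<bar>) * d)" for s
      by (simp add: e_def)
    moreover have "((\<lambda>t. d / 2 * exp (2 * L * t)) has_real_derivative L * (exp (2 * L * s) * d)) (at s)" for s
      by (auto intro!: derivative_eq_intros)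
    ultimately have "norm ((I y t - I y' t) - (I y 0 - I y' 0)) \<le>
        d / 2 * exp (2 * L * \<bar>t\<bar>) - d / 2 * exp (2 * L * 0)"
      using norm_le_of_derivative_le_abs[OF has_vector_derivative_diff[OF dI dI],
          where \<phi> = "\<lambda>t. d / 2 * exp (2 * L * t)" and \<phi>' = "\<lambda>t. L * (exp (2 * L * t) * d)"] by blast
    moreover have "d \<ge> 0" by (simp add: d_def)
    ultimately have "norm (I y t - I y' t) \<le> d / 2 * e t" by (simp add: I0 e_def)
    then show "dist (apply_bcontfun (TT y) t) (apply_bcontfun (TT y') t) \<le> (1/2) * dist y y'"
      using e(1)[of t]
      by (simp add: TT T_def dist_norm d_def divide_simps mult.commute flip: scaleR_diff_right)
  qed
  obtain y where y: "TT y = y"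
    using banach_fix_type[of "1/2" TT] contr by auto
  have "z y t = z0 + I y t" for t
    using TT[of y] e(1)[of t] unfolding y by (simp add: z_def T_def)
  then have "z y = (\<lambda>t. z0 + I y t)" by auto
  then have "z y 0 = z0" "(z y has_vector_derivative X (z y t)) (at t)" for t
    using dI[of y t] I0 by (auto intro!: derivative_eq_intros)
  then show ?thesis by blast
qed

text \<open>The squared norm is used because it is differentiable also at zeros of \<open>z\<close>;
  multiplied by \<open>exp (- 2 * L * s)\<close> it cannot increase.\<close>

lemma gronwall:
  fixes z :: "real \<Rightarrow> 'a::euclidean_space"
  assumes z: "\<And>s. 0 \<le> s \<Longrightarrow> s \<le> t \<Longrightarrow> (z has_vector_derivative z' s) (at s)"
    and le: "\<And>s. 0 \<le> s \<Longrightarrow> s \<le> t \<Longrightarrow> norm (z' s) \<le> L * norm (z s)"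
    and t: "0 \<le> t"
  shows "norm (z t) \<le> norm (z 0) * exp (L * t)"
proof -
  define h where "h s = exp (- (2 * L * s)) * (z s \<bullet> z s)" for s
  have "h t \<le> h 0"
  proof (rule DERIV_nonpos_imp_nonincreasing[OF t])
    fix s assume s: "0 \<le> s" "s \<le> t"
    have "((\<lambda>s. z s \<bullet> z s) has_vector_derivative (z s \<bullet> z' s + z' s \<bullet> z s)) (at s)"
      by (intro bounded_bilinear.has_vector_derivative[OF bounded_bilinear_inner] z s)
    then have "(h has_real_derivative (exp (- (2 * L * s)) * (2 * (z s \<bullet> z' s) - 2 * L * (z s \<bullet> z s)))) (at s)"
      unfolding h_def has_real_derivative_iff_has_vector_derivative[symmetric]
      by (auto intro!: derivative_eq_intros simp: inner_commute algebra_simps)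
    moreover have "z s \<bullet> z' s \<le> norm (z s) * (L * norm (z s))"
      using norm_cauchy_schwarz[of "z s" "z' s"] mult_left_mono[OF le[OF s], of "norm (z s)"] by simp
    then have "z s \<bullet> z' s \<le> L * (z s \<bullet> z s)" by (simp add: dot_square_norm power2_eq_square mult_ac)
    ultimately show "\<exists>y. (h has_real_derivative y) (at s) \<and> y \<le> 0"
      by (intro exI conjI) (auto simp: mult_le_0_iff)
  qed
  then have "(norm (z t))\<^sup>2 \<le> (norm (z 0))\<^sup>2 * exp (2 * L * t)"
    by (simp add: h_def exp_minus divide_simps mult_ac flip: power2_norm_eq_inner)
  also have "\<dots> = (norm (z 0) * exp (L * t))\<^sup>2"
    by (simp add: power_mult_distrib mult.assoc flip: exp_double)
  finally show ?thesis by (rule power2_le_imp_le) simp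
qed

lemma gronwall_abs:
  fixes z :: "real \<Rightarrow> 'a::euclidean_space"
  assumes z: "\<And>s. (z has_vector_derivative z' s) (at s)" and le: "\<And>s. norm (z' s) \<le> L * norm (z s)"
  shows "norm (z t) \<le> norm (z 0) * exp (L * \<bar>t\<bar>)"
proof (cases "t \<ge> 0")
  case True
  then show ?thesis using gronwall[of t z z' L] assms by simp
next
  case False
  have "norm (- z' (- s)) \<le> L * norm (z (- s))" for s using le[of "- s"] by simp
  then show ?thesis
    using gronwall[of "- t" "\<lambda>s. z (- s)" "\<lambda>s. - z' (- s)" L] z False
    by (simp add: has_vector_derivative_reflect)
qed

text \<open>The field is controlled on a ball only. Composed with the nearest point projection to
  the ball it becomes bounded and globally Lipschitz, so solutions exist for all times; those that
  start in \<open>M\<close> never notice the modification, because the set of times spent in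
  \<open>M\<close> is closed and open.\<close>

lemma flow_of_first_integral:
  fixes X :: "'a::euclidean_space \<Rightarrow> 'a" and k :: "'a \<Rightarrow> real"
  assumes R: "R > 0" and lip: "\<And>x y. x \<in> cball 0 R \<Longrightarrow> y \<in> cball 0 R \<Longrightarrow> norm (X x - X y) \<le> L * norm (x - y)"
    and L: "L > 0" and k: "\<And>x. x \<in> ball 0 R \<Longrightarrow> (k has_derivative Dk x) (at x)"
    and kX: "\<And>x. x \<in> ball 0 R \<Longrightarrow> Dk x (X x) = 0"
    and M: "M = {x \<in> cball 0 R. k x = 0}" "compact M" "M \<subseteq> ball 0 R"
  shows "\<exists>\<phi>. flow_on M X \<phi>"
proof -
  define P where "P = closest_point (cball (0::'a) R)"
  have P: "P x \<in> cball 0 R" for x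
    unfolding P_def using R by (intro closest_point_in_set) auto
  have P1: "norm (P x - P y) \<le> norm (x - y)" for x y
    using closest_point_lipschitz[of "cball (0::'a) R" x y] R by (auto simp: P_def dist_norm)
  have P2: "P x = x" if "x \<in> cball 0 R" for x
    unfolding P_def using that by (rule closest_point_self)
  define Y where "Y x = X (P x)" for x
  have Ylip: "norm (Y x - Y y) \<le> L * norm (x - y)" for x y
  proof -
    have "L * norm (P x - P y) \<le> L * norm (x - y)" using P1 L by (intro mult_left_mono) auto
    then show ?thesis using lip[OF P P, of x y] by (simp add: Y_def)
  qed
  have Yb: "norm (Y x) \<le> norm (X 0) + L * R" for x
  proof -
    have "norm (X (P x) - X 0) \<le> L * norm (P x - 0)" using R by (intro lip P) auto
    also have "\<dots> \<le> L * R" using P[of x] L by (intro mult_left_mono) auto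
    finally show ?thesis using norm_triangle_sub[of "X (P x)" "X 0"] by (simp add: Y_def)
  qed
  from ode_solution_exists[OF Ylip L Yb] obtain \<psi>
    where \<psi>: "\<And>z. \<psi> z 0 = z" "\<And>z t. (\<psi> z has_vector_derivative Y (\<psi> z t)) (at t)" by metis
  have inM: "\<psi> z t \<in> M" if z: "z \<in> M" for z t
  proof -
    have cont: "continuous_on UNIV (\<psi> z)"
      by (intro continuous_at_imp_continuous_on ballI has_vector_derivative_continuous[OF \<psi>(2)])
    define S where "S = \<psi> z -` M"
    have "closed S" unfolding S_def
      by (rule continuous_closed_vimage)
        (use cont compact_imp_closed[OF M(2)] in \<open>auto simp: continuous_on_eq_continuous_at\<close>)
    \<comment> \<open>Around a time spent in \<open>M\<close> the solution stays in the open ball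
      for a while; there the modified field is \<open>X\<close> and \<open>k\<close> is
      conserved.\<close>
    moreover have "open S" unfolding open_contains_ball
    proof
      fix s assume "s \<in> S"
      then have s: "\<psi> z s \<in> M" by (simp add: S_def)
      have "open (\<psi> z -` ball 0 R)" by (rule open_vimage[OF open_ball cont])
      moreover have "s \<in> \<psi> z -` ball 0 R" using s M by auto
      ultimately obtain r where r: "r > 0" "ball s r \<subseteq> \<psi> z -` ball 0 R" by (meson open_contains_ball)
      have d: "((\<lambda>t. k (\<psi> z t)) has_vector_derivative 0) (at t)" if "t \<in> ball s r" for t
      proof -
        have b: "\<psi> z t \<in> ball 0 R" using that r by auto
        then have "Y (\<psi> z t) = X (\<psi> z t)" using P2[of "\<psi> z t"] by (auto simp: Y_def)
        then have "(\<psi> z has_derivative (\<lambda>h. h *\<^sub>R X (\<psi> z t))) (at t)"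
          using \<psi>(2)[of z t] by (simp add: has_vector_derivative_def)
        from diff_chain_at[OF this k[OF b]]
        have "(k \<circ> \<psi> z has_derivative Dk (\<psi> z t) \<circ> (\<lambda>h. h *\<^sub>R X (\<psi> z t))) (at t)" .
        moreover have "Dk (\<psi> z t) \<circ> (\<lambda>h. h *\<^sub>R X (\<psi> z t)) = (\<lambda>h. h *\<^sub>R 0)"
          using kX[OF b] k[OF b, THEN has_derivative_linear] by (auto simp: linear_scale)
        ultimately show ?thesis by (simp add: has_vector_derivative_def o_def)
      qed
      have "k (\<psi> z t) = k (\<psi> z s)" if "t \<in> ball s r" for t
        by (rule has_derivative_zero_unique[of "ball s r"])
          (use d that r in \<open>auto simp: has_vector_derivative_def intro: has_derivative_at_withinI\<close>)
      moreover have "k (\<psi> z s) = 0" using s unfolding M(1) by blast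
      moreover have "\<psi> z t \<in> cball 0 R" if "t \<in> ball s r" for t
        using r(2) that ball_subset_cball by blast
      ultimately have "\<psi> z t \<in> M" if "t \<in> ball s r" for t
        unfolding M(1) using that by simp
      then have "ball s r \<subseteq> S" by (auto simp: S_def)
      then show "\<exists>e>0. ball s e \<subseteq> S" using r by blast
    qed
    moreover have "0 \<in> S" using z \<psi>(1) by (simp add: S_def)
    ultimately have "S = UNIV" using clopen[of S] by auto
    then show ?thesis by (auto simp: S_def)
  qed
  have "Y x = X x" if "x \<in> M" for x using that P2[of x] M by (auto simp: Y_def)
  then have "flow_on M X (\<lambda>t z. \<psi> z t)" unfolding flow_on_def using \<psi> inM by metis
  then show ?thesis by blast
qed

section \<open>Uniqueness, symmetry and continuity of flows\<close>

locale lipschitz_flow =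
  fixes M :: "'a::euclidean_space set" and X :: "'a \<Rightarrow> 'a" and \<phi> :: "real \<Rightarrow> 'a \<Rightarrow> 'a" and L :: real
  assumes lip: "\<And>x y. x \<in> M \<Longrightarrow> y \<in> M \<Longrightarrow> norm (X x - X y) \<le> L * norm (x - y)"
    and flow: "flow_on M X \<phi>" and bdd: "bounded M" and Lnn: "L \<ge> 0"
begin

lemma flow_0 [simp]: "z \<in> M \<Longrightarrow> \<phi> 0 z = z"
  and flow_in [simp]: "z \<in> M \<Longrightarrow> \<phi> t z \<in> M"
  and flow_deriv: "z \<in> M \<Longrightarrow> ((\<lambda>s. \<phi> s z) has_vector_derivative X (\<phi> t z)) (at t)"
  using flow by (auto simp: flow_on_def)

lemma solution_dist:
  assumes "\<And>t. x t \<in> M" "\<And>t. (x has_vector_derivative X (x t)) (at t)"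
    "\<And>t. y t \<in> M" "\<And>t. (y has_vector_derivative X (y t)) (at t)"
  shows "norm (x t - y t) \<le> norm (x 0 - y 0) * exp (L * \<bar>t\<bar>)"
  by (rule gronwall_abs[where z = "\<lambda>t. x t - y t" and z' = "\<lambda>t. X (x t) - X (y t)"])
    (auto intro!: has_vector_derivative_diff assms lip)

lemma solution_unique:
  assumes "\<And>t. x t \<in> M" "\<And>t. (x has_vector_derivative X (x t)) (at t)"
  shows "x t = \<phi> t (x 0)"
proof -
  have "norm (x t - \<phi> t (x 0)) \<le> norm (x 0 - \<phi> 0 (x 0)) * exp (L * \<bar>t\<bar>)"
    by (rule solution_dist) (use assms flow_deriv in auto)
  then show ?thesis using assms(1)[of 0] by simp
qed

lemma flow_add: assumes "z \<in> M" shows "\<phi> (s + t) z = \<phi> s (\<phi> t z)"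
proof -
  have "((\<lambda>s. \<phi> (s + t) z) has_vector_derivative X (\<phi> (s + t) z)) (at s)" for s
  proof -
    have "((\<lambda>s. s + t) has_vector_derivative 1) (at s)" by (auto intro!: derivative_eq_intros)
    from vector_diff_chain_at[OF this flow_deriv[OF assms]] show ?thesis by (simp add: o_def)
  qed
  from solution_unique[of "\<lambda>s. \<phi> (s + t) z", OF _ this] show ?thesis using assms by simp
qed

lemma flow_minus: "z \<in> M \<Longrightarrow> \<phi> (- t) (\<phi> t z) = z"
  using flow_add[of z "- t" t] by simp

text \<open>The reflected curve run backwards solves the same equation, so uniqueness
  applies.\<close>

lemma flow_reversible:
  assumes A: "linear A" "\<And>z. z \<in> M \<Longrightarrow> A z \<in> M" "\<And>z. z \<in> M \<Longrightarrow> X (A z) = - A (X z)" and z: "z \<in> M"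
  shows "\<phi> t (A z) = A (\<phi> (- t) z)"
proof -
  have "bounded_linear A" using A(1) by (simp add: linear_conv_bounded_linear)
  from bounded_linear.has_vector_derivative[OF this has_vector_derivative_reflect[OF flow_deriv[OF z]]]
  have "((\<lambda>t. A (\<phi> (- t) z)) has_vector_derivative X (A (\<phi> (- t) z))) (at t)" for t
    using A z by (simp add: linear_neg)
  from solution_unique[of "\<lambda>t. A (\<phi> (- t) z)", OF _ this] show ?thesis using A z by simp
qed

text \<open>Time dependence is controlled by the bound of the field, space dependence by Gronwall.
  Joint continuity is used when initial point and time are the two unknowns of the shooting
  problem.\<close>

lemma flow_continuous: "continuous_on (UNIV \<times> M) (\<lambda>(t, z). \<phi> t z)"
proof -
  obtain B where B: "\<And>z. z \<in> M \<Longrightarrow> norm (X z) \<le> B" "B > 0"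
  proof (cases "M = {}")
    case False
    then obtain z0 where z0: "z0 \<in> M" by blast
    obtain b where b: "\<And>z. z \<in> M \<Longrightarrow> norm z \<le> b" using bdd bounded_iff by blast
    have "norm (X z) \<le> norm (X z0) + L * (2 * b) + 1" if "z \<in> M" for z
    proof -
      have "norm (X z - X z0) \<le> L * norm (z - z0)" using that z0 lip by blast
      also have "\<dots> \<le> L * (2 * b)"
        using norm_triangle_ineq4[of z z0] b[OF that] b[OF z0] Lnn by (intro mult_left_mono) auto
      finally show ?thesis using norm_triangle_sub[of "X z" "X z0"] by simp
    qed
    moreover have "norm (X z0) + L * (2 * b) + 1 > 0"
      using b[OF z0] norm_ge_zero[of z0] Lnn by (intro add_nonneg_pos add_nonneg_nonneg mult_nonneg_nonneg norm_ge_zero) linarith+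
    ultimately show thesis using that by blast
  qed (use that[of 1] in auto)
  have time: "norm (\<phi> t z - \<phi> s z) \<le> B * \<bar>t - s\<bar>" if "z \<in> M" for s t z
  proof -
    have "((\<lambda>r. \<phi> (r + s) z) has_vector_derivative X (\<phi> (r + s) z)) (at r)" for r
    proof -
      have "((\<lambda>r. r + s) has_vector_derivative 1) (at r)" by (auto intro!: derivative_eq_intros)
      from vector_diff_chain_at[OF this flow_deriv[OF that]] show ?thesis by (simp add: o_def)
    qed
    from norm_le_of_derivative_le_abs[OF this, of "\<lambda>r. B * r" "\<lambda>_. B" "t - s"] B that show ?thesis
      by (auto intro!: derivative_eq_intros)
  qed
  have space: "norm (\<phi> t z - \<phi> t w) \<le> norm (z - w) * exp (L * \<bar>t\<bar>)" if "z \<in> M" "w \<in> M" for z w t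
    using solution_dist[of "\<lambda>t. \<phi> t z" "\<lambda>t. \<phi> t w" t] that flow_deriv by auto
  show ?thesis
    unfolding continuous_on_def
  proof safe
    fix t :: real and z assume z: "z \<in> M"
    let ?F = "at (t, z) within UNIV \<times> M"
    have "((\<lambda>p. B * \<bar>fst p - t\<bar> + norm (snd p - z) * exp (L * \<bar>t\<bar>)) \<longlongrightarrow>
        B * \<bar>fst (t, z) - t\<bar> + norm (snd (t, z) - z) * exp (L * \<bar>t\<bar>)) ?F"
      by (intro tendsto_intros)
    then have lim: "((\<lambda>p. B * \<bar>fst p - t\<bar> + norm (snd p - z) * exp (L * \<bar>t\<bar>)) \<longlongrightarrow> 0) ?F" by simp
    have "norm ((case p of (s, w) \<Rightarrow> \<phi> s w) - \<phi> t z) \<le>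
        B * \<bar>fst p - t\<bar> + norm (snd p - z) * exp (L * \<bar>t\<bar>)" if pM: "p \<in> UNIV \<times> M" for p
    proof -
      obtain s w where p: "p = (s, w)" "w \<in> M" using pM by (metis mem_Times_iff prod.collapse)
      have "\<phi> s w - \<phi> t z = (\<phi> s w - \<phi> t w) + (\<phi> t w - \<phi> t z)" by simp
      then have "norm (\<phi> s w - \<phi> t z) \<le> norm (\<phi> s w - \<phi> t w) + norm (\<phi> t w - \<phi> t z)"
        by (metis norm_triangle_ineq)
      then show ?thesis using time[OF p(2), of s t] space[OF p(2) z, of t] p by simp
    qed
    then have "\<forall>\<^sub>F p in ?F. norm ((case p of (s, w) \<Rightarrow> \<phi> s w) - \<phi> t z) \<le>
        B * \<bar>fst p - t\<bar> + norm (snd p - z) * exp (L * \<bar>t\<bar>)"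
      by (auto simp: eventually_at_filter)
    from Lim_null_comparison[OF this lim] show "((\<lambda>(s, w). \<phi> s w) \<longlongrightarrow> \<phi> t z) ?F"
      using LIM_zero_cancel by blast
  qed
qed

end

section \<open>Angles along curves in the plane\<close>

text \<open>An antiderivative of \<open>z' / z\<close> serves as the logarithm, so the argument
  along the curve comes with an explicit derivative.\<close>

lemma log_lift:
  fixes z :: "real \<Rightarrow> complex"
  assumes z: "\<And>t. (z has_vector_derivative z' t) (at t)" "\<And>t. z t \<noteq> 0" and c: "continuous_on UNIV z'"
  obtains \<Lambda> where "\<And>t. z t = exp (\<Lambda> t)" "\<And>t. (\<Lambda> has_vector_derivative z' t / z t) (at t)"
proof -
  have "continuous_on UNIV z"
    by (intro continuous_at_imp_continuous_on ballI has_vector_derivative_continuous[OF z(1)])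
  then have "continuous_on UNIV (\<lambda>t. z' t / z t)"
    using z(2) c by (intro continuous_intros) auto
  from antiderivative_exists[OF this] obtain F where
    F: "F 0 = 0" "\<And>t. (F has_vector_derivative z' t / z t) (at t)" by blast
  define \<Lambda> where "\<Lambda> t = Ln (z 0) + F t" for t
  have d: "(\<Lambda> has_vector_derivative z' t / z t) (at t)" for t
    unfolding \<Lambda>_def using F by (auto intro!: derivative_eq_intros)
  have dexp: "((\<lambda>t. exp (- \<Lambda> t)) has_vector_derivative (- (z' t / z t)) * exp (- \<Lambda> t)) (at t)" for t
    using field_vector_diff_chain_at[OF has_vector_derivative_minus[OF d] DERIV_exp, of t]
    by (simp add: o_def)
  have "((\<lambda>t. z t * exp (- \<Lambda> t)) has_vector_derivative 0) (at t)" for t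
    using has_vector_derivative_mult[OF z(1)[of t] dexp[of t]] z(2)[of t] by (simp add: field_simps)
  then have "((\<lambda>t. z t * exp (- \<Lambda> t)) has_derivative (\<lambda>h. 0)) (at t)" for t
    by (simp add: has_vector_derivative_def)
  then have "z t * exp (- \<Lambda> t) = z 0 * exp (- \<Lambda> 0)" for t
    by (intro has_derivative_zero_unique[of UNIV]) auto
  also have "z 0 * exp (- \<Lambda> 0) = 1"
    using z(2)[of 0] F(1) by (simp add: \<Lambda>_def exp_minus)
  finally have "z t = exp (\<Lambda> t)" for t by (simp add: exp_minus field_simps)
  from that[OF this d] show thesis .
qed

lemma rotating_curve_meets_positive_reals:
  fixes z :: "real \<Rightarrow> complex"
  assumes z: "\<And>t. (z has_vector_derivative z' t) (at t)" "\<And>t. z t \<noteq> 0" and c: "continuous_on UNIV z'"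
    and rot: "\<And>t. Im (z' t / z t) \<le> - r" and r: "r > 0"
  shows "(\<exists>t>0. Im (z t) = 0 \<and> Re (z t) > 0) \<and> (\<exists>t<0. Im (z t) = 0 \<and> Re (z t) > 0)"
proof -
  obtain \<Lambda> where \<Lambda>: "\<And>t. z t = exp (\<Lambda> t)" "\<And>t. (\<Lambda> has_vector_derivative z' t / z t) (at t)"
    using log_lift[OF z c] by blast
  define \<theta> where "\<theta> t = Im (\<Lambda> t)" for t
  have d: "(\<theta> has_real_derivative Im (z' t / z t)) (at t)" for t
    unfolding \<theta>_def has_real_derivative_iff_has_vector_derivative
    by (rule bounded_linear.has_vector_derivative[OF bounded_linear_Im \<Lambda>(2)])
  have le: "\<theta> t + r * (t - s) \<le> \<theta> s" if "s \<le> t" for s t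
  proof -
    have "\<theta> t + r * t \<le> \<theta> s + r * s"
    proof (rule DERIV_nonpos_imp_nonincreasing[OF that])
      fix x assume "s \<le> x" "x \<le> t"
      show "\<exists>y. ((\<lambda>x. \<theta> x + r * x) has_real_derivative y) (at x) \<and> y \<le> 0"
        by (rule exI[of _ "Im (z' x / z x) + r"]) (use rot[of x] in \<open>auto intro!: derivative_eq_intros d\<close>)
    qed
    then show ?thesis by (simp add: algebra_simps)
  qed
  have cont: "continuous_on S \<theta>" for S
    using d by (intro continuous_at_imp_continuous_on ballI DERIV_isCont)
  have hit: "Im (z t) = 0 \<and> Re (z t) > 0" if "\<theta> t = 2 * pi * of_int n" for t n
    using that \<Lambda>(1)[of t] unfolding \<theta>_def
    by (simp add: Re_exp Im_exp cos_int_2pin sin_int_2pin del: mult.commute)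
  define n where "n = \<lfloor>\<theta> 0 / (2 * pi)\<rfloor>"
  have n: "2 * pi * of_int n \<le> \<theta> 0" "\<theta> 0 < 2 * pi * of_int (n + 1)"
  proof -
    have "of_int n \<le> \<theta> 0 / (2 * pi)" "\<theta> 0 / (2 * pi) < of_int (n + 1)"
      unfolding n_def by linarith+
    then show "2 * pi * of_int n \<le> \<theta> 0" "\<theta> 0 < 2 * pi * of_int (n + 1)"
      using pi_gt_zero by (simp_all only: pos_le_divide_eq pos_divide_less_eq zero_less_mult_iff
          zero_less_numeral mult.commute simp_thms)
  qed
  \<comment> \<open>Two full turns instead of one: \<open>\<theta> 0\<close> may itself be
    \<open>2 * pi * n\<close>, so the value aimed at for positive times is \<open>n - 1\<close> and
    that for negative times is \<open>n + 1\<close>. Both are passed within time \<open>T\<close>,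
    and neither at time 0.\<close>
  define T where "T = 4 * pi / r"
  have T: "r * T = 4 * pi" "T > 0" using r by (auto simp: T_def)
  have 1: "\<theta> T \<le> 2 * pi * of_int (n - 1)" using le[of 0 T] T n(2) by (simp add: algebra_simps)
  have 2: "2 * pi * of_int (n + 1) \<le> \<theta> (- T)" using le[of "- T" 0] T n by (simp add: algebra_simps)
  have 3: "2 * pi * of_int (n - 1) \<le> \<theta> 0" "2 * pi * of_int (n - 1) \<noteq> \<theta> 0"
    using n pi_gt_zero by (auto simp: algebra_simps)
  obtain t where t: "0 \<le> t" "t \<le> T" "\<theta> t = 2 * pi * of_int (n - 1)"
    using IVT2'[of \<theta> T "2 * pi * of_int (n - 1)" 0] 1 3 T cont by auto
  obtain s where s: "- T \<le> s" "s \<le> 0" "\<theta> s = 2 * pi * of_int (n + 1)"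
    using IVT2'[of \<theta> 0 "2 * pi * of_int (n + 1)" "- T"] 2 n T cont by auto
  have "t \<noteq> 0" using t 3 by auto
  moreover have "s \<noteq> 0" using s n by auto
  ultimately have "t > 0" "s < 0" using t(1) s(2) by auto
  then show ?thesis using hit[OF t(3)] hit[OF s(3)] by blast
qed

section \<open>The Poincare-Miranda theorem in the plane\<close>

text \<open>Apply Brouwer's theorem to the map that moves by minus the value and clamps to the rectangle.\<close>

lemma poincare_miranda:
  fixes f g :: "real \<Rightarrow> real \<Rightarrow> real"
  assumes ab: "a \<le> b" "c \<le> d"
    and cont: "continuous_on ({a..b} \<times> {c..d}) (\<lambda>(x, y). f x y)" "continuous_on ({a..b} \<times> {c..d}) (\<lambda>(x, y). g x y)"
    and f: "\<And>y. y \<in> {c..d} \<Longrightarrow> f a y < 0" "\<And>y. y \<in> {c..d} \<Longrightarrow> f b y > 0"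
    and g: "\<And>x. x \<in> {a..b} \<Longrightarrow> g x c < 0" "\<And>x. x \<in> {a..b} \<Longrightarrow> g x d > 0"
  shows "\<exists>x\<in>{a..b}. \<exists>y\<in>{c..d}. f x y = 0 \<and> g x y = 0"
proof -
  define F where "F = (\<lambda>p. (max a (min b (fst p - (\<lambda>(x, y). f x y) p)), max c (min d (snd p - (\<lambda>(x, y). g x y) p))))"
  obtain p where p: "p \<in> {a..b} \<times> {c..d}" "F p = p"
  proof (rule brouwer[of "{a..b} \<times> {c..d}" F])
    show "compact ({a..b} \<times> {c..d})" by (intro compact_Times compact_Icc)
    show "convex ({a..b} \<times> {c..d})" by (intro convex_Times convex_real_interval)
    show "continuous_on ({a..b} \<times> {c..d}) F" unfolding F_def by (intro continuous_intros cont)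
  qed (use ab in \<open>auto simp: F_def\<close>)
  obtain x y where xy: "p = (x, y)" "x \<in> {a..b}" "y \<in> {c..d}" using p(1) by auto
  have 1: "max a (min b (x - f x y)) = x" "max c (min d (y - g x y)) = y"
    using p(2) unfolding F_def xy by auto
  \<comment> \<open>Where clamping is active the point lies on an edge, and there the sign of
    \<open>f\<close> pushes it strictly back inside; so the fixed point equation forces the
    displacement to be 0.\<close>
  have "f x y = 0"
    using 1(1) xy f[OF xy(3)] by (smt (verit) atLeastAtMost_iff max_def min_def)
  moreover have "g x y = 0"
    using 1(2) xy g[OF xy(2)] by (smt (verit) atLeastAtMost_iff max_def min_def)
  ultimately show ?thesis using xy by blast
qed

section \<open>Star-shaped level sets\<close>

text \<open>Along a ray the quadratic part runs from -1/4 at radius 1 to 1/2 at radius 2, and 1/8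
  cannot change these signs.\<close>

lemma radial_zero_exists:
  fixes P :: "'a::euclidean_space \<Rightarrow> real"
  assumes P: "\<And>x. x \<in> cball 0 2 \<Longrightarrow> \<bar>P x\<bar> \<le> 1/8"
    "\<And>x y. x \<in> cball 0 2 \<Longrightarrow> y \<in> cball 0 2 \<Longrightarrow> \<bar>P x - P y\<bar> \<le> norm (x - y) / 8"
    and \<xi>: "norm \<xi> = 1"
  shows "\<exists>r. 1 \<le> r \<and> r \<le> 2 \<and> (1/4) * (r *\<^sub>R \<xi> \<bullet> r *\<^sub>R \<xi>) - 1/2 + P (r *\<^sub>R \<xi>) = 0"
proof -
  define h where "h r = (1/4) * (r *\<^sub>R \<xi> \<bullet> r *\<^sub>R \<xi>) - 1/2 + P (r *\<^sub>R \<xi>)" for r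
  have h: "h r = r\<^sup>2 / 4 - 1/2 + P (r *\<^sub>R \<xi>)" for r
    using \<xi> by (simp add: h_def power2_eq_square norm_eq_sqrt_inner)
  have in2: "r *\<^sub>R \<xi> \<in> cball 0 2" if "r \<in> {1..2}" for r using that \<xi> by simp
  have "continuous_on {1..2} (\<lambda>r. P (r *\<^sub>R \<xi>))"
  proof (rule continuous_on_iff[THEN iffD2], intro ballI allI impI)
    fix r e :: real assume r: "r \<in> {1..2}" "0 < e"
    show "\<exists>d>0. \<forall>s\<in>{1..2}. dist s r < d \<longrightarrow> dist (P (s *\<^sub>R \<xi>)) (P (r *\<^sub>R \<xi>)) < e"
    proof (intro exI[of _ e] conjI ballI impI r)
      fix s assume s: "s \<in> {1..2}" "dist s r < e"
      have "norm (s *\<^sub>R \<xi> - r *\<^sub>R \<xi>) = \<bar>s - r\<bar>" using \<xi> by (simp flip: scaleR_diff_left)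
      then show "dist (P (s *\<^sub>R \<xi>)) (P (r *\<^sub>R \<xi>)) < e"
        using P(2)[OF in2 in2, OF s(1) r(1)] s(2) abs_ge_zero[of "P (s *\<^sub>R \<xi>) - P (r *\<^sub>R \<xi>)"]
        unfolding dist_real_def by linarith
    qed
  qed
  then have cont: "continuous_on {1..2} h" unfolding h[abs_def] by (intro continuous_intros) auto
  have "h 1 \<le> 0" "0 \<le> h 2" using P(1)[OF in2[of 1]] P(1)[OF in2[of 2]] by (auto simp: h)
  then show ?thesis using IVT'[of h 1 0 2] cont unfolding h_def by fastforce
qed

text \<open>Both radii are at least 1, so between two points of one ray the quadratic part changes
  by at least half their distance, while \<open>P\<close> can compensate only an eighth of
  it.\<close>

lemma radial_zero_unique:
  fixes P :: "'a::euclidean_space \<Rightarrow> real"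
  assumes P: "\<And>x. x \<in> cball 0 2 \<Longrightarrow> \<bar>P x\<bar> \<le> 1/8"
    "\<And>x y. x \<in> cball 0 2 \<Longrightarrow> y \<in> cball 0 2 \<Longrightarrow> \<bar>P x - P y\<bar> \<le> norm (x - y) / 8"
    and x: "x \<in> cball 0 2" "(1/4) * (x \<bullet> x) - 1/2 + P x = 0"
    and y: "y \<in> cball 0 2" "(1/4) * (y \<bullet> y) - 1/2 + P y = 0"
    and xy: "(1 / norm x) *\<^sub>R x = (1 / norm y) *\<^sub>R y"
  shows "x = y"
proof -
  have g1: "1 \<le> norm x" if "x \<in> cball 0 2" "(1/4) * (x \<bullet> x) - 1/2 + P x = 0" for x
  proof -
    have "1 \<le> (norm x)\<^sup>2" using P(1)[OF that(1)] that(2) by (simp add: power2_norm_eq_inner)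
    then show ?thesis by (simp add: power2_nonneg_ge_1_iff)
  qed
  have 1: "1 \<le> norm x" "1 \<le> norm y" using g1 x y by blast+
  have "norm (x - y) = \<bar>norm x - norm y\<bar>"
  proof -
    define \<xi> where "\<xi> = (1 / norm x) *\<^sub>R x"
    have nz: "norm x \<noteq> 0" "norm y \<noteq> 0" using 1 by linarith+
    have "x = norm x *\<^sub>R \<xi>" "norm \<xi> = 1" using nz unfolding \<xi>_def by simp_all
    moreover have "y = norm y *\<^sub>R \<xi>" using nz unfolding \<xi>_def xy by simp
    ultimately have \<xi>: "x = norm x *\<^sub>R \<xi>" "y = norm y *\<^sub>R \<xi>" "norm \<xi> = 1" by blast+
    have "x - y = (norm x - norm y) *\<^sub>R \<xi>" using \<xi>(1,2) by (metis scaleR_diff_left)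
    then show ?thesis using \<open>norm \<xi> = 1\<close> by simp
  qed
  moreover have "\<bar>P x - P y\<bar> = \<bar>norm x - norm y\<bar> * (norm x + norm y) / 4"
  proof -
    have "P x - P y = - (norm x - norm y) * (norm x + norm y) / 4"
      using x(2) y(2) by (simp add: algebra_simps flip: power2_norm_eq_inner) (simp add: power2_eq_square)
    then show ?thesis unfolding \<open>P x - P y = _\<close> using 1 by (simp add: abs_mult)
  qed
  ultimately have *: "\<bar>norm x - norm y\<bar> * (norm x + norm y) / 4 \<le> \<bar>norm x - norm y\<bar> / 8"
    using P(2)[OF x(1) y(1)] by metis
  have "\<bar>norm x - norm y\<bar> = 0"
  proof (rule ccontr)
    assume "\<bar>norm x - norm y\<bar> \<noteq> 0"
    then have "0 < \<bar>norm x - norm y\<bar>" by simp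
    with * have "(norm x + norm y) / 4 \<le> 1 / 8"
      by (metis mult.right_neutral mult_le_cancel_left_pos times_divide_eq_right)
    then show False using 1 by simp
  qed
  with \<open>norm (x - y) = _\<close> show ?thesis by simp
qed

section \<open>Perturbations of the Hopf flow\<close>

lemma norm_fst_snd_le: "norm (fst z) \<le> norm z" "norm (snd z) \<le> norm z"
  by (metis norm_fst_le norm_snd_le prod.collapse)+

lemma norm_prod_sq: "(norm z)\<^sup>2 = (norm (fst z))\<^sup>2 + (norm (snd z))\<^sup>2"
  by (cases z) (simp add: norm_Pair)

lemma scaleR_diff_le:
  fixes x x' :: "'a::real_normed_vector"
  assumes "\<bar>a - a'\<bar> \<le> A" "norm x \<le> B" "\<bar>a'\<bar> \<le> C" "norm (x - x') \<le> D"
  shows "norm (a *\<^sub>R x - a' *\<^sub>R x') \<le> A * B + C * D"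
proof -
  have "a *\<^sub>R x - a' *\<^sub>R x' = (a - a') *\<^sub>R x + a' *\<^sub>R (x - x')" by (simp add: algebra_simps)
  also have "norm \<dots> \<le> \<bar>a - a'\<bar> * norm x + \<bar>a'\<bar> * norm (x - x')"
    by (rule order_trans[OF norm_triangle_ineq]) simp
  also have "\<dots> \<le> A * B + C * D"
  proof -
    have "0 \<le> A" "0 \<le> C" using assms(1,3) abs_ge_zero order_trans by blast+
    then show ?thesis using assms by (intro add_mono mult_mono) auto
  qed
  finally show ?thesis .
qed

lemma inner_self_diff_le:
  fixes x y :: "'a::real_inner"
  assumes "norm x \<le> B" "norm y \<le> B" "norm (x - y) \<le> D"
  shows "\<bar>x \<bullet> x - y \<bullet> y\<bar> \<le> 2 * B * D"
proof -
  have "x \<bullet> x - y \<bullet> y = (x - y) \<bullet> (x + y)" by (simp add: inner_simps inner_commute)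
  also have "\<bar>\<dots>\<bar> \<le> norm (x - y) * norm (x + y)" by (rule Cauchy_Schwarz_ineq2)
  also have "\<dots> \<le> D * (2 * B)"
    using assms norm_triangle_ineq[of x y] norm_ge_zero[of "x - y"] norm_ge_zero[of "x + y"] by (intro mult_mono) linarith+
  finally show ?thesis by (simp add: mult_ac)
qed

text \<open>Coordinates are scaled so that the unperturbed flow is
  \<open>(z\<^sub>1, z\<^sub>2) \<mapsto> (e\<^sup>i\<^sup>t z\<^sub>1, e\<^sup>-\<^sup>i\<^sup>t z\<^sub>2)\<close>. The term with \<open>\<kappa>\<close> is the Coriolis term; all of its effect on the
  shooting argument is of order \<open>\<kappa>\<close>, while \<open>f\<close>, which carries the rest, is of order \<open>\<delta>\<kappa>\<close>.\<close>

locale hopf_perturbation =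
  fixes \<kappa> \<delta> :: real and f :: "complex \<Rightarrow> real" and m :: "complex \<Rightarrow> complex"
  assumes \<kappa>: "0 < \<kappa>" "\<kappa> \<le> \<delta>" and \<delta>: "\<delta> \<le> 1 / 10^6"
    and f_smooth: "smooth_on (ball 0 5) f"
    and f_deriv: "\<And>s. s \<in> ball 0 5 \<Longrightarrow> (f has_derivative (\<lambda>h. m s \<bullet> h)) (at s)"
    and f_bound: "\<And>s. s \<in> ball 0 5 \<Longrightarrow> \<bar>f s\<bar> \<le> \<delta> * \<kappa>"
    and m_bound: "\<And>s. s \<in> ball 0 5 \<Longrightarrow> norm (m s) \<le> \<delta> * \<kappa>"
    and m_lip: "\<And>s t. s \<in> ball 0 5 \<Longrightarrow> t \<in> ball 0 5 \<Longrightarrow> norm (m s - m t) \<le> \<delta> * \<kappa> * norm (s - t)"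
    and sym: "\<And>s. f (cnj s) = f s" "\<And>s. f (- s) = f s" "\<And>s. m (cnj s) = cnj (m s)" "\<And>s. m (- s) = - m s"
begin

text \<open>Up to scaling \<open>sg\<close> is the regularized position and \<open>dg\<close> the
  angular momentum, so \<open>(sg z \<bullet> sg z) * dg z\<close> is the Coriolis term;
  \<open>V1\<close> and \<open>V2\<close> are half of its partial gradients.\<close>

definition sg :: "complex \<times> complex \<Rightarrow> complex" where "sg z = fst z + snd z"
definition dg :: "complex \<times> complex \<Rightarrow> real" where "dg z = fst z \<bullet> fst z - snd z \<bullet> snd z"
definition V1 where "V1 z = dg z *\<^sub>R sg z + (sg z \<bullet> sg z) *\<^sub>R fst z"
definition V2 where "V2 z = dg z *\<^sub>R sg z - (sg z \<bullet> sg z) *\<^sub>R snd z"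
definition p1 where "p1 z = \<i> * (\<kappa> *\<^sub>R V1 z + 2 *\<^sub>R m (sg z))"
definition p2 where "p2 z = - \<i> * (\<kappa> *\<^sub>R V2 z + 2 *\<^sub>R m (sg z))"
text \<open>The components are \<open>2 * \<i>\<close> and \<open>- 2 * \<i>\<close> times the
  partial gradients of \<open>k\<close>: the symplectic form is standard in the first variable and
  opposite in the second.\<close>

definition X :: "complex \<times> complex \<Rightarrow> complex \<times> complex" where
  "X z = (\<i> * fst z + p1 z, - \<i> * snd z + p2 z)"
definition P :: "complex \<times> complex \<Rightarrow> real" where
  "P z = \<kappa> / 4 * ((sg z \<bullet> sg z) * dg z) + f (sg z)"
definition k :: "complex \<times> complex \<Rightarrow> real" where
  "k z = (1/4) * (z \<bullet> z) - 1/2 + P z"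
definition M where "M = {z \<in> cball 0 3. k z = 0}"
definition Dk where "Dk z h = (1/2) * (z \<bullet> h) + \<kappa> / 2 * (V1 z \<bullet> fst h + V2 z \<bullet> snd h) + m (sg z) \<bullet> sg h"

section \<open>Explicit size and Lipschitz bounds for the perturbation\<close>

lemma \<delta>_pos: "0 < \<delta>" using \<kappa> by linarith

lemma norm_fst: "z \<in> cball 0 3 \<Longrightarrow> norm (fst z) \<le> 3" and norm_snd: "z \<in> cball 0 3 \<Longrightarrow> norm (snd z) \<le> 3"
  using norm_fst_snd_le[of z] by auto

lemma \<delta>\<kappa>: "\<delta> * \<kappa> \<le> \<kappa>" using \<delta> \<kappa> by simp

lemma norm_sg: "norm (sg z) \<le> 3/2 * norm z"
proof -
  have "(norm (fst z) + norm (snd z))\<^sup>2 \<le> 2 * (norm z)\<^sup>2"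
    by (cases z) (use sum_squares_bound[of "norm (fst z)" "norm (snd z)"] in
      \<open>simp add: norm_Pair power2_sum\<close>)
  also have "\<dots> \<le> (3/2 * norm z)\<^sup>2" by (simp add: power_mult_distrib power2_eq_square)
  finally have "norm (fst z) + norm (snd z) \<le> 3/2 * norm z" by (rule power2_le_imp_le) simp
  then show ?thesis unfolding sg_def using norm_triangle_ineq order_trans by blast
qed

lemma sg_ball: "z \<in> cball 0 3 \<Longrightarrow> sg z \<in> ball 0 5" and norm_sg5: "z \<in> cball 0 3 \<Longrightarrow> norm (sg z) \<le> 5"
  using norm_sg[of z] by auto

lemma sg_ball3: "z \<in> ball 0 3 \<Longrightarrow> sg z \<in> ball 0 5"
  by (rule sg_ball) simp

lemma sg_diff: "sg z - sg w = sg (z - w)" by (simp add: sg_def)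

context
  fixes z w :: "complex \<times> complex"
  assumes zw: "z \<in> cball 0 3" "w \<in> cball 0 3"
begin

lemma sg_sq_lip: "\<bar>sg z \<bullet> sg z - sg w \<bullet> sg w\<bar> \<le> 15 * norm (z - w)"
  using inner_self_diff_le[OF norm_sg5[OF zw(1)] norm_sg5[OF zw(2)], of "3/2 * norm (z - w)"] norm_sg[of "z - w"]
  by (simp add: sg_diff)

lemma dg_lip: "\<bar>dg z - dg w\<bar> \<le> 12 * norm (z - w)"
proof -
  have "\<bar>fst z \<bullet> fst z - fst w \<bullet> fst w\<bar> \<le> 2 * 3 * norm (z - w)"
    using norm_fst_snd_le(1)[of "z - w"] by (intro inner_self_diff_le norm_fst zw) simp
  moreover have "\<bar>snd z \<bullet> snd z - snd w \<bullet> snd w\<bar> \<le> 2 * 3 * norm (z - w)"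
    using norm_fst_snd_le(2)[of "z - w"] by (intro inner_self_diff_le norm_snd zw) simp
  ultimately show ?thesis unfolding dg_def by linarith
qed

lemma sg_sq_bound: "\<bar>sg z \<bullet> sg z\<bar> \<le> 25"
  using power_mono[OF norm_sg5[OF zw(1)], of 2] by (simp add: power2_norm_eq_inner)

lemma dg_bound: "\<bar>dg z\<bar> \<le> 9"
proof -
  have "fst z \<bullet> fst z \<le> 9" "snd z \<bullet> snd z \<le> 9"
    using power_mono[OF norm_fst[OF zw(1)], of 2] power_mono[OF norm_snd[OF zw(1)], of 2]
    by (simp_all add: power2_norm_eq_inner)
  moreover have "0 \<le> fst z \<bullet> fst z" "0 \<le> snd z \<bullet> snd z" by simp_all
  ultimately show ?thesis unfolding dg_def by linarith
qed

end

lemma V_bounds: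
  assumes z: "z \<in> cball 0 3"
  shows "norm (V1 z) \<le> 120" "norm (V2 z) \<le> 120"
proof -
  have 1: "norm (dg z *\<^sub>R sg z) \<le> 9 * 5"
    unfolding norm_scaleR using dg_bound[OF z z] norm_sg5[OF z] by (intro mult_mono) auto
  have 2: "norm ((sg z \<bullet> sg z) *\<^sub>R fst z) \<le> 25 * 3" "norm ((sg z \<bullet> sg z) *\<^sub>R snd z) \<le> 25 * 3"
    unfolding norm_scaleR using sg_sq_bound[OF z z] norm_fst[OF z] norm_snd[OF z]
    by (intro mult_mono; simp)+
  show "norm (V1 z) \<le> 120" "norm (V2 z) \<le> 120"
    unfolding V1_def V2_def using 1 2
    by (auto intro: order_trans[OF norm_triangle_ineq] order_trans[OF norm_triangle_ineq4])
qed

lemma V_lip: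
  assumes z: "z \<in> cball 0 3" and w: "w \<in> cball 0 3"
  shows "norm (V1 z - V1 w) \<le> 180 * norm (z - w)" "norm (V2 z - V2 w) \<le> 180 * norm (z - w)"
proof -
  define D where "D = norm (z - w)"
  have D: "norm (fst z - fst w) \<le> D" "norm (snd z - snd w) \<le> D" "norm (sg z - sg w) \<le> 3/2 * D"
    unfolding D_def using norm_fst_snd_le[of "z - w"] norm_sg[of "z - w"]
    by (auto simp: sg_diff)
  have 1: "norm (dg z *\<^sub>R sg z - dg w *\<^sub>R sg w) \<le> (12 * D) * 5 + 9 * (3/2 * D)"
    by (rule scaleR_diff_le)
      (use dg_lip[OF z w] norm_sg5[OF z] dg_bound[OF w w] D in \<open>auto simp: D_def\<close>)
  have 2: "norm ((sg z \<bullet> sg z) *\<^sub>R fst z - (sg w \<bullet> sg w) *\<^sub>R fst w) \<le> (15 * D) * 3 + 25 * D"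
    by (rule scaleR_diff_le)
      (use sg_sq_lip[OF z w] norm_fst[OF z] sg_sq_bound[OF w w] D in \<open>auto simp: D_def\<close>)
  have 3: "norm ((sg z \<bullet> sg z) *\<^sub>R snd z - (sg w \<bullet> sg w) *\<^sub>R snd w) \<le> (15 * D) * 3 + 25 * D"
    by (rule scaleR_diff_le)
      (use sg_sq_lip[OF z w] norm_snd[OF z] sg_sq_bound[OF w w] D in \<open>auto simp: D_def\<close>)
  have "V1 z - V1 w = (dg z *\<^sub>R sg z - dg w *\<^sub>R sg w) + ((sg z \<bullet> sg z) *\<^sub>R fst z - (sg w \<bullet> sg w) *\<^sub>R fst w)"
    "V2 z - V2 w = (dg z *\<^sub>R sg z - dg w *\<^sub>R sg w) - ((sg z \<bullet> sg z) *\<^sub>R snd z - (sg w \<bullet> sg w) *\<^sub>R snd w)"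
    by (simp_all add: V1_def V2_def)
  moreover have "D \<ge> 0" by (simp add: D_def)
  ultimately show "norm (V1 z - V1 w) \<le> 180 * norm (z - w)" "norm (V2 z - V2 w) \<le> 180 * norm (z - w)"
    using 1 2 3 unfolding D_def[symmetric]
    by (auto intro: order_trans[OF norm_triangle_ineq] order_trans[OF norm_triangle_ineq4])
qed

lemma p_bounds:
  assumes z: "z \<in> cball 0 3"
  shows "norm (p1 z) \<le> 200 * \<kappa>" "norm (p2 z) \<le> 200 * \<kappa>"
proof -
  have m: "norm (2 *\<^sub>R m (sg z)) \<le> \<kappa>"
  proof -
    have "\<delta> * \<kappa> \<le> (1/2) * \<kappa>" using \<delta> \<kappa> by (intro mult_right_mono) auto
    then show ?thesis using m_bound[OF sg_ball[OF z]] by simp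
  qed
  have v: "norm (\<kappa> *\<^sub>R V1 z) \<le> 120 * \<kappa>" "norm (\<kappa> *\<^sub>R V2 z) \<le> 120 * \<kappa>"
    using V_bounds[OF z] \<kappa> by auto
  show "norm (p1 z) \<le> 200 * \<kappa>" "norm (p2 z) \<le> 200 * \<kappa>"
    unfolding p1_def p2_def norm_mult norm_minus_cancel norm_ii mult_1
    by (rule order_trans[OF norm_triangle_ineq]; use m v \<kappa> in linarith)+
qed

lemma p_lip:
  assumes z: "z \<in> cball 0 3" and w: "w \<in> cball 0 3"
  shows "norm (p1 z - p1 w) \<le> 200 * \<kappa> * norm (z - w)" "norm (p2 z - p2 w) \<le> 200 * \<kappa> * norm (z - w)"
proof -
  have m: "norm (2 *\<^sub>R (m (sg z) - m (sg w))) \<le> 3 * (\<kappa> * norm (z - w))"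
  proof -
    have "norm (m (sg z) - m (sg w)) \<le> \<delta> * \<kappa> * norm (sg z - sg w)"
      by (rule m_lip[OF sg_ball[OF z] sg_ball[OF w]])
    also have "\<dots> \<le> 1 * \<kappa> * (3/2 * norm (z - w))"
      unfolding sg_diff using \<delta> \<delta>_pos \<kappa> norm_sg by (intro mult_mono) auto
    finally show ?thesis by simp
  qed
  have v: "norm (\<kappa> *\<^sub>R (V1 z - V1 w)) \<le> 180 * (\<kappa> * norm (z - w))" "norm (\<kappa> *\<^sub>R (V2 z - V2 w)) \<le> 180 * (\<kappa> * norm (z - w))"
    using V_lip[OF z w] \<kappa> mult_left_mono[of _ _ \<kappa>] by (fastforce simp: mult_ac)+
  have e: "p1 z - p1 w = \<i> * (\<kappa> *\<^sub>R (V1 z - V1 w) + 2 *\<^sub>R (m (sg z) - m (sg w)))"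
    "p2 z - p2 w = - \<i> * (\<kappa> *\<^sub>R (V2 z - V2 w) + 2 *\<^sub>R (m (sg z) - m (sg w)))"
    by (simp_all add: p1_def p2_def algebra_simps)
  have n: "0 \<le> \<kappa> * norm (z - w)" using \<kappa> by simp
  show "norm (p1 z - p1 w) \<le> 200 * \<kappa> * norm (z - w)" "norm (p2 z - p2 w) \<le> 200 * \<kappa> * norm (z - w)"
    unfolding e norm_mult norm_minus_cancel norm_ii mult_1 mult.assoc
    by (rule order_trans[OF norm_triangle_ineq]; use m v n in linarith)+
qed

lemma P_bound: assumes z: "z \<in> cball 0 3" shows "\<bar>P z\<bar> \<le> 200 * \<kappa>"
proof -
  have "\<bar>(sg z \<bullet> sg z) * dg z\<bar> \<le> 25 * 9"
    unfolding abs_mult using sg_sq_bound[OF z z] dg_bound[OF z z] by (intro mult_mono) auto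
  then have "\<bar>\<kappa> / 4 * ((sg z \<bullet> sg z) * dg z)\<bar> \<le> \<kappa> / 4 * 225"
    unfolding abs_mult[of "\<kappa> / 4"] using \<kappa> by (intro mult_mono) auto
  moreover have "\<bar>f (sg z)\<bar> \<le> \<kappa>"
    using f_bound[OF sg_ball[OF z]] \<delta>\<kappa> by linarith
  ultimately show ?thesis unfolding P_def using \<kappa> by linarith
qed

lemma P_lip: assumes z: "z \<in> cball 0 3" and w: "w \<in> cball 0 3"
  shows "\<bar>P z - P w\<bar> \<le> 200 * \<kappa> * norm (z - w)"
proof -
  have "norm ((sg z \<bullet> sg z) *\<^sub>R dg z - (sg w \<bullet> sg w) *\<^sub>R dg w) \<le>
      (15 * norm (z - w)) * 9 + 25 * (12 * norm (z - w))"
    by (rule scaleR_diff_le)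
      (use sg_sq_lip[OF z w] dg_bound[OF z z] sg_sq_bound[OF w w] dg_lip[OF z w] in auto)
  then have "\<kappa> / 4 * \<bar>(sg z \<bullet> sg z) * dg z - (sg w \<bullet> sg w) * dg w\<bar> \<le> \<kappa> / 4 * (435 * norm (z - w))"
    using \<kappa> by (intro mult_left_mono) auto
  then have 1: "\<bar>\<kappa> / 4 * ((sg z \<bullet> sg z) * dg z) - \<kappa> / 4 * ((sg w \<bullet> sg w) * dg w)\<bar> \<le> \<kappa> / 4 * (435 * norm (z - w))"
    unfolding right_diff_distrib[symmetric] abs_mult using \<kappa> by simp
  have "norm (f (sg z) - f (sg w)) \<le> (\<delta> * \<kappa>) * norm (sg z - sg w)"
  proof (rule differentiable_bound[of "ball 0 5"])
    show "(f has_derivative (\<lambda>h. m s \<bullet> h)) (at s within ball 0 5)" if "s \<in> ball 0 5" for s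
      using f_deriv[OF that] by (rule has_derivative_at_withinI)
    show "onorm (\<lambda>h. m s \<bullet> h) \<le> \<delta> * \<kappa>" if "s \<in> ball 0 5" for s
    proof (rule onorm_le)
      fix h
      have "norm (m s \<bullet> h) \<le> norm (m s) * norm h" by (simp add: Cauchy_Schwarz_ineq2)
      also have "\<dots> \<le> \<delta> * \<kappa> * norm h" using m_bound[OF that] by (intro mult_right_mono) auto
      finally show "norm (m s \<bullet> h) \<le> \<delta> * \<kappa> * norm h" .
    qed
  qed (use sg_ball z w in auto)
  also have "\<dots> \<le> (1 * \<kappa>) * (3/2 * norm (z - w))"
    unfolding sg_diff using \<delta> \<delta>_pos \<kappa> norm_sg by (intro mult_mono) auto
  finally have 2: "\<bar>f (sg z) - f (sg w)\<bar> \<le> 3/2 * (\<kappa> * norm (z - w))" by simp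
  have "0 \<le> \<kappa> * norm (z - w)" using \<kappa> by simp
  moreover have "\<kappa> / 4 * (435 * norm (z - w)) = 435 / 4 * (\<kappa> * norm (z - w))" by simp
  ultimately show ?thesis using 1 2 unfolding P_def mult.assoc[of 200] by linarith
qed

lemma k_deriv: assumes z: "z \<in> cball 0 3" shows "(k has_derivative Dk z) (at z)"
proof -
  have fst: "(fst has_derivative fst) (at z)" and snd: "(snd has_derivative snd) (at z)"
    by (auto intro: bounded_linear_imp_has_derivative bounded_linear_fst bounded_linear_snd)
  have sg: "(sg has_derivative sg) (at z)"
    unfolding sg_def[abs_def] by (intro has_derivative_add fst snd)
  have f: "((\<lambda>z. f (sg z)) has_derivative (\<lambda>h. m (sg z) \<bullet> sg h)) (at z)"
    using diff_chain_at[OF sg f_deriv[OF sg_ball[OF z]]] by (simp add: o_def)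
  have "(k has_derivative (\<lambda>h. (1/4) * (z \<bullet> h + h \<bullet> z) +
     (\<kappa> / 4 * ((sg z \<bullet> sg z) * (fst z \<bullet> fst h + fst h \<bullet> fst z - (snd z \<bullet> snd h + snd h \<bullet> snd z)) +
       (sg z \<bullet> sg h + sg h \<bullet> sg z) * dg z) + m (sg z) \<bullet> sg h))) (at z)"
    unfolding k_def[abs_def] P_def dg_def
    by (auto intro!: derivative_eq_intros fst snd sg f)
  moreover have "(\<lambda>h. (1/4) * (z \<bullet> h + h \<bullet> z) +
     (\<kappa> / 4 * ((sg z \<bullet> sg z) * (fst z \<bullet> fst h + fst h \<bullet> fst z - (snd z \<bullet> snd h + snd h \<bullet> snd z)) +
       (sg z \<bullet> sg h + sg h \<bullet> sg z) * dg z) + m (sg z) \<bullet> sg h)) = Dk z"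
    by (rule ext) (simp add: Dk_def V1_def V2_def inner_simps inner_commute sg_def algebra_simps)
  ultimately show ?thesis by simp
qed

lemma inner_ii: "a \<bullet> (\<i> * a) = 0" by (simp add: inner_complex_def)

text \<open>Conservation of energy and the comparison with the original Hamiltonian field depend on
  this shape alone, not on the formulas for \<open>p\<close> and \<open>q\<close>.\<close>

lemma gradient_form:
  obtains p q where "X z = (\<i> * p, - (\<i> * q))" "\<And>h. Dk z h = (1/2) * (p \<bullet> fst h + q \<bullet> snd h)"
proof
  show "X z = (\<i> * (fst z + \<kappa> *\<^sub>R V1 z + 2 *\<^sub>R m (sg z)), - (\<i> * (snd z + \<kappa> *\<^sub>R V2 z + 2 *\<^sub>R m (sg z))))"
    by (simp add: X_def p1_def p2_def algebra_simps)
  show "Dk z h = (1/2) * ((fst z + \<kappa> *\<^sub>R V1 z + 2 *\<^sub>R m (sg z)) \<bullet> fst h + (snd z + \<kappa> *\<^sub>R V2 z + 2 *\<^sub>R m (sg z)) \<bullet> snd h)" for h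
    by (cases z; cases h) (simp add: Dk_def sg_def inner_simps algebra_simps)
qed

lemma Dk_X: "Dk z (X z) = 0"
proof -
  obtain p q where pq: "X z = (\<i> * p, - (\<i> * q))" "\<And>h. Dk z h = (1/2) * (p \<bullet> fst h + q \<bullet> snd h)"
    by (rule gradient_form[of z]) blast
  show ?thesis unfolding pq by (simp add: inner_ii)
qed

lemma X_lip: assumes "z \<in> cball 0 3" "w \<in> cball 0 3" shows "norm (X z - X w) \<le> 3 * norm (z - w)"
proof -
  have *: "200 * \<kappa> * norm (z - w) \<le> (1/2) * norm (z - w)" using \<kappa> \<delta> by (intro mult_right_mono) auto
  have "X z - X w = (\<i> * fst (z - w) + (p1 z - p1 w), - \<i> * snd (z - w) + (p2 z - p2 w))"
    by (simp add: X_def algebra_simps)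
  also have "norm \<dots> \<le> norm (\<i> * fst (z - w) + (p1 z - p1 w)) + norm (- \<i> * snd (z - w) + (p2 z - p2 w))"
    by (rule norm_Pair_le)
  also have "\<dots> \<le> (norm (z - w) + (1/2) * norm (z - w)) + (norm (z - w) + (1/2) * norm (z - w))"
  proof (intro add_mono order_trans[OF norm_triangle_ineq])
    show "norm (\<i> * fst (z - w)) \<le> norm (z - w)" "norm (- \<i> * snd (z - w)) \<le> norm (z - w)"
      unfolding norm_mult norm_minus_cancel norm_ii mult_1 by (rule norm_fst_snd_le)+
  qed (use p_lip[OF assms] * in linarith)+
  finally show ?thesis by simp
qed

text \<open>The components of \<open>m\<close> are the partial derivatives of
  \<open>f\<close>.\<close>

lemma f_m_smooth: "smooth_on (ball 0 5) m"
proof -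
  have *: "m s = frechet_derivative f (at s) 1 *\<^sub>R 1 + frechet_derivative f (at s) \<i> *\<^sub>R \<i>" if "s \<in> ball 0 5" for s
    using frechet_derivative_at[OF f_deriv[OF that], symmetric] by (simp add: complex_eq_iff inner_complex_def)
  have "smooth_on (ball 0 5) (\<lambda>s. frechet_derivative f (at s) 1 *\<^sub>R 1 + frechet_derivative f (at s) \<i> *\<^sub>R \<i>)"
    by (intro smooth_on_add smooth_on_scaleR smooth_on_const smooth_on_frechet_derivative f_smooth open_ball)
  from smooth_on_cong[OF open_ball *[symmetric] this] show ?thesis .
qed

lemma basic_smooth:
  "smooth_on (ball 0 3) sg" "smooth_on (ball 0 3) dg" "smooth_on (ball 0 3) k" "smooth_on (ball 0 3) X"
proof -
  note o = open_ball[of "0::complex\<times>complex" 3]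
  have fst: "smooth_on (ball 0 3) (\<lambda>z::complex\<times>complex. fst z)" and snd: "smooth_on (ball 0 3) (\<lambda>z::complex\<times>complex. snd z)"
    by (rule smooth_on_fst[OF o smooth_on_id[OF o]], rule smooth_on_snd[OF o smooth_on_id[OF o]])
  show sg: "smooth_on (ball 0 3) sg" unfolding sg_def[abs_def] by (intro smooth_on_add fst snd o)
  show dg: "smooth_on (ball 0 3) dg" unfolding dg_def[abs_def]
    by (intro smooth_on_diff smooth_on_inner fst snd o)
  have fsg: "smooth_on (ball 0 3) (\<lambda>z. f (sg z))" and msg: "smooth_on (ball 0 3) (\<lambda>z. m (sg z))"
    by (rule smooth_on_compose[OF o open_ball sg_ball3 f_smooth sg], assumption)
       (rule smooth_on_compose[OF o open_ball sg_ball3 f_m_smooth sg], assumption)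
  have N: "smooth_on (ball 0 3) (\<lambda>z. sg z \<bullet> sg z)" by (rule smooth_on_inner[OF o sg sg])
  show "smooth_on (ball 0 3) k" unfolding k_def[abs_def] P_def
    by (intro smooth_on_add smooth_on_diff smooth_on_mult smooth_on_inner N smooth_on_const fsg dg o smooth_on_id)
  have V: "smooth_on (ball 0 3) V1" "smooth_on (ball 0 3) V2"
    unfolding V1_def[abs_def] V2_def[abs_def]
    by (intro smooth_on_add smooth_on_diff smooth_on_scaleR N dg sg fst snd o)+
  show "smooth_on (ball 0 3) X" unfolding X_def[abs_def] p1_def p2_def
    by (intro smooth_on_Pair smooth_on_add smooth_on_mult smooth_on_scaleR smooth_on_const msg V fst snd o)
qed

section \<open>The energy surface as a smooth star-shaped sphere\<close>

lemma M_norm: assumes "z \<in> M" shows "19/10 \<le> (norm z)\<^sup>2" "(norm z)\<^sup>2 \<le> 21/10" "z \<in> ball 0 2" "z \<in> cball 0 3"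
proof -
  show c: "z \<in> cball 0 3" using assms by (simp add: M_def)
  have "\<bar>P z\<bar> \<le> 1/100" using P_bound[OF c] \<kappa> \<delta> by simp
  moreover have "(norm z)\<^sup>2 = 2 - 4 * P z" using assms by (simp add: M_def k_def power2_norm_eq_inner)
  ultimately show "19/10 \<le> (norm z)\<^sup>2" and 2: "(norm z)\<^sup>2 \<le> 21/10" by linarith+
  have "(norm z)\<^sup>2 < 2\<^sup>2" using 2 by simp
  then show "z \<in> ball 0 2" using power2_less_imp_less[of "norm z" 2] by simp
qed

lemma M_cball2: "M = {z \<in> cball 0 2. k z = 0}"
proof (intro equalityI subsetI)
  fix z assume "z \<in> M"
  then show "z \<in> {z \<in> cball 0 2. k z = 0}" using M_norm(3)[of z] by (simp add: M_def)
qed (simp add: M_def)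

lemma M_ball3: "z \<in> M \<Longrightarrow> z \<in> ball 0 3"
  using M_norm(3)[of z] by simp

lemma k_continuous: "continuous_on (cball 0 3) k"
  by (intro continuous_at_imp_continuous_on ballI has_derivative_continuous[OF k_deriv])

lemma compact_M: "compact M"
proof -
  have "M = cball 0 3 \<inter> (cball 0 3 \<inter> k -` {0})" unfolding M_def by blast
  moreover have "closed (cball 0 3 \<inter> k -` {0})"
    by (rule continuous_closed_preimage[OF k_continuous]) auto
  ultimately show ?thesis using compact_Int_closed[OF compact_cball] by metis
qed

lemma P_small: "x \<in> cball 0 2 \<Longrightarrow> \<bar>P x\<bar> \<le> 1/8"
  "x \<in> cball 0 2 \<Longrightarrow> y \<in> cball 0 2 \<Longrightarrow> \<bar>P x - P y\<bar> \<le> norm (x - y) / 8"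
proof -
  assume x: "x \<in> cball 0 2"
  then have x3: "x \<in> cball 0 3" by auto
  show "\<bar>P x\<bar> \<le> 1/8" using P_bound[OF x3] \<kappa> \<delta> by simp
  assume y: "y \<in> cball 0 2"
  then have y3: "y \<in> cball 0 3" by auto
  have "200 * \<kappa> * norm (x - y) \<le> (1/8) * norm (x - y)" using \<kappa> \<delta> by (intro mult_right_mono) auto
  then show "\<bar>P x - P y\<bar> \<le> norm (x - y) / 8" using P_lip[OF x3 y3] by simp
qed

lemma M_radial_unique: "x \<in> M \<Longrightarrow> y \<in> M \<Longrightarrow> (1 / norm x) *\<^sub>R x = (1 / norm y) *\<^sub>R y \<Longrightarrow> x = y"
  by (rule radial_zero_unique[OF P_small]) (auto simp: M_cball2 k_def)

lemma M_radial_exists: "norm \<xi> = 1 \<Longrightarrow> \<exists>r. 1 \<le> r \<and> r \<le> 2 \<and> r *\<^sub>R \<xi> \<in> M"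
  using radial_zero_exists[OF P_small, of \<xi>] by (fastforce simp: M_cball2 k_def)

text \<open>Every ray meets the surface exactly once, and compactness makes the inverse continuous.
  This gives connectedness and, later, a continuous curve of initial points.\<close>

lemma radial_homeomorphism:
  obtains \<sigma> where "homeomorphism M (sphere 0 1) (\<lambda>z. (1 / norm z) *\<^sub>R z) \<sigma>"
proof -
  have nz: "norm z \<noteq> 0" if "z \<in> M" for z using M_norm(1)[OF that] by auto
  have cont: "continuous_on M (\<lambda>z. (1 / norm z) *\<^sub>R z)"
    using nz by (intro continuous_intros) auto
  have img: "(\<lambda>z. (1 / norm z) *\<^sub>R z) ` M = sphere 0 1"
  proof (intro equalityI subsetI)
    fix \<xi> :: "complex \<times> complex" assume "\<xi> \<in> sphere 0 1"
    then have \<xi>: "norm \<xi> = 1" by simp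
    then obtain r where r: "1 \<le> r" "r *\<^sub>R \<xi> \<in> M" using M_radial_exists by blast
    then show "\<xi> \<in> (\<lambda>z. (1 / norm z) *\<^sub>R z) ` M"
      by (intro image_eqI[of _ _ "r *\<^sub>R \<xi>"]) (use \<xi> in auto)
  next
    fix \<xi> assume "\<xi> \<in> (\<lambda>z. (1 / norm z) *\<^sub>R z) ` M"
    then obtain z where z: "z \<in> M" "\<xi> = (1 / norm z) *\<^sub>R z" by blast
    then show "\<xi> \<in> sphere 0 1" using nz[OF z(1)] by simp
  qed
  have "inj_on (\<lambda>z. (1 / norm z) *\<^sub>R z) M" using M_radial_unique by (auto simp: inj_on_def)
  from homeomorphism_compact[OF compact_M cont img this] that show thesis by blast
qed

lemma connected_M: "connected M"
proof -
  obtain \<sigma> where "homeomorphism M (sphere 0 1) (\<lambda>z. (1 / norm z) *\<^sub>R z) \<sigma>" by (rule radial_homeomorphism)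
  then have "M = \<sigma> ` sphere 0 1" "continuous_on (sphere 0 1) \<sigma>" by (auto simp: homeomorphism_def)
  moreover have "connected (sphere (0::complex \<times> complex) 1)" by (rule connected_sphere) simp
  ultimately show ?thesis using connected_continuous_image by metis
qed

lemma X_nonzero: assumes "z \<in> M" shows "X z \<noteq> 0"
proof
  assume "X z = 0"
  then have e: "\<i> * fst z = - p1 z" "\<i> * snd z = p2 z" by (auto simp: X_def prod_eq_iff eq_neg_iff_add_eq_0)
  have "norm (fst z) = norm (p1 z)" "norm (snd z) = norm (p2 z)"
    using arg_cong[OF e(1), of norm] arg_cong[OF e(2), of norm] by (simp_all add: norm_mult)
  then have "norm (fst z) \<le> 1/10" "norm (snd z) \<le> 1/10"
    using p_bounds[OF M_norm(4)[OF assms]] \<kappa> \<delta> by auto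
  then have "(norm z)\<^sup>2 \<le> (1/10)\<^sup>2 + (1/10)\<^sup>2"
    unfolding norm_prod_sq by (intro add_mono power_mono) auto
  then show False using M_norm(1)[OF assms] by (simp add: power2_eq_square)
qed

text \<open>The radial direction is transversal to the energy surface. It witnesses regularity of
  the level set, and together with the field that of the disk.\<close>

lemma Dk_radial: assumes "z \<in> M" shows "Dk z z > 0"
proof -
  have z: "z \<in> cball 0 3" by (rule M_norm(4)[OF assms])
  have "\<bar>V1 z \<bullet> fst z\<bar> \<le> 120 * 3" "\<bar>V2 z \<bullet> snd z\<bar> \<le> 120 * 3"
    by (rule order_trans[OF Cauchy_Schwarz_ineq2], use V_bounds[OF z] norm_fst[OF z] norm_snd[OF z] in \<open>intro mult_mono; simp\<close>)+
  then have "\<bar>V1 z \<bullet> fst z + V2 z \<bullet> snd z\<bar> \<le> 720" by linarith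
  then have "\<bar>\<kappa> / 2 * (V1 z \<bullet> fst z + V2 z \<bullet> snd z)\<bar> \<le> \<kappa> / 2 * 720"
    using \<kappa> by (simp add: abs_mult)
  moreover have "\<bar>m (sg z) \<bullet> sg z\<bar> \<le> \<kappa> * 5"
  proof (rule order_trans[OF Cauchy_Schwarz_ineq2])
    have "norm (m (sg z)) \<le> \<kappa>"
      using m_bound[OF sg_ball[OF z]] \<delta>\<kappa> by linarith
    then show "norm (m (sg z)) * norm (sg z) \<le> \<kappa> * 5" using norm_sg5[OF z] \<kappa> by (intro mult_mono) auto
  qed
  moreover have "z \<bullet> z \<ge> 19/10" using M_norm(1)[OF assms] by (simp add: power2_norm_eq_inner)
  ultimately have "- (\<kappa> / 2 * 720) \<le> \<kappa> / 2 * (V1 z \<bullet> fst z + V2 z \<bullet> snd z)" "- (\<kappa> * 5) \<le> m (sg z) \<bullet> sg z"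
    "19/10 \<le> z \<bullet> z" unfolding abs_le_iff by linarith+
  moreover have "\<kappa> \<le> 1/1000000" using \<kappa> \<delta> by simp
  ultimately show ?thesis unfolding Dk_def by linarith
qed

lemma M_submanifold: "smooth_submanifold 3 M"
proof -
  have "smooth_submanifold (DIM(complex \<times> complex) - DIM(real)) M"
  proof (rule smooth_submanifold_regular_level_set)
    show "open (ball (0::complex\<times>complex) 3)" "smooth_on (ball 0 3) k" by (auto intro: basic_smooth)
    show "M = {z \<in> ball 0 3. k z = 0}"
    proof (intro equalityI subsetI)
      fix z assume "z \<in> M"
      then show "z \<in> {z \<in> ball 0 3. k z = 0}" using M_ball3[of z] by (simp add: M_def)
    qed (simp add: M_def)
    fix z assume z: "z \<in> M"
    have d: "(k has_derivative Dk z) (at z)" by (rule k_deriv[OF M_norm(4)[OF z]])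
    have "surj (Dk z)"
    proof (rule surjI)
      show "Dk z ((y / Dk z z) *\<^sub>R z) = y" for y
        using linear_scale[OF has_derivative_linear[OF d]] Dk_radial[OF z] by simp
    qed
    with d show "\<exists>A. (k has_derivative A) (at z) \<and> surj A" by blast
  qed
  then show ?thesis by simp
qed

lemma flow_exists: obtains \<phi> where "flow_on M X \<phi>" "lipschitz_flow M X \<phi> 3"
proof -
  have "\<exists>\<phi>. flow_on M X \<phi>"
  proof (rule flow_of_first_integral[of 3 X 3 k Dk])
    show "(k has_derivative Dk z) (at z)" if "z \<in> ball 0 3" for z using that by (intro k_deriv) simp
    show "M \<subseteq> ball 0 3" using M_ball3 by blast
  qed (use X_lip Dk_X compact_M M_def in simp_all)
  then obtain \<phi> where \<phi>: "flow_on M X \<phi>" by blast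
  moreover have "lipschitz_flow M X \<phi> 3"
  proof
    show "norm (X x - X y) \<le> 3 * norm (x - y)" if "x \<in> M" "y \<in> M" for x y
      using that by (intro X_lip M_norm(4))
  qed (simp_all add: \<phi> compact_imp_bounded[OF compact_M])
  ultimately show thesis using that by blast
qed

text \<open>Both \<open>cj\<close> and \<open>- cj\<close> reverse time. Their fixed sets are the
  points with two real and with two purely imaginary components, the start and the target of the
  shooting argument.\<close>

definition cj :: "complex \<times> complex \<Rightarrow> complex \<times> complex" where "cj z = (cnj (fst z), cnj (snd z))"

lemma cj_linear: "linear cj" "linear (\<lambda>z. - cj z)"
  by (auto simp: cj_def linear_iff)

lemma sym_cj:
  "sg (cj z) = cnj (sg z)" "dg (cj z) = dg z" "k (cj z) = k z" "X (cj z) = - cj (X z)" "norm (cj z) = norm z"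
proof -
  show s: "sg (cj z) = cnj (sg z)" by (simp add: sg_def cj_def)
  have i: "cnj a \<bullet> cnj b = a \<bullet> b" for a b by (simp add: inner_complex_def)
  show d: "dg (cj z) = dg z" by (simp add: dg_def cj_def i)
  have "cj z \<bullet> cj z = z \<bullet> z" by (cases z) (simp add: cj_def i)
  then show "k (cj z) = k z" by (simp add: k_def P_def s d sym i)
  show "X (cj z) = - cj (X z)"
    by (simp add: X_def p1_def p2_def V1_def V2_def s d sym i) (simp add: cj_def algebra_simps)
  show "norm (cj z) = norm z" unfolding norm_eq_sqrt_inner \<open>cj z \<bullet> cj z = z \<bullet> z\<close> ..
qed

lemma sym_neg: "sg (- z) = - sg z" "dg (- z) = dg z" "k (- z) = k z" "X (- z) = - X z"
proof -
  show s: "sg (- z) = - sg z" by (simp add: sg_def)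
  show d: "dg (- z) = dg z" by (simp add: dg_def)
  show "k (- z) = k z" by (simp add: k_def P_def s d sym)
  show "X (- z) = - X z" by (simp add: X_def p1_def p2_def V1_def V2_def s d sym algebra_simps)
qed

lemma M_sym: "z \<in> M \<Longrightarrow> cj z \<in> M" "z \<in> M \<Longrightarrow> - z \<in> M"
  by (simp_all add: M_def sym_cj sym_neg)

end

section \<open>A symmetric periodic orbit\<close>

lemma exp_linear_vector_derivative:
  "((\<lambda>t. exp (c * of_real t)) has_vector_derivative c * exp (c * of_real t)) (at (t::real))" for c :: complex
proof -
  have "((\<lambda>t. c * of_real t) has_vector_derivative c) (at t)"
    using has_vector_derivative_mult_right[OF has_vector_derivative_of_real[OF DERIV_ident], of c]
    by simp
  from field_vector_diff_chain_at[OF this DERIV_exp] show ?thesis by (simp add: o_def)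
qed

lemma (in lipschitz_flow) periodic_int:
  assumes "z \<in> M" "\<phi> T z = z"
  shows "\<phi> (t + of_int n * T) z = \<phi> t z"
proof -
  have 1: "\<phi> (t + T) z = \<phi> t z" for t using flow_add[OF assms(1)] assms(2) by simp
  have 2: "\<phi> (t - T) z = \<phi> t z" for t using 1[of "t - T"] by simp
  show ?thesis
  proof (induction n rule: int_induct[where k = 0])
    case (step1 i)
    then show ?case using 1[of "t + of_int i * T"] by (simp add: algebra_simps)
  next
    case (step2 i)
    then show ?case using 2[of "t + of_int i * T"] by (simp add: algebra_simps)
  qed simp
qed

lemma (in lipschitz_flow) periodic_reduce:
  assumes "z \<in> M" "\<phi> T z = z" "T > 0"
  obtains r where "0 \<le> r" "r \<le> T" "\<phi> t z = \<phi> r z"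
proof -
  define n where "n = \<lfloor>t / T\<rfloor>"
  have "of_int n \<le> t / T" "t / T < of_int n + 1" unfolding n_def by linarith+
  then have "of_int n * T \<le> t" "t \<le> (of_int n + 1) * T"
    using assms(3) by (simp_all only: pos_le_divide_eq pos_divide_less_eq less_imp_le)
  then show thesis
    using that[of "t - of_int n * T"] periodic_int[OF assms(1,2), of "t - of_int n * T" n]
    by (simp add: algebra_simps)
qed

context hopf_perturbation
begin

lemma \<kappa>_small: "\<kappa> \<le> 1 / 1000000" using \<kappa> \<delta> by simp

text \<open>This is the derivative of \<open>Im (z1 * z2)\<close> along the Coriolis part, per unit
  of \<kappa>. That quantity vanishes on the fixed sets of both reflections and so measures the loss
  of symmetry.\<close>

definition A :: "complex \<times> complex \<Rightarrow> real" where
  "A z = 2 * ((sg z \<bullet> sg z) *\<^sub>R Re (fst z * snd z)) + dg z *\<^sub>R Re ((snd z)\<^sup>2 - (fst z)\<^sup>2)"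

lemma mult_lip3:
  fixes a b a' b' :: complex
  assumes "norm b \<le> 3" "norm a' \<le> 3" "norm (a - a') \<le> D" "norm (b - b') \<le> D"
  shows "norm (a * b - a' * b') \<le> 6 * D"
proof -
  have "a * b - a' * b' = (a - a') * b + a' * (b - b')" by (simp add: algebra_simps)
  also have "norm \<dots> \<le> norm (a - a') * norm b + norm a' * norm (b - b')"
    by (rule order_trans[OF norm_triangle_ineq]) (simp add: norm_mult)
  also have "\<dots> \<le> D * 3 + 3 * D"
    using assms order_trans[OF norm_ge_zero assms(3)] by (intro add_mono mult_mono) auto
  finally show ?thesis by simp
qed

lemma mult_bound3:
  fixes a b :: complex
  shows "norm a \<le> 3 \<Longrightarrow> norm b \<le> 3 \<Longrightarrow> norm (a * b) \<le> 9"
  using mult_mono[of "norm a" 3 "norm b" 3] by (simp add: norm_mult)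

lemma A_lip: assumes z: "z \<in> cball 0 3" and w: "w \<in> cball 0 3" shows "\<bar>A z - A w\<bar> \<le> 1000 * norm (z - w)"
proof -
  define D where "D = norm (z - w)"
  have D: "norm (fst z - fst w) \<le> D" "norm (snd z - snd w) \<le> D" "D \<ge> 0"
    unfolding D_def using norm_fst_snd_le[of "z - w"] by simp_all
  note b = norm_fst[OF z] norm_snd[OF z] norm_fst[OF w] norm_snd[OF w]
  have 1: "\<bar>Re (fst z * snd z) - Re (fst w * snd w)\<bar> \<le> 6 * D"
    using abs_Re_le_cmod[of "fst z * snd z - fst w * snd w"] mult_lip3[OF b(2,3) D(1,2)] by simp
  have 2: "\<bar>Re ((snd z)\<^sup>2 - (fst z)\<^sup>2) - Re ((snd w)\<^sup>2 - (fst w)\<^sup>2)\<bar> \<le> 12 * D"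
    using abs_Re_le_cmod[of "snd z * snd z - snd w * snd w"] mult_lip3[OF b(2,4) D(2,2)]
      abs_Re_le_cmod[of "fst z * fst z - fst w * fst w"] mult_lip3[OF b(1,3) D(1,1)]
    unfolding power2_eq_square minus_complex.sel by linarith
  have 3: "\<bar>Re (fst z * snd z)\<bar> \<le> 9"
    using abs_Re_le_cmod[of "fst z * snd z"] mult_bound3[OF b(1,2)] by linarith
  have 4: "\<bar>Re ((snd z)\<^sup>2 - (fst z)\<^sup>2)\<bar> \<le> 18"
    using abs_Re_le_cmod[of "snd z * snd z"] mult_bound3[OF b(2,2)]
      abs_Re_le_cmod[of "fst z * fst z"] mult_bound3[OF b(1,1)]
    unfolding power2_eq_square minus_complex.sel by linarith
  have "\<bar>(sg z \<bullet> sg z) *\<^sub>R Re (fst z * snd z) - (sg w \<bullet> sg w) *\<^sub>R Re (fst w * snd w)\<bar> \<le> (15 * D) * 9 + 25 * (6 * D)"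
    using scaleR_diff_le[OF sg_sq_lip[OF z w], of "Re (fst z * snd z)" 9 25 "Re (fst w * snd w)" "6 * D"]
      1 3 sg_sq_bound[OF w w] by (simp add: D_def)
  moreover have "\<bar>dg z *\<^sub>R Re ((snd z)\<^sup>2 - (fst z)\<^sup>2) - dg w *\<^sub>R Re ((snd w)\<^sup>2 - (fst w)\<^sup>2)\<bar> \<le> (12 * D) * 18 + 9 * (12 * D)"
    using scaleR_diff_le[OF dg_lip[OF z w], of "Re ((snd z)\<^sup>2 - (fst z)\<^sup>2)" 18 9 "Re ((snd w)\<^sup>2 - (fst w)\<^sup>2)" "12 * D"]
      2 4 dg_bound[OF w w] by (simp add: D_def)
  ultimately show ?thesis unfolding A_def D_def[symmetric] using D(3) by linarith
qed

text \<open>The unperturbed flow preserves \<open>z1 * z2\<close>, since the two rotations are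
  opposite; only the perturbation contributes.\<close>

lemma X_prod:
  "Im (fst (X z) * snd z + fst z * snd (X z)) = \<kappa> * A z + 2 * Re (m (sg z) * (snd z - fst z))"
proof -
  have "fst (X z) * snd z + fst z * snd (X z) =
      \<i> * (\<kappa> *\<^sub>R (2 *\<^sub>R ((sg z \<bullet> sg z) *\<^sub>R (fst z * snd z)) + dg z *\<^sub>R (sg z * (snd z - fst z)))
        + 2 *\<^sub>R (m (sg z) * (snd z - fst z)))"
    by (simp add: X_def p1_def p2_def V1_def V2_def scaleR_conv_of_real algebra_simps)
  moreover have "sg z * (snd z - fst z) = (snd z)\<^sup>2 - (fst z)\<^sup>2"
    by (simp add: sg_def power2_eq_square algebra_simps)
  ultimately show ?thesis by (simp add: A_def)
qed

text \<open>The constant part is the secular drift, and its sign is that of \<open>a * b\<close>.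
  The oscillating part integrates to a multiple of \<open>sin (2 * t)\<close>, which is small near a
  quarter period.\<close>

lemma A_unperturbed:
  "A (exp (\<i> * of_real t) * of_real a, exp (- \<i> * of_real t) * of_real b) =
    2 * a * b * (a\<^sup>2 + b\<^sup>2) + (4 * a\<^sup>2 * b\<^sup>2 - (a\<^sup>2 - b\<^sup>2)\<^sup>2) * cos (2 * t)"
proof -
  define c where "c = cos t"
  define s where "s = sin t"
  have cs: "c\<^sup>2 + s\<^sup>2 = 1" by (simp add: c_def s_def)
  have "A (Complex (a * c) (a * s), Complex (b * c) (- (b * s))) =
     2 * (((a * c + b * c)\<^sup>2 + (a * s - b * s)\<^sup>2) * (a * b * (c\<^sup>2 + s\<^sup>2))) +
     (a\<^sup>2 * (c\<^sup>2 + s\<^sup>2) - b\<^sup>2 * (c\<^sup>2 + s\<^sup>2)) * ((b\<^sup>2 - a\<^sup>2) * (c\<^sup>2 - s\<^sup>2))"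
    by (simp add: A_def sg_def dg_def inner_complex_def power2_eq_square algebra_simps)
  also have "\<dots> = 2 * (((a * c + b * c)\<^sup>2 + (a * s - b * s)\<^sup>2) * (a * b)) +
     (a\<^sup>2 - b\<^sup>2) * ((b\<^sup>2 - a\<^sup>2) * (c\<^sup>2 - s\<^sup>2))" unfolding cs by simp
  also have "(a * c + b * c)\<^sup>2 + (a * s - b * s)\<^sup>2 = (a\<^sup>2 + b\<^sup>2) * (c\<^sup>2 + s\<^sup>2) + 2 * a * b * (c\<^sup>2 - s\<^sup>2)"
    by (simp add: power2_eq_square algebra_simps)
  also have "\<dots> = a\<^sup>2 + b\<^sup>2 + 2 * a * b * (c\<^sup>2 - s\<^sup>2)" unfolding cs by simp
  finally have "A (Complex (a * c) (a * s), Complex (b * c) (- (b * s))) =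
     2 * a * b * (a\<^sup>2 + b\<^sup>2) + (4 * a\<^sup>2 * b\<^sup>2 - (a\<^sup>2 - b\<^sup>2)\<^sup>2) * (c\<^sup>2 - s\<^sup>2)"
    by (simp add: power2_eq_square algebra_simps)
  moreover have "exp (\<i> * of_real t) * of_real a = Complex (a * c) (a * s)"
    "exp (- \<i> * of_real t) * of_real b = Complex (b * c) (- (b * s))"
    by (simp_all add: complex_eq_iff Re_exp Im_exp c_def s_def)
  ultimately show ?thesis by (simp add: c_def s_def cos_double)
qed

end

locale hopf_flow = hopf_perturbation + lipschitz_flow "hopf_perturbation.M \<kappa> f" "hopf_perturbation.X \<kappa> m" \<phi> 3 for \<phi>
begin

lemma comp_deriv:
  assumes "z \<in> M"
  shows "((\<lambda>t. fst (\<phi> t z)) has_vector_derivative (\<i> * fst (\<phi> t z) + p1 (\<phi> t z))) (at t)"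
    "((\<lambda>t. snd (\<phi> t z)) has_vector_derivative (- \<i> * snd (\<phi> t z) + p2 (\<phi> t z))) (at t)"
  using bounded_linear.has_vector_derivative[OF bounded_linear_fst flow_deriv[OF assms, of t]]
    bounded_linear.has_vector_derivative[OF bounded_linear_snd flow_deriv[OF assms, of t]]
  by (simp_all add: X_def)

text \<open>Variation of constants: after the unperturbed rotation is undone, the components move
  with speed at most \<open>200 * \<kappa>\<close>.\<close>

lemma flow_approx:
  assumes z: "z \<in> M"
  shows "norm (fst (\<phi> t z) - exp (\<i> * of_real t) * fst z) \<le> 200 * \<kappa> * \<bar>t\<bar>"
    "norm (snd (\<phi> t z) - exp (- \<i> * of_real t) * snd z) \<le> 200 * \<kappa> * \<bar>t\<bar>"
proof -
  have main: "norm (g t - exp (c * of_real t) * g 0) \<le> 200 * \<kappa> * \<bar>t\<bar>"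
    if g: "\<And>t. (g has_vector_derivative (c * g t + q t)) (at t)" and q: "\<And>t. norm (q t) \<le> 200 * \<kappa>"
      and c: "Re c = 0" for g q :: "real \<Rightarrow> complex" and c
  proof -
    have e: "norm (exp (c * of_real t)) = 1" "norm (exp (- c * of_real t)) = 1" for t using c by simp_all
    have "((\<lambda>t. exp (- c * of_real t) * g t) has_vector_derivative exp (- c * of_real t) * q t) (at t)" for t
      using has_vector_derivative_mult[OF exp_linear_vector_derivative[of "- c" t] g[of t]]
      by (simp add: algebra_simps)
    moreover have "((\<lambda>s. 200 * \<kappa> * s) has_real_derivative 200 * \<kappa>) (at s)" for s
      by (auto intro!: derivative_eq_intros)
    moreover have "norm (exp (- c * of_real t) * q t) \<le> 200 * \<kappa>" for t
      using q by (simp only: norm_mult e mult_1)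
    ultimately have "norm (exp (- c * of_real t) * g t - exp (- c * of_real 0) * g 0) \<le> 200 * \<kappa> * \<bar>t\<bar> - 200 * \<kappa> * 0"
      by (rule norm_le_of_derivative_le_abs)
    then have "norm (exp (- c * of_real t) * g t - g 0) \<le> 200 * \<kappa> * \<bar>t\<bar>" by simp
    moreover have "g t - exp (c * of_real t) * g 0 = exp (c * of_real t) * (exp (- c * of_real t) * g t - g 0)"
      by (simp add: algebra_simps exp_minus)
    ultimately show ?thesis by (simp only: norm_mult e mult_1)
  qed
  have "norm (p1 (\<phi> t z)) \<le> 200 * \<kappa>" "norm (p2 (\<phi> t z)) \<le> 200 * \<kappa>" for t
    using p_bounds M_norm(4) flow_in[OF z] by blast+
  from main[OF comp_deriv(1)[OF z] this(1)] main[OF comp_deriv(2)[OF z] this(2)]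
  show "norm (fst (\<phi> t z) - exp (\<i> * of_real t) * fst z) \<le> 200 * \<kappa> * \<bar>t\<bar>"
    "norm (snd (\<phi> t z) - exp (- \<i> * of_real t) * snd z) \<le> 200 * \<kappa> * \<bar>t\<bar>"
    using z by simp_all
qed

text \<open>The error is of second order. The orbit deviates from the unperturbed one by at most
  \<open>1200 * \<kappa>\<close>, \<open>A\<close> has Lipschitz constant 1000 and
  \<open>\<kappa> \<le> \<delta>\<close>; the tidal part adds
  \<open>12 * \<delta> * \<kappa>\<close>. This is integrated over time at most 3.\<close>

lemma angular_approx:
  assumes z: "z \<in> M" "fst z = of_real a" "snd z = of_real b" and t: "0 \<le> t" "t \<le> 3"
  shows "\<bar>Im (fst (\<phi> t z) * snd (\<phi> t z)) - \<kappa> * (2 * a * b * (a\<^sup>2 + b\<^sup>2) * t +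
    (4 * a\<^sup>2 * b\<^sup>2 - (a\<^sup>2 - b\<^sup>2)\<^sup>2) * sin (2 * t) / 2)\<bar> \<le> 4000000 * \<delta> * \<kappa>"
proof -
  define c1 where "c1 = 2 * a * b * (a\<^sup>2 + b\<^sup>2)"
  define c2 where "c2 = 4 * a\<^sup>2 * b\<^sup>2 - (a\<^sup>2 - b\<^sup>2)\<^sup>2"
  define Q where "Q t = Im (fst (\<phi> t z) * snd (\<phi> t z))" for t
  define w where "w t = (exp (\<i> * of_real t) * of_real a, exp (- \<i> * of_real t) * of_real b)" for t :: real
  define r where "r t = \<kappa> * (A (\<phi> t z) - A (w t)) + 2 * Re (m (sg (\<phi> t z)) * (snd (\<phi> t z) - fst (\<phi> t z)))" for t
  have in3: "\<phi> t z \<in> cball 0 3" for t by (rule M_norm(4)[OF flow_in[OF z(1)]])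
  have Aw: "A (w t) = c1 + c2 * cos (2 * t)" for t
    unfolding w_def c1_def c2_def by (rule A_unperturbed)
  have "norm (w t) = norm z" for t
    using z(2,3) by (cases z) (simp add: w_def norm_Pair norm_mult)
  then have w3: "w t \<in> cball 0 3" for t using M_norm(4)[OF z(1)] by simp
  have "(Q has_real_derivative \<kappa> * A (\<phi> t z) + 2 * Re (m (sg (\<phi> t z)) * (snd (\<phi> t z) - fst (\<phi> t z)))) (at t)" for t
  proof -
    have "((\<lambda>t. fst (\<phi> t z) * snd (\<phi> t z)) has_vector_derivative
       (fst (\<phi> t z) * snd (X (\<phi> t z)) + fst (X (\<phi> t z)) * snd (\<phi> t z))) (at t)"
      using has_vector_derivative_mult[OF comp_deriv[OF z(1), of t]] by (simp add: X_def)
    from bounded_linear.has_vector_derivative[OF bounded_linear_Im this]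
    show ?thesis unfolding Q_def has_real_derivative_iff_has_vector_derivative X_prod[symmetric]
      by (simp add: add.commute)
  qed
  then have dQ: "((\<lambda>t. Q t - \<kappa> * (c1 * t + c2 * sin (2 * t) / 2)) has_real_derivative r t) (at t)" for t
    unfolding r_def Aw by (auto intro!: derivative_eq_intros simp: algebra_simps)
  have r: "norm (r s) \<le> 1300000 * \<delta> * \<kappa>" if s: "0 \<le> s" "s \<le> t" for s
  proof -
    have e: "\<phi> s z - w s = (fst (\<phi> s z) - exp (\<i> * of_real s) * fst z, snd (\<phi> s z) - exp (- \<i> * of_real s) * snd z)"
      by (simp add: w_def z prod_eq_iff)
    have "norm (\<phi> s z - w s) \<le> 200 * \<kappa> * \<bar>s\<bar> + 200 * \<kappa> * \<bar>s\<bar>"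
      unfolding e by (rule order_trans[OF norm_Pair_le add_mono[OF flow_approx[OF z(1)]]])
    also have "\<dots> \<le> 200 * \<kappa> * 3 + 200 * \<kappa> * 3" using s t \<kappa> by (intro add_mono mult_left_mono) auto
    finally have "\<bar>A (\<phi> s z) - A (w s)\<bar> \<le> 1200000 * \<delta>" using A_lip[OF in3 w3, of s s] \<kappa> by linarith
    then have 1: "\<bar>\<kappa> * (A (\<phi> s z) - A (w s))\<bar> \<le> \<kappa> * (1200000 * \<delta>)"
      unfolding abs_mult using \<kappa> by (intro mult_mono) auto
    have "norm (m (sg (\<phi> s z)) * (snd (\<phi> s z) - fst (\<phi> s z))) \<le> (\<delta> * \<kappa>) * (3 + 3)"
      unfolding norm_mult
      by (intro mult_mono order_trans[OF norm_triangle_ineq4] add_mono norm_fst norm_snd in3 m_bound sg_ball)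
        (use \<kappa> in auto)
    then have 2: "\<bar>Re (m (sg (\<phi> s z)) * (snd (\<phi> s z) - fst (\<phi> s z)))\<bar> \<le> 6 * (\<delta> * \<kappa>)"
      using abs_Re_le_cmod order_trans by fastforce
    have "0 \<le> \<delta> * \<kappa>" using \<kappa> by simp
    moreover have "\<kappa> * (1200000 * \<delta>) = 1200000 * (\<delta> * \<kappa>)" by simp
    ultimately show ?thesis using 1 2 unfolding r_def real_norm_def mult.assoc[of _ \<delta>] by linarith
  qed
  have "norm ((Q t - \<kappa> * (c1 * t + c2 * sin (2 * t) / 2)) - (Q 0 - \<kappa> * (c1 * 0 + c2 * sin (2 * 0) / 2))) \<le>
      1300000 * \<delta> * \<kappa> * t - 1300000 * \<delta> * \<kappa> * 0"
    by (rule norm_le_of_derivative_le[where F' = r and \<phi>' = "\<lambda>_. 1300000 * \<delta> * \<kappa>"])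
      (use dQ r t in \<open>auto simp: has_real_derivative_iff_has_vector_derivative[symmetric] intro!: derivative_eq_intros\<close>)
  moreover have "Q 0 = 0" using z by (simp add: Q_def)
  moreover have "1300000 * \<delta> * \<kappa> * t \<le> 1300000 * \<delta> * \<kappa> * 3" using t \<kappa> by (intro mult_left_mono) auto
  moreover have "0 \<le> \<delta> * \<kappa>" using \<kappa> by simp
  ultimately show ?thesis unfolding c1_def c2_def Q_def by simp
qed

text \<open>Unperturbed orbits are all symmetric; at first order in \<open>\<kappa>\<close> the orbit is turned in a fixed direction,
  so that the deviation from symmetry after a quarter period changes sign with \<open>x\<close>.\<close>

lemma symmetric_quarter_orbit:
  assumes x0: "0 < x0" "x0 \<le> 1/10" and \<delta>x: "\<delta> \<le> x0 / 10000000"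
  obtains z \<tau> where "z \<in> M" "\<bar>\<tau> - pi/2\<bar> \<le> x0 / 2" "Im (fst z) = 0" "Im (snd z) = 0" "Re (fst z) > 0"
    "norm (snd z) \<le> 2 * x0" "Re (fst (\<phi> \<tau> z)) = 0" "Re (snd (\<phi> \<tau> z)) = 0"
proof -
  obtain \<sigma> where \<sigma>: "homeomorphism M (sphere 0 1) (\<lambda>z. (1 / norm z) *\<^sub>R z) \<sigma>" by (rule radial_homeomorphism)
  \<comment> \<open>Real unit vectors near the axis; carried to \<open>M\<close> along rays they
    form a curve of initial points inside the fixed set of \<open>cj\<close>.\<close>
  define \<xi> where "\<xi> x = (complex_of_real (sqrt (1 - x\<^sup>2)), complex_of_real x)" for x
  define Z where "Z x = \<sigma> (\<xi> x)" for x
  define J where "J = {- x0..x0}"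
  define I where "I = {pi/2 - x0/2..pi/2 + x0/2}"
  have xsq: "x\<^sup>2 \<le> 1/100" if "x \<in> J" for x
    using that x0 power_mono[of "\<bar>x\<bar>" "1/10" 2] by (auto simp: J_def power2_eq_square)
  have sq: "9/10 \<le> sqrt (1 - x\<^sup>2)" "sqrt (1 - x\<^sup>2) \<le> 1" "(sqrt (1 - x\<^sup>2))\<^sup>2 = 1 - x\<^sup>2" if "x \<in> J" for x
  proof -
    show "9/10 \<le> sqrt (1 - x\<^sup>2)"
      by (rule real_le_rsqrt) (use xsq[OF that] in \<open>simp add: power_divide\<close>)
  qed (use xsq[OF that] in simp_all)
  have \<xi>1: "norm (\<xi> x) = 1" if "x \<in> J" for x
    using xsq[OF that] by (simp add: \<xi>_def norm_Pair)
  have ZM: "Z x \<in> M" "Z x = norm (Z x) *\<^sub>R \<xi> x" if "x \<in> J" for x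
  proof -
    have "\<xi> x \<in> sphere 0 1" using \<xi>1[OF that] by simp
    then show "Z x \<in> M" and "Z x = norm (Z x) *\<^sub>R \<xi> x"
      using \<sigma> unfolding Z_def homeomorphism_def
      by (blast, metis (no_types, lifting) M_norm(1) divide_self_if image_eqI mult.right_neutral norm_zero not_numeral_le_zero
          power_zero_numeral scaleR_one scaleR_scaleR times_divide_eq_right zero_le_divide_iff zero_neq_numeral norm_eq_zero zero_less_divide_iff zero_less_numeral not_less)
  qed
  define \<rho> where "\<rho> x = norm (Z x)" for x
  have \<rho>: "19/10 \<le> (\<rho> x)\<^sup>2" "1 \<le> \<rho> x" "\<rho> x \<le> 3/2" if "x \<in> J" for x
  proof -
    note n = M_norm(1,2)[OF ZM(1)[OF that]]
    then show "19/10 \<le> (\<rho> x)\<^sup>2" by (simp add: \<rho>_def)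
    show "1 \<le> \<rho> x" by (rule power2_le_imp_le) (use n in \<open>auto simp: \<rho>_def\<close>)
    show "\<rho> x \<le> 3/2" by (rule power2_le_imp_le) (use n in \<open>auto simp: \<rho>_def power2_eq_square\<close>)
  qed
  define a where "a x = \<rho> x * sqrt (1 - x\<^sup>2)" for x
  define b where "b x = \<rho> x * x" for x
  have Zab: "fst (Z x) = of_real (a x)" "snd (Z x) = of_real (b x)" if "x \<in> J" for x
    using ZM(2)[OF that] by (simp_all add: prod_eq_iff \<rho>_def a_def b_def \<xi>_def scaleR_conv_of_real)
  have ab: "(a x)\<^sup>2 + (b x)\<^sup>2 = (\<rho> x)\<^sup>2" if "x \<in> J" for x
  proof -
    have "(a x)\<^sup>2 + (b x)\<^sup>2 = (\<rho> x)\<^sup>2 * ((sqrt (1 - x\<^sup>2))\<^sup>2 + x\<^sup>2)"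
      by (simp add: a_def b_def power_mult_distrib distrib_left)
    then show ?thesis unfolding sq(3)[OF that] by simp
  qed
  have a9: "9/10 \<le> a x" if "x \<in> J" for x
    unfolding a_def using mult_mono[of 1 "\<rho> x" "9/10" "sqrt (1 - x\<^sup>2)"] \<rho>[OF that] sq[OF that] by simp
  have contZ: "continuous_on J Z"
    unfolding Z_def
  proof (rule continuous_on_compose2[of "sphere 0 1" \<sigma>])
    show "continuous_on (sphere 0 1) \<sigma>" using \<sigma> by (simp add: homeomorphism_def)
    show "continuous_on J \<xi>" unfolding \<xi>_def by (intro continuous_intros)
  qed (use \<xi>1 in auto)
  have I: "0 \<le> t" "t \<le> 3" "29/20 \<le> t" if "t \<in> I" for t
    using that x0 pi_gt3 pi_less_4 by (auto simp: I_def)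
  have cont\<phi>: "continuous_on (J \<times> I) (\<lambda>p. \<phi> (snd p) (Z (fst p)))"
  proof -
    have "continuous_on (J \<times> I) (\<lambda>p. (snd p, Z (fst p)))"
      by (intro continuous_intros continuous_on_compose2[OF contZ]) auto
    moreover have "(\<lambda>p. (snd p, Z (fst p))) ` (J \<times> I) \<subseteq> UNIV \<times> M" using ZM(1) by auto
    ultimately show ?thesis using continuous_on_compose2[OF flow_continuous] by fastforce
  qed
  \<comment> \<open>Common zeros hit the fixed set of \<open>- cj\<close>: if
    \<open>Re z1 = 0\<close> then \<open>Im (z1 * z2) = Im z1 * Re z2\<close>, and \<open>z1\<close>
    is not 0. The product is used instead of \<open>Re z2\<close> because its first order drift is
    explicit.\<close>
  define h1 where "h1 x t = Im (fst (\<phi> t (Z x)) * snd (\<phi> t (Z x)))" for x t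
  define h2 where "h2 x t = - Re (fst (\<phi> t (Z x)))" for x t
  have h1_approx: "\<bar>h1 x t - \<kappa> * (2 * a x * b x * (\<rho> x)\<^sup>2 * t + c2)\<bar> \<le> \<kappa> * (4/10 * x0) \<and> \<bar>c2\<bar> \<le> (\<rho> x)\<^sup>2 * (\<rho> x)\<^sup>2 * (x0 / 2)"
    if "x \<in> J" "t \<in> I" "c2 = (4 * (a x)\<^sup>2 * (b x)\<^sup>2 - ((a x)\<^sup>2 - (b x)\<^sup>2)\<^sup>2) * sin (2 * t) / 2" for x t c2
  proof
    \<comment> \<open>The factor \<open>10^7\<close> between \<open>x0\<close> and \<delta> serves
      this comparison: the second order error stays below a fraction of the drift, which is
      proportional to \<open>x0\<close>.\<close>
    have "4000000 * \<delta> * \<kappa> \<le> \<kappa> * (4/10 * x0)" unfolding mult.commute[of \<kappa>] using \<delta>x \<kappa> by (intro mult_right_mono) auto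
    then show "\<bar>h1 x t - \<kappa> * (2 * a x * b x * (\<rho> x)\<^sup>2 * t + c2)\<bar> \<le> \<kappa> * (4/10 * x0)"
    proof (rule order_trans[rotated])
      show "\<bar>h1 x t - \<kappa> * (2 * a x * b x * (\<rho> x)\<^sup>2 * t + c2)\<bar> \<le> 4000000 * \<delta> * \<kappa>"
        unfolding h1_def that(3) ab[OF that(1), symmetric]
        by (rule angular_approx[OF ZM(1)[OF that(1)] Zab[OF that(1)] I(1,2)[OF that(2)]])
    qed
    \<comment> \<open>The time window is chosen so narrow that \<open>2 * t\<close> is within
      \<open>x0\<close> of \<open>pi\<close>; the oscillating term is then dominated by the
      drift.\<close>
    have "\<bar>sin (2 * t)\<bar> \<le> x0"
    proof -
      have "sin (2 * t) = - sin (2 * t - pi)" by (simp add: sin_diff)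
      moreover have "\<bar>sin (2 * t - pi)\<bar> \<le> \<bar>2 * t - pi\<bar>" by (rule abs_sin_x_le_abs_x)
      moreover have "\<bar>2 * t - pi\<bar> \<le> x0" using that(2) by (auto simp: I_def abs_le_iff field_simps)
      ultimately show ?thesis by simp
    qed
    moreover have "\<bar>4 * (a x)\<^sup>2 * (b x)\<^sup>2 - ((a x)\<^sup>2 - (b x)\<^sup>2)\<^sup>2\<bar> \<le> ((a x)\<^sup>2 + (b x)\<^sup>2)\<^sup>2"
    proof -
      have "((a x)\<^sup>2 + (b x)\<^sup>2)\<^sup>2 = 4 * (a x)\<^sup>2 * (b x)\<^sup>2 + ((a x)\<^sup>2 - (b x)\<^sup>2)\<^sup>2"
        by (simp add: power2_eq_square algebra_simps)
      moreover have "0 \<le> 4 * (a x)\<^sup>2 * (b x)\<^sup>2" "0 \<le> ((a x)\<^sup>2 - (b x)\<^sup>2)\<^sup>2" by simp_all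
      ultimately show ?thesis by linarith
    qed
    ultimately have "\<bar>4 * (a x)\<^sup>2 * (b x)\<^sup>2 - ((a x)\<^sup>2 - (b x)\<^sup>2)\<^sup>2\<bar> * \<bar>sin (2 * t)\<bar> \<le> ((\<rho> x)\<^sup>2)\<^sup>2 * x0"
      unfolding ab[OF that(1)] by (intro mult_mono) auto
    then show "\<bar>c2\<bar> \<le> (\<rho> x)\<^sup>2 * (\<rho> x)\<^sup>2 * (x0 / 2)"
      unfolding that(3) by (simp add: abs_mult power2_eq_square)
  qed
  have sign1: "h1 (- x0) t < 0 \<and> h1 x0 t > 0" if t: "t \<in> I" for t
  proof -
    \<comment> \<open>The factor \<open>y\<close> treats both edges at once. The drift contributes
      at least \<open>26/10 * R * x0\<close>, the oscillation takes away at most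
      \<open>R * x0 / 2\<close> and the error \<open>4/10 * x0\<close>, all in units of
      \<kappa>.\<close>
    have *: "0 < y * h1 (y * x0) t" if y: "y = 1 \<or> y = -1" for y
    proof -
      define x where "x = y * x0"
      have x: "x \<in> J" "\<bar>x\<bar> = x0" "y * x = x0" using y x0 by (auto simp: x_def J_def)
      define R where "R = (\<rho> x)\<^sup>2 * (\<rho> x)\<^sup>2"
      define c2 where "c2 = (4 * (a x)\<^sup>2 * (b x)\<^sup>2 - ((a x)\<^sup>2 - (b x)\<^sup>2)\<^sup>2) * sin (2 * t) / 2"
      define q where "q = sqrt (1 - x\<^sup>2) * t"
      note h = h1_approx[OF x(1) t c2_def]
      have R1: "1 \<le> R" unfolding R_def using \<rho>(1)[OF x(1)] mult_mono[of 1 "(\<rho> x)\<^sup>2" 1 "(\<rho> x)\<^sup>2"] by simp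
      have "9/10 * (29/20) \<le> q" unfolding q_def using sq(1)[OF x(1)] I(3)[OF t] by (intro mult_mono) linarith+
      then have "13/10 \<le> q" by linarith
      then have q: "R * x0 * (13/10) \<le> R * x0 * q" using R1 x0 by (intro mult_left_mono) auto
      have c1: "y * (2 * a x * b x * (\<rho> x)\<^sup>2 * t) = 2 * (R * x0 * q)"
        unfolding R_def q_def x(3)[symmetric] a_def b_def by (simp add: power2_eq_square)
      have "1 * x0 \<le> R * x0" using R1 x0 by (intro mult_right_mono) auto
      moreover have "\<bar>c2\<bar> \<le> R * x0 / 2" using h by (simp add: R_def)
      then have "\<bar>y * c2\<bar> \<le> R * x0 / 2" using y by auto
      then have "- (R * x0 / 2) \<le> y * c2" by linarith
      moreover have "y * (2 * a x * b x * (\<rho> x)\<^sup>2 * t + c2) = 2 * (R * x0 * q) + y * c2"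
        by (simp only: distrib_left c1)
      ultimately have "4/10 * x0 < y * (2 * a x * b x * (\<rho> x)\<^sup>2 * t + c2)"
        using q x0(1) by linarith
      then have "\<kappa> * (4/10 * x0) < \<kappa> * (y * (2 * a x * b x * (\<rho> x)\<^sup>2 * t + c2))"
        using \<kappa> by (intro mult_strict_left_mono) auto
      then have "\<kappa> * (4/10 * x0) < y * (\<kappa> * (2 * a x * b x * (\<rho> x)\<^sup>2 * t + c2))" by (simp add: mult_ac)
      moreover have "\<bar>y * h1 x t - y * (\<kappa> * (2 * a x * b x * (\<rho> x)\<^sup>2 * t + c2))\<bar> \<le> \<kappa> * (4/10 * x0)"
        unfolding right_diff_distrib[symmetric] abs_mult[of y] using h y by auto
      ultimately show ?thesis unfolding x_def[symmetric] by linarith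
    qed
    show ?thesis using *[of 1] *[of "-1"] by simp
  qed
  \<comment> \<open>\<open>Re z1\<close> is close to \<open>a x * cos t\<close>, which at the two
    ends of the window has modulus at least \<open>9/40 * x0\<close>; the deviation is below
    \<open>x0 / 10\<close>.\<close>
  have sign2: "h2 x (pi/2 - x0/2) < 0 \<and> 0 < h2 x (pi/2 + x0/2)" if x: "x \<in> J" for x
  proof -
    have sin: "x0 / 4 \<le> sin (x0 / 2)"
    proof -
      have "\<bar>sin (x0/2) - x0/2\<bar> \<le> inverse (fact 2) * \<bar>x0/2\<bar> ^ 2"
        using Maclaurin_sin_bound[of "x0/2" 2] by (simp add: sin_coeff_def numeral_2_eq_2)
      moreover have "\<bar>x0/2\<bar> ^ 2 \<le> 1/20 * (x0/2)" using x0 by (simp add: power2_eq_square)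
      ultimately have "\<bar>sin (x0/2) - x0/2\<bar> \<le> x0 / 4" using x0(1) by simp
      then show ?thesis by linarith
    qed
    have e: "\<bar>Re (fst (\<phi> t (Z x))) - a x * cos t\<bar> \<le> x0 / 10" if "t \<in> I" for t
    proof -
      have "\<bar>Re (fst (\<phi> t (Z x)) - exp (\<i> * of_real t) * fst (Z x))\<bar> \<le> 200 * \<kappa> * \<bar>t\<bar>"
        using flow_approx(1)[OF ZM(1)[OF x], of t] abs_Re_le_cmod order_trans by blast
      moreover have "200 * \<kappa> * \<bar>t\<bar> \<le> 200 * \<kappa> * 3" using I[OF that] \<kappa> by (intro mult_left_mono) auto
      moreover have "Re (exp (\<i> * of_real t) * fst (Z x)) = a x * cos t"
        using Zab[OF x] by (simp add: Re_exp)
      ultimately show ?thesis using \<kappa> \<delta>x x0 unfolding minus_complex.sel by linarith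
    qed
    have 0: "9/10 * (x0 / 4) \<le> a x * sin (x0 / 2)" using a9[OF x] sin x0 by (intro mult_mono) auto
    have "cos (pi/2 - x0/2) = sin (x0/2)" "cos (pi/2 + x0/2) = - sin (x0/2)"
      by (simp_all add: cos_diff cos_add)
    moreover have "pi/2 - x0/2 \<in> I" "pi/2 + x0/2 \<in> I" using x0 by (auto simp: I_def)
    ultimately have "\<bar>Re (fst (\<phi> (pi/2 - x0/2) (Z x))) - a x * sin (x0/2)\<bar> \<le> x0 / 10"
      "\<bar>Re (fst (\<phi> (pi/2 + x0/2) (Z x))) + a x * sin (x0/2)\<bar> \<le> x0 / 10"
      using e[of "pi/2 - x0/2"] e[of "pi/2 + x0/2"] by simp_all
    then show ?thesis using 0 x0(1) unfolding h2_def abs_le_iff by linarith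
  qed
  obtain x \<tau> where x\<tau>: "x \<in> J" "\<tau> \<in> I" "h1 x \<tau> = 0" "h2 x \<tau> = 0"
  proof -
    have "continuous_on (J \<times> I) (\<lambda>p. Im (fst (\<phi> (snd p) (Z (fst p))) * snd (\<phi> (snd p) (Z (fst p)))))"
      "continuous_on (J \<times> I) (\<lambda>p. - Re (fst (\<phi> (snd p) (Z (fst p)))))"
      by (intro continuous_intros cont\<phi>)+
    then have "continuous_on (J \<times> I) (\<lambda>(x, t). h1 x t)" "continuous_on (J \<times> I) (\<lambda>(x, t). h2 x t)"
      by (simp_all add: h1_def h2_def case_prod_unfold)
    from poincare_miranda[OF _ _ this[unfolded J_def I_def]] sign1 sign2 x0 that show thesis
      unfolding J_def I_def by auto
  qed
  show thesis
  proof (rule that[of "Z x" \<tau>])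
    show "Z x \<in> M" by (rule ZM(1)[OF x\<tau>(1)])
    have "pi/2 - x0/2 \<le> \<tau>" "\<tau> \<le> pi/2 + x0/2" using x\<tau>(2) by (simp_all add: I_def)
    then show "\<bar>\<tau> - pi/2\<bar> \<le> x0/2" unfolding abs_le_iff by linarith
    show "Im (fst (Z x)) = 0" "Im (snd (Z x)) = 0" using Zab[OF x\<tau>(1)] by auto
    show "Re (fst (Z x)) > 0" using Zab[OF x\<tau>(1)] a9[OF x\<tau>(1)] by simp
    have "\<rho> x * \<bar>x\<bar> \<le> 3/2 * x0" using \<rho>[OF x\<tau>(1)] x\<tau>(1) by (intro mult_mono) (auto simp: J_def)
    then show "norm (snd (Z x)) \<le> 2 * x0"
      using Zab(2)[OF x\<tau>(1)] \<rho>(2)[OF x\<tau>(1)] x0 by (simp add: b_def norm_mult)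
    show 1: "Re (fst (\<phi> \<tau> (Z x))) = 0" using x\<tau>(4) by (simp add: h2_def)
    have "fst (\<phi> \<tau> (Z x)) \<noteq> 0"
    proof
      assume "fst (\<phi> \<tau> (Z x)) = 0"
      then have "norm (exp (\<i> * of_real \<tau>) * fst (Z x)) \<le> 200 * \<kappa> * \<bar>\<tau>\<bar>"
        using flow_approx(1)[OF ZM(1)[OF x\<tau>(1)], of \<tau>] by simp
      moreover have "200 * \<kappa> * \<bar>\<tau>\<bar> \<le> 200 * \<kappa> * 3" using I[OF x\<tau>(2)] \<kappa> by (intro mult_left_mono) auto
      ultimately show False using Zab(1)[OF x\<tau>(1)] a9[OF x\<tau>(1)] \<kappa>_small by (simp add: norm_mult)
    qed
    then have "Im (fst (\<phi> \<tau> (Z x))) \<noteq> 0" using 1 by (auto simp: complex_eq_iff)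
    then show "Re (snd (\<phi> \<tau> (Z x))) = 0" using x\<tau>(3) 1 by (simp add: h1_def)
  qed
qed

text \<open>Reflecting the quarter orbit at its end point by \<open>- cj\<close> leads after time
  \<open>2 * \<tau>\<close> from \<open>z\<close> to \<open>- cj z = - z\<close>. The symmetry
  \<open>z \<mapsto> - z\<close>, which preserves time, then closes the orbit after
  \<open>4 * \<tau>\<close>.\<close>

lemma periodic_orbit_near_axis:
  assumes x0: "0 < x0" "x0 \<le> 1/10" and \<delta>x: "\<delta> \<le> x0 / 10000000"
  obtains z T where "z \<in> M" "\<bar>T - 2 * pi\<bar> \<le> 2 * x0" "\<phi> T z = z" "\<And>t. norm (snd (\<phi> t z)) \<le> 3 * x0"
proof -
  obtain z \<tau> where z: "z \<in> M" "\<bar>\<tau> - pi/2\<bar> \<le> x0 / 2" "Im (fst z) = 0" "Im (snd z) = 0" "Re (fst z) > 0"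
    "norm (snd z) \<le> 2 * x0" "Re (fst (\<phi> \<tau> z)) = 0" "Re (snd (\<phi> \<tau> z)) = 0"
    using symmetric_quarter_orbit[OF assms] by blast
  have cjz: "cj z = z" using z by (simp add: cj_def prod_eq_iff complex_eq_iff)
  have cj\<tau>: "- cj (\<phi> \<tau> z) = \<phi> \<tau> z" using z by (simp add: cj_def prod_eq_iff complex_eq_iff)
  have rev: "\<phi> t (- cj y) = - cj (\<phi> (- t) y)" if "y \<in> M" for t y
    by (rule flow_reversible[OF cj_linear(2) _ _ that]) (simp_all add: M_sym sym_cj sym_neg)
  have neg: "\<phi> t (- y) = - \<phi> t y" if "y \<in> M" for t y
  proof -
    have "((\<lambda>t. - \<phi> t y) has_vector_derivative X (- \<phi> t y)) (at t)" for t
      using has_vector_derivative_minus[OF flow_deriv[OF that, of t]] by (simp add: sym_neg)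
    from solution_unique[of "\<lambda>t. - \<phi> t y", OF _ this] that show ?thesis by (simp add: M_sym)
  qed
  have "\<phi> \<tau> (\<phi> \<tau> z) = - cj (\<phi> (- \<tau>) (\<phi> \<tau> z))" using rev[of "\<phi> \<tau> z" \<tau>] cj\<tau> z(1) by simp
  then have half: "\<phi> (\<tau> + \<tau>) z = - z" 
    unfolding flow_add[OF z(1), of \<tau> \<tau>] using flow_minus[OF z(1)] cjz by simp
  define T where "T = (\<tau> + \<tau>) + (\<tau> + \<tau>)"
  have "\<phi> T z = \<phi> (\<tau> + \<tau>) (\<phi> (\<tau> + \<tau>) z)" unfolding T_def by (rule flow_add[OF z(1)])
  then have T: "\<phi> T z = z" unfolding half neg[OF z(1)] by simp
  have T2: "\<bar>T - 2 * pi\<bar> \<le> 2 * x0" using z(2) unfolding T_def by linarith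
  have Tb: "T > 0" "T \<le> 9" using T2 x0 pi_gt3 pi_less_4 by linarith+
  have "norm (snd (\<phi> t z)) \<le> 3 * x0" for t
  proof -
    obtain r where r: "0 \<le> r" "r \<le> T" "\<phi> t z = \<phi> r z" using periodic_reduce[OF z(1) T Tb(1)] by blast
    have "norm (snd (\<phi> r z)) \<le> norm (exp (- \<i> * of_real r) * snd z) + norm (snd (\<phi> r z) - exp (- \<i> * of_real r) * snd z)"
      using norm_triangle_sub by blast
    moreover have "norm (exp (- \<i> * of_real r) * snd z) \<le> 2 * x0" using z(6) by (simp add: norm_mult)
    moreover have "norm (snd (\<phi> r z) - exp (- \<i> * of_real r) * snd z) \<le> 200 * \<kappa> * \<bar>r\<bar>" by (rule flow_approx(2)[OF z(1)])
    moreover have "200 * \<kappa> * \<bar>r\<bar> \<le> 200 * \<kappa> * 9" using r Tb \<kappa> by (intro mult_left_mono) auto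
    ultimately show ?thesis unfolding r(3) using \<kappa> \<delta>x by linarith
  qed
  from that[OF z(1) T2 T this] show thesis .
qed

end

section \<open>The disk spanned by the periodic orbit\<close>

lemma period_int:
  fixes N :: "real \<Rightarrow> 'a"
  assumes "\<And>y. N (y + p) = N y"
  shows "N (y + of_int n * p) = N y"
proof (induction n rule: int_induct[where k = 0])
  case (step1 i)
  then show ?case using assms[of "y + of_int i * p"] by (simp add: algebra_simps)
next
  case (step2 i)
  then show ?case using assms[of "y + of_int i * p - p"] by (simp add: algebra_simps)
qed simp

text \<open>\<eta> bounds the distance of the orbit from the axis. The interval
  \<open>{0..9}\<close> contains \<open>|z1|^2\<close> for \<open>z1\<close> of modulus at most 3,
  and \<open>(6 * B + 5) * \<eta>\<close> will bound the slope of the cut-off graph through the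
  orbit.\<close>

locale spanning_orbit = hopf_flow \<kappa> \<delta> f m \<phi> for \<kappa> \<delta> f m \<phi> +
  fixes \<sigma> \<sigma>' :: "real \<Rightarrow> real" and B \<eta> :: real and z0 :: "complex \<times> complex" and T :: real
  assumes \<sigma>: "smooth_on UNIV \<sigma>" "\<And>x. x \<le> 1/2 \<Longrightarrow> \<sigma> x = 0" "\<And>x. 1 \<le> x \<Longrightarrow> \<sigma> x = 1" "\<And>x. 0 \<le> \<sigma> x" "\<And>x. \<sigma> x \<le> 1"
    and \<sigma>': "\<And>x. (\<sigma> has_real_derivative \<sigma>' x) (at x)" "\<And>x. x \<in> {0..9} \<Longrightarrow> \<bar>\<sigma>' x\<bar> \<le> B"
    and B: "0 \<le> B" and \<eta>: "0 < \<eta>" "(6 * B + 5) * \<eta> \<le> 1/100" and \<kappa>\<eta>: "200 * \<kappa> \<le> \<eta>"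
    and z0: "z0 \<in> M" "\<phi> T z0 = z0" "\<bar>T - 2 * pi\<bar> \<le> 1" "\<And>t. norm (snd (\<phi> t z0)) \<le> \<eta>"
begin

lemma \<eta>_small: "\<eta> \<le> 1/500"
proof -
  have "5 * \<eta> \<le> (6 * B + 5) * \<eta>" using B \<eta>(1) by (intro mult_right_mono) auto
  then show ?thesis using \<eta>(2) by simp
qed

text \<open>On this solid torus around the axis \<open>z1\<close> lies safely outside the cut-off
  region. The bound 51/100 leaves room for a point at distance 1/2 from a graph of height
  \<eta>.\<close>

lemma fst_lower: assumes "z \<in> M" "norm (snd z) \<le> 51/100" shows "6/5 \<le> norm (fst z)"
proof -
  have "(norm (snd z))\<^sup>2 \<le> (51/100)\<^sup>2" using assms(2) by (intro power_mono) auto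
  then have "(6/5)\<^sup>2 \<le> (norm (fst z))\<^sup>2"
    using M_norm(1)[OF assms(1)] unfolding norm_prod_sq[of z] by (simp add: power_divide)
  then show ?thesis by (rule power2_le_imp_le) simp
qed

lemma p1_quot: assumes "z \<in> M" "6/5 \<le> norm (fst z)" shows "\<bar>Im (p1 z / fst z)\<bar> \<le> 200 * \<kappa>"
proof -
  have "\<bar>Im (p1 z / fst z)\<bar> \<le> norm (p1 z) / norm (fst z)"
    using abs_Im_le_cmod[of "p1 z / fst z"] by (simp add: norm_divide)
  also have "\<dots> \<le> norm (p1 z) / 1" using assms(2) by (intro divide_left_mono) auto
  finally show ?thesis using p_bounds(1)[OF M_norm(4)[OF assms(1)]] by simp
qed

lemma orbit_fst: "6/5 \<le> norm (fst (\<phi> t z0))"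
  using fst_lower[OF flow_in[OF z0(1)], of t] z0(4)[of t] \<eta>_small by simp

lemma flow_smooth: assumes "z \<in> M" shows "smooth_on UNIV (\<lambda>t. \<phi> t z)"
  by (rule smooth_on_integral_curve[OF open_ball basic_smooth(4)])
    (use M_ball3 flow_in[OF assms] flow_deriv[OF assms] in auto)

text \<open>Along the orbit the argument of \<open>z1\<close> increases with speed close to 1, so it
  can replace time as the parameter of \<open>z2\<close>. The equation for \<open>p2\<close> says
  that the graph is invariant under the flow; it is later subtracted from the equation of a nearby
  orbit.\<close>

lemma orbit_graph:
  obtains N N' where "smooth_on UNIV N" "\<And>y. (N has_vector_derivative N' y) (at y)"
    "\<And>y. N (y + 2 * pi) = N y" "\<And>y. N' (y + 2 * pi) = N' y"
    "\<And>y. norm (N y) \<le> \<eta>" "\<And>y. norm (N' y) \<le> 3 * \<eta>"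
    "\<And>y. \<exists>t. fst (\<phi> t z0) = of_real (norm (fst (\<phi> t z0))) * exp (\<i> * of_real y) \<and> snd (\<phi> t z0) = N y \<and>
       p2 (\<phi> t z0) - \<i> * N y = (1 + Im (p1 (\<phi> t z0) / fst (\<phi> t z0))) *\<^sub>R N' y"
    "\<And>t. \<exists>y. fst (\<phi> t z0) = of_real (norm (fst (\<phi> t z0))) * exp (\<i> * of_real y) \<and> snd (\<phi> t z0) = N y"
proof -
  define z1 where "z1 t = fst (\<phi> t z0)" for t
  define z2 where "z2 t = snd (\<phi> t z0)" for t
  define \<theta>' where "\<theta>' t = 1 + Im (p1 (\<phi> t z0) / z1 t)" for t
  have nz: "z1 t \<noteq> 0" for t using orbit_fst[of t] by (auto simp: z1_def)
  have d1: "(z1 has_vector_derivative \<i> * z1 t + p1 (\<phi> t z0)) (at t)"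
    and d2: "(z2 has_vector_derivative - \<i> * z2 t + p2 (\<phi> t z0)) (at t)" for t
    using comp_deriv[OF z0(1), of t] by (simp_all add: z1_def[abs_def] z2_def[abs_def])
  have sm: "smooth_on UNIV (\<lambda>t. \<phi> t z0)" by (rule flow_smooth[OF z0(1)])
  have smX: "smooth_on UNIV (\<lambda>t. X (\<phi> t z0))"
    by (rule smooth_on_compose[OF open_UNIV open_ball _ basic_smooth(4) sm]) (use M_ball3 flow_in[OF z0(1)] in auto)
  have sm1: "smooth_on UNIV z1" and sm2: "smooth_on UNIV z2"
    unfolding z1_def[abs_def] z2_def[abs_def] by (intro smooth_on_fst smooth_on_snd open_UNIV sm)+
  have X1: "fst (X (\<phi> t z0)) = \<i> * z1 t + p1 (\<phi> t z0)" for t by (simp add: X_def z1_def)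
  have smX1: "smooth_on UNIV (\<lambda>t. \<i> * z1 t + p1 (\<phi> t z0))"
    using smooth_on_fst[OF open_UNIV smX] unfolding X1 .
  obtain \<Lambda> where \<Lambda>: "\<And>t. z1 t = exp (\<Lambda> t)"
    "\<And>t. (\<Lambda> has_vector_derivative (\<i> * z1 t + p1 (\<phi> t z0)) / z1 t) (at t)"
  proof (rule log_lift[where z = z1 and z' = "\<lambda>t. \<i> * z1 t + p1 (\<phi> t z0)",
        OF d1 nz smooth_on_imp_continuous_on[OF smX1]])
    fix \<Lambda> assume "\<And>t. z1 t = exp (\<Lambda> t)"
      "\<And>t. (\<Lambda> has_vector_derivative (\<i> * z1 t + p1 (\<phi> t z0)) / z1 t) (at t)"
    then show thesis by (rule that)
  qed
  define \<theta> where "\<theta> t = Im (\<Lambda> t)" for t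
  have z1\<theta>: "z1 t = of_real (norm (z1 t)) * exp (\<i> * of_real (\<theta> t))" for t
    unfolding \<Lambda>(1)[of t] \<theta>_def cis_conv_exp[symmetric] norm_exp_eq_Re by (rule exp_eq_polar)
  have Im_eq: "Im ((\<i> * z1 t + p1 (\<phi> t z0)) / z1 t) = \<theta>' t" for t
    using nz[of t] by (simp add: add_divide_distrib \<theta>'_def)
  have d\<theta>: "(\<theta> has_real_derivative \<theta>' t) (at t)" for t
    unfolding \<theta>_def has_real_derivative_iff_has_vector_derivative Im_eq[symmetric]
    by (rule bounded_linear.has_vector_derivative[OF bounded_linear_Im \<Lambda>(2)])
  have sm\<theta>': "smooth_on UNIV \<theta>'"
    unfolding Im_eq[symmetric, abs_def] using nz
    by (intro smooth_on_Im smooth_on_divide smX1 sm1 open_UNIV)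
  have sm\<theta>: "smooth_on UNIV \<theta>"
    by (rule smooth_onI_derivative[OF open_UNIV d\<theta>[unfolded has_field_derivative_def]])
      (intro smooth_on_mult sm\<theta>' smooth_on_const open_UNIV)
  have \<theta>'b: "\<bar>\<theta>' t - 1\<bar> \<le> 1/1000" for t
    using p1_quot[OF flow_in[OF z0(1)] orbit_fst, of t] \<kappa>_small by (simp add: \<theta>'_def z1_def)
  have \<theta>'c: "1/2 \<le> \<theta>' t" for t using \<theta>'b[of t] by linarith
  obtain g where g: "smooth_on UNIV g" "\<And>t. g (\<theta> t) = t" "\<And>y. \<theta> (g y) = y"
    "\<And>y. (g has_real_derivative inverse (\<theta>' (g y))) (at y)"
    using smooth_inverse_real[OF sm\<theta> d\<theta> \<theta>'c] by auto
  have T0: "T > 0" "T \<le> 9" using z0(3) pi_gt3 pi_less_4 by linarith+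
  have per: "\<phi> (t + T) z0 = \<phi> t z0" for t using flow_add[OF z0(1), of t T] z0(2) by simp
  have \<theta>T: "\<theta> (t + T) = \<theta> t + 2 * pi" for t
  proof -
    have "((\<lambda>t. \<theta> (t + T) - \<theta> t) has_real_derivative 0) (at t)" for t
    proof -
      have "((\<lambda>t. \<theta> (t + T)) has_real_derivative \<theta>' (t + T)) (at t)"
        using d\<theta>[of "t + T"] by (simp add: DERIV_shift)
      moreover have "\<theta>' (t + T) = \<theta>' t" by (simp add: \<theta>'_def z1_def per)
      ultimately show ?thesis using DERIV_diff[OF _ d\<theta>[of t]] by fastforce
    qed
    then have const: "\<theta> (t + T) - \<theta> t = \<theta> T - \<theta> 0" for t
      using DERIV_const_ratio_const[of t 0 "\<lambda>t. \<theta> (t + T) - \<theta> t" 0] by (cases "t = 0") auto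
    have "exp (\<Lambda> T) = exp (\<Lambda> 0)" unfolding \<Lambda>(1)[symmetric] z1_def using z0 by simp
    then obtain n :: int where "\<Lambda> T = \<Lambda> 0 + of_int (2 * n) * of_real pi * \<i>" by (auto simp: exp_eq)
    then have n: "\<theta> T - \<theta> 0 = 2 * of_int n * pi" by (simp add: \<theta>_def)
    \<comment> \<open>The increase over one period is a multiple of \<open>2 * pi\<close> lying
      strictly between 0 and \<open>4 * pi\<close>. Hence the orbit winds exactly once, and the
      graph is single-valued.\<close>
    obtain s where s: "\<theta> T - \<theta> 0 = (T - 0) * \<theta>' s" using MVT2[OF T0(1) d\<theta>] by blast
    have "T * (999/1000) \<le> T * \<theta>' s" "T * \<theta>' s \<le> T * (1001/1000)"
      using \<theta>'b[of s] T0 by (intro mult_left_mono; linarith)+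
    moreover have v: "2 * of_int n * pi = T * \<theta>' s" using n s by simp
    moreover have "T \<le> 2 * pi + 1" using z0(3) by linarith
    ultimately have "0 < 2 * of_int n * pi \<and> 2 * of_int n * pi < 2 * 2 * pi"
      unfolding v using T0(1) pi_gt3 by (intro conjI) linarith+
    then have "0 < n" "n < 2" using pi_gt_zero by (auto simp: zero_less_mult_iff)
    then have "n = 1" by simp
    then show ?thesis using const[of t] n by simp
  qed
  have gT: "g (y + 2 * pi) = g y + T" for y using \<theta>T[of "g y"] g(2)[of "g y + T"] g(3)[of y] by simp
  define N where "N y = z2 (g y)" for y
  define N' where "N' y = inverse (\<theta>' (g y)) *\<^sub>R (- \<i> * z2 (g y) + p2 (\<phi> (g y) z0))" for y
  have z2b: "norm (- \<i> * z2 t + p2 (\<phi> t z0)) \<le> 3/2 * (2 * \<eta>) * \<theta>' t" for t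
  proof -
    have "norm (- \<i> * z2 t + p2 (\<phi> t z0)) \<le> \<eta> + 200 * \<kappa>"
      by (rule order_trans[OF norm_triangle_ineq add_mono])
        (use z0(4)[of t] p_bounds(2)[OF M_norm(4)[OF flow_in[OF z0(1)]]] in \<open>auto simp: norm_mult z2_def\<close>)
    also have "\<dots> \<le> 3 * \<eta> * (999/1000)" using \<kappa>\<eta> \<eta>(1) by simp
    also have "\<dots> \<le> 3 * \<eta> * \<theta>' t"
    proof (rule mult_left_mono)
      show "999/1000 \<le> \<theta>' t" using \<theta>'b[of t] by linarith
    qed (use \<eta>(1) in simp)
    finally show ?thesis by simp
  qed
  show thesis
  proof (rule that[of N N'])
    show "smooth_on UNIV N" unfolding N_def[abs_def]
      by (rule smooth_on_compose[OF open_UNIV open_UNIV _ sm2 g(1)]) simp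
    show "(N has_vector_derivative N' y) (at y)" for y
      using vector_diff_chain_at[OF g(4)[of y, unfolded has_real_derivative_iff_has_vector_derivative] d2]
      by (simp add: N_def[abs_def] N'_def o_def)
    show "N (y + 2 * pi) = N y" for y by (simp add: N_def gT z2_def per)
    show "N' (y + 2 * pi) = N' y" for y by (simp add: N'_def gT z1_def z2_def per \<theta>'_def)
    show "norm (N y) \<le> \<eta>" for y unfolding N_def z2_def by (rule z0(4))
    show "norm (N' y) \<le> 3 * \<eta>" for y
      using z2b[of "g y"] \<theta>'c[of "g y"] unfolding N'_def norm_scaleR
      by (simp add: inverse_eq_divide divide_le_eq)
    show "\<exists>t. fst (\<phi> t z0) = of_real (norm (fst (\<phi> t z0))) * exp (\<i> * of_real y) \<and> snd (\<phi> t z0) = N y \<and>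
       p2 (\<phi> t z0) - \<i> * N y = (1 + Im (p1 (\<phi> t z0) / fst (\<phi> t z0))) *\<^sub>R N' y" for y
    proof (intro exI[of _ "g y"] conjI)
      show "fst (\<phi> (g y) z0) = of_real (norm (fst (\<phi> (g y) z0))) * exp (\<i> * of_real y)"
        using z1\<theta>[of "g y"] unfolding g(3) z1_def .
      show "snd (\<phi> (g y) z0) = N y" by (simp add: N_def z2_def)
      have "1 + Im (p1 (\<phi> (g y) z0) / fst (\<phi> (g y) z0)) = \<theta>' (g y)" by (simp add: \<theta>'_def z1_def)
      moreover have "\<theta>' (g y) \<noteq> 0" using \<theta>'c[of "g y"] by linarith
      ultimately show "p2 (\<phi> (g y) z0) - \<i> * N y = (1 + Im (p1 (\<phi> (g y) z0) / fst (\<phi> (g y) z0))) *\<^sub>R N' y"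
        by (simp add: N'_def N_def)
    qed
    show "\<exists>y. fst (\<phi> t z0) = of_real (norm (fst (\<phi> t z0))) * exp (\<i> * of_real y) \<and> snd (\<phi> t z0) = N y" for t
      by (rule exI[of _ "\<theta> t"]) (use z1\<theta>[of t] g(2)[of t] in \<open>simp add: N_def z1_def z2_def\<close>)
  qed
qed

end

text \<open>Near \<open>|z\<^sub>1| \<ge> 1\<close> the function \<open>gam\<close> only depends on the argument of \<open>z\<^sub>1\<close>, and the spanning orbit is the
  part of its graph in \<open>M\<close>.\<close>

locale section_disk = spanning_orbit \<kappa> \<delta> f m \<phi> \<sigma> \<sigma>' B \<eta> z0 T for \<kappa> \<delta> f m \<phi> \<sigma> \<sigma>' B \<eta> z0 T +
  fixes N N' :: "real \<Rightarrow> complex"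
  assumes N: "smooth_on UNIV N" "\<And>y. (N has_vector_derivative N' y) (at y)"
    "\<And>y. N (y + 2 * pi) = N y" "\<And>y. N' (y + 2 * pi) = N' y"
    "\<And>y. norm (N y) \<le> \<eta>" "\<And>y. norm (N' y) \<le> 3 * \<eta>"
    and graph: "\<And>y. \<exists>t. fst (\<phi> t z0) = of_real (norm (fst (\<phi> t z0))) * exp (\<i> * of_real y) \<and> snd (\<phi> t z0) = N y \<and>
       p2 (\<phi> t z0) - \<i> * N y = (1 + Im (p1 (\<phi> t z0) / fst (\<phi> t z0))) *\<^sub>R N' y"
    and on_graph: "\<And>t. \<exists>y. fst (\<phi> t z0) = of_real (norm (fst (\<phi> t z0))) * exp (\<i> * of_real y) \<and> snd (\<phi> t z0) = N y"
begin

section \<open>Extending the graph of the orbit over the whole plane\<close>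

lemma N_Arg:
  assumes "w = of_real r * exp (\<i> * of_real y)" "r > 0"
  shows "N (Arg w) = N y" "N' (Arg w) = N' y"
proof -
  have w: "w \<noteq> 0" and nw: "norm w = r" using assms by (auto simp: norm_mult)
  have "of_real r * exp (\<i> * of_real (Arg w)) = of_real r * exp (\<i> * of_real y)"
    using Arg_eq[OF w] assms(1) nw by metis
  then have "exp (\<i> * of_real (Arg w)) = exp (\<i> * of_real y)" using assms(2) by simp
  then obtain n :: int where "\<i> * of_real (Arg w) = \<i> * of_real y + of_int (2 * n) * of_real pi * \<i>"
    by (auto simp: exp_eq)
  then have "\<i> * of_real (Arg w) = \<i> * of_real (y + of_int n * (2 * pi))" by (simp add: algebra_simps)
  then have "Arg w = y + of_int n * (2 * pi)" by (metis complex_i_not_zero mult_cancel_left of_real_eq_iff)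
  then show "N (Arg w) = N y" "N' (Arg w) = N' y"
    using period_int[of N "2 * pi" y n] period_int[of N' "2 * pi" y n] N(3,4) by simp_all
qed

text \<open>Around \<open>w\<^sub>0\<close> the branch \<open>w \<mapsto> Im (Ln (w / w\<^sub>0)) + Arg w\<^sub>0\<close> of the argument is smooth.\<close>

lemma N_Arg_local:
  assumes w0: "w0 \<noteq> 0"
  defines "U \<equiv> {w. w / w0 \<notin> \<real>\<^sub>\<le>\<^sub>0}" and "b \<equiv> \<lambda>w. Im (Ln (w / w0)) + Arg w0"
  shows "open U" "w0 \<in> U" "\<And>w. w \<in> U \<Longrightarrow> N (Arg w) = N (b w) \<and> N' (Arg w) = N' (b w)"
    "smooth_on U (\<lambda>w. N (b w))"
    "\<And>w. w \<in> U \<Longrightarrow> ((\<lambda>w. N (b w)) has_derivative (\<lambda>h. Im (h / w) *\<^sub>R N' (b w))) (at w)"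
proof -
  have "open ((\<lambda>w. w / w0) -` (- \<real>\<^sub>\<le>\<^sub>0))"
    using w0 by (intro open_vimage continuous_intros) (auto simp: open_Compl)
  moreover have "(\<lambda>w. w / w0) -` (- \<real>\<^sub>\<le>\<^sub>0) = U" by (auto simp: U_def)
  ultimately show U: "open U" by simp
  show "w0 \<in> U" using w0 by (simp add: U_def)
  show "N (Arg w) = N (b w) \<and> N' (Arg w) = N' (b w)" if "w \<in> U" for w
  proof -
    have w: "w \<noteq> 0" using that by (auto simp: U_def)
    have "w / w0 = of_real (norm (w / w0)) * exp (\<i> * of_real (Im (Ln (w / w0))))"
      using Arg_eq[of "w / w0"] w w0 Arg_eq_Im_Ln[of "w / w0"] by simp
    moreover have "w0 = of_real (norm w0) * exp (\<i> * of_real (Arg w0))" by (rule Arg_eq[OF w0])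
    moreover have "w = (w / w0) * w0" using w0 by simp
    ultimately have "w = (of_real (norm (w / w0)) * exp (\<i> * of_real (Im (Ln (w / w0))))) *
        (of_real (norm w0) * exp (\<i> * of_real (Arg w0)))" by metis
    also have "\<dots> = of_real (norm (w / w0) * norm w0) * exp (\<i> * of_real (b w))"
      by (simp add: b_def exp_add distrib_left mult_ac)
    finally show ?thesis using N_Arg[of w "norm (w / w0) * norm w0" "b w"] w w0 by simp
  qed
  have smb: "smooth_on U b" unfolding b_def
  proof (intro smooth_on_add U smooth_on_const smooth_on_Im)
    show "smooth_on U (\<lambda>w. Ln (w / w0))"
      by (rule smooth_on_compose[OF U _ _ smooth_on_Ln])
        (use w0 U in \<open>auto simp: open_Compl U_def intro!: smooth_on_divide smooth_on_id\<close>)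
  qed
  show "smooth_on U (\<lambda>w. N (b w))" by (rule smooth_on_compose[OF U open_UNIV _ N(1) smb]) simp
  show "((\<lambda>w. N (b w)) has_derivative (\<lambda>h. Im (h / w) *\<^sub>R N' (b w))) (at w)" if "w \<in> U" for w
  proof -
    have w: "w \<noteq> 0" using that by (auto simp: U_def)
    have "((\<lambda>w. Ln (w / w0)) has_field_derivative inverse (w / w0) * (1 / w0)) (at w)"
      using that by (intro DERIV_chain2[OF has_field_derivative_Ln]) (auto simp: U_def intro!: derivative_eq_intros)
    moreover have "inverse (w / w0) * (1 / w0) = 1 / w" using w w0 by (simp add: field_simps)
    ultimately have "((\<lambda>w. Ln (w / w0)) has_derivative (\<lambda>h. 1 / w * h)) (at w)"
      by (simp only: has_field_derivative_def)
    from has_derivative_add_const[OF bounded_linear.has_derivative[OF bounded_linear_Im this], of "Arg w0"]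
    have "(b has_derivative (\<lambda>h. Im (h / w))) (at w)" by (simp add: b_def)
    from diff_chain_at[OF this N(2)[unfolded has_vector_derivative_def]]
    show ?thesis by (simp add: o_def)
  qed
qed

lemma N_Arg_smooth: "smooth_on (- {0}) (\<lambda>w. N (Arg w))"
proof (rule smooth_on_local)
  fix w0 :: complex assume "w0 \<in> - {0}"
  then have w0: "w0 \<noteq> 0" by simp
  note l = N_Arg_local[OF w0]
  have "smooth_on {w. w / w0 \<notin> \<real>\<^sub>\<le>\<^sub>0} (\<lambda>w. N (Arg w))"
    by (rule smooth_on_cong[OF l(1) _ l(4)]) (use l(3) in auto)
  with l(1,2) show "\<exists>U. open U \<and> w0 \<in> U \<and> smooth_on U (\<lambda>w. N (Arg w))" by blast
qed

lemma N_Arg_deriv: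
  assumes "w \<noteq> 0" shows "((\<lambda>w. N (Arg w)) has_derivative (\<lambda>h. Im (h / w) *\<^sub>R N' (Arg w))) (at w)"
proof -
  note l = N_Arg_local[OF assms]
  have "((\<lambda>w. N (Arg w)) has_derivative (\<lambda>h. Im (h / w) *\<^sub>R N' (Im (Ln (w / w)) + Arg w))) (at w)"
    by (rule has_derivative_transform_within_open[OF l(5)[OF l(2)] l(1,2)]) (use l(3) in auto)
  then show ?thesis using assms by simp
qed

text \<open>The argument is singular at 0, and \<sigma> switches the function off there.\<close>

definition gam :: "complex \<Rightarrow> complex" where "gam w = \<sigma> (w \<bullet> w) *\<^sub>R N (Arg w)"
definition gam' :: "complex \<Rightarrow> complex \<Rightarrow> complex" where
  "gam' w h = (\<sigma>' (w \<bullet> w) * (2 * (w \<bullet> h))) *\<^sub>R N (Arg w) + \<sigma> (w \<bullet> w) *\<^sub>R (Im (h / w) *\<^sub>R N' (Arg w))"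

lemma gam_zero_near: "open {w::complex. w \<bullet> w < 1/2}" "w \<bullet> w < 1/2 \<Longrightarrow> gam w = 0"
proof -
  show "open {w::complex. w \<bullet> w < 1/2}" by (intro open_Collect_less continuous_intros)
  show "w \<bullet> w < 1/2 \<Longrightarrow> gam w = 0" using \<sigma>(2)[of "w \<bullet> w"] by (simp add: gam_def)
qed

lemma gam_smooth: "smooth_on UNIV gam"
proof (rule smooth_on_local)
  fix w :: complex
  have o: "open (- {0::complex})" by auto
  show "\<exists>U. open U \<and> w \<in> U \<and> smooth_on U gam"
  proof (cases "w = 0")
    case True
    have "smooth_on {w::complex. w \<bullet> w < 1/2} gam"
      by (rule smooth_on_cong[OF gam_zero_near(1), of "\<lambda>_. 0"]) (simp_all add: gam_zero_near(2))
    then show ?thesis using True gam_zero_near(1) by (intro exI[of _ "{w::complex. w \<bullet> w < 1/2}"]) auto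
  next
    case False
    have "smooth_on (- {0::complex}) (\<lambda>w. \<sigma> (w \<bullet> w))"
      by (rule smooth_on_compose[OF o open_UNIV _ \<sigma>(1)]) (simp_all add: smooth_on_inner smooth_on_id o)
    then have "smooth_on (- {0::complex}) gam" unfolding gam_def[abs_def]
      by (intro smooth_on_scaleR N_Arg_smooth o)
    then show ?thesis using False o by blast
  qed
qed

lemma gam_deriv: "(gam has_derivative gam' w) (at w)"
proof (cases "w = 0")
  case True
  have "(gam has_derivative (\<lambda>_. 0)) (at 0)"
    by (rule has_derivative_transform_within_open[OF _ gam_zero_near(1), of "\<lambda>_. 0"])
      (simp_all add: gam_zero_near(2))
  moreover have "gam' 0 = (\<lambda>_. 0)" using \<sigma>(2)[of 0] by (auto simp: gam'_def)
  ultimately show ?thesis using True by simp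
next
  case False
  have "((\<lambda>w::complex. w \<bullet> w) has_derivative (\<lambda>h. 2 * (w \<bullet> h))) (at w)"
    by (auto intro!: derivative_eq_intros simp: inner_commute)
  from diff_chain_at[OF this \<sigma>'(1)[unfolded has_field_derivative_def]]
  have "((\<lambda>w. \<sigma> (w \<bullet> w)) has_derivative (\<lambda>h. \<sigma>' (w \<bullet> w) * (2 * (w \<bullet> h)))) (at w)" by (simp add: o_def)
  from has_derivative_scaleR[OF this N_Arg_deriv[OF False]]
  show ?thesis unfolding gam_def[abs_def] gam'_def[abs_def] by (simp add: add.commute)
qed

lemma gam_bound: "norm (gam w) \<le> \<eta>"
proof -
  have "norm (gam w) \<le> 1 * \<eta>"
    unfolding gam_def norm_scaleR using \<sigma>(4,5) N(5) by (intro mult_mono) (auto simp: abs_le_iff intro: order_trans[of _ 0])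
  then show ?thesis by simp
qed

text \<open>The cut-off contributes \<open>6 * B\<close>, from \<open>2 * |w| \<le> 6\<close>. The
  angular part contributes 5, being nonzero only for \<open>|w| \<ge> 3/5\<close>, where
  \<open>|Im (h / w)| \<le> 5/3 * |h|\<close>, and \<open>N'\<close> is at most
  \<open>3 * \<eta>\<close>.\<close>

lemma gam'_bound: assumes "norm w \<le> 3" shows "norm (gam' w h) \<le> 1/100 * norm h"
proof -
  have ww: "w \<bullet> w \<in> {0..9}" using power_mono[OF assms, of 2] by (simp add: power2_norm_eq_inner)
  have "\<bar>w \<bullet> h\<bar> \<le> 3 * norm h"
    by (rule order_trans[OF Cauchy_Schwarz_ineq2]) (use assms in \<open>intro mult_right_mono; simp\<close>)
  then have "\<bar>2 * (w \<bullet> h)\<bar> \<le> 6 * norm h" by simp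
  then have "\<bar>\<sigma>' (w \<bullet> w) * (2 * (w \<bullet> h))\<bar> \<le> B * (6 * norm h)"
    unfolding abs_mult[of "\<sigma>' (w \<bullet> w)"] using \<sigma>'(2)[OF ww] B by (intro mult_mono) simp_all
  then have 1: "norm ((\<sigma>' (w \<bullet> w) * (2 * (w \<bullet> h))) *\<^sub>R N (Arg w)) \<le> B * (6 * norm h) * \<eta>"
    unfolding norm_scaleR using N(5) B by (intro mult_mono) auto
  have 2: "norm (\<sigma> (w \<bullet> w) *\<^sub>R (Im (h / w) *\<^sub>R N' (Arg w))) \<le> 5 * norm h * \<eta>"
  proof (cases "w \<bullet> w \<le> 1/2")
    case True
    then show ?thesis using \<sigma>(2) \<eta>(1) by simp
  next
    case False
    have "(3/5)\<^sup>2 \<le> (norm w)\<^sup>2" using False by (simp add: power2_norm_eq_inner power_divide)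
    then have w: "3/5 \<le> norm w" by (rule power2_le_imp_le) simp
    have "\<bar>Im (h / w)\<bar> \<le> norm h / norm w" using abs_Im_le_cmod[of "h / w"] by (simp add: norm_divide)
    also have "\<dots> \<le> norm h / (3/5)" using w by (intro divide_left_mono) auto
    finally have "\<bar>Im (h / w)\<bar> \<le> 5/3 * norm h" by simp
    then have "\<bar>\<sigma> (w \<bullet> w)\<bar> * (\<bar>Im (h / w)\<bar> * norm (N' (Arg w))) \<le> 1 * ((5/3 * norm h) * (3 * \<eta>))"
      using \<sigma>(4,5)[of "w \<bullet> w"] N(6)[of "Arg w"] by (intro mult_mono) auto
    then show ?thesis by (simp add: mult_ac abs_mult)
  qed
  have "norm (gam' w h) \<le> B * (6 * norm h) * \<eta> + 5 * norm h * \<eta>"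
    unfolding gam'_def by (rule order_trans[OF norm_triangle_ineq add_mono[OF 1 2]])
  also have "\<dots> = ((6 * B + 5) * \<eta>) * norm h" by (simp add: algebra_simps)
  also have "\<dots> \<le> 1/100 * norm h" using \<eta>(2) by (intro mult_right_mono) auto
  finally show ?thesis .
qed

lemma gam_lip: assumes "norm w \<le> 3" "norm w' \<le> 3" shows "norm (gam w - gam w') \<le> 1/100 * norm (w - w')"
proof (rule differentiable_bound[of "cball 0 3" gam gam'])
  show "onorm (gam' w) \<le> 1/100" if "w \<in> cball 0 3" for w
    by (rule onorm_le) (use gam'_bound that in auto)
  show "(gam has_derivative gam' w) (at w within cball 0 3)" for w
    by (rule has_derivative_at_withinI[OF gam_deriv])
qed (use assms in auto)

text \<open>The shear \<Theta> moves the graph to the axis and \<Psi> undoes it. \<open>Q\<close> is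
  the perturbation of the quadratic energy in sheared coordinates; being small like
  \<open>P\<close>, it leaves the sheared surface star-shaped.\<close>

definition gg :: "complex \<times> complex \<Rightarrow> complex" where "gg z = snd z - gam (fst z)"
definition \<Theta> :: "complex \<times> complex \<Rightarrow> complex \<times> complex" where "\<Theta> z = (fst z, gg z)"
definition \<Psi> :: "complex \<times> complex \<Rightarrow> complex \<times> complex" where "\<Psi> z = (fst z, snd z + gam (fst z))"
definition Q :: "complex \<times> complex \<Rightarrow> real" where
  "Q \<xi> = (1/2) * (snd \<xi> \<bullet> gam (fst \<xi>)) + (1/4) * (gam (fst \<xi>) \<bullet> gam (fst \<xi>)) + P (\<Psi> \<xi>)"

lemma \<Psi>\<Theta>: "\<Psi> (\<Theta> z) = z" "\<Theta> (\<Psi> z) = z" by (simp_all add: \<Psi>_def \<Theta>_def gg_def)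

lemma k_\<Psi>: "k (\<Psi> \<xi>) = (1/4) * (\<xi> \<bullet> \<xi>) - 1/2 + Q \<xi>"
proof -
  have i: "a \<bullet> b = fst a \<bullet> fst b + snd a \<bullet> snd b" for a b :: "complex \<times> complex" by (cases a; cases b) simp
  show ?thesis unfolding k_def Q_def i \<Psi>_def by (simp add: inner_simps inner_commute algebra_simps)
qed

lemma \<Psi>_cball: assumes "\<xi> \<in> cball 0 2" shows "\<Psi> \<xi> \<in> cball 0 3"
proof -
  have "\<Psi> \<xi> = \<xi> + (0, gam (fst \<xi>))" by (simp add: \<Psi>_def prod_eq_iff)
  then have "norm (\<Psi> \<xi>) \<le> norm \<xi> + norm (0::complex, gam (fst \<xi>))" by (metis norm_triangle_ineq)
  then show ?thesis using assms gam_bound[of "fst \<xi>"] \<eta>_small by (simp add: norm_Pair)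
qed

lemma Q_small: "x \<in> cball 0 2 \<Longrightarrow> \<bar>Q x\<bar> \<le> 1/8"
  "x \<in> cball 0 2 \<Longrightarrow> y \<in> cball 0 2 \<Longrightarrow> \<bar>Q x - Q y\<bar> \<le> norm (x - y) / 8"
proof -
  assume x: "x \<in> cball 0 2"
  have nx: "norm (fst x) \<le> 2" "norm (snd x) \<le> 2" using x norm_fst_snd_le[of x] by auto
  have gx: "norm (gam (fst x)) \<le> 1/500" using gam_bound[of "fst x"] \<eta>_small by linarith
  have "\<bar>snd x \<bullet> gam (fst x)\<bar> \<le> 2 * (1/500)"
    by (rule order_trans[OF Cauchy_Schwarz_ineq2]) (use nx gx in \<open>intro mult_mono; simp\<close>)
  moreover have "\<bar>gam (fst x) \<bullet> gam (fst x)\<bar> \<le> (1/500) * (1/500)"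
    by (rule order_trans[OF Cauchy_Schwarz_ineq2]) (use gx in \<open>intro mult_mono; simp\<close>)
  moreover have "\<bar>P (\<Psi> x)\<bar> \<le> 1/1000" using P_bound[OF \<Psi>_cball[OF x]] \<kappa>_small by linarith
  ultimately show "\<bar>Q x\<bar> \<le> 1/8" unfolding Q_def by linarith
  assume y: "y \<in> cball 0 2"
  have ny: "norm (fst y) \<le> 2" "norm (snd y) \<le> 2" using y norm_fst_snd_le[of y] by auto
  have gy: "norm (gam (fst y)) \<le> 1/500" using gam_bound[of "fst y"] \<eta>_small by linarith
  define D where "D = norm (x - y)"
  have D: "norm (fst x - fst y) \<le> D" "norm (snd x - snd y) \<le> D" "0 \<le> D"
    unfolding D_def using norm_fst_snd_le[of "x - y"] by simp_all
  have g: "norm (gam (fst x) - gam (fst y)) \<le> 1/100 * D"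
    using gam_lip[of "fst x" "fst y"] nx ny D(1) by linarith
  have "snd x \<bullet> gam (fst x) - snd y \<bullet> gam (fst y) =
      (snd x - snd y) \<bullet> gam (fst x) + snd y \<bullet> (gam (fst x) - gam (fst y))" by (simp add: inner_simps)
  moreover have "\<bar>(snd x - snd y) \<bullet> gam (fst x)\<bar> \<le> D * (1/500)"
    by (rule order_trans[OF Cauchy_Schwarz_ineq2]) (use gx D in \<open>intro mult_mono; simp\<close>)
  moreover have "\<bar>snd y \<bullet> (gam (fst x) - gam (fst y))\<bar> \<le> 2 * (1/100 * D)"
    by (rule order_trans[OF Cauchy_Schwarz_ineq2]) (use ny g in \<open>intro mult_mono; simp\<close>)
  ultimately have 1: "\<bar>snd x \<bullet> gam (fst x) - snd y \<bullet> gam (fst y)\<bar> \<le> 22/1000 * D" by linarith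
  have 2: "\<bar>gam (fst x) \<bullet> gam (fst x) - gam (fst y) \<bullet> gam (fst y)\<bar> \<le> 2 * (1/500) * (1/100 * D)"
    by (rule inner_self_diff_le[OF gx gy g])
  have "\<Psi> x - \<Psi> y = (x - y) + (0, gam (fst x) - gam (fst y))" by (simp add: \<Psi>_def prod_eq_iff)
  then have "norm (\<Psi> x - \<Psi> y) \<le> norm (x - y) + norm (0::complex, gam (fst x) - gam (fst y))"
    by (metis norm_triangle_ineq)
  then have "norm (\<Psi> x - \<Psi> y) \<le> 2 * D" using g D(3) by (simp add: norm_Pair D_def[symmetric])
  then have "200 * \<kappa> * norm (\<Psi> x - \<Psi> y) \<le> 1/1000 * (2 * D)"
    using \<kappa>_small by (intro mult_mono) auto
  then have 3: "\<bar>P (\<Psi> x) - P (\<Psi> y)\<bar> \<le> 1/500 * D"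
    using P_lip[OF \<Psi>_cball[OF x] \<Psi>_cball[OF y]] by linarith
  show "\<bar>Q x - Q y\<bar> \<le> norm (x - y) / 8"
    unfolding Q_def D_def[symmetric] using 1 2 3 D(3) by linarith
qed

lemma \<Theta>_cball: assumes "z \<in> M" shows "\<Theta> z \<in> cball 0 2"
proof -
  have "(norm z)\<^sup>2 \<le> (3/2)\<^sup>2" using M_norm(2)[OF assms] by (simp add: power_divide)
  then have "norm z \<le> 3/2" by (rule power2_le_imp_le) simp
  moreover have "\<Theta> z = z - (0, gam (fst z))" by (simp add: \<Theta>_def gg_def prod_eq_iff)
  then have "norm (\<Theta> z) \<le> norm z + norm (0::complex, gam (fst z))" by (metis norm_triangle_ineq4)
  ultimately show ?thesis using gam_bound[of "fst z"] \<eta>_small by (simp add: norm_Pair)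
qed

lemma \<Theta>_zero: assumes "z \<in> M" shows "\<Theta> z \<in> cball 0 2" "(1/4) * (\<Theta> z \<bullet> \<Theta> z) - 1/2 + Q (\<Theta> z) = 0"
  using \<Theta>_cball[OF assms] k_\<Psi>[of "\<Theta> z"] assms unfolding \<Psi>\<Theta> by (auto simp: M_def)

lemma \<Theta>_nonzero: "z \<in> M \<Longrightarrow> norm (\<Theta> z) > 0"
  using \<Theta>_zero[of z] Q_small(1)[of "\<Theta> z"] by (cases "\<Theta> z = 0") auto

lemma \<Theta>_radial_unique:
  assumes "z \<in> M" "w \<in> M" "(1 / norm (\<Theta> z)) *\<^sub>R \<Theta> z = (1 / norm (\<Theta> w)) *\<^sub>R \<Theta> w" shows "z = w"
proof -
  have "\<Theta> z = \<Theta> w" by (rule radial_zero_unique[OF Q_small \<Theta>_zero[OF assms(1)] \<Theta>_zero[OF assms(2)] assms(3)])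
  then show ?thesis using \<Psi>\<Theta>(1) by metis
qed

lemma \<Theta>_radial_exists:
  assumes "norm \<xi> = 1" obtains r z where "1 \<le> r" "z \<in> M" "\<Theta> z = r *\<^sub>R \<xi>"
proof -
  obtain r where r: "1 \<le> r" "r \<le> 2" "(1/4) * (r *\<^sub>R \<xi> \<bullet> r *\<^sub>R \<xi>) - 1/2 + Q (r *\<^sub>R \<xi>) = 0"
    using radial_zero_exists[OF Q_small assms] by blast
  then have c: "r *\<^sub>R \<xi> \<in> cball 0 2" using assms by simp
  have "\<Psi> (r *\<^sub>R \<xi>) \<in> M" using r(3) \<Psi>_cball[OF c] unfolding M_def k_\<Psi>[symmetric] by simp
  then show thesis using that[of r "\<Psi> (r *\<^sub>R \<xi>)"] r(1) \<Psi>\<Theta>(2) by simp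
qed

text \<open>The half-planes bounded by the axis, pulled back by the shear, are the pages of an open
  book with binding \<open>Bd\<close>; \<open>D\<close> is the page of angle 0.\<close>

definition Bd where "Bd = {z \<in> M. gg z = 0}"
definition D where "D = {z \<in> M. Im (gg z) = 0 \<and> 0 \<le> Re (gg z)}"

lemma gam_large: assumes "1 \<le> norm w" "w = of_real (norm w) * exp (\<i> * of_real y)" shows "gam w = N y"
proof -
  have "1 \<le> w \<bullet> w" using power_mono[OF assms(1), of 2] by (simp add: power2_norm_eq_inner)
  moreover have "norm w > 0" using assms(1) by linarith
  ultimately show ?thesis using \<sigma>(3) N_Arg(1)[OF assms(2)] by (simp add: gam_def)
qed

text \<open>For the converse inclusion, a point of \<open>Bd\<close> and the orbit point with the
  same argument of \<open>z1\<close> lie after the shear on the same ray, which meets the surface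
  only once.\<close>

lemma Bd_orbit: "Bd = orbit \<phi> z0"
proof (intro equalityI subsetI)
  fix z assume "z \<in> orbit \<phi> z0"
  then obtain t where t: "z = \<phi> t z0" by (auto simp: orbit_def)
  obtain y where y: "fst z = of_real (norm (fst z)) * exp (\<i> * of_real y)" "snd z = N y"
    using on_graph[of t] t by blast
  have "gg z = 0" using gam_large[OF _ y(1)] orbit_fst[of t] y(2) t by (simp add: gg_def)
  then show "z \<in> Bd" using flow_in[OF z0(1)] t by (simp add: Bd_def)
next
  fix z assume z: "z \<in> Bd"
  then have zM: "z \<in> M" and g0: "gg z = 0" by (auto simp: Bd_def)
  have "norm (snd z) \<le> 51/100" using g0 gam_bound[of "fst z"] \<eta>_small by (simp add: gg_def)
  then have f: "6/5 \<le> norm (fst z)" by (rule fst_lower[OF zM])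
  then have fz: "fst z \<noteq> 0" by auto
  obtain t where t: "fst (\<phi> t z0) = of_real (norm (fst (\<phi> t z0))) * exp (\<i> * of_real (Arg (fst z)))"
    "snd (\<phi> t z0) = N (Arg (fst z))" using graph by blast
  define w where "w = \<phi> t z0"
  have wM: "w \<in> M" using flow_in[OF z0(1)] by (simp add: w_def)
  have fw: "6/5 \<le> norm (fst w)" using orbit_fst[of t] by (simp add: w_def)
  have "gg w = 0" using gam_large[of "fst w" "Arg (fst z)"] t fw by (simp add: gg_def w_def)
  then have "\<Theta> w = (of_real (norm (fst w)) * exp (\<i> * of_real (Arg (fst z))), 0)" "\<Theta> z = (of_real (norm (fst z)) * exp (\<i> * of_real (Arg (fst z))), 0)"
    using t(1) g0 Arg_eq[OF fz] by (simp_all add: \<Theta>_def w_def)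
  then have "(1 / norm (\<Theta> z)) *\<^sub>R \<Theta> z = (1 / norm (\<Theta> w)) *\<^sub>R \<Theta> w"
    using f fw fz by (simp add: norm_Pair norm_mult scaleR_conv_of_real) (auto simp: field_simps)
  then have "z = w" by (rule \<Theta>_radial_unique[OF zM wM])
  then show "z \<in> orbit \<phi> z0" by (simp add: orbit_def w_def)
qed

definition Dg where "Dg z h = snd h - gam' (fst z) (fst h)"

lemma gg_deriv: "(gg has_derivative Dg z) (at z)"
proof -
  have fst: "(fst has_derivative fst) (at z)" and snd: "(snd has_derivative snd) (at z)"
    by (auto intro: bounded_linear_imp_has_derivative bounded_linear_fst bounded_linear_snd)
  have "((\<lambda>z. gam (fst z)) has_derivative (\<lambda>h. gam' (fst z) (fst h))) (at z)"
    using diff_chain_at[OF fst gam_deriv] by (simp add: o_def)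
  from has_derivative_diff[OF snd this] show ?thesis by (simp add: gg_def[abs_def] Dg_def[abs_def])
qed

lemma gg_smooth: "smooth_on UNIV gg"
proof -
  have "smooth_on UNIV (\<lambda>z::complex\<times>complex. gam (fst z))"
    by (rule smooth_on_compose[OF open_UNIV open_UNIV _ gam_smooth smooth_on_fst[OF open_UNIV smooth_on_id[OF open_UNIV]]]) simp
  then show ?thesis unfolding gg_def[abs_def]
    by (intro smooth_on_diff smooth_on_snd smooth_on_id open_UNIV)
qed

lemma \<sigma>'_zero: assumes "1 < x" shows "\<sigma>' x = 0"
proof -
  have "((\<lambda>_. 1) has_real_derivative 0) (at x)" by simp
  then have "(\<sigma> has_real_derivative 0) (at x)"
    by (rule has_field_derivative_transform_within_open[of _ _ _ "{1<..}"]) (use assms \<sigma>(3) in auto)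
  then show ?thesis using DERIV_unique \<sigma>'(1) by blast
qed

text \<open>The difference \<open>Dg(X) + \<i> g\<close> vanishes on the spanning orbit; near it, compare with the point of
  the orbit with the same argument of \<open>z\<^sub>1\<close>.\<close>

lemma rotation_estimate: assumes z: "z \<in> M" shows "norm (Dg z (X z) + \<i> * gg z) \<le> 1/2 * norm (gg z)"
proof (cases "1/2 \<le> norm (gg z)")
  case True
  have z3: "z \<in> cball 0 3" by (rule M_norm(4)[OF z])
  \<comment> \<open>Far from the orbit nothing has to cancel beyond the rotation of
    \<open>z2\<close>: each remaining term is small in absolute terms, in total at most 43/1000,
    compared with \<open>|gg z| \<ge> 1/2\<close>.\<close>
  have e: "Dg z (X z) + \<i> * gg z = p2 z - \<i> * gam (fst z) - gam' (fst z) (fst (X z))"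
    by (simp add: Dg_def X_def gg_def algebra_simps)
  have "norm (fst (X z)) \<le> 3 + 200 * \<kappa>"
    unfolding X_def fst_conv by (rule order_trans[OF norm_triangle_ineq add_mono])
      (use norm_fst[OF z3] p_bounds(1)[OF z3] in \<open>auto simp: norm_mult\<close>)
  then have "norm (gam' (fst z) (fst (X z))) \<le> 4/100"
    using gam'_bound[OF norm_fst[OF z3], of "fst (X z)"] \<kappa>_small by linarith
  moreover have "norm (p2 z) \<le> 1/1000" using p_bounds(2)[OF z3] \<kappa>_small by linarith
  moreover have "norm (\<i> * gam (fst z)) \<le> 1/500" using gam_bound[of "fst z"] \<eta>_small by (simp add: norm_mult)
  ultimately have "norm (p2 z - \<i> * gam (fst z) - gam' (fst z) (fst (X z))) \<le> 1/1000 + 1/500 + 4/100"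
    by (intro order_trans[OF norm_triangle_ineq4] add_mono) auto
  then show ?thesis unfolding e using True by linarith
next
  case False
  have z3: "z \<in> cball 0 3" by (rule M_norm(4)[OF z])
  have "norm (snd z) \<le> norm (gg z) + norm (gam (fst z))"
    using norm_triangle_ineq[of "gg z" "gam (fst z)"] by (simp add: gg_def)
  then have sz: "norm (snd z) \<le> 51/100" using False gam_bound[of "fst z"] \<eta>_small by linarith
  then have f: "6/5 \<le> norm (fst z)" by (rule fst_lower[OF z])
  then have fz: "fst z \<noteq> 0" by auto
  define y where "y = Arg (fst z)"
  have zy: "fst z = of_real (norm (fst z)) * exp (\<i> * of_real y)" unfolding y_def by (rule Arg_eq[OF fz])
  obtain t where t: "fst (\<phi> t z0) = of_real (norm (fst (\<phi> t z0))) * exp (\<i> * of_real y)"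
    "snd (\<phi> t z0) = N y" "p2 (\<phi> t z0) - \<i> * N y = (1 + Im (p1 (\<phi> t z0) / fst (\<phi> t z0))) *\<^sub>R N' y"
    using graph by blast
  define w where "w = \<phi> t z0"
  have w: "w \<in> M" using flow_in[OF z0(1)] by (simp add: w_def)
  have w3: "w \<in> cball 0 3" by (rule M_norm(4)[OF w])
  have fw: "6/5 \<le> norm (fst w)" using orbit_fst[of t] by (simp add: w_def)
  then have fw0: "fst w \<noteq> 0" by auto
  have wy: "fst w = of_real (norm (fst w)) * exp (\<i> * of_real y)" "snd w = N y"
    "p2 w - \<i> * N y = (1 + Im (p1 w / fst w)) *\<^sub>R N' y" using t by (simp_all add: w_def)
  have "1 < fst z \<bullet> fst z" using power_mono[OF f, of 2] by (simp add: power2_norm_eq_inner power_divide)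
  then have s: "\<sigma> (fst z \<bullet> fst z) = 1" "\<sigma>' (fst z \<bullet> fst z) = 0" using \<sigma>(3) \<sigma>'_zero by simp_all
  have gz: "gg z = snd z - N y" using gam_large[OF _ zy] f by (simp add: gg_def)
  have quot: "fst (X z) / fst z = \<i> + p1 z / fst z" using fz by (simp add: X_def add_divide_distrib)
  have "Dg z (X z) = snd (X z) - (1 + Im (p1 z / fst z)) *\<^sub>R N' y"
    by (simp add: Dg_def gam'_def s quot y_def del: Im_divide)
  then have "Dg z (X z) + \<i> * gg z = (p2 z - \<i> * N y) - (1 + Im (p1 z / fst z)) *\<^sub>R N' y"
    by (simp add: X_def gz algebra_simps)
  \<comment> \<open>The invariance equation of the graph at \<open>w\<close> is subtracted. What
    remains are differences of the perturbation at \<open>z\<close> and \<open>w\<close>, controlled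
    by Lipschitz bounds.\<close>
  also have "\<dots> = (p2 z - p2 w) - (Im (p1 z / fst z) - Im (p1 w / fst w)) *\<^sub>R N' y"
  proof -
    have "\<i> * N y = p2 w - (1 + Im (p1 w / fst w)) *\<^sub>R N' y" using wy(3) by (simp add: algebra_simps)
    then show ?thesis by (simp add: scaleR_left_diff_distrib scaleR_left_distrib)
  qed
  finally have r: "Dg z (X z) + \<i> * gg z = (p2 z - p2 w) - (Im (p1 z / fst z) - Im (p1 w / fst w)) *\<^sub>R N' y" .
  define E where "E = norm (z - w)"
  define G where "G = norm (gg z)"
  define x where "x = \<bar>norm (fst z) - norm (fst w)\<bar>"
  have snd_diff: "norm (snd z - snd w) = G" by (simp add: G_def gz wy(2))
  have "fst z - fst w = of_real (norm (fst z) - norm (fst w)) * exp (\<i> * of_real y)"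
    unfolding of_real_diff left_diff_distrib zy[symmetric] wy(1)[symmetric] ..
  then have fst_diff: "norm (fst z - fst w) = x"
    by (simp only: x_def norm_mult norm_of_real norm_exp_i_times mult_1_right)
  have E: "E \<le> x + G"
  proof -
    have "z - w = (fst z - fst w, snd z - snd w)" by (simp add: prod_eq_iff)
    then show ?thesis using norm_Pair_le[of "fst z - fst w" "snd z - snd w"] fst_diff snd_diff
      by (simp only: E_def)
  qed
  have G0: "0 \<le> G" by (simp add: G_def)
  have x0: "0 \<le> x" by (simp add: x_def)
  have E0: "0 \<le> E" by (simp add: E_def)
  \<comment> \<open>Conservation of energy determines \<open>|z1|\<close> from the rest: as
    \<open>z\<close> and \<open>w\<close> have the same energy and the same argument of
    \<open>z1\<close>, the difference of their second components, whose norm is \<open>G\<close>,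
    bounds their whole distance up to a factor 2.\<close>
  have "x \<le> G"
  proof -
    have kz: "(norm (fst z))\<^sup>2 + (norm (snd z))\<^sup>2 + 4 * P z = 2" and kw: "(norm (fst w))\<^sup>2 + (norm (snd w))\<^sup>2 + 4 * P w = 2"
    proof -
      have *: "(norm (fst v))\<^sup>2 + (norm (snd v))\<^sup>2 + 4 * P v = 2" if "v \<in> M" for v
      proof -
        have "1/4 * (norm v)\<^sup>2 - 1/2 + P v = 0" using that by (simp add: M_def k_def power2_norm_eq_inner)
        then have "(norm v)\<^sup>2 + 4 * P v = 2" by simp
        then show ?thesis by (simp only: norm_prod_sq)
      qed
      show "(norm (fst z))\<^sup>2 + (norm (snd z))\<^sup>2 + 4 * P z = 2" "(norm (fst w))\<^sup>2 + (norm (snd w))\<^sup>2 + 4 * P w = 2"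
        using *[OF z] *[OF w] .
    qed
    have "\<bar>snd z \<bullet> snd z - snd w \<bullet> snd w\<bar> \<le> 2 * (51/100) * G"
      by (rule inner_self_diff_le[OF sz]) (use N(5)[of y] \<eta>_small snd_diff wy(2) in auto)
    then have "\<bar>(norm (snd z))\<^sup>2 - (norm (snd w))\<^sup>2\<bar> \<le> 102/100 * G" by (simp add: power2_norm_eq_inner)
    moreover have "\<bar>P z - P w\<bar> \<le> 1/1000 * E"
    proof -
      have "200 * \<kappa> * E \<le> 1/1000 * E" using \<kappa>_small E0 by (intro mult_right_mono) auto
      then show ?thesis using P_lip[OF z3 w3] unfolding E_def by linarith
    qed
    ultimately have "\<bar>(norm (fst z))\<^sup>2 - (norm (fst w))\<^sup>2\<bar> \<le> 102/100 * G + 4/1000 * E"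
      using kz kw by linarith
    moreover have "2 * x \<le> \<bar>(norm (fst z))\<^sup>2 - (norm (fst w))\<^sup>2\<bar>"
    proof -
      have "(norm (fst z))\<^sup>2 - (norm (fst w))\<^sup>2 = (norm (fst z) + norm (fst w)) * (norm (fst z) - norm (fst w))"
        by (simp add: power2_eq_square algebra_simps)
      then have "\<bar>(norm (fst z))\<^sup>2 - (norm (fst w))\<^sup>2\<bar> = (norm (fst z) + norm (fst w)) * x"
        by (simp add: abs_mult x_def)
      moreover have "2 * x \<le> (norm (fst z) + norm (fst w)) * x" using f fw x0 by (intro mult_right_mono) auto
      ultimately show ?thesis by simp
    qed
    ultimately show ?thesis using E G0 x0 by linarith
  qed
  then have E2: "E \<le> 2 * G" using E by linarith
  have quot_diff: "\<bar>Im (p1 z / fst z) - Im (p1 w / fst w)\<bar> \<le> 400 * \<kappa> * E"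
  proof -
    have "p1 z / fst z - p1 w / fst w = (p1 z - p1 w) / fst z + p1 w * (fst w - fst z) / (fst z * fst w)"
      using fz fw0 by (simp add: field_simps)
    then have "norm (p1 z / fst z - p1 w / fst w) \<le> norm (p1 z - p1 w) / norm (fst z) + norm (p1 w) * norm (fst w - fst z) / (norm (fst z) * norm (fst w))"
      using norm_triangle_ineq[of "(p1 z - p1 w) / fst z" "p1 w * (fst w - fst z) / (fst z * fst w)"]
      by (simp add: norm_divide norm_mult)
    also have "\<dots> \<le> 200 * \<kappa> * E / 1 + 200 * \<kappa> * E / (1 * 1)"
    proof (intro add_mono frac_le mult_mono)
      show "norm (p1 z - p1 w) \<le> 200 * \<kappa> * E" unfolding E_def by (rule p_lip(1)[OF z3 w3])
      show "norm (p1 w) \<le> 200 * \<kappa>" by (rule p_bounds(1)[OF w3])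
      show "norm (fst w - fst z) \<le> E" unfolding E_def using norm_fst_snd_le(1)[of "z - w"] by (simp add: norm_minus_commute)
    qed (use f fw \<kappa> E0 in auto)
    also have "200 * \<kappa> * E / 1 + 200 * \<kappa> * E / (1 * 1) = 400 * \<kappa> * E" by simp
    finally show ?thesis using abs_Im_le_cmod[of "p1 z / fst z - p1 w / fst w"]
      unfolding minus_complex.sel by linarith
  qed
  have a: "norm ((Im (p1 z / fst z) - Im (p1 w / fst w)) *\<^sub>R N' y) \<le> 400 * \<kappa> * E * 1"
    unfolding norm_scaleR using quot_diff N(6)[of y] \<eta>_small \<kappa> E0 by (intro mult_mono) auto
  have b: "norm (p2 z - p2 w) \<le> 200 * \<kappa> * E" unfolding E_def by (rule p_lip(2)[OF z3 w3])
  have "norm (Dg z (X z) + \<i> * gg z) \<le> 200 * \<kappa> * E + 400 * \<kappa> * E * 1"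
    unfolding r by (rule order_trans[OF norm_triangle_ineq4 add_mono[OF b a]])
  also have "\<dots> = 600 * \<kappa> * E" by simp
  also have "\<dots> \<le> 1/1000 * (2 * G)" using \<kappa>_small \<kappa> E2 E0 by (intro mult_mono) auto
  finally show ?thesis using G0 unfolding G_def[symmetric] by linarith
qed

section \<open>The disk and its intersections with the flow\<close>

lemma gg_continuous: "continuous_on S gg"
  using smooth_on_imp_continuous_on[OF gg_smooth] continuous_on_subset by blast

lemma compact_D: "compact D"
proof -
  have "closed {z \<in> M. Im (gg z) = 0 \<and> 0 \<le> Re (gg z)}"
  proof -
    have "{z \<in> M. Im (gg z) = 0 \<and> 0 \<le> Re (gg z)} = M \<inter> gg -` {c. Im c = 0 \<and> 0 \<le> Re c}" by auto
    moreover have "closed {c. Im c = 0 \<and> 0 \<le> Re c}"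
      by (intro closed_Collect_conj closed_Collect_eq closed_Collect_le continuous_intros)
    ultimately show ?thesis
      using continuous_closed_preimage[OF gg_continuous compact_imp_closed[OF compact_M]] by metis
  qed
  then have "compact (M \<inter> D)" unfolding D_def[symmetric] by (rule compact_Int_closed[OF compact_M])
  moreover have "M \<inter> D = D" unfolding D_def by blast
  ultimately show ?thesis by simp
qed

text \<open>After the shear and radial projection the page becomes the closed hemisphere of unit
  vectors whose second component is real and nonnegative. That component is determined by the first,
  so forgetting it maps the hemisphere onto the unit disk and the binding onto the circle.\<close>

lemma disk_D: "embedded_closed_disk D Bd"
proof -
  define q where "q z = (1 / norm (\<Theta> z)) *\<^sub>R fst z" for z
  have \<Theta>c: "continuous_on D \<Theta>" unfolding \<Theta>_def[abs_def] by (intro continuous_intros gg_continuous)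
  have DM: "z \<in> M" if "z \<in> D" for z using that by (simp add: D_def)
  have cont: "continuous_on D q" unfolding q_def[abs_def]
    using \<Theta>_nonzero[OF DM] by (intro continuous_intros \<Theta>c) auto
  have decomp: "(1 / norm (\<Theta> z)) *\<^sub>R \<Theta> z = (q z, of_real (sqrt (1 - (norm (q z))\<^sup>2))) \<and> norm (q z) \<le> 1 \<and>
      (norm (q z) = 1 \<longleftrightarrow> gg z = 0)" if z: "z \<in> D" for z
  proof -
    define s where "s = (1 / norm (\<Theta> z)) * Re (gg z)"
    have n: "norm (\<Theta> z) > 0" by (rule \<Theta>_nonzero[OF DM[OF z]])
    have g: "gg z = of_real (Re (gg z))" "Re (gg z) \<ge> 0" using z by (auto simp: D_def complex_eq_iff)
    have e: "(1 / norm (\<Theta> z)) *\<^sub>R \<Theta> z = (q z, of_real s)"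
    proof -
      have "(1 / norm (\<Theta> z)) *\<^sub>R gg z = of_real s"
        unfolding s_def by (subst g(1)) (simp add: scaleR_conv_of_real)
      then show ?thesis by (simp add: \<Theta>_def[of z] q_def)
    qed
    have s0: "0 \<le> s" using g(2) n by (simp add: s_def)
    have "norm ((1 / norm (\<Theta> z)) *\<^sub>R \<Theta> z) = 1" using n by simp
    then have 1: "(norm (q z))\<^sup>2 + s\<^sup>2 = 1" unfolding e by (simp add: norm_Pair)
    then have "1 - (norm (q z))\<^sup>2 = s\<^sup>2" by simp
    then have "s = sqrt (1 - (norm (q z))\<^sup>2)" using s0 by simp
    moreover have "(norm (q z))\<^sup>2 \<le> 1\<^sup>2" using 1 zero_le_power2[of s] unfolding one_power2 by linarith
    then have "norm (q z) \<le> 1" by (rule power2_le_imp_le) simp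
    moreover have "norm (q z) = 1 \<longleftrightarrow> s = 0"
    proof
      assume "norm (q z) = 1" then show "s = 0" using 1 by simp
    next
      assume "s = 0" then have "(norm (q z))\<^sup>2 = 1\<^sup>2" using 1 by simp
      then show "norm (q z) = 1" by (metis norm_ge_zero power2_eq_imp_eq zero_le_one)
    qed
    moreover have "s = 0 \<longleftrightarrow> gg z = 0" using n g(1) by (auto simp: s_def complex_eq_iff)
    ultimately show ?thesis using e by simp
  qed
  have img: "q ` D = cball 0 1"
  proof (intro equalityI subsetI)
    fix x assume "x \<in> q ` D" then show "x \<in> cball 0 1" using decomp by auto
  next
    fix x :: complex assume x: "x \<in> cball 0 1"
    then have x1: "(norm x)\<^sup>2 \<le> 1" by (simp add: power_le_one)
    define s where "s = sqrt (1 - (norm x)\<^sup>2)"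
    have s: "0 \<le> s" "(norm x)\<^sup>2 + s\<^sup>2 = 1" using x1 by (auto simp: s_def)
    have "norm (x, complex_of_real s) = 1" using s by (simp add: norm_Pair)
    then obtain r z where r: "1 \<le> r" "z \<in> M" "\<Theta> z = r *\<^sub>R (x, of_real s)" by (rule \<Theta>_radial_exists)
    have "norm (\<Theta> z) = r"
      unfolding r(3) norm_scaleR \<open>norm (x, complex_of_real s) = 1\<close> using r(1) by simp
    moreover have "fst z = r *\<^sub>R x" "gg z = of_real (r * s)"
      using r(3) by (simp_all add: \<Theta>_def scaleR_conv_of_real)
    ultimately have "z \<in> D" "q z = x" using r s by (auto simp: D_def q_def)
    then show "x \<in> q ` D" by blast
  qed
  have inj: "inj_on q D"
  proof (rule inj_onI)
    fix z w assume zw: "z \<in> D" "w \<in> D" "q z = q w"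
    show "z = w" by (rule \<Theta>_radial_unique[OF DM[OF zw(1)] DM[OF zw(2)]]) (use decomp[OF zw(1)] decomp[OF zw(2)] zw(3) in simp)
  qed
  obtain h where h: "homeomorphism D (cball 0 1) q h" using homeomorphism_compact[OF compact_D cont img inj] by blast
  have "Bd = h ` sphere 0 1"
  proof (intro equalityI subsetI)
    fix z assume "z \<in> Bd"
    then have z: "z \<in> D" "gg z = 0" by (auto simp: Bd_def D_def)
    then have "q z \<in> sphere 0 1" using decomp by simp
    moreover have "h (q z) = z" using h z(1) by (simp add: homeomorphism_def)
    ultimately show "z \<in> h ` sphere 0 1" by (metis imageI)
  next
    fix z assume "z \<in> h ` sphere 0 1"
    then obtain x where x: "z = h x" "norm x = 1" by auto
    then have "x \<in> cball 0 1" by simp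
    then have "z \<in> D" "q z = x" using h x(1) by (auto simp: homeomorphism_def)
    then show "z \<in> Bd" using decomp[of z] x(2) by (simp add: Bd_def D_def)
  qed
  then show ?thesis unfolding embedded_closed_disk_def using homeomorphism_symD[OF h] by blast
qed

lemma D_diff: "D - Bd = {z \<in> M. Im (gg z) = 0 \<and> 0 < Re (gg z)}"
  by (auto simp: D_def Bd_def complex_eq_iff)

text \<open>On the page \<open>gg\<close> is positive and its derivative along the field is close to
  \<open>- \<i> * gg\<close>, so every crossing has the same direction.\<close>

lemma Im_Dg_X: assumes "z \<in> D - Bd" shows "Im (Dg z (X z)) < 0"
proof -
  have z: "z \<in> M" "Im (gg z) = 0" "0 < Re (gg z)" using assms unfolding D_diff by auto
  have "norm (gg z) = Re (gg z)" using z(2,3) by (simp add: cmod_def)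
  then have "\<bar>Im (Dg z (X z) + \<i> * gg z)\<bar> \<le> 1/2 * Re (gg z)"
    using rotation_estimate[OF z(1)] abs_Im_le_cmod[of "Dg z (X z) + \<i> * gg z"] by linarith
  then have "\<bar>Im (Dg z (X z)) + Re (gg z)\<bar> \<le> 1/2 * Re (gg z)" by simp
  then show ?thesis using z(3) by linarith
qed

lemma D_transversal: assumes z: "z \<in> D - Bd" shows "X z \<notin> tangent_space (D - Bd) z"
proof
  assume "X z \<in> tangent_space (D - Bd) z"
  then obtain e \<gamma> where e: "e > 0" "\<gamma> ` {-e<..<e} \<subseteq> D - Bd" "\<gamma> (0::real) = z" "(\<gamma> has_vector_derivative X z) (at 0)"
    unfolding tangent_space_def by blast
  have "(gg \<circ> \<gamma> has_derivative Dg z \<circ> (\<lambda>h. h *\<^sub>R X z)) (at 0)"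
    using diff_chain_at[OF e(4)[unfolded has_vector_derivative_def]] gg_deriv[of "\<gamma> 0"] unfolding e(3) by blast
  then have "((\<lambda>s. Im (gg (\<gamma> s))) has_derivative (\<lambda>h. Im (Dg z (h *\<^sub>R X z)))) (at 0)"
    using bounded_linear.has_derivative[OF bounded_linear_Im] by (fastforce simp: o_def)
  moreover have "((\<lambda>s. Im (gg (\<gamma> s))) has_derivative (\<lambda>h. 0)) (at 0)"
  proof (rule has_derivative_transform_within_open[OF has_derivative_const, of "{-e<..<e}"])
    show "0 = Im (gg (\<gamma> s))" if "s \<in> {-e<..<e}" for s
      using e(2) that unfolding D_diff by fastforce
  qed (use e in auto)
  ultimately have "(\<lambda>h. Im (Dg z (h *\<^sub>R X z))) = (\<lambda>h. 0)" using has_derivative_unique by blast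
  from fun_cong[OF this, of 1] show False using Im_Dg_X[OF z] by simp
qed

text \<open>Surjectivity is a triangular system: along the field the energy does not change but
  \<open>Im gg\<close> does, and along the radial direction the energy changes.\<close>

lemma D_submanifold: "smooth_submanifold 2 (D - Bd)"
proof -
  define U where "U = ball (0::complex\<times>complex) 3 \<inter> {z. 0 < Re (gg z)}"
  define F where "F z = (k z, Im (gg z))" for z
  have "smooth_submanifold (DIM(complex \<times> complex) - DIM(real \<times> real)) (D - Bd)"
  proof (rule smooth_submanifold_regular_level_set)
    show "open U" unfolding U_def
      by (intro open_Int open_ball open_Collect_less continuous_intros gg_continuous)
    then show "smooth_on U F" unfolding F_def[abs_def]
      by (intro smooth_on_Pair smooth_on_Im smooth_on_subset[OF basic_smooth(3)] smooth_on_subset[OF gg_smooth])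
        (auto simp: U_def)
    show "D - Bd = {z \<in> U. F z = 0}"
    proof (intro equalityI subsetI)
      fix z assume z: "z \<in> D - Bd"
      then have "z \<in> M" unfolding D_diff by simp
      then show "z \<in> {z \<in> U. F z = 0}" using z M_ball3[of z] unfolding D_diff by (simp add: U_def F_def M_def zero_prod_def)
    next
      fix z assume "z \<in> {z \<in> U. F z = 0}"
      then show "z \<in> D - Bd" unfolding D_diff by (simp add: U_def F_def M_def zero_prod_def)
    qed
    fix z assume z: "z \<in> D - Bd"
    then have zM: "z \<in> M" unfolding D_diff by simp
    define A where "A h = (Dk z h, Im (Dg z h))" for h
    have dk: "(k has_derivative Dk z) (at z)" by (rule k_deriv[OF M_norm(4)[OF zM]])
    have "(F has_derivative A) (at z)" unfolding F_def[abs_def] A_def[abs_def]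
      by (intro has_derivative_Pair dk bounded_linear.has_derivative[OF bounded_linear_Im gg_deriv])
    moreover have "surj A"
    proof (rule surjI)
      fix p :: "real \<times> real"
      define a where "a = fst p / Dk z z"
      define b where "b = (snd p - a * Im (Dg z z)) / Im (Dg z (X z))"
      have lin: "linear (Dk z)" "linear (Dg z)" using has_derivative_linear dk gg_deriv by blast+
      have "Dk z (a *\<^sub>R z + b *\<^sub>R X z) = fst p"
        using lin(1) Dk_radial[OF zM] by (simp add: linear_add linear_scale Dk_X a_def)
      moreover have "Im (Dg z (a *\<^sub>R z + b *\<^sub>R X z)) = snd p"
        using lin(2) Im_Dg_X[OF z] by (simp add: linear_add linear_scale b_def)
      ultimately show "A ((\<lambda>p. (fst p / Dk z z) *\<^sub>R z + ((snd p - fst p / Dk z z * Im (Dg z z)) / Im (Dg z (X z))) *\<^sub>R X z) p) = p"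
        by (simp add: A_def a_def b_def)
    qed
    ultimately show "\<exists>A. (F has_derivative A) (at z) \<and> surj A" by blast
  qed
  then show ?thesis by simp
qed

text \<open>An orbit other than the binding never meets it, so \<open>gg\<close> has an argument
  along the whole orbit; this decreases at rate at least 1/2, and the orbit lies in the interior of
  the page whenever \<open>gg\<close> is a positive real.\<close>

lemma D_return:
  assumes z: "z \<in> M" "orbit \<phi> z \<noteq> Bd"
  shows "(\<exists>t>0. \<phi> t z \<in> D - Bd) \<and> (\<exists>t<0. \<phi> t z \<in> D - Bd)"
proof -
  have notB: "\<phi> t z \<notin> Bd" for t
  proof
    assume "\<phi> t z \<in> Bd"
    then obtain s where s: "\<phi> t z = \<phi> s z0" unfolding Bd_orbit orbit_def by auto
    have "z = \<phi> (- t) (\<phi> s z0)" using flow_minus[OF z(1), of t] s by simp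
    then have zs: "z = \<phi> (s - t) z0" using flow_add[OF z0(1), of "- t" s] by simp
    have "orbit \<phi> z = orbit \<phi> z0" unfolding orbit_def
    proof (intro equalityI subsetI)
      fix w assume "w \<in> range (\<lambda>r. \<phi> r z)"
      then show "w \<in> range (\<lambda>r. \<phi> r z0)" unfolding zs flow_add[OF z0(1), symmetric] by auto
    next
      fix w assume "w \<in> range (\<lambda>r. \<phi> r z0)"
      then obtain r where "w = \<phi> ((r - (s - t)) + (s - t)) z0" by auto
      then show "w \<in> range (\<lambda>r. \<phi> r z)" unfolding zs flow_add[OF z0(1)] by auto
    qed
    then show False using z(2) Bd_orbit by simp
  qed
  define G where "G t = gg (\<phi> t z)" for t
  have G0: "G t \<noteq> 0" for t using notB[of t] flow_in[OF z(1)] by (auto simp: G_def Bd_def)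
  have dG: "(G has_vector_derivative Dg (\<phi> t z) (X (\<phi> t z))) (at t)" for t
  proof -
    have "(gg \<circ> (\<lambda>t. \<phi> t z) has_derivative Dg (\<phi> t z) \<circ> (\<lambda>h. h *\<^sub>R X (\<phi> t z))) (at t)"
      by (rule diff_chain_at[OF flow_deriv[OF z(1), unfolded has_vector_derivative_def] gg_deriv])
    moreover have "Dg (\<phi> t z) (h *\<^sub>R X (\<phi> t z)) = h *\<^sub>R Dg (\<phi> t z) (X (\<phi> t z))" for h
      using linear_scale[OF has_derivative_linear[OF gg_deriv]] by blast
    ultimately show ?thesis by (simp add: has_vector_derivative_def o_def G_def[abs_def])
  qed
  have "smooth_on UNIV G" unfolding G_def[abs_def]
    by (rule smooth_on_compose[OF open_UNIV open_UNIV _ gg_smooth flow_smooth[OF z(1)]]) simp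
  from smooth_on_imp_continuous_on[OF smooth_on_frechet_derivative[OF this, of 1]]
  have "continuous_on UNIV (\<lambda>t. frechet_derivative G (at t) 1)" .
  moreover have "frechet_derivative G (at t) 1 = Dg (\<phi> t z) (X (\<phi> t z))" for t
    using frechet_derivative_at[OF dG[of t, unfolded has_vector_derivative_def], symmetric] by simp
  ultimately have cG: "continuous_on UNIV (\<lambda>t. Dg (\<phi> t z) (X (\<phi> t z)))" by simp
  have rot: "Im (Dg (\<phi> t z) (X (\<phi> t z)) / G t) \<le> - (1/2)" for t
  proof -
    define r where "r = Dg (\<phi> t z) (X (\<phi> t z)) + \<i> * G t"
    have "Dg (\<phi> t z) (X (\<phi> t z)) / G t = r / G t - \<i>" using G0[of t] by (simp add: r_def field_simps)
    moreover have "norm r \<le> 1/2 * norm (G t)" unfolding r_def G_def by (rule rotation_estimate[OF flow_in[OF z(1)]])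
    then have "norm (r / G t) \<le> 1/2" using G0[of t] by (simp add: norm_divide divide_le_eq)
    then have "Im (r / G t) \<le> 1/2" using abs_Im_le_cmod[of "r / G t"] by linarith
    ultimately show ?thesis by (simp del: Im_divide)
  qed
  from rotating_curve_meets_positive_reals[OF dG G0 cG rot] show ?thesis
    unfolding D_diff using flow_in[OF z(1)] by (auto simp: G_def)
qed

lemma section_D: "global_disklike_surface_of_section M X \<phi> D"
proof -
  have "D \<subseteq> M" by (auto simp: D_def)
  moreover have "periodic_orbit M \<phi> Bd"
  proof -
    have "T > 0" using z0(3) pi_gt3 by linarith
    then show ?thesis unfolding periodic_orbit_def Bd_orbit using z0 by blast
  qed
  ultimately show ?thesis
    unfolding global_disklike_surface_of_section_def
    using disk_D D_submanifold D_transversal D_return by (intro conjI exI[of _ Bd] ballI impI) auto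
qed

end

text \<open>The order of quantifiers matters: \<delta> depends only on the step function, so it
  stays fixed while \<kappa> and the tidal terms shrink with \<open>1 - \<mu>\<close>.\<close>

theorem hopf_perturbation_section:
  "\<exists>\<delta>>0. \<delta> \<le> 1 / 10^6 \<and> (\<forall>\<kappa> f m. hopf_perturbation \<kappa> \<delta> f m \<longrightarrow>
    (\<exists>\<phi>. closed_3manifold_with_flow (hopf_perturbation.M \<kappa> f) (hopf_perturbation.X \<kappa> m) \<phi> \<and>
      (\<exists>D. global_disklike_surface_of_section (hopf_perturbation.M \<kappa> f) (hopf_perturbation.X \<kappa> m) \<phi> D)))"
proof -
  obtain \<sigma> :: "real \<Rightarrow> real" where \<sigma>: "smooth_on UNIV \<sigma>" "\<And>x. x \<le> 1/2 \<Longrightarrow> \<sigma> x = 0" "\<And>x. 1 \<le> x \<Longrightarrow> \<sigma> x = 1"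
    "\<And>x. 0 \<le> \<sigma> x" "\<And>x. \<sigma> x \<le> 1"
  proof (rule smooth_step)
    fix \<sigma> :: "real \<Rightarrow> real"
    assume "smooth_on UNIV \<sigma>" "\<And>x. x \<le> 1/2 \<Longrightarrow> \<sigma> x = 0" "\<And>x. 1 \<le> x \<Longrightarrow> \<sigma> x = 1"
      "\<And>x. 0 \<le> \<sigma> x" "\<And>x. \<sigma> x \<le> 1"
    then show thesis by (rule that)
  qed
  define \<sigma>' where "\<sigma>' x = frechet_derivative \<sigma> (at x) 1" for x
  have \<sigma>'d: "(\<sigma> has_real_derivative \<sigma>' x) (at x)" for x
  proof -
    note d = smooth_on_has_derivative[OF \<sigma>(1) UNIV_I[of x]]
    have "frechet_derivative \<sigma> (at x) h = \<sigma>' x * h" for h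
      using linear_scale[OF has_derivative_linear[OF d], of h 1] by (simp add: \<sigma>'_def mult.commute)
    then have "frechet_derivative \<sigma> (at x) = (*) (\<sigma>' x)" by (rule ext)
    with d show ?thesis unfolding has_field_derivative_def by metis
  qed
  have "continuous_on {0..9} \<sigma>'" unfolding \<sigma>'_def[abs_def]
    using smooth_on_imp_continuous_on[OF smooth_on_frechet_derivative[OF \<sigma>(1)]] continuous_on_subset by blast
  then have "bounded (\<sigma>' ` {0..9})" by (intro compact_imp_bounded compact_continuous_image) auto
  then obtain B where B0: "\<forall>x\<in>{0..9}. \<bar>\<sigma>' x\<bar> \<le> B" by (auto simp: bounded_iff)
  have B: "\<bar>\<sigma>' x\<bar> \<le> \<bar>B\<bar>" if "x \<in> {0..9}" for x
    using B0[rule_format, OF that] abs_ge_self[of B] by linarith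
  \<comment> \<open>Chosen to give slope 1/100 to the graph through the orbit.\<close>
  define \<eta> where "\<eta> = 1 / (100 * (6 * \<bar>B\<bar> + 5))"
  have \<eta>: "0 < \<eta>" "(6 * \<bar>B\<bar> + 5) * \<eta> \<le> 1/100" "\<eta> \<le> 1/500" by (auto simp: \<eta>_def divide_simps)
  \<comment> \<open>The shooting argument runs with \<open>x0 = \<eta> / 3\<close>, as its orbit
    stays within \<open>3 * x0\<close> of the axis; it asks for
    \<open>\<delta> \<le> x0 / 10^7\<close>.\<close>
  define \<delta> where "\<delta> = \<eta> / 100000000"
  have \<delta>': "0 < \<delta>" "\<delta> \<le> (\<eta>/3) / 10000000" "200 * \<delta> \<le> \<eta>" using \<eta> by (auto simp: \<delta>_def)
  have "\<delta> \<le> 1 / 10^6" using \<eta>(3) by (simp add: \<delta>_def)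
  show ?thesis
  proof (intro exI[of _ \<delta>] conjI allI impI \<delta>'(1) \<open>\<delta> \<le> 1 / 10^6\<close>)
    fix \<kappa> f m assume "hopf_perturbation \<kappa> \<delta> f m"
    then interpret hopf_perturbation \<kappa> \<delta> f m .
    obtain \<phi> where \<phi>: "flow_on M X \<phi>" "lipschitz_flow M X \<phi> 3" by (rule flow_exists)
    interpret hopf_flow \<kappa> \<delta> f m \<phi> using \<phi>(2) by unfold_locales (auto simp: lipschitz_flow_def)
    obtain z T where zT: "z \<in> M" "\<bar>T - 2 * pi\<bar> \<le> 2 * (\<eta>/3)" "\<phi> T z = z" "\<And>t. norm (snd (\<phi> t z)) \<le> 3 * (\<eta>/3)"
    proof (rule periodic_orbit_near_axis[of "\<eta>/3"])
      show "0 < \<eta>/3" "\<eta>/3 \<le> 1/10" "\<delta> \<le> (\<eta>/3) / 10000000" using \<eta> \<delta>'(2) by simp_all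
      fix z T assume "z \<in> M" "\<bar>T - 2 * pi\<bar> \<le> 2 * (\<eta>/3)" "\<phi> T z = z" "\<And>t. norm (snd (\<phi> t z)) \<le> 3 * (\<eta>/3)"
      then show thesis by (rule that)
    qed
    interpret spanning_orbit \<kappa> \<delta> f m \<phi> \<sigma> \<sigma>' "\<bar>B\<bar>" \<eta> z T
    proof -
      have 1: "200 * \<kappa> \<le> \<eta>" "0 \<le> \<bar>B\<bar>" using \<kappa> \<delta>'(3) by linarith+
      have 2: "\<bar>T - 2 * pi\<bar> \<le> 1" using zT(2) \<eta>(3) by linarith
      have 3: "norm (snd (\<phi> t z)) \<le> \<eta>" for t using zT(4)[of t] by linarith
      show "spanning_orbit \<kappa> \<delta> f m \<phi> \<sigma> \<sigma>' \<bar>B\<bar> \<eta> z T"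
        by unfold_locales (fact \<sigma> \<sigma>'d B \<eta> zT(1,3) 1 2 3)+
    qed
    obtain N N' where "section_disk \<kappa> \<delta> f m \<phi> \<sigma> \<sigma>' \<bar>B\<bar> \<eta> z T N N'"
    proof (rule orbit_graph)
      fix N N' assume *: "smooth_on UNIV N" "\<And>y. (N has_vector_derivative N' y) (at y)"
        "\<And>y. N (y + 2 * pi) = N y" "\<And>y. N' (y + 2 * pi) = N' y"
        "\<And>y. norm (N y) \<le> \<eta>" "\<And>y. norm (N' y) \<le> 3 * \<eta>"
        "\<And>y. \<exists>t. fst (\<phi> t z) = of_real (norm (fst (\<phi> t z))) * exp (\<i> * of_real y) \<and> snd (\<phi> t z) = N y \<and>
           p2 (\<phi> t z) - \<i> * N y = (1 + Im (p1 (\<phi> t z) / fst (\<phi> t z))) *\<^sub>R N' y"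
        "\<And>t. \<exists>y. fst (\<phi> t z) = of_real (norm (fst (\<phi> t z))) * exp (\<i> * of_real y) \<and> snd (\<phi> t z) = N y"
      have "section_disk \<kappa> \<delta> f m \<phi> \<sigma> \<sigma>' \<bar>B\<bar> \<eta> z T N N'" by unfold_locales (fact *)+
      then show thesis by (rule that)
    qed
    then interpret section_disk \<kappa> \<delta> f m \<phi> \<sigma> \<sigma>' "\<bar>B\<bar>" \<eta> z T N N' .
    have "closed_3manifold_with_flow M X \<phi>"
      unfolding closed_3manifold_with_flow_def
      using compact_M M_submanifold basic_smooth(4) M_ball3 X_nonzero \<phi>(1) by blast
    with section_D show "\<exists>\<phi>. closed_3manifold_with_flow M X \<phi> \<and> (\<exists>D. global_disklike_surface_of_section M X \<phi> D)"
      by blast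
  qed
qed

section \<open>Linear changes of coordinates\<close>

locale linear_change =
  fixes A Ai :: "'a::euclidean_space \<Rightarrow> 'a"
  assumes lin: "linear A" "linear Ai" and inv [simp]: "\<And>z. Ai (A z) = z" "\<And>z. A (Ai z) = z"
begin

lemma bl: "bounded_linear A" "bounded_linear Ai"
  using lin by (simp_all add: linear_conv_bounded_linear)

lemma cont: "continuous_on S A" "continuous_on S Ai"
  using bl linear_continuous_on by blast+

lemma image_eq: "A ` S = Ai -` S"
  by (auto intro: image_eqI[of _ A, OF inv(2)[symmetric]])

lemma open_image: "open S \<Longrightarrow> open (A ` S)"
  unfolding image_eq by (rule open_vimage[OF _ cont(2)])

lemma homeo: "homeomorphism (A ` S) S Ai A"
  by (rule homeomorphismI) (auto intro: cont)

lemma smooth_comp_inverse: "open S \<Longrightarrow> smooth_on S g \<Longrightarrow> smooth_on (A ` S) (\<lambda>z. g (Ai z))"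
  by (rule smooth_on_compose[OF open_image _ _ _ smooth_on_bounded_linear[OF bl(2) open_image smooth_on_id[OF open_image]]])
    auto

lemma smooth_submanifold_image:
  assumes "smooth_submanifold k S" shows "smooth_submanifold k (A ` S)"
  unfolding smooth_submanifold_def
proof
  fix w assume "w \<in> A ` S"
  then obtain z where z: "z \<in> S" "w = A z" by blast
  obtain W V and \<Phi> \<Psi> :: "'a \<Rightarrow> 'a" and L where c: "open W" "z \<in> W" "open V" "homeomorphism W V \<Phi> \<Psi>"
    "smooth_on W \<Phi>" "smooth_on V \<Psi>" "subspace L" "dim L = k" "\<Phi> ` (S \<inter> W) = L \<inter> V"
    using assms[unfolded smooth_submanifold_def, rule_format, OF z(1)] by (elim exE conjE) (rule that)
  have "open (A ` W)" "w \<in> A ` W" using c(1,2) z open_image by auto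
  moreover have "homeomorphism (A ` W) V (\<Phi> \<circ> Ai) (A \<circ> \<Psi>)"
    by (rule homeomorphism_compose[OF homeo c(4)])
  moreover have "smooth_on (A ` W) (\<Phi> \<circ> Ai)"
    using smooth_comp_inverse[OF c(1,5)] by (simp add: o_def)
  moreover have "smooth_on V (A \<circ> \<Psi>)"
    using smooth_on_bounded_linear[OF bl(1) c(3,6)] by (simp add: o_def)
  moreover have "(\<Phi> \<circ> Ai) ` (A ` S \<inter> A ` W) = L \<inter> V"
  proof -
    have "inj A" using inv(1) by (metis injI)
    then have "A ` S \<inter> A ` W = A ` (S \<inter> W)" by (simp add: image_Int)
    then show ?thesis using c(9) by (simp add: image_comp o_def)
  qed
  ultimately have "open (A ` W) \<and> w \<in> A ` W \<and> open V \<and> homeomorphism (A ` W) V (\<Phi> \<circ> Ai) (A \<circ> \<Psi>) \<and>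
      smooth_on (A ` W) (\<Phi> \<circ> Ai) \<and> smooth_on V (A \<circ> \<Psi>) \<and> subspace L \<and> dim L = k \<and>
      (\<Phi> \<circ> Ai) ` (A ` S \<inter> A ` W) = L \<inter> V"
    using c(3,7,8) by (intro conjI)
  then show "\<exists>W V (\<Phi> :: 'a \<Rightarrow> 'a) \<Psi> L. open W \<and> w \<in> W \<and> open V \<and> homeomorphism W V \<Phi> \<Psi> \<and> smooth_on W \<Phi> \<and>
      smooth_on V \<Psi> \<and> subspace L \<and> dim L = k \<and> \<Phi> ` (A ` S \<inter> W) = L \<inter> V"
    by (intro exI)
qed

context
  fixes M :: "'a set" and X Y :: "'a \<Rightarrow> 'a" and \<phi> :: "real \<Rightarrow> 'a \<Rightarrow> 'a" and c :: real and W :: "'a set"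
  assumes c: "c > 0" and W: "open W" "M \<subseteq> W" and Y: "\<And>z. z \<in> W \<Longrightarrow> Y (A z) = c *\<^sub>R A (X z)"
    and M: "closed_3manifold_with_flow M X \<phi>"
begin

text \<open>The factor \<open>c\<close> is a constant change of time, needed because the linear
  coordinates normalize the frequency to 1.\<close>

definition "push t z = A (\<phi> (c * t) (Ai z))"

lemma flow: "flow_on M X \<phi>" using M by (simp add: closed_3manifold_with_flow_def)

lemma closed_3manifold_with_flow_image: "closed_3manifold_with_flow (A ` M) Y push"
  unfolding closed_3manifold_with_flow_def
proof (intro conjI)
  show "compact (A ` M)" using M cont by (auto simp: closed_3manifold_with_flow_def intro: compact_continuous_image)
  show "smooth_submanifold 3 (A ` M)"
    using M smooth_submanifold_image by (simp add: closed_3manifold_with_flow_def)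
  obtain U where U: "open U" "M \<subseteq> U" "smooth_on U X" using M by (auto simp: closed_3manifold_with_flow_def)
  have o: "open (U \<inter> W)" using U W by auto
  have "smooth_on (A ` (U \<inter> W)) (\<lambda>z. c *\<^sub>R A (X (Ai z)))"
    by (intro smooth_on_scaleR smooth_on_const smooth_on_bounded_linear[OF bl(1)] open_image o
        smooth_comp_inverse smooth_on_subset[OF U(3)]) auto
  then have "smooth_on (A ` (U \<inter> W)) Y"
    by (rule smooth_on_cong[OF open_image[OF o], rotated]) (use Y in auto)
  then show "\<exists>U. open U \<and> A ` M \<subseteq> U \<and> smooth_on U Y"
    using open_image[OF o] U(2) W(2) by (intro exI[of _ "A ` (U \<inter> W)"]) auto
  show "\<forall>z\<in>A ` M. Y z \<noteq> 0"
  proof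
    fix w assume "w \<in> A ` M"
    then obtain z where z: "z \<in> M" "w = A z" by blast
    have "X z \<noteq> 0" using M z(1) by (simp add: closed_3manifold_with_flow_def)
    then have "A (X z) \<noteq> 0" using inv(1)[of "X z"] linear_0[OF lin(2)] by force
    then show "Y w \<noteq> 0" using Y[of z] z W(2) c by auto
  qed
  show "flow_on (A ` M) Y push"
    unfolding flow_on_def
  proof (intro ballI conjI allI)
    fix w t assume "w \<in> A ` M"
    then obtain z where z: "z \<in> M" "w = A z" by blast
    have f: "\<phi> 0 z = z" "\<And>t. \<phi> t z \<in> M" "\<And>t. ((\<lambda>s. \<phi> s z) has_vector_derivative X (\<phi> t z)) (at t)"
      using flow z(1) by (auto simp: flow_on_def)
    show "push 0 w = w" using f(1) by (simp add: push_def z)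
    show "push t w \<in> A ` M" using f(2) by (simp add: push_def z)
    have "((\<lambda>t. c * t) has_vector_derivative c) (at t)"
      unfolding has_real_derivative_iff_has_vector_derivative[symmetric] by (auto intro!: derivative_eq_intros)
    from bounded_linear.has_vector_derivative[OF bl(1) vector_diff_chain_at[OF this f(3)]]
    have "((\<lambda>t. A (\<phi> (c * t) z)) has_vector_derivative A (c *\<^sub>R X (\<phi> (c * t) z))) (at t)" by (simp add: o_def)
    moreover have "\<phi> (c * t) z \<in> W" using f(2) W(2) by blast
    then have "A (c *\<^sub>R X (\<phi> (c * t) z)) = Y (A (\<phi> (c * t) z))"
      by (simp add: Y linear_scale[OF lin(1)])
    ultimately show "((\<lambda>s. push s w) has_vector_derivative Y (push t w)) (at t)" by (simp add: push_def z)
  qed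
qed

lemma push_divide: "push (r / c) (A z) = A (\<phi> r z)"
  using c by (simp add: push_def)

lemma orbit_image: "orbit push (A z) = A ` orbit \<phi> z"
proof (intro equalityI subsetI)
  fix w assume "w \<in> orbit push (A z)"
  then show "w \<in> A ` orbit \<phi> z" by (auto simp: orbit_def push_def)
next
  fix w assume "w \<in> A ` orbit \<phi> z"
  then obtain s where "w = push (s / c) (A z)" by (auto simp: orbit_def push_divide)
  then show "w \<in> orbit push (A z)" by (simp add: orbit_def)
qed

lemma tangent_space_image:
  assumes "Y (A z) \<in> tangent_space (A ` S) (A z)" "z \<in> W"
  shows "X z \<in> tangent_space S z"
proof -
  obtain e \<gamma> where e: "e > 0" "smooth_on {-e<..<e} \<gamma>" "\<gamma> ` {-e<..<e} \<subseteq> A ` S" "\<gamma> (0::real) = A z"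
    "(\<gamma> has_vector_derivative Y (A z)) (at 0)"
    using assms(1) unfolding tangent_space_def by blast
  define g where "g s = Ai (\<gamma> (s / c))" for s
  have sc: "s / c \<in> {-e<..<e}" if "s \<in> {-(c * e)<..<c * e}" for s
    using that c by (auto simp: field_simps)
  have "smooth_on {-(c * e)<..<c * e} (\<lambda>s. s / c)"
    by (rule smooth_on_bounded_linear[OF bounded_linear_divide open_greaterThanLessThan
          smooth_on_id[OF open_greaterThanLessThan]])
  from smooth_on_compose[OF open_greaterThanLessThan open_greaterThanLessThan sc e(2) this]
  have "smooth_on {-(c * e)<..<c * e} g" unfolding g_def[abs_def]
    by (rule smooth_on_bounded_linear[OF bl(2) open_greaterThanLessThan])
  moreover have "g ` {-(c * e)<..<c * e} \<subseteq> S"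
  proof
    fix w assume "w \<in> g ` {-(c * e)<..<c * e}"
    then obtain s where s: "s \<in> {-(c * e)<..<c * e}" "w = g s" by blast
    then have "\<gamma> (s / c) \<in> A ` S" using e(3) sc by blast
    then show "w \<in> S" using s(2) by (auto simp: g_def)
  qed
  moreover have "g 0 = z" using e(4) by (simp add: g_def)
  moreover have "(g has_vector_derivative X z) (at 0)"
  proof -
    have "((\<lambda>s. s / c) has_vector_derivative 1 / c) (at 0)"
      unfolding has_real_derivative_iff_has_vector_derivative[symmetric]
      using c by (auto intro!: derivative_eq_intros)
    moreover have "(\<gamma> has_vector_derivative Y (A z)) (at (0 / c))" using e(5) by simp
    ultimately have "(\<gamma> \<circ> (\<lambda>s. s / c) has_vector_derivative (1 / c) *\<^sub>R Y (A z)) (at 0)"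
      by (rule vector_diff_chain_at)
    from bounded_linear.has_vector_derivative[OF bl(2) this]
    have "(g has_vector_derivative Ai ((1 / c) *\<^sub>R Y (A z))) (at 0)" by (simp add: g_def[abs_def] o_def)
    moreover have "Ai ((1 / c) *\<^sub>R Y (A z)) = X z" using Y[OF assms(2)] c by simp
    ultimately show ?thesis by simp
  qed
  moreover have "c * e > 0" using c e(1) by simp
  ultimately show ?thesis unfolding tangent_space_def by blast
qed

lemma global_disklike_surface_of_section_image:
  assumes "global_disklike_surface_of_section M X \<phi> D"
  shows "global_disklike_surface_of_section (A ` M) Y push (A ` D)"
proof -
  obtain B where D: "D \<subseteq> M" "embedded_closed_disk D B" "periodic_orbit M \<phi> B" "smooth_submanifold 2 (D - B)"
    "\<And>z. z \<in> D - B \<Longrightarrow> X z \<notin> tangent_space (D - B) z"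
    "\<And>z. z \<in> M \<Longrightarrow> orbit \<phi> z \<noteq> B \<Longrightarrow> (\<exists>t>0. \<phi> t z \<in> D - B) \<and> (\<exists>t<0. \<phi> t z \<in> D - B)"
    using assms unfolding global_disklike_surface_of_section_def by blast
  have inj: "inj A" using inv(1) by (metis injI)
  have diff: "A ` D - A ` B = A ` (D - B)" by (simp add: image_set_diff[OF inj])
  have "embedded_closed_disk (A ` D) (A ` B)"
  proof -
    obtain h g where h: "homeomorphism (cball (0::complex) 1) D h g" "B = h ` sphere 0 1"
      using D(2) by (auto simp: embedded_closed_disk_def)
    have "homeomorphism (cball 0 1) (A ` D) (A \<circ> h) (g \<circ> Ai)"
      by (rule homeomorphism_compose[OF h(1) homeomorphism_symD[OF homeo]])
    moreover have "A ` B = (A \<circ> h) ` sphere 0 1" unfolding h(2) image_comp ..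
    ultimately show ?thesis unfolding embedded_closed_disk_def by blast
  qed
  moreover have "periodic_orbit (A ` M) push (A ` B)"
  proof -
    obtain z T where z: "z \<in> M" "B = orbit \<phi> z" "T > 0" "\<phi> T z = z"
      using D(3) by (auto simp: periodic_orbit_def)
    have "push (T / c) (A z) = A z" using z(4) c by (simp add: push_def)
    moreover have "T / c > 0" using z(3) c by simp
    ultimately show ?thesis unfolding periodic_orbit_def using z(1,2) orbit_image by blast
  qed
  moreover have "smooth_submanifold 2 (A ` D - A ` B)" unfolding diff by (rule smooth_submanifold_image[OF D(4)])
  moreover have "Y w \<notin> tangent_space (A ` D - A ` B) w" if w: "w \<in> A ` D - A ` B" for w
  proof
    assume *: "Y w \<in> tangent_space (A ` D - A ` B) w"
    obtain z where z: "z \<in> D - B" "w = A z" using w unfolding diff by blast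
    have "z \<in> W" using z D(1) W(2) by blast
    then show False using tangent_space_image[of z "D - B"] * D(5)[OF z(1)] unfolding diff z(2) by blast
  qed
  moreover have "(\<exists>t>0. push t w \<in> A ` D - A ` B) \<and> (\<exists>t<0. push t w \<in> A ` D - A ` B)"
    if w: "w \<in> A ` M" "orbit push w \<noteq> A ` B" for w
  proof -
    obtain z where z: "z \<in> M" "w = A z" using w(1) by blast
    have "orbit \<phi> z \<noteq> B" using w(2) unfolding z(2) orbit_image by blast
    then obtain t s where t: "t > 0" "\<phi> t z \<in> D - B" "s < 0" "\<phi> s z \<in> D - B" using D(6)[OF z(1)] by blast
    have "push (t / c) w \<in> A ` (D - B)" "push (s / c) w \<in> A ` (D - B)"
      unfolding z(2) push_divide using imageI[OF t(2), of A] imageI[OF t(4), of A] .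
    moreover have "t / c > 0" "s / c < 0" using t(1,3) c by (simp_all add: divide_neg_pos)
    ultimately show ?thesis unfolding diff by blast
  qed
  moreover have "A ` D \<subseteq> A ` M" using D(1) by blast
  ultimately show ?thesis unfolding global_disklike_surface_of_section_def by blast
qed

end

end

section \<open>The tidal potential\<close>

text \<open>The potential of the primary at 1 without its constant and linear Taylor terms at 0: the
  constant enters the frequency, and the linear term is cancelled by the momentum shift.\<close>

definition tidal :: "complex \<Rightarrow> real" where "tidal q = 1 / norm (1 - q) - 1 - Re q"
text \<open>This equals \<open>(1 - q) / |1 - q|^3 - 1\<close>. The factorization into inverses
  allows Lipschitz bounds from those of the inverse.\<close>

definition tidal_grad :: "complex \<Rightarrow> complex" where
  "tidal_grad q = inverse (cnj (1 - q)) * of_real (inverse (norm (1 - q))) - 1"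

lemma norm_one_minus_ge: "norm q \<le> 1/2 \<Longrightarrow> 1/2 \<le> norm (1 - q)" for q :: complex
  using norm_triangle_ineq2[of 1 q] by simp

text \<open>With \<open>s = |1 - q|\<close> the function is exactly
  \<open>(s - 1)^2 * (1/2 + 1/s) - |q|^2 / 2\<close>, and \<open>|s - 1| \<le> |q|\<close>. No
  Taylor remainder has to be estimated.\<close>

lemma tidal_bound: assumes "norm q \<le> 1/2" shows "\<bar>tidal q\<bar> \<le> 4 * (norm q)\<^sup>2"
proof -
  define s where "s = norm (1 - q)"
  have s: "1/2 \<le> s" unfolding s_def by (rule norm_one_minus_ge[OF assms])
  have "\<bar>s - 1\<bar> \<le> norm q" unfolding s_def using norm_triangle_ineq3[of "1 - q" 1] by simp
  then have 1: "(s - 1)\<^sup>2 \<le> (norm q)\<^sup>2" using power_mono[of "\<bar>s - 1\<bar>" "norm q" 2] by simp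
  have "s\<^sup>2 = 1 - 2 * Re q + (norm q)\<^sup>2"
    unfolding s_def cmod_power2 by (simp add: power2_eq_square algebra_simps)
  then have re: "Re q = (1 + (norm q)\<^sup>2 - s\<^sup>2) / 2" by simp
  have "tidal q = (s - 1)\<^sup>2 * (1/2 + 1/s) - (norm q)\<^sup>2 / 2"
    unfolding tidal_def s_def[symmetric] re using s by (simp add: field_simps power2_eq_square)
  moreover have "1 / s \<le> 2" using s by (simp add: divide_le_eq)
  then have "(s - 1)\<^sup>2 * (1/2 + 1/s) \<le> (norm q)\<^sup>2 * (5/2)" using 1 s by (intro mult_mono) auto
  moreover have "0 \<le> (s - 1)\<^sup>2 * (1/2 + 1/s)" using s by simp
  moreover have "0 \<le> (norm q)\<^sup>2" by simp
  ultimately show ?thesis by linarith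
qed

lemma inverse_lip:
  fixes a b :: "'a::real_normed_field"
  assumes "1/2 \<le> norm a" "1/2 \<le> norm b" shows "norm (inverse a - inverse b) \<le> 4 * norm (a - b)"
proof -
  have nz: "a \<noteq> 0" "b \<noteq> 0" using assms by auto
  have "norm (inverse a - inverse b) = norm (a - b) / (norm a * norm b)"
    using nz by (simp add: inverse_diff_inverse norm_mult norm_inverse divide_inverse mult_ac)
  also have "\<dots> \<le> norm (a - b) / (1/2 * (1/2))" using assms nz by (intro divide_left_mono mult_mono) auto
  finally show ?thesis by simp
qed

lemma tidal_grad_lip:
  assumes "norm p \<le> 1/2" "norm q \<le> 1/2" shows "norm (tidal_grad p - tidal_grad q) \<le> 16 * norm (p - q)"
proof -
  define a where "a = 1 - p"
  define b where "b = 1 - q"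
  have ab: "1/2 \<le> norm a" "1/2 \<le> norm b"
    unfolding a_def b_def by (intro norm_one_minus_ge assms)+
  have n: "norm (a - b) = norm (p - q)" by (simp add: a_def b_def norm_minus_commute)
  have i2: "inverse (norm x) \<le> 2" if "1/2 \<le> norm x" for x :: complex
    using that by (simp add: inverse_eq_divide divide_le_eq)
  have "norm (inverse (cnj a) - inverse (cnj b)) \<le> 4 * norm (a - b)"
    using inverse_lip[of "cnj a" "cnj b"] ab complex_mod_cnj[of "a - b"] by simp
  moreover have "\<bar>inverse (norm a) - inverse (norm b)\<bar> \<le> 4 * norm (a - b)"
    using inverse_lip[of "norm a" "norm b"] ab norm_triangle_ineq3[of a b] by simp
  ultimately have "norm (inverse (norm a) *\<^sub>R inverse (cnj a) - inverse (norm b) *\<^sub>R inverse (cnj b))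
      \<le> (4 * norm (a - b)) * 2 + 2 * (4 * norm (a - b))"
    using ab i2 by (intro scaleR_diff_le) (auto simp: norm_inverse)
  then show ?thesis
    unfolding tidal_grad_def a_def[symmetric] b_def[symmetric] n[symmetric] by (simp add: scaleR_conv_of_real mult.commute)
qed

lemma tidal_grad_bound: "norm q \<le> 1/2 \<Longrightarrow> norm (tidal_grad q) \<le> 16 * norm q"
  using tidal_grad_lip[of q 0] by (simp add: tidal_grad_def)

lemma tidal_deriv: assumes "norm q < 1" shows "(tidal has_derivative (\<lambda>h. tidal_grad q \<bullet> h)) (at q)"
proof -
  define a where "a = 1 - q"
  have a: "a \<noteq> 0" using assms by (auto simp: a_def)
  have "((\<lambda>q. 1 - q) has_derivative (\<lambda>h. - h)) (at q)" by (auto intro!: derivative_eq_intros)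
  from diff_chain_at[OF this has_derivative_norm[OF a[unfolded a_def]]]
  have n: "((\<lambda>q. norm (1 - q)) has_derivative (\<lambda>h. sgn a \<bullet> - h)) (at q)" by (simp add: o_def a_def inner_commute)
  have "(tidal has_derivative (\<lambda>h. - (inverse (norm a) * (sgn a \<bullet> - h) * inverse (norm a)) - Re h)) (at q)"
    unfolding tidal_def[abs_def] inverse_eq_divide[symmetric]
    using a by (auto intro!: derivative_eq_intros n simp: a_def)
  moreover have "- (inverse (norm a) * (sgn a \<bullet> - h) * inverse (norm a)) - Re h = tidal_grad q \<bullet> h" for h
  proof -
    have "a * cnj a = of_real ((norm a)\<^sup>2)" by (rule complex_norm_square[symmetric])
    then have "inverse (cnj a) = a / of_real ((norm a)\<^sup>2)" using a by (simp add: field_simps)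
    then have "tidal_grad q = (inverse (norm a) ^ 3) *\<^sub>R a - 1"
      by (simp add: tidal_grad_def a_def[symmetric] scaleR_conv_of_real field_simps power2_eq_square power3_eq_cube)
    then show ?thesis
      by (simp add: sgn_div_norm inner_diff_left power3_eq_cube mult_ac)
  qed
  ultimately show ?thesis by simp
qed

lemma tidal_lip:
  assumes "norm p \<le> \<rho>" "norm q \<le> \<rho>" "\<rho> \<le> 1/2" shows "\<bar>tidal p - tidal q\<bar> \<le> 16 * \<rho> * norm (p - q)"
proof -
  have "norm (tidal p - tidal q) \<le> (16 * \<rho>) * norm (p - q)"
  proof (rule differentiable_bound[where S = "cball 0 \<rho>" and f = tidal and f' = "\<lambda>x h. tidal_grad x \<bullet> h"])
    show "convex (cball (0::complex) \<rho>)" "p \<in> cball 0 \<rho>" "q \<in> cball 0 \<rho>" using assms by simp_all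
    fix x :: complex assume x: "x \<in> cball 0 \<rho>"
    then have "norm x < 1" using assms(3) by simp
    then show "(tidal has_derivative (\<lambda>h. tidal_grad x \<bullet> h)) (at x within cball 0 \<rho>)"
      by (rule has_derivative_at_withinI[OF tidal_deriv])
    show "onorm (\<lambda>h. tidal_grad x \<bullet> h) \<le> 16 * \<rho>"
    proof (rule onorm_le)
      fix h
      have "norm (tidal_grad x \<bullet> h) \<le> norm (tidal_grad x) * norm h" by (simp add: Cauchy_Schwarz_ineq2)
      also have "\<dots> \<le> (16 * \<rho>) * norm h"
      proof (rule mult_right_mono)
        have "norm x \<le> 1/2" "norm x \<le> \<rho>" using x assms(3) by simp_all
        then show "norm (tidal_grad x) \<le> 16 * \<rho>" using tidal_grad_bound[of x] by linarith
      qed simp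
      finally show "norm (tidal_grad x \<bullet> h) \<le> 16 * \<rho> * norm h" .
    qed
  qed
  then show ?thesis by simp
qed

lemma tidal_smooth: "smooth_on (ball 0 1) tidal"
proof -
  have "1 - q \<noteq> 0" if "q \<in> ball 0 1" for q :: complex using that by auto
  then show ?thesis unfolding tidal_def[abs_def]
    by (intro smooth_on_diff smooth_on_divide smooth_on_norm smooth_on_Re smooth_on_const smooth_on_id open_ball) auto
qed

context
  fixes a \<beta> :: real
  assumes a: "0 \<le> a" and \<beta>: "0 < \<beta>" "\<beta> \<le> 1/50"
begin

text \<open>The tidal term of \<open>K\<close> divided by \<open>1 - \<mu>\<close>, in scaled
  coordinates where \<open>q = 2 * v^2\<close> becomes \<open>\<beta> * s^2\<close>. Since the tidal
  potential is quadratic in \<open>q\<close>, the term is of order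
  \<open>a * \<beta>^2\<close>.\<close>

definition tf :: "complex \<Rightarrow> real" where "tf s = - a * ((s \<bullet> s) * tidal (of_real \<beta> * s\<^sup>2))"
definition tm :: "complex \<Rightarrow> complex" where
  "tm s = (- a) *\<^sub>R ((2 * tidal (of_real \<beta> * s\<^sup>2)) *\<^sub>R s
    + (s \<bullet> s) *\<^sub>R (cnj (of_real (2 * \<beta>) * s) * tidal_grad (of_real \<beta> * s\<^sup>2)))"

lemma sq_bound: fixes s :: complex assumes "norm s \<le> 5" shows "norm (of_real \<beta> * s\<^sup>2) \<le> 25 * \<beta>" "norm (of_real \<beta> * s\<^sup>2) \<le> 1/2" "s \<bullet> s \<le> 25"
proof -
  have "(norm s)\<^sup>2 \<le> 5\<^sup>2" using assms by (intro power_mono) auto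
  then show "s \<bullet> s \<le> 25" by (simp add: power2_norm_eq_inner)
  have "\<beta> * (norm s)\<^sup>2 \<le> \<beta> * 5\<^sup>2" using \<open>(norm s)\<^sup>2 \<le> 5\<^sup>2\<close> \<beta> by (intro mult_left_mono) auto
  then show 1: "norm (of_real \<beta> * s\<^sup>2) \<le> 25 * \<beta>" using \<beta> by (simp add: norm_mult norm_power)
  then show "norm (of_real \<beta> * s\<^sup>2) \<le> 1/2" using \<beta> by linarith
qed

lemma tidal_sq: assumes "norm s \<le> 5"
  shows "\<bar>tidal (of_real \<beta> * s\<^sup>2)\<bar> \<le> 2500 * \<beta>\<^sup>2" "norm (tidal_grad (of_real \<beta> * s\<^sup>2)) \<le> 400 * \<beta>"
proof -
  have "(norm (of_real \<beta> * s\<^sup>2))\<^sup>2 \<le> (25 * \<beta>)\<^sup>2" by (intro power_mono sq_bound(1)[OF assms]) simp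
  then show "\<bar>tidal (of_real \<beta> * s\<^sup>2)\<bar> \<le> 2500 * \<beta>\<^sup>2"
    using tidal_bound[OF sq_bound(2)[OF assms]] by (simp add: power_mult_distrib)
  show "norm (tidal_grad (of_real \<beta> * s\<^sup>2)) \<le> 400 * \<beta>"
    using tidal_grad_bound[OF sq_bound(2)[OF assms]] sq_bound(1)[OF assms] by linarith
qed

lemma tf_bound: assumes "norm s \<le> 5" shows "\<bar>tf s\<bar> \<le> 150000 * a * \<beta>\<^sup>2"
proof -
  have "\<bar>(s \<bullet> s) * tidal (of_real \<beta> * s\<^sup>2)\<bar> \<le> 25 * (2500 * \<beta>\<^sup>2)"
    unfolding abs_mult using sq_bound(3)[OF assms] tidal_sq(1)[OF assms] by (intro mult_mono) auto
  then have "a * \<bar>(s \<bullet> s) * tidal (of_real \<beta> * s\<^sup>2)\<bar> \<le> a * (150000 * \<beta>\<^sup>2)"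
    using a by (intro mult_left_mono) (auto intro: order_trans)
  then show ?thesis using a by (simp add: tf_def abs_mult)
qed

lemma tm_bound: assumes "norm s \<le> 5" shows "norm (tm s) \<le> 150000 * a * \<beta>\<^sup>2"
proof -
  have 1: "norm ((2 * tidal (of_real \<beta> * s\<^sup>2)) *\<^sub>R s) \<le> (5000 * \<beta>\<^sup>2) * 5"
    unfolding norm_scaleR using tidal_sq(1)[OF assms] assms by (intro mult_mono) auto
  have "norm (cnj (of_real (2 * \<beta>) * s) * tidal_grad (of_real \<beta> * s\<^sup>2)) \<le> (2 * \<beta> * 5) * (400 * \<beta>)"
    unfolding norm_mult complex_mod_cnj norm_of_real
    using tidal_sq(2)[OF assms] assms \<beta> by (intro mult_mono) auto
  then have 2: "norm ((s \<bullet> s) *\<^sub>R (cnj (of_real (2 * \<beta>) * s) * tidal_grad (of_real \<beta> * s\<^sup>2))) \<le> 25 * ((2 * \<beta> * 5) * (400 * \<beta>))"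
    unfolding norm_scaleR[of "s \<bullet> s"] using sq_bound(3)[OF assms] \<beta> by (intro mult_mono) auto
  have "norm (tm s) \<le> a * ((5000 * \<beta>\<^sup>2) * 5 + 25 * ((2 * \<beta> * 5) * (400 * \<beta>)))"
    unfolding tm_def norm_scaleR[of "- a"] using a order_trans[OF norm_triangle_ineq add_mono[OF 1 2]]
    by (intro mult_mono) auto
  also have "\<dots> = 125000 * (a * \<beta>\<^sup>2)" by (simp add: power2_eq_square)
  also have "\<dots> \<le> 150000 * (a * \<beta>\<^sup>2)" using a by (intro mult_right_mono) auto
  finally show ?thesis by (simp add: mult.assoc)
qed

text \<open>The differences of the two summands add up to 145000; 150000 is a common round bound for
  the function, its gradient and this Lipschitz constant.\<close>

lemma tm_lip:
  assumes s: "norm s \<le> 5" and t: "norm t \<le> 5" shows "norm (tm s - tm t) \<le> 150000 * a * \<beta>\<^sup>2 * norm (s - t)"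
proof -
  define D where "D = norm (s - t)"
  have D: "D \<ge> 0" by (simp add: D_def)
  have "s\<^sup>2 - t\<^sup>2 = (s + t) * (s - t)" by (simp add: power2_eq_square algebra_simps)
  then have "norm (s\<^sup>2 - t\<^sup>2) \<le> 10 * D"
    unfolding D_def using s t norm_triangle_ineq[of s t]
    by (simp only: norm_mult) (intro mult_right_mono; simp)
  then have "\<beta> * norm (s\<^sup>2 - t\<^sup>2) \<le> \<beta> * (10 * D)" using \<beta> by (intro mult_left_mono) auto
  then have q: "norm (of_real \<beta> * s\<^sup>2 - of_real \<beta> * t\<^sup>2) \<le> 10 * \<beta> * D"
    using \<beta> by (simp add: norm_mult flip: right_diff_distrib)
  have G: "\<bar>tidal (of_real \<beta> * s\<^sup>2) - tidal (of_real \<beta> * t\<^sup>2)\<bar> \<le> 4000 * \<beta>\<^sup>2 * D"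
  proof -
    have "\<bar>tidal (of_real \<beta> * s\<^sup>2) - tidal (of_real \<beta> * t\<^sup>2)\<bar> \<le>
        16 * (25 * \<beta>) * norm (of_real \<beta> * s\<^sup>2 - of_real \<beta> * t\<^sup>2)"
      using \<beta> by (intro tidal_lip sq_bound(1) s t) simp
    also have "\<dots> \<le> 16 * (25 * \<beta>) * (10 * \<beta> * D)"
      using q \<beta> by (intro mult_left_mono) auto
    also have "\<dots> = 4000 * \<beta>\<^sup>2 * D" by (simp add: power2_eq_square)
    finally show ?thesis .
  qed
  have dG: "norm (tidal_grad (of_real \<beta> * s\<^sup>2) - tidal_grad (of_real \<beta> * t\<^sup>2)) \<le> 160 * \<beta> * D"
    using tidal_grad_lip[OF sq_bound(2)[OF s] sq_bound(2)[OF t]] q by linarith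
  have 1: "norm ((2 * tidal (of_real \<beta> * s\<^sup>2)) *\<^sub>R s - (2 * tidal (of_real \<beta> * t\<^sup>2)) *\<^sub>R t) \<le>
      (8000 * \<beta>\<^sup>2 * D) * 5 + (5000 * \<beta>\<^sup>2) * D"
    by (rule scaleR_diff_le) (use G s tidal_sq(1)[OF t] D_def in auto)
  define x where "x s = cnj (of_real (2 * \<beta>) * s) * tidal_grad (of_real \<beta> * s\<^sup>2)" for s
  have xs: "norm (x s) \<le> 4000 * \<beta>\<^sup>2"
  proof -
    have "norm (x s) \<le> (2 * \<beta> * 5) * (400 * \<beta>)"
      unfolding x_def norm_mult complex_mod_cnj norm_of_real
      using tidal_sq(2)[OF s] s \<beta> by (intro mult_mono) auto
    then show ?thesis by (simp add: power2_eq_square)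
  qed
  have xd: "norm (x s - x t) \<le> 2400 * \<beta>\<^sup>2 * D"
  proof -
    have "x s - x t = cnj (of_real (2 * \<beta>) * (s - t)) * tidal_grad (of_real \<beta> * s\<^sup>2)
       + cnj (of_real (2 * \<beta>) * t) * (tidal_grad (of_real \<beta> * s\<^sup>2) - tidal_grad (of_real \<beta> * t\<^sup>2))"
      by (simp add: x_def algebra_simps)
    also have "norm \<dots> \<le> (2 * \<beta> * D) * (400 * \<beta>) + (2 * \<beta> * 5) * (160 * \<beta> * D)"
    proof (rule order_trans[OF norm_triangle_ineq add_mono])
      show "norm (cnj (of_real (2 * \<beta>) * (s - t)) * tidal_grad (of_real \<beta> * s\<^sup>2)) \<le> (2 * \<beta> * D) * (400 * \<beta>)"
        unfolding norm_mult complex_mod_cnj norm_of_real D_def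
        using tidal_sq(2)[OF s] \<beta> by (intro mult_mono) auto
      show "norm (cnj (of_real (2 * \<beta>) * t) * (tidal_grad (of_real \<beta> * s\<^sup>2) - tidal_grad (of_real \<beta> * t\<^sup>2)))
          \<le> (2 * \<beta> * 5) * (160 * \<beta> * D)"
        unfolding norm_mult complex_mod_cnj norm_of_real
        using dG t \<beta> by (intro mult_mono) auto
    qed
    finally show ?thesis by (simp add: power2_eq_square algebra_simps)
  qed
  have 2: "norm ((s \<bullet> s) *\<^sub>R x s - (t \<bullet> t) *\<^sub>R x t) \<le> (10 * D) * (4000 * \<beta>\<^sup>2) + 25 * (2400 * \<beta>\<^sup>2 * D)"
    by (rule scaleR_diff_le)
      (use inner_self_diff_le[OF s t, of D] xs xd sq_bound(3)[OF t] D_def in auto)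
  have "tm s - tm t = (- a) *\<^sub>R (((2 * tidal (of_real \<beta> * s\<^sup>2)) *\<^sub>R s - (2 * tidal (of_real \<beta> * t\<^sup>2)) *\<^sub>R t)
      + ((s \<bullet> s) *\<^sub>R x s - (t \<bullet> t) *\<^sub>R x t))"
    by (simp add: tm_def x_def algebra_simps)
  also have "norm \<dots> \<le> a * (((8000 * \<beta>\<^sup>2 * D) * 5 + (5000 * \<beta>\<^sup>2) * D) + ((10 * D) * (4000 * \<beta>\<^sup>2) + 25 * (2400 * \<beta>\<^sup>2 * D)))"
    unfolding norm_scaleR[of "- a"] using a order_trans[OF norm_triangle_ineq add_mono[OF 1 2]]
    by (intro mult_mono) auto
  also have "\<dots> = 145000 * (a * \<beta>\<^sup>2 * D)" by (simp add: algebra_simps)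
  also have "\<dots> \<le> 150000 * (a * \<beta>\<^sup>2 * D)" using a D by (intro mult_right_mono) auto
  finally show ?thesis unfolding D_def by (simp add: mult.assoc)
qed

lemma tf_deriv: assumes s: "norm s \<le> 5" shows "(tf has_derivative (\<lambda>h. tm s \<bullet> h)) (at s)"
proof -
  have "((\<lambda>s. of_real \<beta> * s\<^sup>2) has_derivative (\<lambda>h. of_real (2 * \<beta>) * s * h)) (at s)"
    by (auto intro!: derivative_eq_intros)
  moreover have "norm (of_real \<beta> * s\<^sup>2) < 1" using sq_bound(2)[OF s] by linarith
  ultimately have t: "((\<lambda>s. tidal (of_real \<beta> * s\<^sup>2)) has_derivative
      (\<lambda>h. tidal_grad (of_real \<beta> * s\<^sup>2) \<bullet> (of_real (2 * \<beta>) * s * h))) (at s)"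
    using diff_chain_at[OF _ tidal_deriv] by (fastforce simp: o_def)
  have i: "((\<lambda>s::complex. s \<bullet> s) has_derivative (\<lambda>h. 2 * (s \<bullet> h))) (at s)"
    by (auto intro!: derivative_eq_intros simp: inner_commute)
  have "(tf has_derivative (\<lambda>h. - a * ((s \<bullet> s) * (tidal_grad (of_real \<beta> * s\<^sup>2) \<bullet> (of_real (2 * \<beta>) * s * h))
      + 2 * (s \<bullet> h) * tidal (of_real \<beta> * s\<^sup>2)))) (at s)"
    unfolding tf_def[abs_def]
    by (intro has_derivative_mult_right has_derivative_mult i t)
  moreover have "(\<lambda>h. - a * ((s \<bullet> s) * (tidal_grad (of_real \<beta> * s\<^sup>2) \<bullet> (of_real (2 * \<beta>) * s * h))
      + 2 * (s \<bullet> h) * tidal (of_real \<beta> * s\<^sup>2))) = (\<lambda>h. tm s \<bullet> h)"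
  proof
    fix h
    have "tidal_grad (of_real \<beta> * s\<^sup>2) \<bullet> (of_real (2 * \<beta>) * s * h) =
        (cnj (of_real (2 * \<beta>) * s) * tidal_grad (of_real \<beta> * s\<^sup>2)) \<bullet> h"
      by (simp add: inner_complex_def algebra_simps)
    then show "- a * ((s \<bullet> s) * (tidal_grad (of_real \<beta> * s\<^sup>2) \<bullet> (of_real (2 * \<beta>) * s * h))
      + 2 * (s \<bullet> h) * tidal (of_real \<beta> * s\<^sup>2)) = tm s \<bullet> h"
      unfolding tm_def by (simp only: inner_add_left inner_scaleR_left) (simp add: algebra_simps)
  qed
  ultimately show ?thesis by simp
qed

lemma tf_smooth: "smooth_on (ball 0 5) tf"
proof -
  have o: "open (ball (0::complex) 5)" by simp
  have "smooth_on (ball 0 5) (\<lambda>s. tidal (of_real \<beta> * s\<^sup>2))"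
  proof (rule smooth_on_compose[OF o open_ball _ tidal_smooth])
    show "of_real \<beta> * s\<^sup>2 \<in> ball 0 1" if "s \<in> ball 0 5" for s :: complex
      using sq_bound(2)[of s] that by simp
  qed (intro smooth_on_mult smooth_on_power smooth_on_const smooth_on_id o)
  then show ?thesis unfolding tf_def[abs_def]
    by (intro smooth_on_mult smooth_on_inner smooth_on_const smooth_on_id o)
qed

lemma tidal_cnj: "tidal (cnj q) = tidal q" "tidal_grad (cnj q) = cnj (tidal_grad q)"
proof -
  have "1 - cnj q = cnj (1 - q)" by simp
  then have "norm (1 - cnj q) = norm (1 - q)" by (simp only: complex_mod_cnj)
  then show "tidal (cnj q) = tidal q" "tidal_grad (cnj q) = cnj (tidal_grad q)"
    by (simp_all add: tidal_def tidal_grad_def)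
qed

lemma tf_tm_sym: "tf (cnj s) = tf s" "tf (- s) = tf s" "tm (cnj s) = cnj (tm s)" "tm (- s) = - tm s"
proof -
  have i: "cnj s \<bullet> cnj s = s \<bullet> s" by (simp add: inner_complex_def)
  have q: "of_real \<beta> * (cnj s)\<^sup>2 = cnj (of_real \<beta> * s\<^sup>2)" by simp
  show "tf (cnj s) = tf s" unfolding tf_def i q tidal_cnj ..
  show "tm (cnj s) = cnj (tm s)" unfolding tm_def i q tidal_cnj by (simp add: scaleR_conv_of_real)
  show "tf (- s) = tf s" "tm (- s) = - tm s" by (simp_all add: tf_def tm_def algebra_simps)
qed

lemma tidal_hopf_perturbation:
  assumes "0 < \<kappa>" "\<kappa> \<le> \<delta>" "\<delta> \<le> 1 / 10^6" "150000 * a * \<beta>\<^sup>2 \<le> \<delta> * \<kappa>"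
  shows "hopf_perturbation \<kappa> \<delta> tf tm"
proof
  fix s t :: complex assume s: "s \<in> ball 0 5"
  then have s5: "norm s \<le> 5" by simp
  show "(tf has_derivative (\<lambda>h. tm s \<bullet> h)) (at s)" by (rule tf_deriv[OF s5])
  show "\<bar>tf s\<bar> \<le> \<delta> * \<kappa>" "norm (tm s) \<le> \<delta> * \<kappa>"
    using tf_bound[OF s5] tm_bound[OF s5] assms(4) by linarith+
  assume t: "t \<in> ball 0 5"
  then have t5: "norm t \<le> 5" by simp
  show "norm (tm s - tm t) \<le> \<delta> * \<kappa> * norm (s - t)"
    using tm_lip[OF s5 t5] mult_right_mono[OF assms(4) norm_ge_zero[of "s - t"]] by linarith
qed (use assms tf_smooth tf_tm_sym in auto)

end

section \<open>The regularized problem near the light primary\<close>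

locale levi_civita =
  fixes c \<mu> :: real
  assumes \<mu>: "0 < \<mu>" "\<mu> < 1" and c: "3/2 < c"
begin

text \<open>\<open>\<omega>^2 / 2\<close> is the coefficient of \<open>|v|^2\<close> after the
  momentum shift, \<open>r\<close> the radius of the collision circle, and \<open>kap\<close> the
  strength of the Coriolis term once the energy is divided by \<open>1 - \<mu>\<close>.\<close>

definition \<omega> where "\<omega> = sqrt (2 * (c - \<mu>\<^sup>2 / 2 - \<mu>))"
definition r where "r = sqrt (1 - \<mu>)"
definition \<beta> where "\<beta> = (1 - \<mu>) / (2 * \<omega>\<^sup>2)"
definition kap where "kap = \<beta> / \<omega>"
definition a where "a = \<mu> / (4 * \<omega>\<^sup>2)"

lemma \<omega>: "2 * (c - 3/2) \<le> \<omega>\<^sup>2" "0 < \<omega>" "\<omega>\<^sup>2 = 2 * (c - \<mu>\<^sup>2 / 2 - \<mu>)"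
proof -
  have "\<mu>\<^sup>2 \<le> 1\<^sup>2" using \<mu> by (intro power_mono) auto
  then have 1: "2 * (c - 3/2) \<le> 2 * (c - \<mu>\<^sup>2 / 2 - \<mu>)" using \<mu> by simp
  have 2: "0 < 2 * (c - \<mu>\<^sup>2 / 2 - \<mu>)" by (rule less_le_trans[OF _ 1]) (use c in simp)
  show 3: "\<omega>\<^sup>2 = 2 * (c - \<mu>\<^sup>2 / 2 - \<mu>)" unfolding \<omega>_def by (rule real_sqrt_pow2[OF less_imp_le[OF 2]])
  show "2 * (c - 3/2) \<le> \<omega>\<^sup>2" unfolding 3 by (rule 1)
  show "0 < \<omega>" unfolding \<omega>_def using 2 by (rule real_sqrt_gt_zero)
qed

lemma r: "0 < r" "r\<^sup>2 = 1 - \<mu>" using \<mu> by (simp_all add: r_def)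

lemma pos: "0 < \<beta>" "0 < kap" "0 < a"
  using \<mu> \<omega>(2) by (simp_all add: \<beta>_def kap_def a_def)

text \<open>Besides rescaling, the coordinate change contains the momentum shift \<open>u \<mapsto> u - \<i>\<mu> cnj v\<close>, i.e.
  \<open>p \<mapsto> p - \<i>\<mu>\<close>, which absorbs the motion of the light primary in the rotating frame.\<close>

definition cv where "cv z = of_real (r / (2 * \<omega>)) * (fst z + snd z)"
definition cu where "cu z = \<i> * of_real (r / 2) * (fst z - snd z)"
definition A :: "complex \<times> complex \<Rightarrow> complex \<times> complex" where
  "A z = (cv z, cu z + \<i> * of_real \<mu> * cnj (cv z))"
definition Ai :: "complex \<times> complex \<Rightarrow> complex \<times> complex" where
  "Ai w = ((of_real \<omega> * fst w - \<i> * (snd w - \<i> * of_real \<mu> * cnj (fst w))) / of_real r,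
     (of_real \<omega> * fst w + \<i> * (snd w - \<i> * of_real \<mu> * cnj (fst w))) / of_real r)"

sublocale linear_change A Ai
proof (rule linear_change.intro)
  have cv: "cv (x + y) = cv x + cv y" "cv (t *\<^sub>R x) = t *\<^sub>R cv x"
    and cu: "cu (x + y) = cu x + cu y" "cu (t *\<^sub>R x) = t *\<^sub>R cu x" for x y t
    by (simp_all del: of_real_divide of_real_mult add: cv_def cu_def scaleR_conv_of_real algebra_simps)
  show "linear A" unfolding linear_iff
    by (simp add: A_def cv cu prod_eq_iff algebra_simps scaleR_conv_of_real)
  show "linear Ai" unfolding linear_iff
    by (simp add: Ai_def prod_eq_iff algebra_simps scaleR_conv_of_real add_divide_distrib diff_divide_distrib)
  have nz: "complex_of_real r \<noteq> 0" "complex_of_real \<omega> \<noteq> 0" using r(1) \<omega>(2) by auto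
  show "Ai (A z) = z" for z
  proof -
    have 1: "snd (A z) - \<i> * of_real \<mu> * cnj (fst (A z)) = cu z" by (simp add: A_def)
    have 2: "of_real \<omega> * fst (A z) = of_real (r / 2) * (fst z + snd z)"
      using nz by (simp add: A_def cv_def field_simps)
    have 3: "\<i> * cu z = - (of_real (r / 2) * (fst z - snd z))" by (simp add: cu_def mult.assoc[symmetric])
    have "Ai (A z) = ((of_real (r / 2) * (fst z + snd z) + of_real (r / 2) * (fst z - snd z)) / of_real r,
        (of_real (r / 2) * (fst z + snd z) - of_real (r / 2) * (fst z - snd z)) / of_real r)"
      unfolding Ai_def 1 2 3 by simp
    also have "\<dots> = z" using nz by (simp add: prod_eq_iff field_simps)
    finally show ?thesis .
  qed
  show "A (Ai w) = w" for w
  proof -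
    define x where "x = snd w - \<i> * of_real \<mu> * cnj (fst w)"
    have w: "fst (Ai w) = (of_real \<omega> * fst w - \<i> * x) / of_real r" "snd (Ai w) = (of_real \<omega> * fst w + \<i> * x) / of_real r"
      by (simp_all add: Ai_def x_def)
    have v: "cv (Ai w) = fst w" unfolding cv_def w using nz by (simp add: field_simps)
    have "cu (Ai w) = x" unfolding cu_def w using nz by (simp add: field_simps)
    then show ?thesis by (simp add: A_def v prod_eq_iff x_def)
  qed
qed

text \<open>The shift cancels the term \<open>\<mu> * Im (u * v)\<close> and lowers the coefficient
  of \<open>|v|^2\<close> by \<open>\<mu>^2 / 2\<close>. In the Coriolis term it produces
  \<open>2 * \<mu> * |v|^2 * Re (v^2)\<close>, which cancels the linear part of the potential of the
  primary at 1.\<close>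

lemma K_shift:
  "K \<mu> c (v, w + \<i> * of_real \<mu> * cnj v) = (1/2) * (w \<bullet> w) + 2 * (v \<bullet> v) * (w \<bullet> (\<i> * v)) + (\<omega>\<^sup>2 / 2) * (v \<bullet> v)
     - (1 - \<mu>) / 2 - \<mu> * ((v \<bullet> v) * tidal (2 * v\<^sup>2))"
proof -
  define N where "N = inverse (norm (2 * v\<^sup>2 - 1))"
  have N: "1 / norm (1 - 2 * v\<^sup>2) = N" "x / norm (2 * v\<^sup>2 - 1) = x * N" for x
    by (simp_all add: N_def norm_minus_commute divide_inverse)
  show ?thesis
    unfolding K_def prod.case tidal_def N \<omega>(3) cmod_power2 inner_complex_def
    by (simp add: power2_eq_square field_simps)
qed

text \<open>The shift is symplectic, so its contributions cancel. The letters \<open>b\<close> and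
  \<open>h\<close> stand for \<open>r / (2 * \<omega>)\<close> and \<open>r / 2\<close> and keep the
  identity free of divisions.\<close>

lemma symp_scaled:
  fixes b h :: real
  shows "symp (\<omega> *\<^sub>R (of_real b * (\<i> * p - \<i> * q), \<i> * of_real h * (\<i> * p + \<i> * q) + \<i> * of_real \<mu> * cnj (of_real b * (\<i> * p - \<i> * q))))
     (of_real b * (x + y), \<i> * of_real h * (x - y) + \<i> * of_real \<mu> * cnj (of_real b * (x + y))) =
     2 * \<omega> * b * h * (p \<bullet> x + q \<bullet> y)"
  by (simp add: symp_def inner_complex_def scaleR_conv_of_real algebra_simps)

text \<open>In the new coordinates the symplectic form is a multiple of the standard form in the
  first variable minus that in the second. This explains the opposite rotations; \<omega> is the
  ratio of the two time scales.\<close>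

lemma symp_A: "symp (\<omega> *\<^sub>R A (\<i> * p, - (\<i> * q))) (A z) = (1 - \<mu>) * ((1/2) * (p \<bullet> fst z + q \<bullet> snd z))"
proof -
  have "A (\<i> * p, - (\<i> * q)) = (of_real (r / (2 * \<omega>)) * (\<i> * p - \<i> * q),
      \<i> * of_real (r / 2) * (\<i> * p + \<i> * q) + \<i> * of_real \<mu> * cnj (of_real (r / (2 * \<omega>)) * (\<i> * p - \<i> * q)))"
    by (simp add: A_def cv_def cu_def)
  moreover have "A z = (of_real (r / (2 * \<omega>)) * (fst z + snd z),
      \<i> * of_real (r / 2) * (fst z - snd z) + \<i> * of_real \<mu> * cnj (of_real (r / (2 * \<omega>)) * (fst z + snd z)))"
    by (simp add: A_def cv_def cu_def)
  ultimately have "symp (\<omega> *\<^sub>R A (\<i> * p, - (\<i> * q))) (A z) = 2 * \<omega> * (r / (2 * \<omega>)) * (r / 2) * (p \<bullet> fst z + q \<bullet> snd z)"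
    by (simp only: symp_scaled)
  also have "2 * \<omega> * (r / (2 * \<omega>)) * (r / 2) = (1 - \<mu>) / 2" using \<omega>(2) r(2) by (simp add: power2_eq_square)
  finally show ?thesis by simp
qed

end

section \<open>Identification with a perturbed Hopf flow\<close>

locale levi_civita_small = levi_civita c \<mu> for c \<mu> +
  fixes \<delta> :: real
  assumes \<delta>0: "0 < \<delta>" "\<delta> \<le> 1 / 10^6" and \<beta>: "\<beta> \<le> 1/50" "\<beta> \<le> \<delta> * \<omega> / 10^5"
begin

abbreviation F where "F \<equiv> tf a \<beta>"
abbreviation F' where "F' \<equiv> tm a \<beta>"

text \<open>The tidal size \<open>150000 * a * \<beta>^2\<close> carries one power of \<beta> more
  than \<open>kap = \<beta> / \<omega>\<close>. The bound
  \<open>\<beta> \<le> \<delta> * \<omega> / 10^5\<close> converts this power into \<delta>, with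
  factor \<open>37500 / 10^5\<close> to spare.\<close>

lemma hopf: "hopf_perturbation kap \<delta> F F'"
proof (rule tidal_hopf_perturbation)
  show "0 \<le> a" "0 < \<beta>" "\<beta> \<le> 1/50" "0 < kap" "\<delta> \<le> 1 / 10^6" using pos \<beta> \<delta>0 by simp_all
  have "0 < \<delta> * \<omega>" using \<delta>0(1) \<omega>(2) by (rule mult_pos_pos)
  then have "\<beta> \<le> \<delta> * \<omega>" using \<beta>(2) by (elim order_trans) (simp add: divide_le_eq)
  then show "kap \<le> \<delta>" using \<omega>(2) by (simp add: kap_def divide_le_eq)
  have "150000 * a * \<beta>\<^sup>2 = 37500 * \<mu> * (\<beta> * \<beta>) / \<omega>\<^sup>2" by (simp add: a_def power2_eq_square)
  also have "\<dots> \<le> 37500 * 1 * (\<beta> * (\<delta> * \<omega> / 10^5)) / \<omega>\<^sup>2"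
    using \<beta>(2) \<mu> pos \<delta>0 \<omega>(2) by (intro divide_right_mono mult_mono mult_left_mono) auto
  also have "\<dots> = 37500 / 10^5 * (\<delta> * kap)" using \<omega>(2) by (simp add: kap_def power2_eq_square)
  also have "\<dots> \<le> 1 * (\<delta> * kap)" using pos \<delta>0 by (intro mult_right_mono) auto
  finally show "150000 * a * \<beta>\<^sup>2 \<le> \<delta> * kap" by simp
qed

sublocale h: hopf_perturbation kap \<delta> F F' by (rule hopf)

lemma cv_sq: "2 * (cv z)\<^sup>2 = of_real \<beta> * (h.sg z)\<^sup>2"
proof -
  have "2 * (r / (2 * \<omega>))\<^sup>2 = \<beta>" using r(2) \<omega>(2) by (simp add: \<beta>_def power_divide power_mult_distrib field_simps)
  then have "2 * (of_real (r / (2 * \<omega>)))\<^sup>2 = complex_of_real \<beta>" by (metis of_real_mult of_real_numeral of_real_power)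
  then show ?thesis by (simp del: of_real_divide of_real_mult add: cv_def h.sg_def power_mult_distrib)
qed

text \<open>The scaling gives kinetic and potential part the same coefficient, so that
  \<open>|z1 - z2|^2 / 8 + |z1 + z2|^2 / 8\<close> is the pair of oscillators
  \<open>(|z1|^2 + |z2|^2) / 4\<close>.\<close>

lemma K_A: "K \<mu> c (A z) = (1 - \<mu>) * h.k z"
proof -
  define b where "b = r / (2 * \<omega>)"
  obtain x y where z: "z = (x, y)" by (cases z)
  have vv: "cv z \<bullet> cv z = b\<^sup>2 * (h.sg z \<bullet> h.sg z)"
    unfolding cv_def h.sg_def b_def[symmetric] by (simp add: inner_complex_def power2_eq_square algebra_simps)
  have uu: "cu z \<bullet> cu z = (1 - \<mu>) / 4 * ((x - y) \<bullet> (x - y))"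
    unfolding cu_def r(2)[symmetric] z by (simp add: inner_complex_def power2_eq_square field_simps)
  have uv: "cu z \<bullet> (\<i> * cv z) = (r / 2) * b * h.dg z"
    unfolding cu_def cv_def h.dg_def b_def[symmetric] z by (simp add: inner_complex_def field_simps)
  have b2: "b\<^sup>2 = (1 - \<mu>) / (4 * \<omega>\<^sup>2)" using r(2) by (simp add: b_def power_divide power_mult_distrib)
  have "K \<mu> c (A z) = (1/2) * (cu z \<bullet> cu z) + 2 * (cv z \<bullet> cv z) * (cu z \<bullet> (\<i> * cv z)) + (\<omega>\<^sup>2 / 2) * (cv z \<bullet> cv z)
     - (1 - \<mu>) / 2 - \<mu> * ((cv z \<bullet> cv z) * tidal (2 * (cv z)\<^sup>2))"
    unfolding A_def by (rule K_shift)
  also have "\<dots> = (1/2) * ((1 - \<mu>) / 4 * ((x - y) \<bullet> (x - y))) + (1 - \<mu>) * (kap / 4 * ((h.sg z \<bullet> h.sg z) * h.dg z))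
      + (1 - \<mu>) / 8 * (h.sg z \<bullet> h.sg z) - (1 - \<mu>) / 2 + (1 - \<mu>) * F (h.sg z)"
  proof -
    have c1: "2 * (cv z \<bullet> cv z) * (cu z \<bullet> (\<i> * cv z)) = (1 - \<mu>) * (kap / 4 * ((h.sg z \<bullet> h.sg z) * h.dg z))"
    proof -
      have rb: "(r / 2) * b = (1 - \<mu>) / (4 * \<omega>)" using r(2) by (simp add: b_def power2_eq_square)
      have rat: "2 * (m / (4 * x)) * (m / (4 * y)) = m * (m / (2 * x) / y / 4)" for m x y :: real by simp
      have "2 * b\<^sup>2 * ((r / 2) * b) = (1 - \<mu>) * (kap / 4)"
        unfolding b2 rb kap_def \<beta>_def by (rule rat)
      moreover have "2 * (b\<^sup>2 * S) * (r / 2 * b * D) = (2 * b\<^sup>2 * (r / 2 * b)) * (S * D)" for S D by (simp only: mult_ac)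
      ultimately show ?thesis unfolding vv uv by (simp only: mult.assoc)
    qed
    have c2: "(\<omega>\<^sup>2 / 2) * (cv z \<bullet> cv z) = (1 - \<mu>) / 8 * (h.sg z \<bullet> h.sg z)"
      unfolding vv b2 using \<omega>(2) by simp
    have "a * (1 - \<mu>) = \<mu> * b\<^sup>2" by (simp add: a_def b2)
    then have c3: "\<mu> * ((cv z \<bullet> cv z) * tidal (2 * (cv z)\<^sup>2)) = - ((1 - \<mu>) * F (h.sg z))"
      unfolding vv cv_sq tf_def[OF less_imp_le[OF pos(3)] pos(1) \<beta>(1)] by (simp add: mult_ac)
    show ?thesis unfolding uu c1 c2 c3 by simp
  qed
  also have "\<dots> = (1 - \<mu>) * h.k z"
    unfolding h.k_def h.P_def z h.sg_def by (simp add: inner_simps inner_commute field_simps)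
  finally show ?thesis .
qed

lemma hamiltonian_vf_A: assumes "z \<in> ball 0 3" shows "hamiltonian_vf (K \<mu> c) (A z) = \<omega> *\<^sub>R A (h.X z)"
proof (rule hamiltonian_vf_eqI)
  have "(Ai has_derivative Ai) (at (A z))" by (rule bounded_linear_imp_has_derivative[OF bl(2)])
  moreover have "(h.k has_derivative h.Dk z) (at (Ai (A z)))" using h.k_deriv[of z] assms by simp
  ultimately have "(h.k \<circ> Ai has_derivative h.Dk z \<circ> Ai) (at (A z))" by (rule diff_chain_at)
  from has_derivative_mult_right[OF this, of "1 - \<mu>"]
  have "((\<lambda>w. (1 - \<mu>) * h.k (Ai w)) has_derivative (\<lambda>h. (1 - \<mu>) * h.Dk z (Ai h))) (at (A z))"
    by (simp add: o_def)
  moreover have "(\<lambda>w. (1 - \<mu>) * h.k (Ai w)) = K \<mu> c"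
    using K_A[of "Ai w" for w] by (intro ext) simp
  moreover have "(\<lambda>h. (1 - \<mu>) * h.Dk z (Ai h)) = symp (\<omega> *\<^sub>R A (h.X z))"
  proof
    fix h
    obtain p q where pq: "h.X z = (\<i> * p, - (\<i> * q))" "\<And>h. h.Dk z h = (1/2) * (p \<bullet> fst h + q \<bullet> snd h)"
      by (rule h.gradient_form[of z]) blast
    show "(1 - \<mu>) * h.Dk z (Ai h) = symp (\<omega> *\<^sub>R A (h.X z)) h"
      using symp_A[of p q "Ai h"] unfolding pq by simp
  qed
  ultimately show "(K \<mu> c has_derivative symp (\<omega> *\<^sub>R A (h.X z))) (at (A z))" by simp
qed

text \<open>In this ball \<open>|2 * v^2| \<le> 1/2\<close>, so the collision with the other primary
  stays out of reach and the level set is that of the scaled energy.\<close>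

lemma A_in_K_level: assumes "z \<in> cball 0 3" shows "A z \<in> K_level \<mu> c \<longleftrightarrow> z \<in> h.M"
proof -
  have s: "norm (h.sg z) \<le> 5" by (rule h.norm_sg5[OF assms])
  have "norm (2 * (cv z)\<^sup>2) \<le> 1/2"
    unfolding cv_sq by (rule sq_bound(2)[OF less_imp_le[OF pos(3)] pos(1) \<beta>(1) s])
  then have "norm (2 * (cv z)\<^sup>2) \<noteq> norm (1::complex)" unfolding norm_one by linarith
  then have "2 * (cv z)\<^sup>2 \<noteq> 1" by metis
  moreover have "A z = (fst (A z), snd (A z))" "fst (A z) = cv z" by (simp_all add: A_def)
  ultimately have "A z \<in> K_level \<mu> c \<longleftrightarrow> K \<mu> c (A z) = 0" unfolding K_level_def by (simp add: A_def)
  also have "\<dots> \<longleftrightarrow> h.k z = 0" unfolding K_A using \<mu> by simp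
  finally show ?thesis using assms by (simp add: h.M_def)
qed

text \<open>Within the image of the closed ball of radius 3 the level set is just the image of
  \<open>h.M\<close>, which stays inside the open ball. So it cuts a closed and open piece out of
  the component, and the component is no larger.\<close>

lemma Sigma_comp_image: "Sigma_comp \<mu> c = A ` h.M"
proof -
  define w0 where "w0 = (0::complex, complex_of_real (sqrt (1 - \<mu>)))"
  define C where "C = connected_component_set (K_level \<mu> c) w0"
  have sub: "A ` h.M \<subseteq> K_level \<mu> c"
    using A_in_K_level h.M_norm(4) by (intro image_subsetI) blast
  have cap: "K_level \<mu> c \<inter> A ` cball 0 3 \<subseteq> A ` h.M" using A_in_K_level by auto
  have w0K: "w0 \<in> K_level \<mu> c" using \<mu> by (simp add: w0_def K_level_def K_def)
  have nz: "complex_of_real r \<noteq> 0" using r(1) by simp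
  \<comment> \<open>The base point on the collision circle has norm \<open>sqrt 2\<close> in the new
    coordinates, so it lies in the ball where the level set is known.\<close>
  have "Ai w0 = (- \<i>, \<i>)" using nz by (simp add: Ai_def w0_def r_def[symmetric])
  then have "norm (Ai w0) = sqrt 2" by (simp add: norm_Pair)
  moreover have "sqrt 2 \<le> 3" by (rule real_le_lsqrt) auto
  ultimately have "Ai w0 \<in> cball 0 3" by simp
  then have "w0 \<in> A ` cball 0 3" by (metis imageI inv(2))
  then have w0: "w0 \<in> A ` h.M" using cap w0K by blast
  have "connected (A ` h.M)" by (rule connected_continuous_image[OF cont(1) h.connected_M])
  then have 1: "A ` h.M \<subseteq> C" unfolding C_def by (rule connected_component_maximal[OF w0 _ sub])
  have CK: "C \<subseteq> K_level \<mu> c" unfolding C_def by (rule connected_component_subset)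
  have eq: "C \<inter> A ` h.M = C \<inter> A ` ball 0 3" "C \<inter> A ` h.M = C \<inter> A ` cball 0 3"
  proof -
    have "A ` h.M \<subseteq> A ` ball 0 3" using h.M_ball3 by (intro image_mono) blast
    moreover have "A ` ball 0 3 \<subseteq> A ` cball 0 3" by (intro image_mono ball_subset_cball)
    ultimately show "C \<inter> A ` h.M = C \<inter> A ` ball 0 3" "C \<inter> A ` h.M = C \<inter> A ` cball 0 3"
      using cap CK by blast+
  qed
  have "openin (top_of_set C) (C \<inter> A ` h.M)" unfolding eq(1)
    by (rule openin_open_Int[OF open_image[OF open_ball]])
  moreover have "closedin (top_of_set C) (C \<inter> A ` h.M)" unfolding eq(2)
    by (rule closedin_closed_Int) (intro compact_imp_closed compact_continuous_image cont compact_cball)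
  moreover have "connected C" unfolding C_def by simp
  ultimately have "C \<inter> A ` h.M = {} \<or> C \<inter> A ` h.M = C" unfolding connected_clopen by blast
  moreover have "w0 \<in> C" using 1 w0 by blast
  ultimately have "C \<subseteq> A ` h.M" using w0 by blast
  then have "C = A ` h.M" using 1 by blast
  then show ?thesis unfolding Sigma_comp_eq[OF \<mu>(2)] C_def w0_def .
qed

lemma section_transfer:
  assumes "\<exists>\<phi>. closed_3manifold_with_flow h.M h.X \<phi> \<and> (\<exists>D. global_disklike_surface_of_section h.M h.X \<phi> D)"
  shows "\<exists>\<phi>. closed_3manifold_with_flow (Sigma_comp \<mu> c) (hamiltonian_vf (K \<mu> c)) \<phi> \<and>
    (\<exists>D. global_disklike_surface_of_section (Sigma_comp \<mu> c) (hamiltonian_vf (K \<mu> c)) \<phi> D)"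
proof -
  obtain \<phi> D where \<phi>: "closed_3manifold_with_flow h.M h.X \<phi>" "global_disklike_surface_of_section h.M h.X \<phi> D"
    using assms by blast
  have sub: "h.M \<subseteq> ball 0 3" using h.M_ball3 by blast
  note * = \<omega>(2) open_ball sub hamiltonian_vf_A \<phi>(1)
  show ?thesis unfolding Sigma_comp_image
    using closed_3manifold_with_flow_image[OF *] global_disklike_surface_of_section_image[OF * \<phi>(2)] by blast
qed

end

section \<open>The lowest critical value\<close>

text \<open>The momentum is eliminated: the centrifugal force about the barycentre \<mu> balances
  the attraction of the two primaries.\<close>

definition critical_eq :: "real \<Rightarrow> complex \<Rightarrow> bool" where
  "critical_eq \<mu> q \<longleftrightarrow> q - of_real \<mu> =
    ((1 - \<mu>) / norm q ^ 3) *\<^sub>R q + (\<mu> / norm (q - 1) ^ 3) *\<^sub>R (q - 1)"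

lemma has_derivative_inverse_norm:
  fixes q :: complex assumes "q \<noteq> a"
  shows "((\<lambda>q. 1 / norm (q - a)) has_derivative (\<lambda>h. - ((1 / norm (q - a) ^ 3) *\<^sub>R (q - a) \<bullet> h))) (at q)"
proof -
  have nz: "q - a \<noteq> 0" using assms by simp
  have "((\<lambda>q. q - a) has_derivative (\<lambda>h. h)) (at q)" by (auto intro!: derivative_eq_intros)
  from diff_chain_at[OF this has_derivative_norm[OF nz]]
  have n: "((\<lambda>q. norm (q - a)) has_derivative (\<lambda>h. sgn (q - a) \<bullet> h)) (at q)"
    by (simp add: o_def inner_commute)
  have "((\<lambda>q. inverse (norm (q - a))) has_derivative
      (\<lambda>h. - (inverse (norm (q - a)) * (sgn (q - a) \<bullet> h) * inverse (norm (q - a))))) (at q)"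
    by (rule Deriv.has_derivative_inverse[OF _ n]) (use nz in simp)
  moreover have "- (inverse (norm (q - a)) * (sgn (q - a) \<bullet> h) * inverse (norm (q - a))) =
      - ((1 / norm (q - a) ^ 3) *\<^sub>R (q - a) \<bullet> h)" for h
    by (simp add: sgn_div_norm power3_eq_cube divide_inverse mult_ac)
  ultimately show ?thesis by (simp add: inverse_eq_divide)
qed

lemma H_deriv:
  assumes "q \<noteq> 0" "q \<noteq> 1"
  shows "(H \<mu> has_derivative (\<lambda>h. (p + \<i> * q - \<i> * of_real \<mu>) \<bullet> snd h +
    (((1 - \<mu>) / norm q ^ 3) *\<^sub>R q + (\<mu> / norm (q - 1) ^ 3) *\<^sub>R (q - 1) - \<i> * p) \<bullet> fst h)) (at (q, p))"
proof -
  have fst: "(fst has_derivative fst) (at (q, p))" and snd: "(snd has_derivative snd) (at (q, p))"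
    by (auto intro: bounded_linear_imp_has_derivative bounded_linear_fst bounded_linear_snd)
  have 1: "((\<lambda>z. 1 / norm (fst z)) has_derivative (\<lambda>h. - ((1 / norm q ^ 3) *\<^sub>R q \<bullet> fst h))) (at (q, p))"
    using diff_chain_at[OF fst has_derivative_inverse_norm[of "fst (q, p)" 0]] assms by (simp add: o_def)
  have 2: "((\<lambda>z. 1 / norm (fst z - 1)) has_derivative (\<lambda>h. - ((1 / norm (q - 1) ^ 3) *\<^sub>R (q - 1) \<bullet> fst h))) (at (q, p))"
    using diff_chain_at[OF fst has_derivative_inverse_norm[of "fst (q, p)" 1]] assms by (simp add: o_def)
  have H: "H \<mu> = (\<lambda>z. (1/2) * (snd z \<bullet> snd z) + snd z \<bullet> (\<i> * fst z) - snd z \<bullet> (\<i> * of_real \<mu>)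
            - (1 - \<mu>) * (1 / norm (fst z)) - \<mu> * (1 / norm (fst z - 1)))"
    by (simp add: fun_eq_iff H_def power2_norm_eq_inner)
  have "(H \<mu> has_derivative (\<lambda>h. (1/2) * (p \<bullet> snd h + snd h \<bullet> p) + (p \<bullet> (\<i> * fst h) + snd h \<bullet> (\<i> * q)) - snd h \<bullet> (\<i> * of_real \<mu>)
        - (1 - \<mu>) * (- ((1 / norm q ^ 3) *\<^sub>R q \<bullet> fst h)) - \<mu> * (- ((1 / norm (q - 1) ^ 3) *\<^sub>R (q - 1) \<bullet> fst h)))) (at (q, p))"
    unfolding H
    by (rule has_derivative_eq_rhs, (rule derivative_intros fst snd 1 2)+) (simp add: fun_eq_iff)
  moreover have "(1/2) * (p \<bullet> snd h + snd h \<bullet> p) + (p \<bullet> (\<i> * fst h) + snd h \<bullet> (\<i> * q)) - snd h \<bullet> (\<i> * of_real \<mu>)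
        - (1 - \<mu>) * (- ((1 / norm q ^ 3) *\<^sub>R q \<bullet> fst h)) - \<mu> * (- ((1 / norm (q - 1) ^ 3) *\<^sub>R (q - 1) \<bullet> fst h)) =
    (p + \<i> * q - \<i> * of_real \<mu>) \<bullet> snd h +
    (((1 - \<mu>) / norm q ^ 3) *\<^sub>R q + (\<mu> / norm (q - 1) ^ 3) *\<^sub>R (q - 1) - \<i> * p) \<bullet> fst h" for h
  proof -
    have "p \<bullet> (\<i> * fst h) = - ((\<i> * p) \<bullet> fst h)" by (simp add: inner_complex_def)
    then show ?thesis by (simp add: inner_add_left inner_diff_left inner_commute[of "snd h"])
  qed
  ultimately show ?thesis by simp
qed

lemma critical_points_eq:
  "critical_points_H \<mu> = {(q, p). q \<noteq> 0 \<and> q \<noteq> 1 \<and> p = - \<i> * (q - of_real \<mu>) \<and> critical_eq \<mu> q}"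
proof -
  have "(H \<mu> has_derivative (\<lambda>_. 0)) (at (q, p)) \<longleftrightarrow> p = - \<i> * (q - of_real \<mu>) \<and> critical_eq \<mu> q"
    if q: "q \<noteq> 0" "q \<noteq> 1" for q p
  proof -
    define X where "X = p + \<i> * q - \<i> * of_real \<mu>"
    define Y where "Y = ((1 - \<mu>) / norm q ^ 3) *\<^sub>R q + (\<mu> / norm (q - 1) ^ 3) *\<^sub>R (q - 1) - \<i> * p"
    have d: "(H \<mu> has_derivative (\<lambda>h. X \<bullet> snd h + Y \<bullet> fst h)) (at (q, p))"
      unfolding X_def Y_def by (rule H_deriv[OF q])
    have "(H \<mu> has_derivative (\<lambda>_. 0)) (at (q, p)) \<longleftrightarrow> X = 0 \<and> Y = 0"
    proof
      assume "(H \<mu> has_derivative (\<lambda>_. 0)) (at (q, p))"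
      then have e: "(\<lambda>h. X \<bullet> snd h + Y \<bullet> fst h) = (\<lambda>_. 0)" using has_derivative_unique[OF d] by blast
      show "X = 0 \<and> Y = 0" using fun_cong[OF e, of "(0, X)"] fun_cong[OF e, of "(Y, 0)"] by simp
    qed (use d in simp)
    also have "X = 0 \<longleftrightarrow> p = - \<i> * (q - of_real \<mu>)" unfolding X_def by (auto simp: algebra_simps eq_neg_iff_add_eq_0)
    finally show ?thesis by (auto simp: Y_def critical_eq_def)
  qed
  then show ?thesis unfolding critical_points_H_def by auto
qed

section \<open>Critical points when the primary at 0 is the lighter one\<close>

locale light_earth =
  fixes \<mu> :: real
  assumes \<mu>: "1/2 \<le> \<mu>" "\<mu> < 1"
begin

definition \<epsilon> where "\<epsilon> = 1 - \<mu>"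

lemma \<epsilon>: "0 < \<epsilon>" "\<epsilon> \<le> \<mu>" "\<epsilon> \<le> 1/2" "\<mu> = 1 - \<epsilon>" using \<mu> by (simp_all add: \<epsilon>_def)

text \<open>By the identity for \<open>|q - \<mu>|^2\<close> the value depends only on the distances
  to the two primaries. The function \<open>d^2 / 2 + 1 / d\<close> equals 3/2 at distance 1, which
  is the source of the limit \<open>- 3/2\<close>.\<close>

lemma H_critical:
  "H \<mu> (q, - \<i> * (q - of_real \<mu>)) = \<epsilon> * \<mu> / 2 - \<epsilon> * ((norm q)\<^sup>2 / 2 + 1 / norm q) - \<mu> * ((norm (q - 1))\<^sup>2 / 2 + 1 / norm (q - 1))"
proof -
  have "H \<mu> (q, - \<i> * (q - of_real \<mu>)) = - ((q - of_real \<mu>) \<bullet> (q - of_real \<mu>)) / 2 - \<epsilon> * (1 / norm q) - \<mu> * (1 / norm (q - 1))"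
  proof -
    have n: "(norm (- \<i> * (q - of_real \<mu>)))\<^sup>2 = (q - of_real \<mu>) \<bullet> (q - of_real \<mu>)"
      by (simp add: norm_mult power2_norm_eq_inner)
    have "(- \<i> * (q - of_real \<mu>)) \<bullet> (\<i> * q) - (- \<i> * (q - of_real \<mu>)) \<bullet> (\<i> * of_real \<mu>) =
        - ((q - of_real \<mu>) \<bullet> (q - of_real \<mu>))"
      by (simp add: inner_complex_def algebra_simps)
    then show ?thesis unfolding H_def case_prod_conv n \<epsilon>_def by simp
  qed
  also have "(q - of_real \<mu>) \<bullet> (q - of_real \<mu>) = \<epsilon> * (norm q)\<^sup>2 + \<mu> * (norm (q - 1))\<^sup>2 - \<epsilon> * \<mu>"
    unfolding \<epsilon>_def cmod_power2 by (simp add: inner_complex_def power2_eq_square algebra_simps)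
  finally show ?thesis by (simp add: distrib_left add_divide_distrib diff_divide_distrib)
qed

lemma critical_eq_iff:
  "critical_eq \<mu> q \<longleftrightarrow> (\<epsilon> * (1 - 1 / norm q ^ 3)) *\<^sub>R q + (\<mu> * (1 - 1 / norm (q - 1) ^ 3)) *\<^sub>R (q - 1) = 0"
proof -
  have "q - of_real \<mu> = \<epsilon> *\<^sub>R q + \<mu> *\<^sub>R (q - 1)" by (simp add: \<epsilon>_def scaleR_conv_of_real algebra_simps)
  moreover have "\<epsilon> *\<^sub>R q + \<mu> *\<^sub>R w = (\<epsilon> / a) *\<^sub>R q + (\<mu> / b) *\<^sub>R w \<longleftrightarrow>
      (\<epsilon> * (1 - 1 / a)) *\<^sub>R q + (\<mu> * (1 - 1 / b)) *\<^sub>R w = 0" for w :: complex and a b :: real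
    unfolding right_diff_distrib mult_1_right times_divide_eq_right scaleR_left_diff_distrib
    by (metis add_diff_add eq_iff_diff_eq_0)
  ultimately show ?thesis unfolding critical_eq_def \<epsilon>_def[symmetric] by simp
qed

lemma cube_one: "x ^ 3 = 1 \<Longrightarrow> 0 \<le> x \<Longrightarrow> x = 1" for x :: real
  using power_eq_imp_eq_base[of x 3 1] by simp

text \<open>Off the real axis \<open>q\<close> and \<open>q - 1\<close> are linearly independent
  over the reals, so both coefficients vanish and both distances are 1: the equilateral
  points.\<close>

lemma critical_value_nonreal:
  assumes "critical_eq \<mu> q" "q \<noteq> 0" "q \<noteq> 1" "Im q \<noteq> 0"
  shows "- 3/2 \<le> H \<mu> (q, - \<i> * (q - of_real \<mu>))"
proof -
  define x where "x = \<epsilon> * (1 - 1 / norm q ^ 3)"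
  define y where "y = \<mu> * (1 - 1 / norm (q - 1) ^ 3)"
  have e: "x *\<^sub>R q + y *\<^sub>R (q - 1) = 0" using assms(1) unfolding critical_eq_iff x_def y_def .
  have "(x + y) * Im q = 0" using arg_cong[OF e, of Im] by (simp add: algebra_simps)
  then have xy: "x + y = 0" using assms(4) by simp
  have "(x + y) * Re q = y" using arg_cong[OF e, of Re] by (simp add: algebra_simps)
  then have "y = 0" "x = 0" using xy by auto
  then have "1 / norm (q - 1) ^ 3 = 1" "1 / norm q ^ 3 = 1" using \<epsilon> \<mu> by (auto simp: x_def y_def)
  then have "norm (q - 1) ^ 3 = 1" "norm q ^ 3 = 1" by (simp_all add: divide_eq_1_iff)
  then have "norm (q - 1) = 1" "norm q = 1" using cube_one by auto
  then have "H \<mu> (q, - \<i> * (q - of_real \<mu>)) = \<epsilon> * \<mu> / 2 - \<epsilon> * (3/2) - \<mu> * (3/2)" unfolding H_critical by simp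
  moreover have "0 \<le> \<epsilon> * \<mu> / 2" using \<epsilon> by simp
  ultimately show ?thesis using \<epsilon>(4) by linarith
qed

text \<open>On the real axis the equation says that the attractions, corrected by the centrifugal force, balance. Near
  the light primary this forces \<open>r\<^sup>3\<close> to be of order \<open>\<epsilon>\<close>.\<close>

lemma critical_value_real:
  assumes q: "critical_eq \<mu> (of_real x)" "x \<noteq> 0" "x \<noteq> 1" and \<rho>: "0 < \<rho>" "\<rho> \<le> 1/2" "\<epsilon> \<le> \<rho> ^ 3 / 2"
  shows "- 3/2 - 13 * \<rho> \<le> H \<mu> (of_real x, - \<i> * (of_real x - of_real \<mu>))"
proof -
  define r where "r = \<bar>x\<bar>"
  define s where "s = \<bar>x - 1\<bar>"
  have rs: "norm (complex_of_real x) = r" "norm (complex_of_real x - 1) = s"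
    using norm_of_real[of "x - 1", where 'a = complex] by (simp_all add: r_def s_def)
  have pos: "0 < r" "0 < s" using q by (auto simp: r_def s_def)
  have "complex_of_real (\<epsilon> * (1 - 1 / r ^ 3) * x + \<mu> * (1 - 1 / s ^ 3) * (x - 1)) = 0"
    using q(1) unfolding critical_eq_iff rs by (simp add: scaleR_conv_of_real)
  then have eq: "\<epsilon> * (1 - 1 / r ^ 3) * x + \<mu> * (1 - 1 / s ^ 3) * (x - 1) = 0" unfolding of_real_eq_0_iff .
  have red: "(1 - 1 / t ^ 3) * t = t - 1 / t\<^sup>2" if "0 < t" for t :: real
    using that by (simp add: field_simps power2_eq_square power3_eq_cube)
  have \<rho>3: "\<epsilon> \<le> \<rho>"
  proof -
    have "\<rho> ^ 3 \<le> \<rho> * (1/2)\<^sup>2" using \<rho> power_mono[of \<rho> "1/2" 2] by (simp add: power3_eq_cube power2_eq_square)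
    then show ?thesis using \<rho> by (simp add: power2_eq_square)
  qed
  \<comment> \<open>The excess over 3/2 is below \<open>8 * \<rho>\<close> in each of the three
    cases; 13 is a generous common constant.\<close>
  have main: "\<epsilon> * (r\<^sup>2 / 2 + 1 / r) + \<mu> * (s\<^sup>2 / 2 + 1 / s) \<le> 3/2 + 13 * \<rho>"
  proof -
    \<comment> \<open>This is the source of the cube in the assumption on \<rho>: the premise gives
      \<open>r^3 \<le> \<epsilon> / \<mu> \<le> 2 * \<epsilon>\<close>.\<close>
    have small: "r \<le> \<rho>" if "\<mu> * r \<le> \<epsilon> / r\<^sup>2"
    proof -
      have "\<mu> * r ^ 3 \<le> \<epsilon>" using that pos by (simp add: field_simps power2_eq_square power3_eq_cube)
      moreover have "(1/2) * r ^ 3 \<le> \<mu> * r ^ 3" using \<mu> pos by (intro mult_right_mono) auto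
      ultimately have "r ^ 3 \<le> \<rho> ^ 3" using \<rho>(3) by linarith
      then show ?thesis using \<rho>(1) by (meson not_le power_strict_mono less_imp_le zero_less_numeral)
    qed
    consider "x < 0" | "0 < x" "x < 1" | "1 < x" using q by linarith
    then show ?thesis
    proof cases
      case 1
      then have s: "s = 1 + r" and x: "x = - r" and x1: "x - 1 = - s" by (auto simp: r_def s_def)
      have "\<epsilon> * ((1 - 1 / r ^ 3) * r) + \<mu> * ((1 - 1 / s ^ 3) * s) = 0" using eq unfolding x1 unfolding x mult_minus_right mult.assoc by linarith
      then have b: "\<mu> * (s - 1 / s\<^sup>2) = \<epsilon> / r\<^sup>2 - \<epsilon> * r" unfolding red[OF pos(1)] red[OF pos(2)] by (simp add: algebra_simps)
      have s2: "1 / s\<^sup>2 \<le> 1" using s pos by (simp add: divide_le_eq)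
      have s2': "1 - 2 * r \<le> 1 / s\<^sup>2"
      proof -
        have "(1 - 2 * r) * s\<^sup>2 = 1 - 3 * r\<^sup>2 - 2 * r ^ 3" by (simp add: s power2_eq_square power3_eq_cube algebra_simps)
        also have "\<dots> \<le> 1" using pos zero_le_power[of r 3] zero_le_power2[of r] by linarith
        finally show ?thesis using pos by (simp add: le_divide_eq)
      qed
      have "\<mu> * r \<le> \<mu> * (s - 1 / s\<^sup>2)" using s2 s \<mu> by (intro mult_left_mono) auto
      also have "\<dots> \<le> \<epsilon> / r\<^sup>2" unfolding b using \<epsilon> pos by simp
      finally have r\<rho>: "r \<le> \<rho>" by (rule small)
      have "\<mu> * (s - 1 / s\<^sup>2) \<le> 1 * (3 * r)" using s2' s \<mu> pos s2 by (intro mult_mono) linarith+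
      then have "\<epsilon> / r\<^sup>2 \<le> 3 * r + \<epsilon> * r" unfolding b by linarith
      also have "\<epsilon> * r \<le> 1 * r" using \<epsilon> pos by (intro mult_right_mono) auto
      finally have "\<epsilon> / r\<^sup>2 * r \<le> 4 * r * r" using pos by (intro mult_right_mono) auto
      then have e1: "\<epsilon> * (1 / r) \<le> 4 * r\<^sup>2" using pos by (simp add: power2_eq_square)
      have e2: "\<epsilon> * (r\<^sup>2 / 2) \<le> 1 * (r\<^sup>2 / 2)" using \<epsilon> by (intro mult_right_mono) auto
      have "1 / s \<le> 1" using s pos by (simp add: divide_le_eq)
      then have e3: "\<mu> * (s\<^sup>2 / 2 + 1 / s) \<le> 1 * ((1 + r)\<^sup>2 / 2 + 1)" using \<mu> s pos by (intro mult_mono) auto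
      have e4: "(1 + r)\<^sup>2 = 1 + 2 * r + r\<^sup>2" by (simp add: power2_sum)
      have e5: "r\<^sup>2 \<le> 1 * r" unfolding power2_eq_square using r\<rho> \<rho> pos by (intro mult_right_mono) auto
      have "x2 + x1 + x3 \<le> 3/2 + 13 * \<rho>" if "x1 \<le> 4 * y" "x2 \<le> 1 * (y / 2)" "x3 \<le> 1 * ((1 + 2 * r + y) / 2 + 1)" "y \<le> 1 * r"
        for x1 x2 x3 y :: real using that r\<rho> pos(1) by (simp add: field_simps)
      from this[OF e1 e2 e3[unfolded e4] e5] show ?thesis unfolding distrib_left[of \<epsilon>] .
    next
      case 2
      then have s: "s = 1 - r" and x: "x = r" and x1: "x - 1 = - s" by (auto simp: r_def s_def)
      have "\<epsilon> * ((1 - 1 / r ^ 3) * r) - \<mu> * ((1 - 1 / s ^ 3) * s) = 0" using eq unfolding x1 unfolding x mult_minus_right mult.assoc by linarith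
      then have b: "\<mu> * (1 / s\<^sup>2 - s) = \<epsilon> / r\<^sup>2 - \<epsilon> * r" unfolding red[OF pos(1)] red[OF pos(2)] by (simp add: algebra_simps)
      have "s\<^sup>2 \<le> 1" using s pos by (simp add: power_le_one)
      then have s2: "1 \<le> 1 / s\<^sup>2" using pos by (simp add: le_divide_eq)
      have "\<mu> * r \<le> \<mu> * (1 / s\<^sup>2 - s)" using s2 s \<mu> by (intro mult_left_mono) auto
      also have "\<dots> \<le> \<epsilon> / r\<^sup>2" unfolding b using \<epsilon> pos by simp
      finally have r\<rho>: "r \<le> \<rho>" by (rule small)
      then have s12: "1/2 \<le> s" using s \<rho> by simp
      have i: "1 / s \<le> 1 + 2 * r"
      proof -
        have "(1 + 2 * r) * s = 1 + r * (1 - 2 * r)" by (simp add: s algebra_simps)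
        moreover have "0 \<le> r * (1 - 2 * r)" using r\<rho> \<rho> pos by (intro mult_nonneg_nonneg) auto
        ultimately show ?thesis using pos by (simp add: divide_le_eq)
      qed
      have "1 / s\<^sup>2 \<le> 1 + 8 * r"
      proof -
        have "(1 / s)\<^sup>2 \<le> (1 + 2 * r)\<^sup>2" using i pos by (intro power_mono) auto
        also have "\<dots> = 1 + 4 * r + 4 * r * r" by (simp add: power2_eq_square algebra_simps)
        also have "4 * r * r \<le> 4 * r * 1" using r\<rho> \<rho> pos by (intro mult_left_mono) auto
        finally show ?thesis by (simp add: power_divide)
      qed
      then have "\<mu> * (1 / s\<^sup>2 - s) \<le> 1 * (9 * r)" using s \<mu> pos s2 by (intro mult_mono) linarith+
      then have "\<epsilon> / r\<^sup>2 \<le> 9 * r + \<epsilon> * r" unfolding b by linarith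
      also have "\<epsilon> * r \<le> 1 * r" using \<epsilon> pos by (intro mult_right_mono) auto
      finally have "\<epsilon> / r\<^sup>2 * r \<le> 10 * r * r" using pos by (intro mult_right_mono) auto
      then have e1: "\<epsilon> * (1 / r) \<le> 10 * r\<^sup>2" using pos by (simp add: power2_eq_square)
      have e2: "\<epsilon> * (r\<^sup>2 / 2) \<le> 1/2 * (r\<^sup>2 / 2)" using \<epsilon> by (intro mult_right_mono) auto
      have e3: "\<mu> * (s\<^sup>2 / 2 + 1 / s) \<le> 1 * (1 / 2 + (1 + 2 * r))"
        using \<mu> i pos \<open>s\<^sup>2 \<le> 1\<close> by (intro mult_mono) auto
      have e4: "r\<^sup>2 \<le> 1/2 * r" unfolding power2_eq_square using r\<rho> \<rho> pos by (intro mult_right_mono) auto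
      have "x2 + x1 + x3 \<le> 3/2 + 13 * \<rho>" if "x1 \<le> 10 * y" "x2 \<le> 1/2 * (y / 2)" "x3 \<le> 1 * (1 / 2 + (1 + 2 * r))" "y \<le> 1/2 * r"
        for x1 x2 x3 y :: real using that r\<rho> pos(1) by (simp add: field_simps)
      from this[OF e1 e2 e3 e4] show ?thesis unfolding distrib_left[of \<epsilon>] .
    next
      \<comment> \<open>Beyond the heavy primary the point is not close to 0: it is near distance 1
        from that primary, and the deviation is of order \<epsilon> instead of its cube
        root.\<close>
      case 3
      then have r: "r = 1 + s" and x: "x = r" and x1: "x - 1 = s" by (auto simp: r_def s_def)
      have "\<epsilon> * ((1 - 1 / r ^ 3) * r) + \<mu> * ((1 - 1 / s ^ 3) * s) = 0" using eq unfolding x1 unfolding x mult.assoc by linarith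
      then have b: "\<mu> * (1 / s\<^sup>2 - s) = \<epsilon> * (r - 1 / r\<^sup>2)" unfolding red[OF pos(1)] red[OF pos(2)] by (simp add: algebra_simps)
      have r2: "1 / r\<^sup>2 \<le> 1" using r pos by (simp add: divide_le_eq)
      have "0 < r - 1 / r\<^sup>2" using r2 r pos by linarith
      from mult_pos_pos[OF \<epsilon>(1) this] have "0 < \<mu> * (1 / s\<^sup>2 - s)" unfolding b .
      then have p: "0 < 1 / s\<^sup>2 - s" using \<mu> by (simp add: zero_less_mult_iff)
      have s1: "s < 1"
      proof (rule ccontr)
        assume "\<not> s < 1"
        then have "1 / s\<^sup>2 \<le> 1" by (simp add: divide_le_eq)
        with p \<open>\<not> s < 1\<close> show False by linarith
      qed
      have "(1/2) * (1 / s\<^sup>2 - s) \<le> \<mu> * (1 / s\<^sup>2 - s)" using p \<mu> by (intro mult_right_mono) auto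
      also have "\<dots> \<le> \<epsilon> * 2" unfolding b
      proof (rule mult_left_mono[OF _ less_imp_le[OF \<epsilon>(1)]])
        have "0 \<le> 1 / r\<^sup>2" by simp
        then show "r - 1 / r\<^sup>2 \<le> 2" using r s1 by linarith
      qed
      finally have i1: "(1/2) * (1 / s\<^sup>2 - s) \<le> \<epsilon> * 2" .
      have "x \<le> 4 * e" if "(1/2) * x \<le> e * 2" for x e :: real using that by simp
      from this[OF i1] have i2: "1 / s\<^sup>2 \<le> 1 + 4 * \<epsilon>" using s1 by linarith
      have "s\<^sup>2 \<le> s" using s1 pos by (simp add: power2_eq_square)
      then have "1 / s \<le> 1 / s\<^sup>2" using pos by (intro divide_left_mono) auto
      then have i: "1 / s \<le> 1 + 4 * \<epsilon>" using i2 by linarith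
      have "r\<^sup>2 \<le> 2\<^sup>2" using r s1 pos by (intro power_mono) auto
      moreover have "1 / r \<le> 1" using r pos by (simp add: divide_le_eq)
      ultimately have e1: "\<epsilon> * (r\<^sup>2 / 2 + 1 / r) \<le> \<epsilon> * 3" using \<epsilon> by (intro mult_left_mono) auto
      have "s\<^sup>2 \<le> 1" using s1 pos by (simp add: power_le_one)
      then have e2: "\<mu> * (s\<^sup>2 / 2 + 1 / s) \<le> 1 * (1 / 2 + (1 + 4 * \<epsilon>))" using \<mu> i pos by (intro mult_mono) auto
      have "x + y \<le> 3/2 + 13 * \<rho>" if "x \<le> \<epsilon> * 3" "y \<le> 1 * (1 / 2 + (1 + 4 * \<epsilon>))" for x y
        using that \<rho>3 \<rho>(1) by (simp add: field_simps)
      from this[OF e1 e2] show ?thesis .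
    qed
  qed
  have "0 \<le> \<epsilon> * \<mu> / 2" using \<epsilon> by simp
  then show ?thesis using main unfolding H_critical rs by linarith
qed

lemma equilateral: "critical_eq \<mu> (Complex (1/2) (sqrt 3 / 2))"
proof -
  have "norm (Complex (1/2) (sqrt 3 / 2)) = 1" "norm (Complex (1/2) (sqrt 3 / 2) - 1) = 1"
    by (simp_all add: cmod_def power_divide)
  then show ?thesis unfolding critical_eq_iff by simp
qed

text \<open>Close to one primary only its own attraction is large, and far away both attractions are
  too weak to balance the centrifugal force. So the critical points lie in a compact set that avoids
  the singularities.\<close>

lemma critical_away:
  assumes "critical_eq \<mu> q" "q \<noteq> 0" "q \<noteq> 1"
  shows "norm q \<le> 3" "\<epsilon> \<le> 16 * (norm q)\<^sup>2" "\<epsilon> \<le> 16 * (norm (q - 1))\<^sup>2"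
proof -
  define r where "r = norm q"
  define s where "s = norm (q - 1)"
  have pos: "0 < r" "0 < s" using assms by (auto simp: r_def s_def)
  have n1: "norm ((\<epsilon> / r ^ 3) *\<^sub>R q) = \<epsilon> / r\<^sup>2" and n2: "norm ((\<mu> / s ^ 3) *\<^sub>R (q - 1)) = \<mu> / s\<^sup>2"
    using pos \<epsilon> \<mu> by (simp_all add: r_def[symmetric] s_def[symmetric] power2_eq_square power3_eq_cube)
  have e: "q - of_real \<mu> = (\<epsilon> / r ^ 3) *\<^sub>R q + (\<mu> / s ^ 3) *\<^sub>R (q - 1)"
    using assms(1) unfolding critical_eq_def r_def s_def \<epsilon>_def .
  have qm: "r - 1 \<le> norm (q - of_real \<mu>)" "norm (q - of_real \<mu>) \<le> r + 1"
    using norm_triangle_ineq2[of q "of_real \<mu>"] norm_triangle_ineq4[of q "of_real \<mu>"] \<mu> by (auto simp: r_def)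
  have up: "norm (q - of_real \<mu>) \<le> \<epsilon> / r\<^sup>2 + \<mu> / s\<^sup>2"
    unfolding e using norm_triangle_ineq n1 n2 by metis
  have "\<epsilon> / r\<^sup>2 \<le> norm (q - of_real \<mu>) + \<mu> / s\<^sup>2"
    using norm_triangle_ineq4[of "q - of_real \<mu>" "(\<mu> / s ^ 3) *\<^sub>R (q - 1)"] n1 n2 e by simp
  then have lo1: "\<epsilon> / r\<^sup>2 \<le> r + 1 + \<mu> / s\<^sup>2" using qm by linarith
  have "\<mu> / s\<^sup>2 \<le> norm (q - of_real \<mu>) + \<epsilon> / r\<^sup>2"
    using norm_triangle_ineq4[of "q - of_real \<mu>" "(\<epsilon> / r ^ 3) *\<^sub>R q"] n1 n2 e by simp
  then have lo2: "\<mu> / s\<^sup>2 \<le> r + 1 + \<epsilon> / r\<^sup>2" using qm by linarith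
  have rs: "r \<le> s + 1" "s \<le> r + 1" "1 \<le> r + s"
    using norm_triangle_ineq[of "q - 1" 1] norm_triangle_ineq4[of q 1] norm_triangle_ineq4[of q "q - 1"]
    by (simp_all add: r_def s_def)
  have inv: "x / t\<^sup>2 \<le> 4" if "x \<le> 1" "1/2 \<le> t" "0 \<le> x" for x t :: real
  proof -
    have "(1/2)\<^sup>2 \<le> t\<^sup>2" using that by (intro power_mono) auto
    then have "x / t\<^sup>2 \<le> 1 / (1/2)\<^sup>2" using that by (intro frac_le) auto
    then show ?thesis by (simp add: power2_eq_square)
  qed
  show "norm q \<le> 3"
  proof (rule ccontr)
    assume "\<not> norm q \<le> 3"
    then have 3: "3 < r" "2 \<le> s" using rs by (auto simp: r_def)
    have "\<epsilon> / r\<^sup>2 \<le> 1 / 1" "\<mu> / s\<^sup>2 \<le> 1 / 1"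
      using 3 \<epsilon> \<mu> by (intro frac_le; simp add: one_le_power)+
    then show False using up qm 3 by linarith
  qed
  then have r3: "r \<le> 3" by (simp add: r_def)
  have key: "x \<le> 16 * t\<^sup>2" if "x / t\<^sup>2 \<le> 16" "0 < t" for x t :: real
    using that by (simp add: divide_le_eq)
  show "\<epsilon> \<le> 16 * (norm q)\<^sup>2"
  proof (cases "1/2 \<le> r")
    case True
    have "\<epsilon> / r\<^sup>2 \<le> 4" using inv[OF _ True] \<epsilon> by simp
    then show ?thesis using key[OF _ pos(1)] by (simp add: r_def)
  next
    case False
    then have "\<mu> / s\<^sup>2 \<le> 4" using rs \<mu> by (intro inv) auto
    then have "\<epsilon> / r\<^sup>2 \<le> 16" using lo1 False by linarith
    then show ?thesis using key[OF _ pos(1)] by (simp add: r_def)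
  qed
  show "\<epsilon> \<le> 16 * (norm (q - 1))\<^sup>2"
  proof (cases "1/2 \<le> s")
    case True
    have "\<mu> / s\<^sup>2 \<le> 4" using inv[OF _ True] \<mu> by simp
    then have "\<mu> \<le> 16 * s\<^sup>2" using key[OF _ pos(2), of \<mu>] by simp
    then show ?thesis using \<epsilon>(2) by (simp add: s_def)
  next
    case False
    then have "\<epsilon> / r\<^sup>2 \<le> 4" using rs \<epsilon> by (intro inv) auto
    then have "\<mu> / s\<^sup>2 \<le> 16" using lo2 False rs by linarith
    then have "\<mu> \<le> 16 * s\<^sup>2" using key[OF _ pos(2), of \<mu>] by simp
    then show ?thesis using \<epsilon>(2) by (simp add: s_def)
  qed
qed

text \<open>\<open>arg_min\<close> is meaningful only if a minimum is attained. Compactness of the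
  set of solutions provides one without solving the equation, and the equilateral point shows that
  the set is not empty.\<close>

lemma L1_critical: "L1 \<mu> \<in> critical_points_H \<mu>"
proof -
  define h where "h q = H \<mu> (q, - \<i> * (q - of_real \<mu>))" for q
  define S where "S = {q :: complex. q \<in> cball 0 3 \<and> \<epsilon> \<le> 16 * (norm q)\<^sup>2 \<and> \<epsilon> \<le> 16 * (norm (q - 1))\<^sup>2}"
  define C where "C = {q \<in> S. critical_eq \<mu> q}"
  have nz: "q \<noteq> 0" "q \<noteq> 1" if "q \<in> S" for q using that \<epsilon>(1) by (auto simp: S_def)
  have "S = cball 0 3 \<inter> ({q. \<epsilon> \<le> 16 * (norm q)\<^sup>2} \<inter> {q. \<epsilon> \<le> 16 * (norm (q - 1))\<^sup>2})" unfolding S_def by blast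
  moreover have "closed {q :: complex. \<epsilon> \<le> 16 * (norm q)\<^sup>2}" "closed {q :: complex. \<epsilon> \<le> 16 * (norm (q - 1))\<^sup>2}"
    by (intro closed_Collect_le continuous_intros)+
  ultimately have "closed S" by (simp add: closed_Int)
  moreover have "bounded S" by (rule bounded_subset[OF bounded_cball[of 0 3]]) (auto simp: S_def)
  ultimately have S: "compact S" by (simp add: compact_eq_bounded_closed)
  have "continuous_on S (\<lambda>q. (\<epsilon> * (1 - 1 / norm q ^ 3)) *\<^sub>R q + (\<mu> * (1 - 1 / norm (q - 1) ^ 3)) *\<^sub>R (q - 1))"
    using nz by (intro continuous_intros) auto
  from continuous_closed_preimage[OF this \<open>closed S\<close> closed_singleton[of 0]]
  have "closed (S \<inter> C)" by (simp add: C_def critical_eq_iff Int_def vimage_def cong: conj_cong)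
  then have "compact (S \<inter> C)" using compact_Int_closed[OF S] by (metis Int_left_absorb)
  moreover have "S \<inter> C = C" by (auto simp: C_def)
  ultimately have "compact C" by simp
  moreover have "Complex (1/2) (sqrt 3 / 2) \<noteq> 0" "Complex (1/2) (sqrt 3 / 2) \<noteq> 1" by (simp_all add: complex_eq_iff)
  then have "Complex (1/2) (sqrt 3 / 2) \<in> C"
    using equilateral critical_away[OF equilateral] by (simp add: C_def S_def)
  then have "C \<noteq> {}" by blast
  moreover have "continuous_on C h"
    unfolding h_def[abs_def] H_critical using nz by (intro continuous_intros) (auto simp: C_def)
  ultimately obtain q where q: "q \<in> C" "\<And>y. y \<in> C \<Longrightarrow> h q \<le> h y"
    using continuous_attains_inf[of C h] by metis
  have crit: "(y, p) \<in> critical_points_H \<mu> \<longleftrightarrow> y \<in> C \<and> p = - \<i> * (y - of_real \<mu>)" for y p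
  proof
    assume "(y, p) \<in> critical_points_H \<mu>"
    then have y: "y \<noteq> 0" "y \<noteq> 1" "p = - \<i> * (y - of_real \<mu>)" "critical_eq \<mu> y"
      unfolding critical_points_eq by simp_all
    then show "y \<in> C \<and> p = - \<i> * (y - of_real \<mu>)" using critical_away[OF y(4,1,2)] by (simp add: C_def S_def)
  next
    assume y: "y \<in> C \<and> p = - \<i> * (y - of_real \<mu>)"
    then have "y \<in> S" "critical_eq \<mu> y" by (simp_all add: C_def)
    then show "(y, p) \<in> critical_points_H \<mu>" using nz[of y] y unfolding critical_points_eq by simp
  qed
  have "is_arg_min (H \<mu>) (\<lambda>z. z \<in> critical_points_H \<mu>) (q, - \<i> * (q - of_real \<mu>))"
    unfolding is_arg_min_linorder
  proof (intro conjI allI impI)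
    show "(q, - \<i> * (q - of_real \<mu>)) \<in> critical_points_H \<mu>" using crit q(1) by blast
    fix z assume z: "z \<in> critical_points_H \<mu>"
    obtain y p where yp: "z = (y, p)" by (cases z)
    have "y \<in> C" and p: "p = - \<i> * (y - of_real \<mu>)" using z unfolding yp crit by simp_all
    from q(2)[OF this(1)] show "H \<mu> (q, - \<i> * (q - of_real \<mu>)) \<le> H \<mu> z" unfolding yp p h_def .
  qed
  then have "is_arg_min (H \<mu>) (\<lambda>z. z \<in> critical_points_H \<mu>) (L1 \<mu>)"
    unfolding L1_def arg_min_def by (rule someI)
  then show ?thesis by (simp add: is_arg_min_def)
qed

lemma L1_value:
  assumes \<rho>: "0 < \<rho>" "\<rho> \<le> 1/2" "\<epsilon> \<le> \<rho> ^ 3 / 2"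
  shows "- 3/2 - 13 * \<rho> \<le> H \<mu> (L1 \<mu>)"
proof -
  obtain q where q: "L1 \<mu> = (q, - \<i> * (q - of_real \<mu>))" "q \<noteq> 0" "q \<noteq> 1" "critical_eq \<mu> q"
    using L1_critical unfolding critical_points_eq by auto
  show ?thesis
  proof (cases "Im q = 0")
    case True
    then have r: "q = of_real (Re q)" by (simp add: complex_eq_iff)
    then have "Re q \<noteq> 0" "Re q \<noteq> 1" using q(2,3) by (auto simp: complex_eq_iff)
    then show ?thesis using critical_value_real[of "Re q" \<rho>] q(1,4) r \<rho> by metis
  next
    case False
    then show ?thesis using critical_value_nonreal[OF q(4,2,3)] \<rho>(1) unfolding q(1) by linarith
  qed
qed

end

section \<open>Choice of the mass threshold\<close>

theorem theorem1p1:
  fixes c :: real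
  assumes "c > 3/2"
  shows "\<exists>\<mu>\<^sub>0::real. 0 \<le> \<mu>\<^sub>0 \<and> \<mu>\<^sub>0 < 1 \<and>
           (\<forall>\<mu>. \<mu>\<^sub>0 < \<mu> \<and> \<mu> < 1 \<longrightarrow>
              - c < H \<mu> (L1 \<mu>) \<and>
              (\<exists>\<phi>. closed_3manifold_with_flow (Sigma_comp \<mu> c) (hamiltonian_vf (K \<mu> c)) \<phi> \<and>
                 (\<exists>D. global_disklike_surface_of_section
                        (Sigma_comp \<mu> c) (hamiltonian_vf (K \<mu> c)) \<phi> D)))"
proof -
  obtain \<delta> :: real where \<delta>: "0 < \<delta>" "\<delta> \<le> 1 / 10^6"
    and sec: "\<forall>\<kappa> f m. hopf_perturbation \<kappa> \<delta> f m \<longrightarrow>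
      (\<exists>\<phi>. closed_3manifold_with_flow (hopf_perturbation.M \<kappa> f) (hopf_perturbation.X \<kappa> m) \<phi> \<and>
        (\<exists>D. global_disklike_surface_of_section (hopf_perturbation.M \<kappa> f) (hopf_perturbation.X \<kappa> m) \<phi> D))"
    using hopf_perturbation_section by metis
  define e where "e = c - 3/2"
  \<comment> \<open>A lower bound for \<omega> that is the same for all \<mu>; its positivity uses
    \<open>c > 3/2\<close>.\<close>
  define w where "w = sqrt (2 * e)"
  \<comment> \<open>Then \<open>13 * \<rho>\<close> is at most half of the gap between
    \<open>c\<close> and 3/2, so the lowest critical value stays above \<open>- c\<close>.\<close>
  define \<rho> where "\<rho> = min (1/2) (e / 26)"
  define b where "b = min (1/50) (\<delta> * w / 10^5)"
  \<comment> \<open>The first entry serves the critical value. The second one gives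
    \<open>\<beta> = (1 - \<mu>) / (2 * \<omega>^2) \<le> b\<close>, as \<omega> is at least
    \<open>w\<close>.\<close>
  define \<epsilon>0 where "\<epsilon>0 = min (\<rho> ^ 3 / 2) (2 * w\<^sup>2 * b)"
  have e: "0 < e" using assms by (simp add: e_def)
  then have w: "0 < w" "w\<^sup>2 = 2 * e" by (simp_all add: w_def)
  have \<rho>: "0 < \<rho>" "\<rho> \<le> 1/2" "13 * \<rho> < e" using e by (auto simp: \<rho>_def min_def)
  have "0 < \<delta> * w" using \<delta>(1) w(1) by (rule mult_pos_pos)
  then have b: "0 < b" "b \<le> 1/50" "b \<le> \<delta> * w / 10^5" by (auto simp: b_def)
  have "0 < 2 * w\<^sup>2 * b" using w(1) b(1) by simp
  then have \<epsilon>0: "0 < \<epsilon>0" "\<epsilon>0 \<le> \<rho> ^ 3 / 2" "\<epsilon>0 \<le> 2 * w\<^sup>2 * b" using \<rho>(1) by (auto simp: \<epsilon>0_def)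
  have "\<rho> ^ 3 \<le> (1/2) ^ 3" using \<rho> by (intro power_mono) auto
  then have half: "\<epsilon>0 \<le> 1/2" using \<epsilon>0(2) by (simp add: power3_eq_cube)
  show ?thesis
  proof (rule exI[of _ "1 - \<epsilon>0"], intro conjI allI impI)
    show "0 \<le> 1 - \<epsilon>0" "1 - \<epsilon>0 < 1" using half \<epsilon>0(1) by simp_all
    fix \<mu> assume "1 - \<epsilon>0 < \<mu> \<and> \<mu> < 1"
    then have mu: "1 - \<mu> < \<epsilon>0" "1/2 \<le> \<mu>" "\<mu> < 1" using half by auto
    interpret L: light_earth \<mu> by (rule light_earth.intro[OF mu(2,3)])
    have "- 3/2 - 13 * \<rho> \<le> H \<mu> (L1 \<mu>)"
      using L.L1_value[OF \<rho>(1,2)] mu(1) \<epsilon>0(2) by (simp add: L.\<epsilon>_def)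
    then show "- c < H \<mu> (L1 \<mu>)" using \<rho>(3) unfolding e_def by linarith
    interpret levi_civita c \<mu> using mu assms by unfold_locales auto
    have "w\<^sup>2 \<le> \<omega>\<^sup>2" using \<omega>(1) w(2) by (simp add: e_def)
    then have "w \<le> \<omega>" using \<omega>(2) by (meson less_imp_le power2_le_imp_le)
    have "\<beta> \<le> (2 * w\<^sup>2 * b) / (2 * w\<^sup>2)"
      unfolding \<beta>_def using \<open>w\<^sup>2 \<le> \<omega>\<^sup>2\<close> mu \<epsilon>0(3) w(1) b(1) by (intro frac_le) auto
    also have "\<dots> = b" using w(1) by simp
    finally have "\<beta> \<le> b" .
    moreover have "\<delta> * w / 10^5 \<le> \<delta> * \<omega> / 10^5"
      using \<open>w \<le> \<omega>\<close> \<delta>(1) by (intro divide_right_mono mult_left_mono) auto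
    ultimately have "\<beta> \<le> 1/50" "\<beta> \<le> \<delta> * \<omega> / 10^5" using b(2,3) by (metis order_trans)+
    then interpret levi_civita_small c \<mu> \<delta> using \<delta> by unfold_locales
    show "\<exists>\<phi>. closed_3manifold_with_flow (Sigma_comp \<mu> c) (hamiltonian_vf (K \<mu> c)) \<phi> \<and>
        (\<exists>D. global_disklike_surface_of_section (Sigma_comp \<mu> c) (hamiltonian_vf (K \<mu> c)) \<phi> D)"
      using sec hopf by (intro section_transfer) blast
  qed
qed

end
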